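(* Let $\mathcal K$ be a closed left-invariant subspace of $L^2(N)$ with $\mathcal P(\mathcal K)=\int_\Sigma^\oplus L^2(\mathbb R^d)\otimes P_\lambda(L^2(\mathbb R^d))\,d\mu(\lambda)$ and multiplicity function $m(\lambda)=\mathrm{rank}(P_\lambda)\in\mathbb N\cup\{0,\infty\}$. Let $a\in(0,\infty)^{n-2d}$, $q,b\in(0,\infty)^d$, and let $\mathbf I\subseteq\{\lambda\in\Sigma:0\le\lambda_i\le a_i,\ 1\le i\le n-2d\}$ be measurable. If there exists a function $\phi\in\mathcal K$ such that $\{L(\gamma)\phi\}_{\gamma\in\Gamma_{a,q,b}}$ forms a Parseval frame in $\mathcal K$, then for almost every $\lambda\in\mathbf I$, $$|\det B(\lambda)|\,m(\lambda)\le\prod_{i=1}^d(b_iq_i).$$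
   Context: Setting. $\mathfrak n$ is a real two-step nilpotent Lie algebra of dimension $n$ with center $\mathfrak z$ and a basis $Z_1,\dots,Z_{n-2d},Y_1,\dots,Y_d,X_1,\dots,X_d$ ($d\ge1$) such that the $Z_k$ span $\mathfrak z$, the $Z_k,Y_j$ span a commutative ideal, the $X_j$ span a commutative subalgebra, and $[X_i,Y_j]\in\mathfrak z$. $N=\exp\mathfrak n$ is the connected, simply connected Lie group. For $\lambda\in\mathfrak n^*$ let $B(\lambda)=\big[-\lambda([X_i,Y_j])\big]_{1\le i,j\le d}$; it is assumed that $\det B(\lambda)$ is not identically zero (i.e. $N$ is square-integrable modulo its center). $\Sigma=\{\lambda\in\mathfrak n^*:\lambda(Y_j)=\lambda(X_j)=0\ \forall j,\ \det B(\lambda)\ne0\}$, identified with an open co-null subset of $\mathbb R^{n-2d}$ via $\lambda_k=\lambda(Z_k)$. For $\lambda\in\Sigma$, $\pi_\lambda$ is the irreducible unitary representation of $N$ on $L^2(\mathbb R^d)$, $$\pi_\lambda\Big(\exp(\textstyle\sum z_kZ_k)\exp(\sum y_jY_j)\exp(\sum t_jX_j)\Big)F(x)=e^{2\pi i\sum_k\lambda_kz_k}e^{2\pi i\langle x,B(\lambda)y\rangle}F(x-t).$$ Haar measure on $N$ is Lebesgue measure in the coordinates $(z,y,t)$; $d\mu(\lambda)=|\det B(\lambda)|\,d\lambda$. The Plancherel transform $\mathcal P:L^2(N)\to\int_\Sigma^\oplus L^2(\mathbb R^d)\otimes L^2(\mathbb R^d)\,d\mu(\lambda)$ is the unitary extension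 of $f\mapsto\big(\int_Nf(n)\pi_\lambda(n)\,dn\big)_\lambda$ (with $L^2(\mathbb R^d)\otimes L^2(\mathbb R^d)$ the Hilbert–Schmidt operators, $f\otimes u$ being $h\mapsto\langle h,u\rangle f$). $L$ is the left regular representation; $\mathcal P(L(x)f)(\lambda)=\pi_\lambda(x)\mathcal Pf(\lambda)$. Every closed left-invariant subspace $\mathcal K$ satisfies $\mathcal P(\mathcal K)=\int_\Sigma^\oplus L^2(\mathbb R^d)\otimes P_\lambda(L^2(\mathbb R^d))\,d\mu(\lambda)$ for a measurable field of orthogonal projections $P_\lambda$ on $L^2(\mathbb R^d)$. Quasi-lattice: $\Gamma_{a,q,b}=\Big\{\prod_{j=1}^{n-2d}\exp(\tfrac{m_j}{a_j}Z_j)\prod_{j=1}^d\exp(\tfrac{k_j}{q_j}Y_j)\prod_{j=1}^d\exp(\tfrac{n_j}{b_j}X_j):m_j,k_j,n_j\in\mathbb Z\Big\}$. A family $\{f_i\}$ in a Hilbert space $\mathcal K$ is a Parseval frame in $\mathcal K$ if $\sum_i|\langle f,f_i\rangle|^2=\|f\|^2$ for all $f\in\mathcal K$. *)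

theory Defs
  imports "HOL-Analysis.Analysis"
begin

section \<open>The space \<open>L\<^sup>2(M)\<close> and its operators\<close>

text \<open>
  Elements of \<open>L\<^sup>2(M)\<close> are represented by square-integrable measurable functions; all notions
  below are insensitive to changing representatives on null sets.
\<close>

definition L2 :: "'a measure \<Rightarrow> ('a \<Rightarrow> complex) set" where
  "L2 M = {f \<in> borel_measurable M. integrable M (\<lambda>x. (cmod (f x))\<^sup>2)}"

definition L2_inner :: "'a measure \<Rightarrow> ('a \<Rightarrow> complex) \<Rightarrow> ('a \<Rightarrow> complex) \<Rightarrow> complex" where
  "L2_inner M f g = (LINT x|M. f x * cnj (g x))"

definition L2_norm :: "'a measure \<Rightarrow> ('a \<Rightarrow> complex) \<Rightarrow> real" where
  "L2_norm M f = sqrt (LINT x|M. (cmod (f x))\<^sup>2)"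

definition L2_closed_subspace :: "'a measure \<Rightarrow> ('a \<Rightarrow> complex) set \<Rightarrow> bool" where
  "L2_closed_subspace M K \<longleftrightarrow>
     K \<subseteq> L2 M \<and> (\<lambda>_. 0) \<in> K \<and>
     (\<forall>f\<in>K. \<forall>g\<in>K. (\<lambda>x. f x + g x) \<in> K) \<and>
     (\<forall>c. \<forall>f\<in>K. (\<lambda>x. c * f x) \<in> K) \<and>
     (\<forall>g f. (\<forall>k::nat. g k \<in> K) \<longrightarrow> f \<in> L2 M \<longrightarrow>
        (\<lambda>k. L2_norm M (\<lambda>x. g k x - f x)) \<longlonglongrightarrow> 0 \<longrightarrow> f \<in> K)"

definition parseval_frame ::
  "'a measure \<Rightarrow> 'i set \<Rightarrow> ('i \<Rightarrow> 'a \<Rightarrow> complex) \<Rightarrow> ('a \<Rightarrow> complex) set \<Rightarrow> bool" where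
  "parseval_frame M A v K \<longleftrightarrow>
     (\<forall>i\<in>A. v i \<in> K) \<and>
     (\<forall>f\<in>K. ((\<lambda>i. (cmod (L2_inner M f (v i)))\<^sup>2) has_sum (L2_norm M f)\<^sup>2) A)"

type_synonym 'a operator = "('a \<Rightarrow> complex) \<Rightarrow> ('a \<Rightarrow> complex)"

definition bounded_operator :: "'a measure \<Rightarrow> 'a operator \<Rightarrow> bool" where
  "bounded_operator M T \<longleftrightarrow>
     (\<forall>f\<in>L2 M. T f \<in> L2 M) \<and>
     (\<forall>f\<in>L2 M. \<forall>g\<in>L2 M. AE x in M. T (\<lambda>y. f y + g y) x = T f x + T g x) \<and>
     (\<forall>c. \<forall>f\<in>L2 M. AE x in M. T (\<lambda>y. c * f y) x = c * T f x) \<and>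
     (\<exists>C. \<forall>f\<in>L2 M. L2_norm M (T f) \<le> C * L2_norm M f)"

definition orthogonal_projection :: "'a measure \<Rightarrow> 'a operator \<Rightarrow> bool" where
  "orthogonal_projection M P \<longleftrightarrow>
     bounded_operator M P \<and>
     (\<forall>f\<in>L2 M. AE x in M. P (P f) x = P f x) \<and>
     (\<forall>f\<in>L2 M. \<forall>g\<in>L2 M. L2_inner M (P f) g = L2_inner M f (P g))"

definition L2_range :: "'a measure \<Rightarrow> 'a operator \<Rightarrow> ('a \<Rightarrow> complex) set" where
  "L2_range M T = {u \<in> L2 M. \<exists>h\<in>L2 M. AE x in M. u x = T h x}"

definition L2_independent :: "'a measure \<Rightarrow> nat \<Rightarrow> (nat \<Rightarrow> 'a \<Rightarrow> complex) \<Rightarrow> bool" where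
  "L2_independent M n u \<longleftrightarrow>
     (\<forall>c. (AE x in M. (\<Sum>i<n. c i * u i x) = 0) \<longrightarrow> (\<forall>i<n. c i = 0))"

definition L2_rank :: "'a measure \<Rightarrow> 'a operator \<Rightarrow> enat" where
  "L2_rank M T = Sup {enat n | n. \<exists>u. (\<forall>i<n. u i \<in> L2_range M T) \<and> L2_independent M n u}"

subsection \<open>Hilbert--Schmidt operators\<close>

text \<open>
  Orthonormal bases are indexed by \<open>nat\<close>: this is used only for the infinite-dimensional
  separable spaces \<open>L\<^sup>2(\<real>\<^sup>d)\<close> with \<open>d \<ge> 1\<close>. The Hilbert--Schmidt norm of a bounded operator
  does not depend on the basis selected by \<open>SOME\<close>.
\<close>

definition orthonormal_basis :: "'a measure \<Rightarrow> (nat \<Rightarrow> 'a \<Rightarrow> complex) \<Rightarrow> bool" where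
  "orthonormal_basis M e \<longleftrightarrow>
     (\<forall>i. e i \<in> L2 M) \<and>
     (\<forall>i j. L2_inner M (e i) (e j) = (if i = j then 1 else 0)) \<and>
     (\<forall>f\<in>L2 M. (\<forall>i. L2_inner M f (e i) = 0) \<longrightarrow> (AE x in M. f x = 0))"

definition hs_norm2 :: "'a measure \<Rightarrow> 'a operator \<Rightarrow> ennreal" where
  "hs_norm2 M T =
     (\<Sum>i. ennreal ((L2_norm M (T ((SOME e. orthonormal_basis M e) i)))\<^sup>2))"

definition hs_operator :: "'a measure \<Rightarrow> 'a operator \<Rightarrow> bool" where
  "hs_operator M T \<longleftrightarrow> bounded_operator M T \<and> hs_norm2 M T < \<infinity>"

definition elem_tensor :: "'a measure \<Rightarrow> ('a \<Rightarrow> complex) \<Rightarrow> ('a \<Rightarrow> complex) \<Rightarrow> 'a operator" where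
  "elem_tensor M f u = (\<lambda>h x. L2_inner M h u * f x)"

text \<open>
  The Hilbert space tensor product \<open>L\<^sup>2(M) \<otimes> U\<close> inside the Hilbert--Schmidt operators: the
  closure of the span of the elementary tensors.
\<close>

definition hs_tensor :: "'a measure \<Rightarrow> ('a \<Rightarrow> complex) set \<Rightarrow> 'a operator set" where
  "hs_tensor M U = {T. hs_operator M T \<and>
     (\<forall>\<epsilon>>0. \<exists>n f u. (\<forall>i<n. f i \<in> L2 M \<and> u i \<in> U) \<and>
        hs_norm2 M (\<lambda>h x. T h x - (\<Sum>i<(n::nat). elem_tensor M (f i) (u i) h x)) < \<epsilon>)}"


section \<open>The group\<close>

text \<open>
  The connected, simply connected group of a two-step nilpotent Lie algebra is modelled on the Lie
  algebra itself, with \<open>exp\<close> the identity map and the multiplication given by the (in two steps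
  exact) Baker--Campbell--Hausdorff formula. The inverse of \<open>x\<close> is \<open>-x\<close>. The inner product
  carried by the type \<open>'g\<close> plays no role: it only supplies the topology and Borel sets of a
  finite-dimensional real vector space.
\<close>

definition grp_mult :: "('g::euclidean_space \<Rightarrow> 'g \<Rightarrow> 'g) \<Rightarrow> 'g \<Rightarrow> 'g \<Rightarrow> 'g" where
  "grp_mult br x y = x + y + (1/2) *\<^sub>R br x y"

lemma grp_mult_inverse:
  assumes "bilinear br" "\<And>x. br x x = 0"
  shows "grp_mult br x (- x) = 0" "grp_mult br (- x) x = 0"
  using assms bilinear_rneg[OF assms(1)] bilinear_lneg[OF assms(1)] by (simp_all add: grp_mult_def)

text \<open>
  A product of exponentials of commuting elements is the exponential of the sum. Thus products such
  as \<open>\<Prod>\<^sub>j exp (c\<^sub>j Z\<^sub>j)\<close> are written below as sums over the (unordered) index type.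
\<close>

lemma grp_mult_commuting_list:
  assumes "bilinear br" "\<And>i j. br (c i) (c j) = 0" "distinct js" "set js = UNIV"
  shows "foldr (\<lambda>j. grp_mult br (c j)) js 0 = (\<Sum>j\<in>UNIV. c j)"
proof -
  have comm: "br (c i) (sum_list (map c xs)) = 0" for i xs
    by (induction xs) (simp_all add: bilinear_rzero[OF assms(1)] bilinear_radd[OF assms(1)] assms(2))
  have "foldr (\<lambda>j. grp_mult br (c j)) xs 0 = sum_list (map c xs)" for xs
    by (induction xs) (simp_all add: grp_mult_def comm)
  then show ?thesis
    using sum_list_distinct_conv_sum_set[OF assms(3), of c] assms(4) by simp
qed

text \<open>
  Here \<open>'k\<close> indexes the \<open>n - 2d\<close> central basis vectors and \<open>'d\<close> has \<open>d\<close> elements. Neither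
  can be empty: \<open>d \<ge> 1\<close> by assumption, and a trivial center would force \<open>[X\<^sub>i,Y\<^sub>j] = 0\<close>.
\<close>

definition B_mat ::
  "('g::euclidean_space \<Rightarrow> 'g \<Rightarrow> 'g) \<Rightarrow> ('d::finite \<Rightarrow> 'g) \<Rightarrow> ('d \<Rightarrow> 'g) \<Rightarrow> ('g \<Rightarrow> real) \<Rightarrow> real^'d^'d"
  where "B_mat br Y X l = (\<chi> i j. - l (br (X i) (Y j)))"

locale two_step_setting =
  fixes br :: "'g::euclidean_space \<Rightarrow> 'g \<Rightarrow> 'g"
    and Z :: "'k::finite \<Rightarrow> 'g" and Y X :: "'d::finite \<Rightarrow> 'g"
  assumes bilinear: "bilinear br"
    and alternating: "br x x = 0"
    and jacobi: "br x (br y z) + br y (br z x) + br z (br x y) = 0"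
    and two_step: "br x (br y z) = 0"
    and nonabelian: "\<exists>x y. br x y \<noteq> 0"
    and basis_inj: "inj (case_sum Z (case_sum Y X))"
    and basis_independent: "independent (range (case_sum Z (case_sum Y X)))"
    and basis_span: "span (range (case_sum Z (case_sum Y X))) = UNIV"
    and center: "span (range Z) = {x. \<forall>y. br x y = 0}"
    and ZY_commutative: "\<lbrakk>x \<in> span (range Z \<union> range Y); y \<in> span (range Z \<union> range Y)\<rbrakk> \<Longrightarrow> br x y = 0"
    and ZY_ideal: "x \<in> span (range Z \<union> range Y) \<Longrightarrow> br v x \<in> span (range Z \<union> range Y)"
    and X_commutative: "\<lbrakk>x \<in> span (range X); y \<in> span (range X)\<rbrakk> \<Longrightarrow> br x y = 0"
    and XY_central: "br (X i) (Y j) \<in> span (range Z)"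
    and square_integrable_mod_center: "\<exists>l. linear l \<and> det (B_mat br Y X l) \<noteq> 0"

definition grp_param ::
  "('g::euclidean_space \<Rightarrow> 'g \<Rightarrow> 'g) \<Rightarrow> ('k::finite \<Rightarrow> 'g) \<Rightarrow> ('d::finite \<Rightarrow> 'g) \<Rightarrow> ('d \<Rightarrow> 'g) \<Rightarrow>
   (real^'k) \<times> (real^'d) \<times> (real^'d) \<Rightarrow> 'g" where
  "grp_param br Z Y X = (\<lambda>(z, y, t).
     grp_mult br
       (grp_mult br (\<Sum>k\<in>UNIV. (z $ k) *\<^sub>R Z k) (\<Sum>j\<in>UNIV. (y $ j) *\<^sub>R Y j))
       (\<Sum>j\<in>UNIV. (t $ j) *\<^sub>R X j))"

definition haar ::
  "('g::euclidean_space \<Rightarrow> 'g \<Rightarrow> 'g) \<Rightarrow> ('k::finite \<Rightarrow> 'g) \<Rightarrow> ('d::finite \<Rightarrow> 'g) \<Rightarrow> ('d \<Rightarrow> 'g) \<Rightarrow> 'g measure"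
  where "haar br Z Y X = distr lborel borel (grp_param br Z Y X)"

definition left_regular :: "('g::euclidean_space \<Rightarrow> 'g \<Rightarrow> 'g) \<Rightarrow> 'g \<Rightarrow> 'g operator" where
  "left_regular br x f = (\<lambda>y. f (grp_mult br (- x) y))"

definition quasi_lattice ::
  "('g::euclidean_space \<Rightarrow> 'g \<Rightarrow> 'g) \<Rightarrow> ('k::finite \<Rightarrow> 'g) \<Rightarrow> ('d::finite \<Rightarrow> 'g) \<Rightarrow> ('d \<Rightarrow> 'g) \<Rightarrow>
   real^'k \<Rightarrow> real^'d \<Rightarrow> real^'d \<Rightarrow> 'g set" where
  "quasi_lattice br Z Y X a q b =
     {grp_mult br
        (grp_mult br (\<Sum>j\<in>UNIV. (of_int (m j) / a $ j) *\<^sub>R Z j) (\<Sum>j\<in>UNIV. (of_int (k j) / q $ j) *\<^sub>R Y j))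
        (\<Sum>j\<in>UNIV. (of_int (n j) / b $ j) *\<^sub>R X j)
      | (m :: 'k \<Rightarrow> int) (k :: 'd \<Rightarrow> int) (n :: 'd \<Rightarrow> int). True}"


section \<open>Representations and the Plancherel transform\<close>

text \<open>
  The point \<open>l\<close> of \<open>real^'k\<close> stands for the functional with \<open>Z\<^sub>k \<mapsto> l\<^sub>k\<close> that vanishes on all
  \<open>Y\<^sub>j\<close> and \<open>X\<^sub>j\<close>.
\<close>

definition functional ::
  "('k::finite \<Rightarrow> 'g::euclidean_space) \<Rightarrow> ('d::finite \<Rightarrow> 'g) \<Rightarrow> ('d \<Rightarrow> 'g) \<Rightarrow> real^'k \<Rightarrow> 'g \<Rightarrow> real" where
  "functional Z Y X l =
     (THE \<phi>. linear \<phi> \<and> (\<forall>k. \<phi> (Z k) = l $ k) \<and> (\<forall>j. \<phi> (Y j) = 0 \<and> \<phi> (X j) = 0))"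

definition B ::
  "('g::euclidean_space \<Rightarrow> 'g \<Rightarrow> 'g) \<Rightarrow> ('k::finite \<Rightarrow> 'g) \<Rightarrow> ('d::finite \<Rightarrow> 'g) \<Rightarrow> ('d \<Rightarrow> 'g) \<Rightarrow>
   real^'k \<Rightarrow> real^'d^'d" where
  "B br Z Y X l = B_mat br Y X (functional Z Y X l)"

definition Sigma_dual ::
  "('g::euclidean_space \<Rightarrow> 'g \<Rightarrow> 'g) \<Rightarrow> ('k::finite \<Rightarrow> 'g) \<Rightarrow> ('d::finite \<Rightarrow> 'g) \<Rightarrow> ('d \<Rightarrow> 'g) \<Rightarrow> (real^'k) set"
  where "Sigma_dual br Z Y X = {l. det (B br Z Y X l) \<noteq> 0}"

definition plancherel_measure ::
  "('g::euclidean_space \<Rightarrow> 'g \<Rightarrow> 'g) \<Rightarrow> ('k::finite \<Rightarrow> 'g) \<Rightarrow> ('d::finite \<Rightarrow> 'g) \<Rightarrow> ('d \<Rightarrow> 'g) \<Rightarrow>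
   (real^'k) measure" where
  "plancherel_measure br Z Y X =
     density (lebesgue_on (Sigma_dual br Z Y X)) (\<lambda>l. ennreal \<bar>det (B br Z Y X l)\<bar>)"

definition irrep ::
  "('g::euclidean_space \<Rightarrow> 'g \<Rightarrow> 'g) \<Rightarrow> ('k::finite \<Rightarrow> 'g) \<Rightarrow> ('d::finite \<Rightarrow> 'g) \<Rightarrow> ('d \<Rightarrow> 'g) \<Rightarrow>
   real^'k \<Rightarrow> 'g \<Rightarrow> (real^'d) operator" where
  "irrep br Z Y X l g F =
     (case inv (grp_param br Z Y X) g of (z, y, t) \<Rightarrow>
       (\<lambda>x. cis (2 * pi * (l \<bullet> z)) * cis (2 * pi * (x \<bullet> (B br Z Y X l *v y))) * F (x - t)))"

text \<open>
  The operator \<open>\<integral> f(n) \<pi>\<^sub>l(n) dn\<close>, evaluated at \<open>F\<close> and \<open>x\<close>. For \<open>f\<close> integrable and \<open>F\<close> in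
  \<open>L\<^sup>2\<close> the integral converges absolutely for almost every \<open>x\<close>, and it defines the same operator
  as the weak integral.
\<close>

definition integrated_rep ::
  "('g::euclidean_space \<Rightarrow> 'g \<Rightarrow> 'g) \<Rightarrow> ('k::finite \<Rightarrow> 'g) \<Rightarrow> ('d::finite \<Rightarrow> 'g) \<Rightarrow> ('d \<Rightarrow> 'g) \<Rightarrow>
   ('g \<Rightarrow> complex) \<Rightarrow> real^'k \<Rightarrow> (real^'d) operator" where
  "integrated_rep br Z Y X f l F =
     (\<lambda>x. LINT g|haar br Z Y X. f g * irrep br Z Y X l g F x)"

definition measurable_field :: "(real^'k) measure \<Rightarrow> (real^'k \<Rightarrow> (real^'d) operator) \<Rightarrow> bool" where
  "measurable_field \<mu> T \<longleftrightarrow>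
     (\<forall>u\<in>L2 lborel. \<forall>v\<in>L2 lborel. (\<lambda>l. L2_inner lborel (T l u) v) \<in> borel_measurable \<mu>)"

text \<open>
  The direct integral of the spaces \<open>H l\<close> of Hilbert--Schmidt operators with respect to \<open>\<mu>\<close>. As with
  \<open>L\<^sup>2\<close>, fields are not identified when they agree almost everywhere, but membership only
  depends on the class.
\<close>

definition direct_integral ::
  "(real^'k) measure \<Rightarrow> (real^'k \<Rightarrow> (real^'d) operator set) \<Rightarrow> (real^'k \<Rightarrow> (real^'d) operator) set"
  where
  "direct_integral \<mu> H = {\<Phi>. measurable_field \<mu> \<Phi> \<and>
     (AE l in \<mu>. hs_operator lborel (\<Phi> l) \<and> \<Phi> l \<in> H l) \<and>
     (\<integral>\<^sup>+l. hs_norm2 lborel (\<Phi> l) \<partial>\<mu>) < \<infinity>}"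

text \<open>
  The relation between (representatives of) \<open>f\<close> in \<open>L\<^sup>2(N)\<close> and \<open>\<P>f\<close>: the extension by
  continuity of the integrated representation from \<open>L\<^sup>1 \<inter> L\<^sup>2\<close>.
\<close>

definition is_plancherel ::
  "('g::euclidean_space \<Rightarrow> 'g \<Rightarrow> 'g) \<Rightarrow> ('k::finite \<Rightarrow> 'g) \<Rightarrow> ('d::finite \<Rightarrow> 'g) \<Rightarrow> ('d \<Rightarrow> 'g) \<Rightarrow>
   ('g \<Rightarrow> complex) \<Rightarrow> (real^'k \<Rightarrow> (real^'d) operator) \<Rightarrow> bool" where
  "is_plancherel br Z Y X f \<Phi> \<longleftrightarrow>
     f \<in> L2 (haar br Z Y X) \<and>
     \<Phi> \<in> direct_integral (plancherel_measure br Z Y X) (\<lambda>_. Collect (hs_operator lborel)) \<and>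
     (\<exists>g :: nat \<Rightarrow> 'g \<Rightarrow> complex.
        (\<forall>k. g k \<in> L2 (haar br Z Y X) \<and> integrable (haar br Z Y X) (g k)) \<and>
        (\<lambda>k. L2_norm (haar br Z Y X) (\<lambda>x. g k x - f x)) \<longlonglongrightarrow> 0 \<and>
        (\<lambda>k. \<integral>\<^sup>+l. hs_norm2 lborel (\<lambda>h x. integrated_rep br Z Y X (g k) l h x - \<Phi> l h x)
           \<partial>plancherel_measure br Z Y X) \<longlonglongrightarrow> 0)"

definition plancherel_image ::
  "('g::euclidean_space \<Rightarrow> 'g \<Rightarrow> 'g) \<Rightarrow> ('k::finite \<Rightarrow> 'g) \<Rightarrow> ('d::finite \<Rightarrow> 'g) \<Rightarrow> ('d \<Rightarrow> 'g) \<Rightarrow>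
   ('g \<Rightarrow> complex) set \<Rightarrow> (real^'k \<Rightarrow> (real^'d) operator) set" where
  "plancherel_image br Z Y X K = {\<Phi>. \<exists>f\<in>K. is_plancherel br Z Y X f \<Phi>}"

end

theory Submission
  imports Defs "HOL-Computational_Algebra.Polynomial"
begin

text \<open>
  In the coordinates \<open>(z, y, t)\<close> the operators \<open>\<Phi> l\<close> of the transform of the frame generator are
  multiplied by a translation and a modulation when the generator is translated by a quasi-lattice
  point. Let \<open>e\<close> be an orthonormal basis and \<open>w\<close> the indicator of a set on which the modulations
  from the lattice form an orthogonal basis. Test the frame identity on the operator fields of rank
  one built from \<open>w\<close> and \<open>P l (e i)\<close>, localized in \<open>l\<close>. Three Parseval identities (in \<open>l\<close>, for the
  modulations, and for the translates) and a sum over \<open>i\<close> and over the translates of \<open>w\<close> turn it into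
  \<open>\<Prod>a \<cdot> \<Prod>q \<cdot> \<Prod>b \<cdot> \<parallel>\<Phi> l\<parallel>\<^sup>2 = tr (P l)\<close> in the Hilbert--Schmidt norm. Testing it on the field \<open>\<Phi>\<close> itself,
  localized in \<open>l\<close>, and keeping only the central lattice points gives
  \<open>\<Prod>a \<cdot> \<bar>det (B l)\<bar> \<cdot> \<parallel>\<Phi> l\<parallel>\<^sup>2 \<le> 1\<close>. Together they bound \<open>\<bar>det (B l)\<bar> \<cdot> tr (P l)\<close>, and the trace of a
  projection dominates its rank.
\<close>

section \<open>Square-integrable functions\<close>

text \<open>No measurable orthonormal basis of the range of \<open>P l\<close> is chosen. The fields
  \<open>P l (e i)\<close> take its place: their weak measurability is a hypothesis, and their
  squared norms add up to the trace. The modulations depend on \<open>B(l)\<close>, so the tiles on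
  which they form an orthogonal basis move with \<open>l\<close>, and neither a tile nor a
  fundamental cell of the translations has to contain the other. Each window is therefore the part
  of the translation cell inside one tile; the windows of all tiles add up to the cell, whose volume
  is the reciprocal of the product of the \<open>b\<close>. The determinant enters as the Plancherel
  density. Parseval in \<open>l\<close> is an identity for Lebesgue measure and produces this
  density twice, once more than the Plancherel integral absorbs. The modulation tiles have a volume
  inversely proportional to the determinant, which cancels the surplus. Testing on
  \<open>\<Phi>\<close> with central points alone involves no modulation sum, so there the surplus
  survives. Integrals must be finite before they can be compared, hence the test fields live on sets
  where the relevant quantities are bounded.\<close>

definition nn2 :: "'a measure \<Rightarrow> ('a \<Rightarrow> complex) \<Rightarrow> ennreal" where
  "nn2 M f = (\<integral>\<^sup>+x. ennreal ((cmod (f x))\<^sup>2) \<partial>M)"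

lemma borel_measurable_cnj [measurable]: "cnj \<in> borel_measurable borel"
  by (intro borel_measurable_continuous_onI continuous_intros)

lemma L2_measurable [measurable_dest]: "f \<in> L2 M \<Longrightarrow> f \<in> borel_measurable M"
  by (simp add: L2_def)

lemma L2_integrable: "f \<in> L2 M \<Longrightarrow> integrable M (\<lambda>x. (cmod (f x))\<^sup>2)"
  by (simp add: L2_def)

text \<open>Membership becomes finiteness of an extended nonnegative integral, so that Tonelli
  interchanges of squared norms come without an integrability check.\<close>

lemma L2_iff: "f \<in> L2 M \<longleftrightarrow> f \<in> borel_measurable M \<and> nn2 M f < \<infinity>"
proof -
  have "integrable M (\<lambda>x. (cmod (f x))\<^sup>2) \<longleftrightarrow> nn2 M f < \<infinity>" if [measurable]: "f \<in> borel_measurable M"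
    unfolding nn2_def integrable_iff_bounded by simp
  then show ?thesis unfolding L2_def by auto
qed

lemma L2_norm_nonneg [simp]: "0 \<le> L2_norm M f"
  by (simp add: L2_norm_def)

lemma L2_norm_sq: "(L2_norm M f)\<^sup>2 = (LINT x|M. (cmod (f x))\<^sup>2)"
  by (simp add: L2_norm_def)

lemma nn2_L2: "f \<in> L2 M \<Longrightarrow> nn2 M f = ennreal ((L2_norm M f)\<^sup>2)"
  unfolding nn2_def L2_norm_sq by (rule nn_integral_eq_integral) (auto simp: L2_integrable)

lemma L2_norm_nn2: "f \<in> borel_measurable M \<Longrightarrow> (L2_norm M f)\<^sup>2 = enn2real (nn2 M f)"
  unfolding nn2_def L2_norm_sq by (subst integral_eq_nn_integral) auto

lemma nn2_cong_AE: "AE x in M. f x = g x \<Longrightarrow> nn2 M f = nn2 M g"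
  unfolding nn2_def by (rule nn_integral_cong_AE) auto

lemma L2_norm_cong_AE:
  assumes "AE x in M. f x = g x" "f \<in> borel_measurable M" "g \<in> borel_measurable M"
  shows "L2_norm M f = L2_norm M g"
proof -
  have "(LINT x|M. (cmod (f x))\<^sup>2) = (LINT x|M. (cmod (g x))\<^sup>2)"
    using assms by (intro integral_cong_AE) auto
  then show ?thesis by (simp add: L2_norm_def)
qed

lemma L2_inner_cong_AE:
  assumes "AE x in M. f x = g x" "AE x in M. h x = k x"
    "f \<in> borel_measurable M" "g \<in> borel_measurable M" "h \<in> borel_measurable M" "k \<in> borel_measurable M"
  shows "L2_inner M f h = L2_inner M g k"
  unfolding L2_inner_def using assms by (intro integral_cong_AE) auto

lemma mult_le_sum_squares:
  fixes a b :: real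
  assumes "0 \<le> a" "0 \<le> b"
  shows "a * b \<le> a\<^sup>2 + b\<^sup>2"
proof -
  have "2 * (a * b) \<le> a\<^sup>2 + b\<^sup>2" using sum_squares_bound[of a b] by (simp only: mult.assoc)
  then show ?thesis using mult_nonneg_nonneg[OF assms] by linarith
qed

lemma cmod_add_sq: "(cmod (x + y))\<^sup>2 \<le> 2 * (cmod x)\<^sup>2 + 2 * (cmod y)\<^sup>2"
proof -
  have "(cmod (x + y))\<^sup>2 \<le> (cmod x + cmod y)\<^sup>2"
    by (intro power_mono norm_triangle_ineq norm_ge_zero)
  also have "\<dots> \<le> 2 * (cmod x)\<^sup>2 + 2 * (cmod y)\<^sup>2"
    using sum_squares_bound[of "cmod x" "cmod y"] by (simp add: power2_sum)
  finally show ?thesis .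
qed

lemma L2_zero [simp]: "(\<lambda>_. 0) \<in> L2 M"
  by (simp add: L2_def)

lemma L2_add [simp]:
  assumes "f \<in> L2 M" "g \<in> L2 M" shows "(\<lambda>x. f x + g x) \<in> L2 M"
proof -
  note [measurable] = L2_measurable[OF assms(1)] L2_measurable[OF assms(2)]
  have "integrable M (\<lambda>x. (cmod (f x + g x))\<^sup>2)"
    by (rule Bochner_Integration.integrable_bound[of M "\<lambda>x. 2 * (cmod (f x))\<^sup>2 + 2 * (cmod (g x))\<^sup>2"])
       (auto simp: L2_integrable assms cmod_add_sq)
  then show ?thesis by (simp add: L2_def)
qed

lemma L2_scale [simp]: "f \<in> L2 M \<Longrightarrow> (\<lambda>x. c * f x) \<in> L2 M"
  by (auto simp: L2_def norm_mult power_mult_distrib)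

lemma L2_uminus [simp]: "f \<in> L2 M \<Longrightarrow> (\<lambda>x. - f x) \<in> L2 M"
  using L2_scale[of f M "-1"] by simp

lemma L2_diff [simp]:
  assumes "f \<in> L2 M" "g \<in> L2 M" shows "(\<lambda>x. f x - g x) \<in> L2 M"
  using L2_add[OF assms(1) L2_uminus[OF assms(2)]] by simp

lemma L2_sum [simp]: "(\<And>i. i \<in> A \<Longrightarrow> f i \<in> L2 M) \<Longrightarrow> (\<lambda>x. \<Sum>i\<in>A. f i x) \<in> L2 M"
  by (induction A rule: infinite_finite_induct) auto

lemma L2_lincomb [simp]:
  "(\<And>i. i \<in> A \<Longrightarrow> u i \<in> L2 M) \<Longrightarrow> (\<lambda>x. \<Sum>i\<in>A. c i * u i x) \<in> L2 M"
  by (rule L2_sum) (rule L2_scale)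

lemma L2_cnj [simp]: "f \<in> L2 M \<Longrightarrow> (\<lambda>x. cnj (f x)) \<in> L2 M"
  by (auto simp: L2_def)

lemma L2_bounded_mult:
  assumes "f \<in> L2 M" and [measurable]: "c \<in> borel_measurable M" and "\<And>x. cmod (c x) \<le> C"
  shows "(\<lambda>x. c x * f x) \<in> L2 M"
proof -
  note [measurable] = L2_measurable[OF assms(1)]
  have "integrable M (\<lambda>x. (cmod (c x * f x))\<^sup>2)"
  proof (rule Bochner_Integration.integrable_bound[of M "\<lambda>x. C\<^sup>2 * (cmod (f x))\<^sup>2"])
    have "(cmod (c x))\<^sup>2 \<le> C\<^sup>2" for x using assms(3) by (intro power_mono) auto
    then show "AE x in M. norm ((cmod (c x * f x))\<^sup>2) \<le> norm (C\<^sup>2 * (cmod (f x))\<^sup>2)"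
      by (auto simp: norm_mult power_mult_distrib intro!: mult_right_mono)
  qed (auto simp: L2_integrable assms)
  then show ?thesis by (simp add: L2_def)
qed

lemma L2_integrable_mult:
  assumes "f \<in> L2 M" "g \<in> L2 M"
  shows "integrable M (\<lambda>x. f x * cnj (g x))"
proof -
  note [measurable] = L2_measurable[OF assms(1)] L2_measurable[OF assms(2)]
  show ?thesis
  proof (rule Bochner_Integration.integrable_bound[of M "\<lambda>x. (cmod (f x))\<^sup>2 + (cmod (g x))\<^sup>2"])
    have "cmod x * cmod y \<le> (cmod x)\<^sup>2 + (cmod y)\<^sup>2" for x y
      by (rule mult_le_sum_squares) auto
    then show "AE x in M. norm (f x * cnj (g x)) \<le> norm ((cmod (f x))\<^sup>2 + (cmod (g x))\<^sup>2)"
      by (simp add: norm_mult)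
  qed (auto simp: L2_integrable assms)
qed

lemma L2_integrable_mult': "f \<in> L2 M \<Longrightarrow> g \<in> L2 M \<Longrightarrow> integrable M (\<lambda>x. f x * g x)"
  using L2_integrable_mult[of f M "\<lambda>x. cnj (g x)"] by auto

section \<open>Sesquilinearity, Cauchy-Schwarz and convergence in norm\<close>

lemma L2_inner_add_left:
  "f \<in> L2 M \<Longrightarrow> g \<in> L2 M \<Longrightarrow> h \<in> L2 M \<Longrightarrow> L2_inner M (\<lambda>x. f x + g x) h = L2_inner M f h + L2_inner M g h"
  by (simp add: L2_inner_def distrib_right L2_integrable_mult)

lemma L2_inner_diff_left:
  "f \<in> L2 M \<Longrightarrow> g \<in> L2 M \<Longrightarrow> h \<in> L2 M \<Longrightarrow> L2_inner M (\<lambda>x. f x - g x) h = L2_inner M f h - L2_inner M g h"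
  by (simp add: L2_inner_def left_diff_distrib L2_integrable_mult)

lemma L2_inner_add_right:
  "f \<in> L2 M \<Longrightarrow> g \<in> L2 M \<Longrightarrow> h \<in> L2 M \<Longrightarrow> L2_inner M h (\<lambda>x. f x + g x) = L2_inner M h f + L2_inner M h g"
  by (simp add: L2_inner_def distrib_left L2_integrable_mult)

lemma L2_inner_diff_right:
  "f \<in> L2 M \<Longrightarrow> g \<in> L2 M \<Longrightarrow> h \<in> L2 M \<Longrightarrow> L2_inner M h (\<lambda>x. f x - g x) = L2_inner M h f - L2_inner M h g"
  by (simp add: L2_inner_def right_diff_distrib L2_integrable_mult)

lemma L2_inner_scale_left: "L2_inner M (\<lambda>x. c * f x) h = c * L2_inner M f h"
  by (simp add: L2_inner_def mult.assoc)

lemma L2_inner_scale_right: "L2_inner M h (\<lambda>x. c * f x) = cnj c * L2_inner M h f"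
proof -
  have "L2_inner M h (\<lambda>x. c * f x) = (LINT x|M. cnj c * (h x * cnj (f x)))"
    unfolding L2_inner_def by (rule Bochner_Integration.integral_cong) (auto simp: mult_ac)
  then show ?thesis by (simp add: L2_inner_def)
qed

lemma L2_inner_commute: "L2_inner M g f = cnj (L2_inner M f g)"
  by (simp add: L2_inner_def Bochner_Integration.integral_cnj[symmetric] mult.commute)

lemma L2_inner_zero_left [simp]: "L2_inner M (\<lambda>_. 0) f = 0"
  by (simp add: L2_inner_def)

lemma L2_inner_zero_right [simp]: "L2_inner M f (\<lambda>_. 0) = 0"
  by (simp add: L2_inner_def)

lemma L2_inner_sum_left:
  assumes "\<And>i. i \<in> A \<Longrightarrow> f i \<in> L2 M" "h \<in> L2 M"
  shows "L2_inner M (\<lambda>x. \<Sum>i\<in>A. f i x) h = (\<Sum>i\<in>A. L2_inner M (f i) h)"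
  using assms by (induction A rule: infinite_finite_induct) (auto simp: L2_inner_add_left L2_sum)

lemma L2_inner_sum_right:
  assumes "\<And>i. i \<in> A \<Longrightarrow> f i \<in> L2 M" "h \<in> L2 M"
  shows "L2_inner M h (\<lambda>x. \<Sum>i\<in>A. f i x) = (\<Sum>i\<in>A. L2_inner M h (f i))"
  using assms by (induction A rule: infinite_finite_induct) (auto simp: L2_inner_add_right L2_sum)

lemma L2_inner_self: "L2_inner M f f = of_real ((L2_norm M f)\<^sup>2)"
  by (simp add: L2_inner_def L2_norm_sq complex_norm_square[symmetric] flip: integral_complex_of_real)

lemma L2_norm_scale: "L2_norm M (\<lambda>x. c * f x) = cmod c * L2_norm M f"
  by (simp add: L2_norm_def norm_mult power_mult_distrib real_sqrt_mult)

lemma L2_norm_zero [simp]: "L2_norm M (\<lambda>_. 0) = 0"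
  by (simp add: L2_norm_def)

lemma L2_norm_minus_commute: "L2_norm M (\<lambda>x. f x - g x) = L2_norm M (\<lambda>x. g x - f x)"
  by (simp add: L2_norm_def norm_minus_commute)

lemma L2_norm_cnj: "L2_norm M (\<lambda>x. cnj (f x)) = L2_norm M f"
  by (simp add: L2_norm_def)

lemma L2_norm_diff_sq:
  assumes "f \<in> L2 M" "g \<in> L2 M"
  shows "(L2_norm M (\<lambda>x. f x - g x))\<^sup>2 = (L2_norm M f)\<^sup>2 + (L2_norm M g)\<^sup>2 - 2 * Re (L2_inner M f g)"
proof -
  have "complex_of_real ((L2_norm M (\<lambda>x. f x - g x))\<^sup>2) =
     L2_inner M f f - L2_inner M f g - (L2_inner M g f - L2_inner M g g)"
    using assms by (simp add: L2_inner_self[symmetric] L2_inner_diff_left L2_inner_diff_right L2_diff del: of_real_power)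
  also have "\<dots> = L2_inner M f f + L2_inner M g g - (L2_inner M f g + cnj (L2_inner M f g))"
    by (simp add: L2_inner_commute[of M g f])
  also have "\<dots> = complex_of_real ((L2_norm M f)\<^sup>2 + (L2_norm M g)\<^sup>2 - 2 * Re (L2_inner M f g))"
    by (simp add: L2_inner_self complex_add_cnj)
  finally show ?thesis by (simp only: of_real_eq_iff)
qed

lemma L2_norm_add_sq:
  assumes "f \<in> L2 M" "g \<in> L2 M"
  shows "(L2_norm M (\<lambda>x. f x + g x))\<^sup>2 = (L2_norm M f)\<^sup>2 + (L2_norm M g)\<^sup>2 + 2 * Re (L2_inner M f g)"
proof -
  have m: "(\<lambda>x. (-1) * g x) \<in> L2 M" using assms by auto
  show ?thesis
    using L2_norm_diff_sq[OF assms(1) m] L2_norm_scale[of M "-1" g] L2_inner_scale_right[of M f "-1" g]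
    by simp
qed

lemma L2_norm_eq_0:
  assumes "f \<in> L2 M" "L2_norm M f = 0"
  shows "AE x in M. f x = 0"
proof -
  have "(LINT x|M. (cmod (f x))\<^sup>2) = 0" using L2_norm_sq[of M f] assms(2) by simp
  then have "AE x in M. (cmod (f x))\<^sup>2 = 0"
    using integral_nonneg_eq_0_iff_AE[OF L2_integrable[OF assms(1)]] by simp
  then show ?thesis by simp
qed

lemma L2_Cauchy_Schwarz:
  assumes "f \<in> L2 M" "g \<in> L2 M"
  shows "cmod (L2_inner M f g) \<le> L2_norm M f * L2_norm M g"
proof (cases "L2_norm M g = 0")
  case True
  have "AE x in M. g x = 0" using L2_norm_eq_0[OF assms(2) True] .
  then have "L2_inner M f g = L2_inner M f (\<lambda>_. 0)"
    using assms by (intro L2_inner_cong_AE) (auto dest: L2_measurable)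
  then show ?thesis using True by simp
next
  case False
  define n where "n = (L2_norm M g)\<^sup>2"
  have n: "n > 0" using False by (simp add: n_def)
  \<comment> \<open>The coefficient of the orthogonal projection of \<open>f\<close> onto the line
    through \<open>g\<close>. The inequality says that the residual has a nonnegative squared
    norm.\<close>
  define c where "c = L2_inner M f g / of_real n"
  have "0 \<le> (L2_norm M (\<lambda>x. f x - c * g x))\<^sup>2" by simp
  also have "\<dots> = (L2_norm M f)\<^sup>2 + (cmod c)\<^sup>2 * n - 2 * Re (cnj c * L2_inner M f g)"
    using assms by (subst L2_norm_diff_sq) (auto simp: L2_norm_scale L2_inner_scale_right power_mult_distrib n_def)
  also have "Re (cnj c * L2_inner M f g) = (cmod (L2_inner M f g))\<^sup>2 / n"
    by (simp add: c_def complex_mod_cnj complex_norm_square[symmetric] mult.commute[of "cnj _"] flip: of_real_power of_real_divide)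
  also have "(cmod c)\<^sup>2 * n = (cmod (L2_inner M f g))\<^sup>2 / n"
    using n by (simp add: c_def norm_divide power_divide power2_eq_square)
  finally have "(cmod (L2_inner M f g))\<^sup>2 / n \<le> (L2_norm M f)\<^sup>2" by simp
  then have "(cmod (L2_inner M f g))\<^sup>2 \<le> (L2_norm M f * L2_norm M g)\<^sup>2"
    using n by (simp add: pos_divide_le_eq power_mult_distrib n_def)
  then show ?thesis by (rule power2_le_imp_le) simp
qed

lemma L2_triangle:
  assumes "f \<in> L2 M" "g \<in> L2 M"
  shows "L2_norm M (\<lambda>x. f x + g x) \<le> L2_norm M f + L2_norm M g"
proof -
  have "(L2_norm M (\<lambda>x. f x + g x))\<^sup>2 \<le> (L2_norm M f + L2_norm M g)\<^sup>2"
    using L2_norm_add_sq[OF assms] L2_Cauchy_Schwarz[OF assms] complex_Re_le_cmod[of "L2_inner M f g"]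
    by (simp add: power2_sum)
  then show ?thesis by (rule power2_le_imp_le) simp
qed

lemma L2_triangle_diff:
  assumes "f \<in> L2 M" "g \<in> L2 M" "h \<in> L2 M"
  shows "L2_norm M (\<lambda>x. f x - h x) \<le> L2_norm M (\<lambda>x. f x - g x) + L2_norm M (\<lambda>x. g x - h x)"
  using L2_triangle[of "\<lambda>x. f x - g x" M "\<lambda>x. g x - h x"] assms by (auto simp: L2_diff)

lemma L2_norm_diff_abs:
  assumes "f \<in> L2 M" "g \<in> L2 M"
  shows "\<bar>L2_norm M f - L2_norm M g\<bar> \<le> L2_norm M (\<lambda>x. f x - g x)"
  using L2_triangle_diff[of f M g "\<lambda>_. 0"] L2_triangle_diff[of g M f "\<lambda>_. 0"] assms
    L2_norm_minus_commute[of M f g] by (auto simp: abs_if)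

lemma L2_norm_tendsto:
  assumes "\<And>k. f k \<in> L2 M" "g \<in> L2 M" "(\<lambda>k. L2_norm M (\<lambda>x. f k x - g x)) \<longlonglongrightarrow> 0"
  shows "(\<lambda>k. L2_norm M (f k)) \<longlonglongrightarrow> L2_norm M g"
proof -
  have "(\<lambda>k. L2_norm M (f k) - L2_norm M g) \<longlonglongrightarrow> 0"
    by (rule Lim_null_comparison[OF _ assms(3)]) (simp add: L2_norm_diff_abs assms(1,2))
  then show ?thesis using LIM_zero_iff by blast
qed

lemma L2_inner_tendsto:
  assumes f: "\<And>k. f k \<in> L2 M" "f' \<in> L2 M" "(\<lambda>k. L2_norm M (\<lambda>x. f k x - f' x)) \<longlonglongrightarrow> 0"
    and g: "\<And>k. g k \<in> L2 M" "g' \<in> L2 M" "(\<lambda>k. L2_norm M (\<lambda>x. g k x - g' x)) \<longlonglongrightarrow> 0"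
  shows "(\<lambda>k. L2_inner M (f k) (g k)) \<longlonglongrightarrow> L2_inner M f' g'"
proof -
  have "(\<lambda>k. L2_inner M (f k) (g k) - L2_inner M f' g') \<longlonglongrightarrow> 0"
  proof (rule Lim_null_comparison)
    show "(\<lambda>k. L2_norm M (\<lambda>x. f k x - f' x) * L2_norm M (g k) + L2_norm M f' * L2_norm M (\<lambda>x. g k x - g' x)) \<longlonglongrightarrow> 0"
      using tendsto_add[OF tendsto_mult[OF f(3) L2_norm_tendsto[OF g]] tendsto_mult_left[OF g(3), of "L2_norm M f'"]]
      by simp
    have "cmod (L2_inner M (f k) (g k) - L2_inner M f' g') \<le>
        L2_norm M (\<lambda>x. f k x - f' x) * L2_norm M (g k) + L2_norm M f' * L2_norm M (\<lambda>x. g k x - g' x)" for k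
    proof -
      have "L2_inner M (f k) (g k) - L2_inner M f' g' =
        L2_inner M (\<lambda>x. f k x - f' x) (g k) + L2_inner M f' (\<lambda>x. g k x - g' x)"
        using f g by (simp add: L2_inner_diff_left L2_inner_diff_right)
      also have "cmod \<dots> \<le> cmod (L2_inner M (\<lambda>x. f k x - f' x) (g k)) + cmod (L2_inner M f' (\<lambda>x. g k x - g' x))"
        by (rule norm_triangle_ineq)
      finally show ?thesis
        using L2_Cauchy_Schwarz[OF L2_diff[OF f(1)[of k] f(2)] g(1)[of k]] L2_Cauchy_Schwarz[OF f(2) L2_diff[OF g(1)[of k] g(2)]]
        by linarith
    qed
    then show "\<forall>\<^sub>F k in sequentially. cmod (L2_inner M (f k) (g k) - L2_inner M f' g') \<le>
        L2_norm M (\<lambda>x. f k x - f' x) * L2_norm M (g k) + L2_norm M f' * L2_norm M (\<lambda>x. g k x - g' x)" by simp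
  qed
  then show ?thesis using LIM_zero_iff by blast
qed

text \<open>The values 1, -1, i and -i of \<open>c\<close> recover the inner product from norms. The
  two pairs may live over different measures, and only norms of their combinations enter. A map
  known to preserve these norms thus preserves inner products, even if it is linear only up to null
  sets.\<close>

lemma L2_polarization:
  assumes "f1 \<in> L2 M" "f2 \<in> L2 M" "m1 \<in> L2 N" "m2 \<in> L2 N"
    and eq: "\<And>c. L2_norm M (\<lambda>x. f1 x + c * f2 x) = L2_norm N (\<lambda>x. m1 x + c * m2 x)"
  shows "L2_inner M f1 f2 = L2_inner N m1 m2"
proof -
  have n1: "L2_norm M f1 = L2_norm N m1" using eq[of 0] by simp
  have R: "(L2_norm M f1)\<^sup>2 + (cmod c)\<^sup>2 * (L2_norm M f2)\<^sup>2 + 2 * Re (cnj c * L2_inner M f1 f2) =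
        (L2_norm N m1)\<^sup>2 + (cmod c)\<^sup>2 * (L2_norm N m2)\<^sup>2 + 2 * Re (cnj c * L2_inner N m1 m2)" for c
    using arg_cong[OF eq[of c], of "\<lambda>x. x^2"] L2_norm_add_sq[OF assms(1) L2_scale[OF assms(2), of c]]
      L2_norm_add_sq[OF assms(3) L2_scale[OF assms(4), of c]]
    by (simp add: L2_norm_scale power_mult_distrib L2_inner_scale_right)
  show ?thesis
    using R[of 1] R[of "-1"] R[of "\<i>"] R[of "-\<i>"] n1 by (auto simp: complex_eq_iff)
qed

subsection \<open>Completeness\<close>

text \<open>A subsequence whose increments have norm at most \<open>(1/2)^j\<close> converges almost
  everywhere, because the increments are then absolutely summable at almost every point. Fatou's
  lemma carries the Cauchy estimates over to the pointwise limit.\<close>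

lemma L2_Riesz_Fischer:
  fixes u :: "nat \<Rightarrow> 'a \<Rightarrow> complex"
  assumes u: "\<And>k. u k \<in> L2 M"
    and cauchy: "\<And>e. e > 0 \<Longrightarrow> \<exists>N. \<forall>m\<ge>N. \<forall>n\<ge>N. L2_norm M (\<lambda>x. u m x - u n x) < e"
  obtains f where "f \<in> L2 M" "(\<lambda>k. L2_norm M (\<lambda>x. u k x - f x)) \<longlonglongrightarrow> 0"
proof -
  note [measurable] = L2_measurable[OF u]
  have "\<exists>N. \<forall>m\<ge>N. \<forall>n\<ge>N. L2_norm M (\<lambda>x. u m x - u n x) < (1/2)^j" for j :: nat
    by (rule cauchy) simp
  then obtain N where N: "\<And>j m n. m \<ge> N j \<Longrightarrow> n \<ge> N j \<Longrightarrow> L2_norm M (\<lambda>x. u m x - u n x) < (1/2)^j"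
    by metis
  \<comment> \<open>The summand \<open>j\<close> makes \<open>r j \<ge> j\<close>, and the sum over
    all \<open>N i\<close> up to \<open>j\<close> makes \<open>r\<close> monotone with
    \<open>r j \<ge> N j\<close>.\<close>
  define r where "r = (\<lambda>j. j + (\<Sum>i\<le>j. N i))"
  have rN: "r j \<ge> N j" for j unfolding r_def by (rule trans_le_add2, rule member_le_sum) auto
  have r_mono: "r i \<le> r j" if "i \<le> j" for i j unfolding r_def using that by (intro add_mono sum_mono2) auto
  \<comment> \<open>The squared norms of these increments are at most \<open>(1/4)^j\<close>.
    Weighted by \<open>2^j\<close> their sum is still finite, so the weighted series of squares
    converges almost everywhere.\<close>
  define D where "D = (\<lambda>j x. cmod (u (r (Suc j)) x - u (r j) x))"
  have D_bound: "(\<integral>\<^sup>+x. ennreal ((D j x)\<^sup>2) \<partial>M) \<le> ennreal ((1/4)^j)" for j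
  proof -
    have "(\<integral>\<^sup>+x. ennreal ((D j x)\<^sup>2) \<partial>M) = ennreal ((L2_norm M (\<lambda>x. u (r (Suc j)) x - u (r j) x))\<^sup>2)"
      using nn2_L2[OF L2_diff[OF u u]] by (simp add: nn2_def D_def)
    also have "\<dots> \<le> ennreal (((1/2)^j)\<^sup>2)"
      using N[of j "r (Suc j)" "r j"] rN[of j] r_mono[of j "Suc j"] by (intro ennreal_leI power_mono) auto
    also have "((1/2)^j)\<^sup>2 = (1/4::real)^j" by (simp add: power2_eq_square power_mult_distrib[symmetric])
    finally show ?thesis .
  qed
  have "(\<integral>\<^sup>+x. (\<Sum>j. ennreal (2^j * (D j x)\<^sup>2)) \<partial>M) = (\<Sum>j. \<integral>\<^sup>+x. ennreal (2^j * (D j x)\<^sup>2) \<partial>M)"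
    unfolding D_def by (rule nn_integral_suminf) measurable
  also have "\<dots> \<le> (\<Sum>j. ennreal ((1/2)^j))"
  proof (rule suminf_le)
    fix j
    have "(\<integral>\<^sup>+x. ennreal (2^j * (D j x)\<^sup>2) \<partial>M) = ennreal (2^j) * (\<integral>\<^sup>+x. ennreal ((D j x)\<^sup>2) \<partial>M)"
      unfolding D_def by (subst nn_integral_cmult[symmetric]) (auto simp: ennreal_mult)
    also have "\<dots> \<le> ennreal (2^j) * ennreal ((1/4)^j)" by (intro mult_left_mono D_bound) auto
    also have "\<dots> = ennreal ((1/2)^j)" by (simp add: ennreal_mult[symmetric] power_mult_distrib[symmetric])
    finally show "(\<integral>\<^sup>+x. ennreal (2^j * (D j x)\<^sup>2) \<partial>M) \<le> ennreal ((1/2)^j)" .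
  qed auto
  also have "\<dots> < \<infinity>"
  proof -
    have "(\<Sum>j. ennreal ((1/2)^j)) = ennreal (\<Sum>j. (1/2)^j)"
      by (rule suminf_ennreal2) (auto intro!: summable_geometric)
    then show ?thesis by simp
  qed
  finally have "(\<integral>\<^sup>+x. (\<Sum>j. ennreal (2^j * (D j x)\<^sup>2)) \<partial>M) \<noteq> \<infinity>" by simp
  then have "AE x in M. (\<Sum>j. ennreal (2^j * (D j x)\<^sup>2)) \<noteq> \<infinity>"
    unfolding D_def by (intro nn_integral_PInf_AE) measurable
  then have conv: "AE x in M. convergent (\<lambda>j. u (r j) x)"
  proof eventually_elim
    case (elim x)
    have "summable (\<lambda>j. 2^j * (D j x)\<^sup>2)"
      using elim by (intro summable_suminf_not_top) auto
    then have "summable (\<lambda>j. (1/2)^j + 2^j * (D j x)\<^sup>2)"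
      by (intro summable_add) (auto intro!: summable_geometric)
    then have "summable (\<lambda>j. D j x)"
    proof (rule summable_comparison_test_ev[rotated], intro always_eventually allI)
      fix j
      \<comment> \<open>Applying \<open>a * b \<le> a^2 + b^2\<close> to \<open>1/s\<close> and
        \<open>s * D j x\<close> bounds the increment by \<open>(1/2)^j\<close> plus the summable
        weighted square.\<close>
      define s where "s = sqrt (2^j)"
      have s2: "s\<^sup>2 = 2^j" unfolding s_def by (rule real_sqrt_pow2) simp
      have s: "s > 0" "2^j = s\<^sup>2" "(1/2)^j = (1/s)\<^sup>2"
        using s2 by (simp_all add: s_def power_one_over)
      have "D j x = (1/s) * (s * D j x)" using s by simp
      also have "\<dots> \<le> (1/s)\<^sup>2 + (s * D j x)\<^sup>2"
        using s(1) by (intro mult_le_sum_squares) (auto simp: D_def)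
      finally show "norm (D j x) \<le> (1/2)^j + 2^j * (D j x)\<^sup>2"
        using s by (simp add: power_mult_distrib D_def)
    qed
    then have "summable (\<lambda>j. u (r (Suc j)) x - u (r j) x)"
      unfolding D_def by (rule summable_norm_cancel)
    then have "convergent (\<lambda>n. \<Sum>j<n. u (r (Suc j)) x - u (r j) x)"
      by (simp add: summable_iff_convergent)
    then have "convergent (\<lambda>n. u (r n) x - u (r 0) x)" using sum_lessThan_telescope[of "\<lambda>j. u (r j) x"] by simp
    then show ?case
      using convergent_add[OF _ convergent_const[of "u (r 0) x"]] by fastforce
  qed
  define f where "f = (\<lambda>x. lim (\<lambda>j. u (r j) x))"
  have [measurable]: "f \<in> borel_measurable M" unfolding f_def by (rule borel_measurable_lim_metric) simp
  \<comment> \<open>Fatou along \<open>j\<close>: the distance to the limit is controlled by the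
    distances to the members of the subsequence.\<close>
  have key: "nn2 M (\<lambda>x. u n x - f x) \<le> ennreal (e\<^sup>2)"
    if e: "e > 0" and K: "\<forall>m\<ge>K. \<forall>n\<ge>K. L2_norm M (\<lambda>x. u m x - u n x) < e" "n \<ge> K" for e K n
  proof -
    have "nn2 M (\<lambda>x. u n x - f x) = (\<integral>\<^sup>+x. liminf (\<lambda>j. ennreal ((cmod (u n x - u (r j) x))\<^sup>2)) \<partial>M)"
      unfolding nn2_def
    proof (rule nn_integral_cong_AE)
      show "AE x in M. ennreal ((cmod (u n x - f x))\<^sup>2) = liminf (\<lambda>j. ennreal ((cmod (u n x - u (r j) x))\<^sup>2))"
        using conv
      proof eventually_elim
        case (elim x)
        then have "(\<lambda>j. u (r j) x) \<longlonglongrightarrow> f x" unfolding f_def by (simp add: convergent_LIMSEQ_iff)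
        then have "(\<lambda>j. ennreal ((cmod (u n x - u (r j) x))\<^sup>2)) \<longlonglongrightarrow> ennreal ((cmod (u n x - f x))\<^sup>2)"
          by (intro tendsto_intros)
        then show ?case using lim_imp_Liminf[OF sequentially_bot] by metis
      qed
    qed
    also have "\<dots> \<le> liminf (\<lambda>j. \<integral>\<^sup>+x. ennreal ((cmod (u n x - u (r j) x))\<^sup>2) \<partial>M)"
      by (rule nn_integral_liminf) measurable
    also have "\<dots> \<le> ennreal (e\<^sup>2)"
    proof -
      have "(\<integral>\<^sup>+x. ennreal ((cmod (u n x - u (r j) x))\<^sup>2) \<partial>M) \<le> ennreal (e\<^sup>2)" if "j \<ge> K" for j
      proof -
        have "r j \<ge> K" using that by (simp add: r_def)
        have "(\<integral>\<^sup>+x. ennreal ((cmod (u n x - u (r j) x))\<^sup>2) \<partial>M) = ennreal ((L2_norm M (\<lambda>x. u n x - u (r j) x))\<^sup>2)"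
          using nn2_L2[OF L2_diff[OF u u]] by (simp add: nn2_def)
        also have "\<dots> \<le> ennreal (e\<^sup>2)"
          using K \<open>r j \<ge> K\<close> by (intro ennreal_leI power_mono) (auto intro: less_imp_le)
        finally show ?thesis .
      qed
      then show ?thesis
        by (intro Liminf_le) (auto simp: eventually_sequentially)
    qed
    finally show ?thesis .
  qed
  obtain K1 where K1: "\<forall>m\<ge>K1. \<forall>n\<ge>K1. L2_norm M (\<lambda>x. u m x - u n x) < 1" using cauchy[of 1] by auto
  have d: "(\<lambda>x. u K1 x - f x) \<in> L2 M"
    using key[OF _ K1, of K1] by (auto simp: L2_iff intro: le_less_trans)
  have f: "f \<in> L2 M" using L2_diff[OF u[of K1] d] by simp
  have "(\<lambda>k. L2_norm M (\<lambda>x. u k x - f x)) \<longlonglongrightarrow> 0"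
  proof (rule LIMSEQ_I)
    fix e :: real assume e: "e > 0"
    then obtain K where K: "\<forall>m\<ge>K. \<forall>n\<ge>K. L2_norm M (\<lambda>x. u m x - u n x) < e/2"
      using cauchy[of "e/2"] by auto
    have "L2_norm M (\<lambda>x. u n x - f x) \<le> e/2" if "n \<ge> K" for n
    proof -
      have "ennreal ((L2_norm M (\<lambda>x. u n x - f x))\<^sup>2) \<le> ennreal ((e/2)\<^sup>2)"
        using key[OF _ K that] e nn2_L2[OF L2_diff[OF u f]] by auto
      then have "(L2_norm M (\<lambda>x. u n x - f x))\<^sup>2 \<le> (e/2)\<^sup>2" by (subst (asm) ennreal_le_iff) auto
      then show ?thesis by (rule power2_le_imp_le) (use e in auto)
    qed
    then have le: "\<And>n. n \<ge> K \<Longrightarrow> L2_norm M (\<lambda>x. u n x - f x) \<le> e/2" .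
    show "\<exists>no. \<forall>n\<ge>no. norm (L2_norm M (\<lambda>x. u n x - f x) - 0) < e"
    proof (intro exI allI impI)
      fix n assume "K \<le> n"
      from le[OF this] e show "norm (L2_norm M (\<lambda>x. u n x - f x) - 0) < e" by simp
    qed
  qed
  then show ?thesis using f that by blast
qed

subsection \<open>Orthonormal families\<close>

lemma L2_inner_orthonormal_sum:
  assumes "finite A" "\<And>i. i \<in> A \<Longrightarrow> u i \<in> L2 M"
    and on: "\<And>i j. i \<in> A \<Longrightarrow> j \<in> A \<Longrightarrow> L2_inner M (u i) (u j) = (if i = j then 1 else 0)"
    and "j \<in> A"
  shows "L2_inner M (\<lambda>x. \<Sum>i\<in>A. c i * u i x) (u j) = c j"
proof -
  have "L2_inner M (\<lambda>x. \<Sum>i\<in>A. c i * u i x) (u j) = (\<Sum>i\<in>A. c i * L2_inner M (u i) (u j))"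
    using assms by (subst L2_inner_sum_left) (auto simp: L2_inner_scale_left)
  also have "\<dots> = (\<Sum>i\<in>A. if i = j then c i else 0)"
    using assms by (intro sum.cong) auto
  also have "\<dots> = c j" using assms by simp
  finally show ?thesis .
qed

lemma L2_norm_orthonormal_sum:
  assumes A: "finite A" "\<And>i. i \<in> A \<Longrightarrow> u i \<in> L2 M"
    and on: "\<And>i j. i \<in> A \<Longrightarrow> j \<in> A \<Longrightarrow> L2_inner M (u i) (u j) = (if i = j then 1 else 0)"
  shows "(L2_norm M (\<lambda>x. \<Sum>i\<in>A. c i * u i x))\<^sup>2 = (\<Sum>i\<in>A. (cmod (c i))\<^sup>2)"
proof -
  have "complex_of_real ((L2_norm M (\<lambda>x. \<Sum>i\<in>A. c i * u i x))\<^sup>2) =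
      (\<Sum>j\<in>A. cnj (c j) * L2_inner M (\<lambda>x. \<Sum>i\<in>A. c i * u i x) (u j))"
    unfolding L2_inner_self[symmetric] using A
    by (subst L2_inner_sum_right) (auto simp: L2_inner_scale_right)
  also have "\<dots> = (\<Sum>j\<in>A. complex_of_real ((cmod (c j))\<^sup>2))"
    using L2_inner_orthonormal_sum[OF A on]
    by (intro sum.cong) (auto simp: complex_norm_square mult.commute simp del: of_real_power)
  finally show ?thesis by (simp only: of_real_sum[symmetric] of_real_eq_iff)
qed

text \<open>Pythagoras. Nonnegativity of the residual gives Bessel's inequality, and a residual
  tending to zero gives Parseval's identity.\<close>

lemma L2_norm_orthonormal_rest:
  assumes A: "finite A" "\<And>i. i \<in> A \<Longrightarrow> u i \<in> L2 M"
    and on: "\<And>i j. i \<in> A \<Longrightarrow> j \<in> A \<Longrightarrow> L2_inner M (u i) (u j) = (if i = j then 1 else 0)"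
    and f: "f \<in> L2 M"
  shows "(L2_norm M (\<lambda>x. f x - (\<Sum>i\<in>A. L2_inner M f (u i) * u i x)))\<^sup>2 =
    (L2_norm M f)\<^sup>2 - (\<Sum>i\<in>A. (cmod (L2_inner M f (u i)))\<^sup>2)"
proof -
  have "L2_inner M f (\<lambda>x. \<Sum>i\<in>A. L2_inner M f (u i) * u i x) = (\<Sum>i\<in>A. cnj (L2_inner M f (u i)) * L2_inner M f (u i))"
    using A f by (subst L2_inner_sum_right) (auto simp: L2_inner_scale_right)
  also have "\<dots> = complex_of_real (\<Sum>i\<in>A. (cmod (L2_inner M f (u i)))\<^sup>2)"
    unfolding of_real_sum by (intro sum.cong) (auto simp: complex_norm_square mult.commute simp del: of_real_power)
  finally show ?thesis
    using A f by (subst L2_norm_diff_sq) (auto simp: L2_norm_orthonormal_sum[OF A on])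
qed

lemma L2_Bessel:
  assumes A: "finite A" "\<And>i. i \<in> A \<Longrightarrow> u i \<in> L2 M"
    and on: "\<And>i j. i \<in> A \<Longrightarrow> j \<in> A \<Longrightarrow> L2_inner M (u i) (u j) = (if i = j then 1 else 0)"
    and f: "f \<in> L2 M"
  shows "(\<Sum>i\<in>A. (cmod (L2_inner M f (u i)))\<^sup>2) \<le> (L2_norm M f)\<^sup>2"
  using L2_norm_orthonormal_rest[OF A on f] zero_le_power2[of "L2_norm M (\<lambda>x. f x - (\<Sum>i\<in>A. L2_inner M f (u i) * u i x))"]
  by linarith

lemma orthonormal_basisD:
  assumes "orthonormal_basis M e"
  shows "e i \<in> L2 M" "L2_inner M (e i) (e j) = (if i = j then 1 else 0)"
    "f \<in> L2 M \<Longrightarrow> (\<And>i. L2_inner M f (e i) = 0) \<Longrightarrow> AE x in M. f x = 0"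
  using assms by (auto simp: orthonormal_basis_def)

text \<open>The partial sums are Cauchy because the squared coefficients are summable by Bessel.
  Their limit has the same coefficients as \<open>f\<close>; completeness, which is stated only as
  vanishing of whatever is orthogonal to the whole family, identifies the two.\<close>

lemma orthonormal_basis_expansion:
  assumes e: "orthonormal_basis M e" and f: "f \<in> L2 M"
  shows "(\<lambda>n. L2_norm M (\<lambda>x. f x - (\<Sum>i<n. L2_inner M f (e i) * e i x))) \<longlonglongrightarrow> 0"
proof -
  note e1 = orthonormal_basisD(1)[OF e] and e2 = orthonormal_basisD(2)[OF e]
  define c where "c = (\<lambda>i. L2_inner M f (e i))"
  define S where "S = (\<lambda>n x. \<Sum>i<n. c i * e i x)"
  have S: "S n \<in> L2 M" for n unfolding S_def using e1 by simp
  have summ: "summable (\<lambda>i. (cmod (c i))\<^sup>2)"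
    unfolding c_def
    by (rule summableI_nonneg_bounded[of _ "(L2_norm M f)\<^sup>2"]) (auto intro!: L2_Bessel e1 e2 f)
  have diff: "(L2_norm M (\<lambda>x. S m x - S n x))\<^sup>2 = (\<Sum>i\<in>{n..<m}. (cmod (c i))\<^sup>2)" if "n \<le> m" for m n
  proof -
    have "S m x - S n x = (\<Sum>i\<in>{n..<m}. c i * e i x)" for x
      unfolding S_def using sum.nat_group sum_diff_nat_ivl[of 0 n m "\<lambda>i. c i * e i x"] that
      by (simp add: atLeast0LessThan)
    then show ?thesis using L2_norm_orthonormal_sum[of "{n..<m}" e M c] e1 e2 by simp
  qed
  obtain g where g: "g \<in> L2 M" "(\<lambda>k. L2_norm M (\<lambda>x. S k x - g x)) \<longlonglongrightarrow> 0"
  proof (rule L2_Riesz_Fischer[OF S])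
    fix r :: real assume r: "r > 0"
    obtain N where N: "\<And>m n. m \<ge> N \<Longrightarrow> norm (\<Sum>i\<in>{m..<n}. (cmod (c i))\<^sup>2) < r\<^sup>2"
      using summ[unfolded summable_Cauchy] r by (meson zero_less_power)
    have *: "L2_norm M (\<lambda>x. S m x - S n x) < r" if "n \<ge> N" "n \<le> m" for m n
    proof (rule power2_less_imp_less)
      show "(L2_norm M (\<lambda>x. S m x - S n x))\<^sup>2 < r\<^sup>2"
        using N[OF that(1), of m] diff[OF that(2)] by (auto simp: abs_less_iff)
    qed (use r in simp)
    show "\<exists>N. \<forall>m\<ge>N. \<forall>n\<ge>N. L2_norm M (\<lambda>x. S m x - S n x) < r"
    proof (intro exI allI impI)
      fix m n assume "N \<le> m" "N \<le> n"
      then show "L2_norm M (\<lambda>x. S m x - S n x) < r"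
        using *[of n m] *[of m n] L2_norm_minus_commute[of M "S m" "S n"] by (cases "n \<le> m") auto
    qed
  qed auto
  have "L2_inner M (\<lambda>x. f x - g x) (e i) = 0" for i
  proof -
    have "(\<lambda>k. L2_inner M (S k) (e i)) \<longlonglongrightarrow> L2_inner M g (e i)"
      by (rule L2_inner_tendsto) (auto simp: S g e1)
    moreover have "eventually (\<lambda>k. L2_inner M (S k) (e i) = c i) sequentially"
      using eventually_gt_at_top[of i]
    proof eventually_elim
      case (elim k)
      show ?case unfolding S_def by (rule L2_inner_orthonormal_sum) (use e1 e2 elim in auto)
    qed
    ultimately have "L2_inner M g (e i) = c i"
      using tendsto_eventually LIMSEQ_unique by metis
    then show ?thesis using f g e1 by (simp add: L2_inner_diff_left c_def)
  qed
  then have "AE x in M. f x - g x = 0"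
    using orthonormal_basisD(3)[OF e L2_diff[OF f g(1)]] by simp
  then have "L2_norm M (\<lambda>x. f x - S n x) = L2_norm M (\<lambda>x. S n x - g x)" for n
    unfolding L2_norm_minus_commute[of M "S n" g] using L2_measurable[OF f] L2_measurable[OF g(1)] L2_measurable[OF S]
    by (intro L2_norm_cong_AE) auto
  then show ?thesis using g(2) by (simp add: S_def c_def)
qed

lemma orthonormal_basis_sums:
  assumes e: "orthonormal_basis M e" and f: "f \<in> L2 M"
  shows "(\<lambda>i. (cmod (L2_inner M f (e i)))\<^sup>2) sums (L2_norm M f)\<^sup>2"
proof -
  note e1 = orthonormal_basisD(1)[OF e] and e2 = orthonormal_basisD(2)[OF e]
  have "(\<lambda>n. (L2_norm M f)\<^sup>2 - (L2_norm M (\<lambda>x. f x - (\<Sum>i<n. L2_inner M f (e i) * e i x)))\<^sup>2)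
      \<longlonglongrightarrow> (L2_norm M f)\<^sup>2 - 0\<^sup>2"
    by (intro tendsto_intros orthonormal_basis_expansion e f)
  then show ?thesis
    unfolding sums_def using e1 e2 f by (subst (asm) L2_norm_orthonormal_rest) auto
qed

lemma orthonormal_basis_nn2:
  assumes e: "orthonormal_basis M e" and f: "f \<in> L2 M"
  shows "(\<Sum>i. ennreal ((cmod (L2_inner M f (e i)))\<^sup>2)) = nn2 M f"
  using orthonormal_basis_sums[OF e f] by (auto simp: nn2_L2[OF f] sums_iff intro!: suminf_ennreal_eq)

lemma nn2_count_space: "nn2 (count_space UNIV) c = (\<Sum>i::nat. ennreal ((cmod (c i))\<^sup>2))"
  by (simp add: nn2_def nn_integral_count_space_nat)

lemma orthonormal_basis_coeff_L2:
  assumes e: "orthonormal_basis M e" and f: "f \<in> L2 M"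
  shows "(\<lambda>i. L2_inner M f (e i)) \<in> L2 (count_space UNIV)"
  using orthonormal_basis_nn2[OF e f] nn2_L2[OF f] by (simp add: L2_iff nn2_count_space)

text \<open>Parseval's identity for \<open>f + c * g\<close>, polarized. Treating coefficient
  sequences as elements of \<open>L2 (count_space UNIV)\<close> makes the polarization lemma
  applicable.\<close>

lemma orthonormal_basis_inner:
  assumes e: "orthonormal_basis M e" and f: "f \<in> L2 M" and g: "g \<in> L2 M"
  shows "L2_inner (count_space UNIV) (\<lambda>i. L2_inner M f (e i)) (\<lambda>i. L2_inner M g (e i)) = L2_inner M f g"
proof (rule L2_polarization[symmetric])
  fix c
  have h: "(\<lambda>x. f x + c * g x) \<in> L2 M" using f g by auto
  have "(L2_norm M (\<lambda>x. f x + c * g x))\<^sup>2 = (L2_norm (count_space UNIV) (\<lambda>i. L2_inner M (\<lambda>x. f x + c * g x) (e i)))\<^sup>2"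
    by (simp add: L2_norm_nn2 L2_measurable[OF h] nn2_count_space orthonormal_basis_nn2[OF e h])
  then have "L2_norm M (\<lambda>x. f x + c * g x) = L2_norm (count_space UNIV) (\<lambda>i. L2_inner M (\<lambda>x. f x + c * g x) (e i))"
    by simp
  moreover have "(\<lambda>i. L2_inner M (\<lambda>x. f x + c * g x) (e i)) = (\<lambda>i. L2_inner M f (e i) + c * L2_inner M g (e i))"
    using f g orthonormal_basisD(1)[OF e] by (auto simp: L2_inner_add_left L2_inner_scale_left L2_scale)
  ultimately show "L2_norm M (\<lambda>x. f x + c * g x) = L2_norm (count_space UNIV) (\<lambda>i. L2_inner M f (e i) + c * L2_inner M g (e i))"
    by simp
qed (use e f g orthonormal_basis_coeff_L2 in auto)

section \<open>Fourier series on cubes\<close>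

text \<open>Lattice points are vectors with integer coordinates, not tuples of integers, so that
  they can be added to points, paired by the inner product and acted on by matrices without
  conversion.\<close>

definition int_lattice :: "'a::euclidean_space set" where
  "int_lattice = {x. \<forall>b\<in>Basis. x \<bullet> b \<in> \<int>}"

definition ucube :: "'a::euclidean_space set" where
  "ucube = {x. \<forall>b\<in>Basis. 0 \<le> x \<bullet> b \<and> x \<bullet> b < 1}"

text \<open>The vector \<open>k\<close> is arbitrary, so that the same function serves as a
  character of Fourier series and as the kernel of the Fourier transform.\<close>

definition fchar :: "'a::euclidean_space \<Rightarrow> 'a \<Rightarrow> complex" where
  "fchar k x = cis (2 * pi * (k \<bullet> x))"

definition vfloor :: "'a::euclidean_space \<Rightarrow> 'a" where
  "vfloor x = (\<Sum>b\<in>Basis. of_int \<lfloor>x \<bullet> b\<rfloor> *\<^sub>R b)"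

lemma int_lattice_add: "x \<in> int_lattice \<Longrightarrow> y \<in> int_lattice \<Longrightarrow> x + y \<in> int_lattice"
  by (auto simp: int_lattice_def inner_add_left)

lemma int_lattice_diff: "x \<in> int_lattice \<Longrightarrow> y \<in> int_lattice \<Longrightarrow> x - y \<in> int_lattice"
  by (auto simp: int_lattice_def inner_diff_left)

lemma int_lattice_uminus: "x \<in> int_lattice \<Longrightarrow> - x \<in> int_lattice"
  by (auto simp: int_lattice_def)

lemma int_lattice_0 [simp]: "0 \<in> int_lattice"
  by (auto simp: int_lattice_def)

lemma int_lattice_Basis: "b \<in> Basis \<Longrightarrow> b \<in> int_lattice"
  by (auto simp: int_lattice_def inner_Basis)

lemma countable_int_lattice: "countable (int_lattice :: 'a::euclidean_space set)"
proof -
  have "countable (Basis \<rightarrow>\<^sub>E (UNIV :: int set) :: ('a \<Rightarrow> int) set)"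
    by (intro countable_PiE) auto
  moreover have "(int_lattice :: 'a set) \<subseteq> (\<lambda>f. \<Sum>b\<in>Basis. of_int (f b) *\<^sub>R b) ` (Basis \<rightarrow>\<^sub>E UNIV)"
  proof
    fix x :: 'a assume x: "x \<in> int_lattice"
    have "x = (\<Sum>b\<in>Basis. (x \<bullet> b) *\<^sub>R b)" by (simp add: euclidean_representation)
    also have "\<dots> = (\<Sum>b\<in>Basis. of_int (restrict (\<lambda>b. \<lfloor>x \<bullet> b\<rfloor>) Basis b) *\<^sub>R b)"
      using x by (intro sum.cong) (auto simp: int_lattice_def Ints_def)
    finally show "x \<in> (\<lambda>f. \<Sum>b\<in>Basis. of_int (f b) *\<^sub>R b) ` (Basis \<rightarrow>\<^sub>E (UNIV :: int set))"
      by (intro image_eqI[where x = "restrict (\<lambda>b. \<lfloor>x \<bullet> b\<rfloor>) Basis"]) auto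
  qed
  ultimately show ?thesis using countable_image countable_subset by blast
qed

lemma infinite_int_lattice: "infinite (int_lattice :: 'a::euclidean_space set)"
proof -
  obtain b :: 'a where b: "b \<in> Basis" using nonempty_Basis by blast
  have "inj (\<lambda>n::nat. real n *\<^sub>R b)" using b by (intro injI) auto
  then have "infinite (range (\<lambda>n::nat. real n *\<^sub>R b))" using finite_imageD by blast
  moreover have "range (\<lambda>n::nat. real n *\<^sub>R b) \<subseteq> int_lattice"
    using b by (auto simp: int_lattice_def inner_Basis)
  ultimately show ?thesis using finite_subset by blast
qed

lemma vfloor_lattice [simp]: "vfloor x \<in> int_lattice"
  by (auto simp: int_lattice_def vfloor_def)

text \<open>The cube is half-open, so its lattice translates tile the space exactly and no null set
  of shared faces has to be discarded.\<close>

lemma ucube_vfloor: "r \<in> int_lattice \<Longrightarrow> x - r \<in> ucube \<longleftrightarrow> r = vfloor x"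
proof
  assume r: "r \<in> int_lattice" and u: "x - r \<in> ucube"
  show "r = vfloor x"
  proof (rule euclidean_eqI)
    fix b :: 'a assume b: "b \<in> Basis"
    from r b obtain n where n: "r \<bullet> b = of_int n" by (auto simp: int_lattice_def Ints_def)
    have "\<lfloor>x \<bullet> b\<rfloor> = n" using u b n by (intro floor_unique) (auto simp: ucube_def inner_diff_left)
    then show "r \<bullet> b = vfloor x \<bullet> b" using b n by (simp add: vfloor_def)
  qed
next
  assume "r = vfloor x"
  then show "x - r \<in> ucube" by (auto simp: ucube_def vfloor_def inner_diff_left) linarith+
qed

lemma ucube_measurable [measurable]: "ucube \<in> sets borel"
  unfolding ucube_def by measurable

lemma lattice_sum_ucube:
  "(\<integral>\<^sup>+r. f r * indicator ucube (x - r) \<partial>count_space int_lattice) = f (vfloor x)"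
proof -
  have "(\<integral>\<^sup>+r. f r * indicator ucube (x - r) \<partial>count_space int_lattice) =
      (\<integral>\<^sup>+r. f (vfloor x) * indicator {vfloor x} r \<partial>count_space int_lattice)"
    by (intro nn_integral_cong) (auto simp: ucube_vfloor indicator_def)
  also have "\<dots> = f (vfloor x)" by (subst nn_integral_cmult_indicator) auto
  finally show ?thesis .
qed

text \<open>Pulling the tiling by cubes back along \<open>T\<close> partitions the domain for any
  measurable \<open>T\<close>. Later \<open>T\<close> is the identity, a dilation, or a matrix that
  may depend on a parameter.\<close>

lemma nn_integral_lattice:
  assumes [measurable]: "f \<in> borel_measurable borel" "T \<in> borel_measurable borel"
  shows "(\<integral>\<^sup>+x. f x \<partial>lborel) = (\<integral>\<^sup>+r. \<integral>\<^sup>+x. f x * indicator ucube (T x - r) \<partial>lborel \<partial>count_space int_lattice)"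
proof -
  have "(\<integral>\<^sup>+r. \<integral>\<^sup>+x. f x * indicator ucube (T x - r) \<partial>lborel \<partial>count_space int_lattice) =
     (\<integral>\<^sup>+x. \<integral>\<^sup>+r. f x * indicator ucube (T x - r) \<partial>count_space int_lattice \<partial>lborel)"
    by (rule nn_integral_count_space_nn_integral[symmetric]) (auto simp: countable_int_lattice)
  then show ?thesis by (simp add: lattice_sum_ucube[of "\<lambda>_. f _"])
qed

subsection \<open>Characters\<close>

lemma norm_fchar [simp]: "cmod (fchar k x) = 1"
  by (simp add: fchar_def)

lemma fchar_measurable [measurable]: "fchar k \<in> borel_measurable borel"
  unfolding fchar_def[abs_def] by (intro borel_measurable_continuous_onI continuous_intros)

lemma fchar_mult: "fchar k x * fchar l x = fchar (k + l) x"
  by (simp add: fchar_def cis_mult inner_add_left ring_distribs)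

lemma fchar_add: "fchar k (x + y) = fchar k x * fchar k y"
  by (simp add: fchar_def cis_mult inner_add_right ring_distribs)

lemma fchar_0 [simp]: "fchar 0 x = 1" "fchar k 0 = 1"
  by (simp_all add: fchar_def)

lemma cnj_fchar: "cnj (fchar k x) = fchar (- k) x"
  by (simp add: fchar_def cis_cnj)

lemma fchar_lattice:
  assumes "k \<in> int_lattice" "r \<in> int_lattice"
  shows "fchar k r = 1"
proof -
  have "k \<bullet> r \<in> \<int>"
    using assms by (subst euclidean_inner) (auto simp: int_lattice_def intro!: Ints_sum Ints_mult)
  then obtain n where "k \<bullet> r = of_int n" by (auto simp: Ints_def)
  then show ?thesis by (simp add: fchar_def)
qed

lemma integral_lborel_prod:
  fixes f :: "'a::euclidean_space \<Rightarrow> real \<Rightarrow> complex"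
  assumes f: "\<And>b. b \<in> Basis \<Longrightarrow> integrable lborel (f b)"
  shows "(LINT x|lborel. (\<Prod>b\<in>Basis. f b (x \<bullet> b))) = (\<Prod>b\<in>Basis. (LINT t|lborel. f b t))"
proof -
  interpret product_sigma_finite "\<lambda>_::'a. lborel :: real measure" by standard
  have [measurable]: "b \<in> Basis \<Longrightarrow> f b \<in> borel_measurable borel" for b
    using borel_measurable_integrable[OF f] by simp
  have "(LINT x|lborel. (\<Prod>b\<in>Basis. f b (x \<bullet> b))) =
      (LINT x|(\<Pi>\<^sub>M b\<in>Basis. lborel). (\<Prod>b\<in>Basis. f b ((\<Sum>b\<in>Basis. x b *\<^sub>R b) \<bullet> b)))"
    by (subst lborel_eq, subst integral_distr) auto
  also have "\<dots> = (LINT x|(\<Pi>\<^sub>M b\<in>Basis. lborel). (\<Prod>b\<in>Basis. f b (x b)))"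
    by (intro Bochner_Integration.integral_cong prod.cong) auto
  also have "\<dots> = (\<Prod>b\<in>Basis. (LINT t|lborel. f b t))"
    by (rule product_integral_prod) (auto simp: f)
  finally show ?thesis .
qed

lemma borel_measurable_cis [measurable]: "cis \<in> borel_measurable borel"
  by (intro borel_measurable_continuous_onI continuous_intros)

lemma integral_cis_period:
  fixes n :: real
  assumes "n \<in> \<int>"
  shows "integrable lborel (\<lambda>t. indicator {0..<1} t * cis (2 * pi * (n * t)))" (is ?A)
    "(LINT t|lborel. indicator {0..<1} t * cis (2 * pi * (n * t))) = (if n = 0 then 1 else 0)" (is ?B)
proof -
  show ?A
    by (rule Bochner_Integration.integrable_bound[of lborel "indicator {0..<1} :: real \<Rightarrow> real"])
       (auto simp: norm_mult split: split_indicator)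
  show ?B
  proof (cases "n = 0")
    case True
    then have "(LINT t|lborel. indicator {0..<1} t * cis (2 * pi * (n * t))) = (LINT t|lborel. complex_of_real (indicator {0..<1} (t::real)))"
      by (intro Bochner_Integration.integral_cong) (auto simp: indicator_def)
    also have "\<dots> = 1" by (subst integral_complex_of_real) simp
    finally show ?thesis using True by simp
  next
    case False
    define F where "F = (\<lambda>t. cis (2 * pi * (n * t)) / (2 * of_real pi * of_real n * \<i>))"
    have "AE t in lborel. t \<noteq> (1::real)" by (rule AE_lborel_singleton)
    then have "(LINT t|lborel. indicator {0..<1} t * cis (2 * pi * (n * t))) =
        (LINT t|lborel. indicator {0..1::real} t *\<^sub>R cis (2 * pi * (n * t)))"
      by (intro integral_cong_AE)
         (auto simp: indicator_def)
    also have "\<dots> = F 1 - F 0"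
    proof (rule integral_FTC_Icc)
      fix x
      have "((\<lambda>z. exp (\<i> * (2 * of_real pi * of_real n * z)) / (2 * of_real pi * of_real n * \<i>))
          has_field_derivative exp (\<i> * (2 * of_real pi * of_real n * of_real x))) (at (of_real x))"
        using False by (auto intro!: derivative_eq_intros)
      then have "((\<lambda>t. exp (\<i> * (2 * of_real pi * of_real n * of_real t)) / (2 * of_real pi * of_real n * \<i>))
          has_vector_derivative exp (\<i> * (2 * of_real pi * of_real n * of_real x))) (at x)"
        by (rule has_vector_derivative_real_field)
      then have "(F has_vector_derivative cis (2 * pi * (n * x))) (at x)"
        unfolding F_def cis_conv_exp by (simp add: mult.assoc)
      then show "(F has_vector_derivative cis (2 * pi * (n * x))) (at x within {0..1})"
        by (rule has_vector_derivative_at_within)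
    qed (auto intro!: continuous_intros)
    also have "\<dots> = 0"
    proof -
      obtain m where m: "n = of_int m" using assms by (auto simp: Ints_def)
      have "cis (2 * pi * (of_int m)) = 1" by (rule cis_multiple_2pi) simp
      then show ?thesis by (simp add: F_def m)
    qed
    finally show ?thesis using False by simp
  qed
qed

lemma integral_ucube_fchar:
  assumes k: "k \<in> int_lattice"
  shows "(LINT x|lborel. indicator ucube x * fchar k x) = (if k = 0 then 1 else 0)"
proof -
  have eq: "indicator ucube x * fchar k x = (\<Prod>b\<in>Basis. indicator {0..<1} (x \<bullet> b) * cis (2 * pi * ((k \<bullet> b) * (x \<bullet> b))))" for x :: 'a
  proof -
    have "fchar k x = (\<Prod>b\<in>Basis. cis (2 * pi * ((k \<bullet> b) * (x \<bullet> b))))"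
    proof -
      have "(\<Prod>b\<in>A. cis (g b)) = cis (\<Sum>b\<in>A. g b)" for A :: "'a set" and g
        by (induction A rule: infinite_finite_induct) (auto simp: cis_mult)
      then show ?thesis unfolding fchar_def by (subst euclidean_inner) (simp add: sum_distrib_left)
    qed
    moreover have "indicator ucube x = (\<Prod>b\<in>Basis. indicator {0..<1} (x \<bullet> b) :: complex)"
    proof (cases "x \<in> ucube")
      case False
      then obtain b where "b \<in> Basis" "x \<bullet> b \<notin> {0..<1}" by (auto simp: ucube_def not_less)
      then have "(\<Prod>b\<in>Basis. indicator {0..<1} (x \<bullet> b) :: complex) = 0"
        by (intro prod_zero bexI[of _ b]) auto
      then show ?thesis using False by simp
    qed (auto simp: ucube_def)
    ultimately show ?thesis by (simp add: prod.distrib)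
  qed
  have kb: "k \<bullet> b \<in> \<int>" if "b \<in> Basis" for b using k that by (auto simp: int_lattice_def)
  have "(LINT x|lborel. indicator ucube x * fchar k x) = (\<Prod>b\<in>Basis. if k \<bullet> b = 0 then 1 else 0)"
    unfolding eq using kb by (subst integral_lborel_prod) (auto simp: integral_cis_period)
  also have "\<dots> = (if k = 0 then 1 else 0)"
  proof (cases "k = 0")
    case False
    then obtain b where "b \<in> Basis" "k \<bullet> b \<noteq> 0" using euclidean_all_zero_iff by blast
    then show ?thesis using False by (auto intro!: prod_zero)
  qed auto
  finally show ?thesis .
qed

lemma lborel_shift:
  fixes c :: "'a::euclidean_space"
  shows "f \<in> borel_measurable borel \<Longrightarrow> (\<integral>\<^sup>+x. f (x + c) \<partial>lborel) = (\<integral>\<^sup>+x. f x \<partial>lborel)"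
proof -
  assume f: "f \<in> borel_measurable borel"
  have "(\<integral>\<^sup>+x. f x \<partial>distr lborel borel ((+) c)) = (\<integral>\<^sup>+x. f (c + x) \<partial>lborel)"
    using f by (intro nn_integral_distr) auto
  then show ?thesis by (simp add: lborel_distr_plus add.commute)
qed

lemma integral_shift:
  fixes c :: "'a::euclidean_space" and f :: "'a \<Rightarrow> complex"
  shows "f \<in> borel_measurable borel \<Longrightarrow> (LINT x|lborel. f (x + c)) = (LINT x|lborel. f x)"
proof -
  assume f: "f \<in> borel_measurable borel"
  have "(LINT x|distr lborel borel ((+) c). f x) = (LINT x|lborel. f (c + x))"
    using f by (intro integral_distr) auto
  then show ?thesis by (simp add: lborel_distr_plus add.commute)
qed

subsection \<open>Trigonometric polynomials\<close>

text \<open>The span of the characters with lattice frequencies. Closure under products is a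
  consequence, as characters multiply by adding frequencies; it is what turns polynomials in points
  of the circle into trigonometric polynomials.\<close>

inductive_set trigp :: "('a::euclidean_space \<Rightarrow> complex) set" where
  char: "k \<in> int_lattice \<Longrightarrow> fchar k \<in> trigp"
| add: "p \<in> trigp \<Longrightarrow> q \<in> trigp \<Longrightarrow> (\<lambda>x. p x + q x) \<in> trigp"
| scale: "p \<in> trigp \<Longrightarrow> (\<lambda>x. c * p x) \<in> trigp"

lemma trigp_const: "(\<lambda>x. c) \<in> trigp"
  using trigp.scale[OF trigp.char[OF int_lattice_0], of c] by (simp add: fchar_0[abs_def])

lemma trigp_mult:
  assumes "p \<in> trigp" "q \<in> trigp" shows "(\<lambda>x. p x * q x) \<in> trigp"
  using assms(1)
proof induction
  case (char k)
  show ?case using assms(2)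
  proof induction
    case (char l)
    then show ?case using trigp.char[of "k + l"] \<open>k \<in> int_lattice\<close>
      by (simp add: fchar_mult int_lattice_add)
  next
    case (add p q)
    then show ?case using trigp.add by (fastforce simp: distrib_left)
  next
    case (scale p c)
    then show ?case using trigp.scale[of "\<lambda>x. fchar k x * p x" c] by (simp add: mult_ac)
  qed
next
  case (add p1 p2)
  then show ?case using trigp.add by (fastforce simp: distrib_right)
next
  case (scale p c)
  then show ?case using trigp.scale[of "\<lambda>x. p x * q x" c] by (simp add: mult_ac)
qed

lemma trigp_prod: "(\<And>i. i \<in> A \<Longrightarrow> p i \<in> trigp) \<Longrightarrow> (\<lambda>x. \<Prod>i\<in>A. p i x) \<in> trigp"
  by (induction A rule: infinite_finite_induct) (auto intro: trigp_const trigp_mult)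

text \<open>A real linear functional of \<open>cis\<close> is a combination of the characters with
  frequencies \<open>b\<close> and \<open>-b\<close>, and sums and products stay trigonometric. In
  this way Stone-Weierstrass approximants on the circle become finite sums of characters.\<close>

lemma trigp_coordinate:
  fixes b :: "'a::euclidean_space"
  assumes b: "b \<in> Basis" and "real_polynomial_function g"
  shows "(\<lambda>x. complex_of_real (g (cis (2 * pi * (x \<bullet> b))))) \<in> trigp"
  using assms(2)
proof induction
  case (linear f)
  interpret bounded_linear f by fact
  have f: "f z = Re z * f 1 + Im z * f \<i>" for z
  proof -
    have "z = Re z *\<^sub>R 1 + Im z *\<^sub>R \<i>" by (simp add: complex_eq_iff)
    then show ?thesis by (metis add real_scaleR_def scaleR)
  qed
  define c where "c = (of_real (f 1) - \<i> * of_real (f \<i>)) / 2"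
  define d where "d = (of_real (f 1) + \<i> * of_real (f \<i>)) / 2"
  have "complex_of_real (f (cis (2 * pi * (x \<bullet> b)))) = c * fchar b x + d * fchar (- b) x" for x
    unfolding f[of "cis _"] c_def d_def
    by (simp add: fchar_def complex_eq_iff inner_commute field_simps)
  moreover have "(\<lambda>x. c * fchar b x + d * fchar (- b) x) \<in> trigp"
    by (intro trigp.intros int_lattice_uminus int_lattice_Basis b)
  ultimately show ?case by simp
next
  case (const c)
  then show ?case by (rule trigp_const)
next
  case (add f g)
  then show ?case using trigp.add by fastforce
next
  case (mult f g)
  then show ?case using trigp_mult by fastforce
qed

section \<open>Uniqueness of Fourier coefficients on the unit cube\<close>

lemma integral_trigp_zero:
  assumes F: "integrable lborel F" and zero: "\<And>k. k \<in> int_lattice \<Longrightarrow> (LINT x|lborel. F x * fchar k x) = 0"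
    and "p \<in> trigp"
  shows "integrable lborel (\<lambda>x. F x * p x) \<and> (LINT x|lborel. F x * p x) = 0"
  using assms(3)
proof induction
  case (char k)
  have "integrable lborel (\<lambda>x. F x * fchar k x)"
    by (rule Bochner_Integration.integrable_bound[OF F])
       (use borel_measurable_integrable[OF F] in \<open>auto simp: norm_mult\<close>)
  then show ?case using zero char by auto
next
  case (add p q)
  then show ?case by (simp add: distrib_left)
next
  case (scale p c)
  then have "integrable lborel (\<lambda>x. c * (F x * p x)) \<and> (LINT x|lborel. c * (F x * p x)) = 0"
    by simp
  then show ?case by (simp add: mult_ac)
qed

text \<open>The functions \<open>min 1 (j * distance)\<close>, with the distance to the complement
  of the arc, are continuous on the circle and increase to the indicator of the arc.
  Stone-Weierstrass replaces each of them by a polynomial within \<open>1 / (j + 1)\<close>. The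
  bound 2 adds the bound 1 of the function and the bound 1 of the error; it serves dominated
  convergence.\<close>

lemma trig_approx_interval:
  fixes u v :: real
  shows "\<exists>g. (\<forall>j::nat. real_polynomial_function (g j)) \<and>
    (\<forall>j x. \<bar>g j (cis (2 * pi * x))\<bar> \<le> 2) \<and>
    (\<forall>x. 0 < x \<and> x < 1 \<longrightarrow> (\<lambda>j. g j (cis (2 * pi * x))) \<longlonglongrightarrow> indicator {u<..<v} x)"
proof -
  \<comment> \<open>The image on the circle of the complement of the interval. Clipping to
    \<open>max 0 u\<close> and \<open>min 1 v\<close> keeps the point with parameter 0 in
    \<open>C\<close> in all cases, so \<open>C\<close> is nonempty and \<open>infdist\<close> is a
    true distance.\<close>
  define C where "C = (\<lambda>x. cis (2 * pi * x)) ` ({0..1} - {max 0 u<..<min 1 v})"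
  have "{0..1} - {max 0 u<..<min 1 v} = {0..1} \<inter> - {max 0 u<..<min 1 v}" by auto
  then have "compact ({0..1} - {max 0 u<..<min 1 v})"
    by (metis compact_Icc compact_Int_closed closed_Compl open_greaterThanLessThan)
  then have "compact C" unfolding C_def by (intro compact_continuous_image continuous_intros)
  then have C: "closed C" by (rule compact_imp_closed)
  have "cis (2 * pi * 0) \<in> C" unfolding C_def by (rule imageI) auto
  then have C0: "C \<noteq> {}" by blast
  \<comment> \<open>Parameters with the same point on the circle differ by an integer, and this
    integer is 0 because \<open>x\<close> lies strictly inside the unit interval.\<close>
  have inC: "cis (2 * pi * x) \<in> C \<longleftrightarrow> x \<notin> {u<..<v}" if x: "0 < x" "x < 1" for x
  proof
    assume "cis (2 * pi * x) \<in> C"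
    then obtain y where y: "y \<in> {0..1}" "y \<notin> {max 0 u<..<min 1 v}" "cis (2 * pi * x) = cis (2 * pi * y)"
      by (auto simp: C_def)
    then have "cis (2 * pi * x - 2 * pi * y) = 1"
      by (simp add: cis_divide[symmetric])
    then have "cos (2 * pi * (x - y)) = 1"
      by (metis cis.sel(1) one_complex.sel(1) right_diff_distrib)
    then obtain n :: int where "2 * pi * (x - y) = of_int n * (2 * pi)"
      by (auto simp: cos_one_2pi_int)
    then have n: "x - y = of_int n" by simp
    then have "\<bar>real_of_int n\<bar> < 1" using x y(1) by (auto simp: abs_less_iff)
    then have "n = 0" by linarith
    then show "x \<notin> {u<..<v}" using n y x by auto
  qed (use x in \<open>auto simp: C_def\<close>)
  define H where "H = (\<lambda>j::nat. \<lambda>z. min 1 (real j * infdist z C))"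
  have "\<exists>g. real_polynomial_function g \<and> (\<forall>z\<in>sphere 0 1. \<bar>H j z - g z\<bar> < 1 / (real j + 1))" for j
  proof -
    have "continuous_on (sphere 0 1) (H j)" unfolding H_def by (intro continuous_intros)
    then obtain g where "real_polynomial_function g" "\<And>z. z \<in> sphere 0 1 \<Longrightarrow> \<bar>H j z - g z\<bar> < 1 / (real j + 1)"
      using Stone_Weierstrass_real_polynomial_function[of "sphere 0 1" "H j" "1 / (real j + 1)"] by auto
    then show ?thesis by blast
  qed
  then obtain g where g: "\<And>j. real_polynomial_function (g j)"
    "\<And>j z. z \<in> sphere 0 1 \<Longrightarrow> \<bar>H j z - g j z\<bar> < 1 / (real j + 1)" by metis
  have g': "\<bar>H j (cis t) - g j (cis t)\<bar> < 1 / (real j + 1)" for j t by (rule g(2)) simp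
  have "\<bar>g j (cis t)\<bar> \<le> 2" for j t
  proof -
    have "0 \<le> H j (cis t)" "H j (cis t) \<le> 1" by (auto simp: H_def infdist_nonneg)
    moreover have "1 / (real j + 1) \<le> 1" by simp
    ultimately show ?thesis using g'[of j t] by linarith
  qed
  moreover have "(\<lambda>j. g j (cis (2 * pi * x))) \<longlonglongrightarrow> indicator {u<..<v} x" if x: "0 < x" "x < 1" for x
  proof -
    let ?z = "cis (2 * pi * x)"
    have H: "(\<lambda>j. H j ?z) \<longlonglongrightarrow> indicator {u<..<v} x"
    proof (cases "?z \<in> C")
      case True
      then show ?thesis using inC[OF x] by (simp add: H_def)
    next
      case False
      then have pos: "infdist ?z C > 0"
        using in_closed_iff_infdist_zero[OF C C0] infdist_nonneg[of ?z C] by (metis less_eq_real_def)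
      then obtain J :: nat where J: "real J > 1 / infdist ?z C" using reals_Archimedean2 by blast
      have "H j ?z = 1" if "j \<ge> J" for j
      proof -
        have "real j > 1 / infdist ?z C" using that J by linarith
        then have "1 \<le> real j * infdist ?z C" using pos by (simp add: pos_divide_less_eq)
        then show ?thesis by (simp add: H_def)
      qed
      then have "(\<lambda>j. H j ?z) \<longlonglongrightarrow> 1"
        by (intro tendsto_eventually) (auto simp: eventually_sequentially)
      then show ?thesis using False inC[OF x] by simp
    qed
    have "(\<lambda>j. g j ?z - H j ?z) \<longlonglongrightarrow> 0"
    proof (rule Lim_null_comparison)
      show "\<forall>\<^sub>F j in sequentially. norm (g j ?z - H j ?z) \<le> 1 / (real j + 1)"
        using g' by (intro always_eventually allI) (metis abs_minus_commute less_eq_real_def real_norm_def)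
      show "(\<lambda>j. 1 / (real j + 1)) \<longlonglongrightarrow> 0"
        using LIMSEQ_inverse_real_of_nat by (simp add: inverse_eq_divide add.commute)
    qed
    from tendsto_add[OF this H] show ?thesis by simp
  qed
  ultimately show ?thesis using g(1) by blast
qed

text \<open>The positive and the negative part of \<open>F\<close> are densities of two finite
  measures that agree on boxes. Boxes are closed under intersection and generate the Borel sets, so
  the measures agree, and hence their densities.\<close>

lemma AE_zero_if_box_integrals_zero:
  fixes F :: "'a::euclidean_space \<Rightarrow> real"
  assumes F: "integrable lborel F" and zero: "\<And>u v. (LINT x|lborel. F x * indicator (box u v) x) = 0"
  shows "AE x in lborel. F x = 0"
proof -
  have [measurable]: "F \<in> borel_measurable borel" using borel_measurable_integrable[OF F] by simp
  have fin: "(\<integral>\<^sup>+x. ennreal (F x) \<partial>lborel) \<noteq> \<infinity>" "(\<integral>\<^sup>+x. ennreal (- F x) \<partial>lborel) \<noteq> \<infinity>"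
    using F by (auto simp: real_integrable_def)
  have "density lborel (\<lambda>x. ennreal (F x)) = density lborel (\<lambda>x. ennreal (- F x))"
  proof (rule measure_eqI_generator_eq)
    let ?E = "range (\<lambda>(a, b). box a b::'a set)"
    show "Int_stable ?E" by (auto simp: Int_stable_def box_Int_box)
    show "?E \<subseteq> Pow UNIV" "sets (density lborel (\<lambda>x. ennreal (F x))) = sigma_sets UNIV ?E"
       "sets (density lborel (\<lambda>x. ennreal (- F x))) = sigma_sets UNIV ?E"
      by (simp_all add: borel_eq_box)
    let ?A = "\<lambda>n::nat. box (- (real n *\<^sub>R One)) (real n *\<^sub>R One) :: 'a set"
    show "range ?A \<subseteq> ?E" "(\<Union>i. ?A i) = UNIV"
      unfolding UN_box_eq_UNIV by auto
    show "emeasure (density lborel (\<lambda>x. ennreal (F x))) (?A i) \<noteq> \<infinity>" for i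
    proof -
      have "emeasure (density lborel (\<lambda>x. ennreal (F x))) (?A i) \<le> (\<integral>\<^sup>+x. ennreal (F x) \<partial>lborel)"
        by (subst emeasure_density) (auto intro!: nn_integral_mono simp: indicator_def)
      then show ?thesis using fin by (auto simp: top_unique)
    qed
    fix X assume "X \<in> ?E"
    then obtain u v where X: "X = box u v" by auto
    have i: "integrable lborel (\<lambda>x. F x * indicator X x)"
      unfolding X by (rule integrable_real_mult_indicator) (auto simp: F)
    have f2: "(\<integral>\<^sup>+x. ennreal (F x * indicator X x) \<partial>lborel) \<noteq> \<infinity>" "(\<integral>\<^sup>+x. ennreal (- (F x * indicator X x)) \<partial>lborel) \<noteq> \<infinity>"
      using i by (auto simp: real_integrable_def)
    have "enn2real (\<integral>\<^sup>+x. ennreal (F x * indicator X x) \<partial>lborel) = enn2real (\<integral>\<^sup>+x. ennreal (- (F x * indicator X x)) \<partial>lborel)"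
      using zero[of u v] real_lebesgue_integral_def[OF i] X by simp
    then have "(\<integral>\<^sup>+x. ennreal (F x * indicator X x) \<partial>lborel) = (\<integral>\<^sup>+x. ennreal (- (F x * indicator X x)) \<partial>lborel)"
      using f2 by (metis ennreal_enn2real infinity_ennreal_def less_top)
    moreover have "ennreal (F x * indicator X x) = ennreal (F x) * indicator X x"
        "ennreal (- (F x * indicator X x)) = ennreal (- F x) * indicator X x" for x
      by (auto simp: indicator_def)
    ultimately show "emeasure (density lborel (\<lambda>x. ennreal (F x))) X = emeasure (density lborel (\<lambda>x. ennreal (- F x))) X"
      by (simp add: emeasure_density X)
  qed
  then have "AE x in lborel. ennreal (F x) = ennreal (- F x)"
    using fin by (subst (asm) finite_density_unique) auto
  then show ?thesis
  proof eventually_elim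
    case (elim x)
    then show ?case by (cases "F x \<ge> 0") (auto simp: ennreal_neg)
  qed
qed

lemma ucube_minus_box_null: "emeasure lborel (ucube - box 0 One :: 'a::euclidean_space set) = 0"
proof -
  have "(ucube - box 0 One :: 'a set) \<subseteq> cbox 0 One - box 0 One"
    by (auto simp: ucube_def mem_box less_imp_le)
  moreover have "emeasure lborel (cbox 0 One - box 0 One :: 'a set) = 0"
    by (subst emeasure_Diff) (auto simp: box_subset_cbox emeasure_lborel_cbox_eq emeasure_lborel_box_eq)
  ultimately show ?thesis
    using emeasure_mono[of "ucube - box 0 One :: 'a set" "cbox 0 One - box 0 One" lborel] by simp
qed

text \<open>Orthogonality to the characters extends to trigonometric polynomials and then, by
  dominated convergence, to products of interval indicators, that is, to boxes. The approximation
  works only in the open cube, but the part of the half-open cube outside it is null.\<close>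

lemma fourier_uniqueness_ucube:
  fixes F :: "'a::euclidean_space \<Rightarrow> complex"
  assumes F: "integrable lborel F" and supp: "\<And>x. x \<notin> ucube \<Longrightarrow> F x = 0"
    and zero: "\<And>k. k \<in> int_lattice \<Longrightarrow> (LINT x|lborel. F x * fchar k x) = 0"
  shows "AE x in lborel. F x = 0"
proof -
  have [measurable]: "F \<in> borel_measurable borel" using borel_measurable_integrable[OF F] by simp
  have "AE x in lborel. x \<notin> (ucube - box 0 One :: 'a set)"
    by (rule AE_not_in) (auto simp: null_sets_def ucube_minus_box_null)
  then have inside: "AE x in lborel. F x = 0 \<or> x \<in> box 0 One"
    by eventually_elim (use supp in auto)
  have box: "(LINT x|lborel. F x * indicator (box u v) x) = 0" for u v :: 'a
  proof -
    obtain g :: "'a \<Rightarrow> nat \<Rightarrow> complex \<Rightarrow> real" where g: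
      "\<And>b j. real_polynomial_function (g b j)" "\<And>b j x. \<bar>g b j (cis (2 * pi * x))\<bar> \<le> 2"
      "\<And>b x. 0 < x \<Longrightarrow> x < 1 \<Longrightarrow> (\<lambda>j. g b j (cis (2 * pi * x))) \<longlonglongrightarrow> indicator {u \<bullet> b<..<v \<bullet> b} x"
      using trig_approx_interval[of "u \<bullet> b" "v \<bullet> b" for b] by metis
    \<comment> \<open>One approximating polynomial per coordinate. The product is bounded by
      \<open>2 ^ DIM('a)\<close> and converges to the indicator of the box at every point of the
      open unit cube.\<close>
    define p where "p = (\<lambda>j (x::'a). \<Prod>b\<in>Basis. complex_of_real (g b j (cis (2 * pi * (x \<bullet> b)))))"
    have p: "p j \<in> trigp" for j
      unfolding p_def by (intro trigp_prod trigp_coordinate g)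
    have zero_p: "(LINT x|lborel. F x * p j x) = 0" "integrable lborel (\<lambda>x. F x * p j x)" for j
      using integral_trigp_zero[OF F zero p] by auto
    have pb: "cmod (p j x) \<le> 2 ^ DIM('a)" for j x
    proof -
      have "cmod (p j x) = (\<Prod>b\<in>Basis. \<bar>g b j (cis (2 * pi * (x \<bullet> b)))\<bar>)"
        by (simp add: p_def flip: prod_norm)
      also have "\<dots> \<le> (\<Prod>b\<in>(Basis::'a set). 2)" by (intro prod_mono) (auto intro: g)
      finally show ?thesis by simp
    qed
    have "(\<lambda>j. LINT x|lborel. F x * p j x) \<longlonglongrightarrow> (LINT x|lborel. F x * indicator (box u v) x)"
    proof (rule integral_dominated_convergence)
      show "integrable lborel (\<lambda>x. 2 ^ DIM('a) * cmod (F x))" using F by auto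
      show "AE x in lborel. (\<lambda>j. F x * p j x) \<longlonglongrightarrow> F x * indicator (box u v) x"
        using inside
      proof eventually_elim
        case (elim x)
        then show ?case
        proof
          assume x: "x \<in> box 0 One"
          have "(\<lambda>j. p j x) \<longlonglongrightarrow> (\<Prod>b\<in>Basis. complex_of_real (indicator {u \<bullet> b<..<v \<bullet> b} (x \<bullet> b)))"
            unfolding p_def using x by (intro tendsto_prod tendsto_of_real g) (auto simp: mem_box)
          also have "(\<Prod>b\<in>Basis. complex_of_real (indicator {u \<bullet> b<..<v \<bullet> b} (x \<bullet> b))) = indicator (box u v) x"
          proof (cases "x \<in> box u v")
            case False
            then obtain b where "b \<in> Basis" "x \<bullet> b \<notin> {u \<bullet> b<..<v \<bullet> b}" by (auto simp: mem_box)
            then show ?thesis using False by (auto intro!: prod_zero bexI[of _ b])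
          qed (auto simp: mem_box)
          finally show ?thesis by (intro tendsto_mult tendsto_const)
        qed auto
      qed
      show "AE x in lborel. norm (F x * p j x) \<le> 2 ^ DIM('a) * cmod (F x)" for j
        using pb by (simp add: norm_mult mult.commute[of _ "cmod (F _)"] mult_left_mono)
    qed (use zero_p(2) borel_measurable_integrable in auto)
    then show ?thesis by (simp add: zero_p LIMSEQ_const_iff)
  qed
  have i: "integrable lborel (\<lambda>x. F x * indicator (box u v) x)" for u v :: 'a
    by (rule Bochner_Integration.integrable_bound[OF F]) (auto simp: norm_mult indicator_def)
  have "AE x in lborel. Re (F x) = 0"
  proof (rule AE_zero_if_box_integrals_zero)
    fix u v :: 'a
    have "Re (F x) * indicator (box u v) x = Re (F x * indicator (box u v) x)" for x by (simp add: indicator_def)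
    then show "(LINT x|lborel. Re (F x) * indicator (box u v) x) = 0"
      by (simp only: integral_Re[OF i] box) simp
  qed (use F in auto)
  moreover have "AE x in lborel. Im (F x) = 0"
  proof (rule AE_zero_if_box_integrals_zero)
    fix u v :: 'a
    have "Im (F x) * indicator (box u v) x = Im (F x * indicator (box u v) x)" for x by (simp add: indicator_def)
    then show "(LINT x|lborel. Im (F x) * indicator (box u v) x) = 0"
      by (simp only: integral_Im[OF i] box) simp
  qed (use F in auto)
  ultimately show ?thesis by eventually_elim (simp add: complex_eq_iff)
qed

subsection \<open>The Fourier basis\<close>

lemma emeasure_ucube [simp]: "emeasure lborel (ucube :: 'a::euclidean_space set) = 1"
proof -
  have "box 0 One \<subseteq> (ucube :: 'a set)" by (auto simp: ucube_def mem_box less_imp_le)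
  moreover have "(ucube :: 'a set) \<subseteq> cbox 0 One" by (auto simp: ucube_def mem_box less_imp_le)
  ultimately have "emeasure lborel (box 0 One :: 'a set) \<le> emeasure lborel (ucube :: 'a set)"
    "emeasure lborel (ucube :: 'a set) \<le> emeasure lborel (cbox 0 One :: 'a set)"
    by (simp_all only: emeasure_mono sets_lborel ucube_measurable borel_closed closed_cbox)
  then show ?thesis by (simp add: emeasure_lborel_cbox_eq emeasure_lborel_box_eq)
qed

text \<open>The Fourier bases of all lattice translates of the cube, taken together, form an
  orthonormal basis of the whole \<open>L2\<close> space: the Gabor basis of the cube.\<close>

definition wave :: "'a::euclidean_space \<Rightarrow> 'a \<Rightarrow> 'a \<Rightarrow> complex" where
  "wave r k x = indicator ucube (x - r) * fchar k x"

lemma wave_measurable [measurable]: "wave r k \<in> borel_measurable borel"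
  unfolding wave_def[abs_def] by measurable

lemma wave_L2: "wave r k \<in> L2 lborel"
proof -
  have "nn2 lborel (wave r k) = (\<integral>\<^sup>+x. indicator ucube (x + - r) \<partial>lborel)"
    unfolding nn2_def by (intro nn_integral_cong) (auto simp: wave_def norm_mult indicator_def)
  also have "\<dots> = 1" by (subst lborel_shift) auto
  finally show ?thesis by (simp add: L2_iff)
qed

lemma wave_inner:
  assumes "r \<in> int_lattice" "k \<in> int_lattice" "r' \<in> int_lattice" "k' \<in> int_lattice"
  shows "L2_inner lborel (wave r k) (wave r' k') = (if r = r' \<and> k = k' then 1 else 0)"
proof (cases "r = r'")
  case True
  have "L2_inner lborel (wave r k) (wave r' k') = (LINT x|lborel. indicator ucube (x - r) * fchar (k - k') x)"
    unfolding L2_inner_def True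
    by (intro Bochner_Integration.integral_cong) (auto simp: wave_def cnj_fchar fchar_mult indicator_def)
  also have "\<dots> = (LINT x|lborel. indicator ucube (x + r - r) * fchar (k - k') (x + r))"
    by (rule integral_shift[symmetric]) measurable
  also have "\<dots> = (LINT x|lborel. indicator ucube x * fchar (k - k') x)"
    using assms by (intro Bochner_Integration.integral_cong) (auto simp: fchar_add fchar_lattice int_lattice_diff)
  also have "\<dots> = (if k = k' then 1 else 0)"
    using assms by (subst integral_ucube_fchar) (auto simp: int_lattice_diff)
  finally show ?thesis using True by simp
next
  case False
  then have "wave r k x * cnj (wave r' k' x) = 0" for x
    using assms ucube_vfloor[of r x] ucube_vfloor[of r' x] by (auto simp: wave_def indicator_def)
  then have "L2_inner lborel (wave r k) (wave r' k') = (LINT (x::'a)|lborel. 0)"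
    unfolding L2_inner_def by (simp only:)
  then show ?thesis using False by simp
qed

lemma wave_complete:
  fixes f :: "'a::euclidean_space \<Rightarrow> complex"
  assumes f: "f \<in> L2 lborel"
    and zero: "\<And>r k. r \<in> int_lattice \<Longrightarrow> k \<in> int_lattice \<Longrightarrow> L2_inner lborel f (wave r k) = 0"
  shows "AE x in lborel. f x = 0"
proof -
  have [measurable]: "f \<in> borel_measurable borel" using L2_measurable[OF f] by simp
  have part: "(\<integral>\<^sup>+x. ennreal ((cmod (f x))\<^sup>2) * indicator ucube (x - r) \<partial>lborel) = 0" if r: "r \<in> int_lattice" for r
  proof -
    \<comment> \<open>The piece of \<open>f\<close> over the cube at \<open>r\<close>, moved to the
      unit cube. Characters with lattice frequencies do not see this translation.\<close>
    define F where "F = (\<lambda>x. f (x + r) * indicator ucube x)"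
    have [measurable]: "F \<in> borel_measurable borel" unfolding F_def by measurable
    have eq: "F x * fchar k x = f (x + r) * cnj (wave r (- k) (x + r))" if "k \<in> int_lattice" for x k
      using that r by (auto simp: F_def wave_def cnj_fchar fchar_add fchar_lattice indicator_def)
    have int: "integrable lborel (\<lambda>x. f x * cnj (wave r k x))" for k
      by (rule L2_integrable_mult[OF f wave_L2])
    have "integrable lborel (\<lambda>x. F x * fchar 0 x)"
      unfolding eq[OF int_lattice_0] integrable_iff_bounded
      using lborel_shift[of "\<lambda>x. ennreal (norm (f x * cnj (wave r (- 0) x)))" r] int[of "-0"]
      unfolding integrable_iff_bounded by simp
    then have F: "integrable lborel F" by simp
    have "AE x in lborel. F x = 0"
    proof (rule fourier_uniqueness_ucube[OF F])
      fix k :: 'a assume k: "k \<in> int_lattice"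
      have "(LINT x|lborel. F x * fchar k x) = (LINT x|lborel. f (x + r) * cnj (wave r (- k) (x + r)))"
        by (simp add: eq k)
      also have "\<dots> = (LINT x|lborel. f x * cnj (wave r (- k) x))"
        by (rule integral_shift) measurable
      also have "\<dots> = 0" using zero[OF r int_lattice_uminus[OF k]] by (simp add: L2_inner_def)
      finally show "(LINT x|lborel. F x * fchar k x) = 0" .
    qed (simp add: F_def)
    then have "(\<integral>\<^sup>+x. ennreal ((cmod (f (x + r)))\<^sup>2) * indicator ucube (x + r - r) \<partial>lborel) = (\<integral>\<^sup>+(x::'a). 0 \<partial>lborel)"
      by (intro nn_integral_cong_AE, eventually_elim) (auto simp: F_def indicator_def)
    then show ?thesis by (subst (asm) lborel_shift[of "\<lambda>x. ennreal ((cmod (f x))\<^sup>2) * indicator ucube (x - r)"]) auto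
  qed
  have "(\<integral>\<^sup>+x. ennreal ((cmod (f x))\<^sup>2) \<partial>lborel) =
     (\<integral>\<^sup>+r. \<integral>\<^sup>+x. ennreal ((cmod (f x))\<^sup>2) * indicator ucube (x - r) \<partial>lborel \<partial>count_space int_lattice)"
    by (rule nn_integral_lattice[where T = "\<lambda>x. x"]) auto
  also have "\<dots> = (\<integral>\<^sup>+(r::'a). 0 \<partial>count_space int_lattice)"
    by (intro nn_integral_cong) (auto simp: part)
  finally have "(\<integral>\<^sup>+x. ennreal ((cmod (f x))\<^sup>2) \<partial>lborel) = 0" by simp
  then show ?thesis by (subst (asm) nn_integral_0_iff_AE) auto
qed

definition wave_seq :: "nat \<Rightarrow> 'a::euclidean_space \<Rightarrow> complex" where
  "wave_seq i = (case from_nat_into (int_lattice \<times> int_lattice) i of (r, k) \<Rightarrow> wave r k)"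

lemma wave_seq_bij:
  "bij_betw (from_nat_into (int_lattice \<times> int_lattice :: ('a::euclidean_space \<times> 'a) set)) UNIV (int_lattice \<times> int_lattice)"
  by (intro bij_betw_from_nat_into countable_SIGMA countable_int_lattice)
     (auto simp: infinite_int_lattice finite_cartesian_product_iff intro: int_lattice_0)

lemma orthonormal_basis_wave_seq: "orthonormal_basis lborel (wave_seq :: nat \<Rightarrow> 'a::euclidean_space \<Rightarrow> complex)"
  unfolding orthonormal_basis_def
proof (intro conjI allI ballI impI)
  let ?p = "from_nat_into (int_lattice \<times> int_lattice :: ('a \<times> 'a) set)"
  have p: "?p i \<in> int_lattice \<times> int_lattice" for i
    using wave_seq_bij by (auto simp: bij_betw_def)
  show "wave_seq i \<in> L2 (lborel :: 'a measure)" for i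
    by (simp add: wave_seq_def wave_L2 split: prod.splits)
  fix i j
  have "?p i = ?p j \<longleftrightarrow> i = j" using wave_seq_bij by (auto simp: bij_betw_def dest: injD)
  then show "L2_inner lborel (wave_seq i) (wave_seq j :: 'a \<Rightarrow> complex) = (if i = j then 1 else 0)"
    using p[of i] p[of j] by (auto simp: wave_seq_def wave_inner split: prod.splits)
next
  let ?p = "from_nat_into (int_lattice \<times> int_lattice :: ('a \<times> 'a) set)"
  fix f :: "'a \<Rightarrow> complex" assume f: "f \<in> L2 lborel" "\<forall>i. L2_inner lborel f (wave_seq i) = 0"
  show "AE x in lborel. f x = 0"
  proof (rule wave_complete[OF f(1)])
    fix r k :: 'a assume "r \<in> int_lattice" "k \<in> int_lattice"
    then have "(r, k) \<in> range ?p" using wave_seq_bij by (auto simp: bij_betw_def)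
    then obtain i where "(r, k) = ?p i" by (rule rangeE)
    then show "L2_inner lborel f (wave r k) = 0" using f(2)[rule_format, of i] by (simp add: wave_seq_def split: prod.splits)
  qed
qed

text \<open>In the expansion along the waves only those at the cube \<open>r\<close> meet the
  support of \<open>F\<close>, so the double sum collapses to a sum over \<open>k\<close>. The sign
  of the frequency is absorbed by reflecting the lattice.\<close>

lemma fourier_Parseval:
  fixes F :: "'a::euclidean_space \<Rightarrow> complex"
  assumes F: "F \<in> L2 lborel" and r: "r \<in> int_lattice" and supp: "\<And>x. x - r \<notin> ucube \<Longrightarrow> F x = 0"
  shows "(\<integral>\<^sup>+k. ennreal ((cmod (LINT x|lborel. F x * fchar k x))\<^sup>2) \<partial>count_space int_lattice) = nn2 lborel F"
proof -
  define c where "c = (\<lambda>k. LINT x|lborel. F x * fchar k x)"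
  let ?h = "\<lambda>(s::'a, k::'a). ennreal ((cmod (L2_inner lborel F (wave s k)))\<^sup>2)"
  let ?p = "from_nat_into (int_lattice \<times> int_lattice :: ('a \<times> 'a) set)"
  have inner: "L2_inner lborel F (wave s k) = (if s = r then c (- k) else 0)" if "s \<in> int_lattice" for s k
  proof (cases "s = r")
    case True
    have "F x * cnj (wave r k x) = F x * fchar (- k) x" for x
      using supp[of x] by (auto simp: wave_def cnj_fchar indicator_def)
    then have "L2_inner lborel F (wave r k) = c (- k)" unfolding L2_inner_def c_def by (simp only:)
    then show ?thesis using True by simp
  next
    case False
    then have "F x * cnj (wave s k x) = 0" for x
      using supp[of x] that r ucube_vfloor[of r x] ucube_vfloor[of s x] by (auto simp: wave_def indicator_def)
    then have "L2_inner lborel F (wave s k) = (LINT (x::'a)|lborel. 0)"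
      unfolding L2_inner_def by (simp only:)
    then show ?thesis using False by simp
  qed
  have "nn2 lborel F = (\<Sum>i. ennreal ((cmod (L2_inner lborel F (wave_seq i)))\<^sup>2))"
    by (rule orthonormal_basis_nn2[OF orthonormal_basis_wave_seq F, symmetric])
  also have "\<dots> = (\<integral>\<^sup>+i. ?h (?p i) \<partial>count_space UNIV)"
    unfolding nn_integral_count_space_nat by (intro suminf_cong) (simp add: wave_seq_def split: prod.splits)
  also have "\<dots> = (\<integral>\<^sup>+y. ?h y \<partial>count_space (int_lattice \<times> int_lattice))"
    by (rule nn_integral_bij_count_space[OF wave_seq_bij])
  also have "\<dots> = (\<integral>\<^sup>+s. \<integral>\<^sup>+k. ?h (s, k) \<partial>count_space int_lattice \<partial>count_space int_lattice)"
    by (subst pair_measure_countable[symmetric, OF countable_int_lattice countable_int_lattice],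
        rule sigma_finite_measure.nn_integral_fst[symmetric])
       (auto intro: sigma_finite_measure_count_space_countable countable_int_lattice
          simp: pair_measure_countable countable_int_lattice)
  also have "\<dots> = (\<integral>\<^sup>+s. (\<integral>\<^sup>+k. ennreal ((cmod (c (- k)))\<^sup>2) \<partial>count_space int_lattice) * indicator {r} s \<partial>count_space int_lattice)"
    by (intro nn_integral_cong) (auto simp: inner indicator_def)
  also have "\<dots> = (\<integral>\<^sup>+k. ennreal ((cmod (c (- k)))\<^sup>2) \<partial>count_space int_lattice)"
    using r by (subst nn_integral_cmult_indicator) auto
  also have "\<dots> = (\<integral>\<^sup>+k. ennreal ((cmod (c k))\<^sup>2) \<partial>count_space int_lattice)"
    by (rule nn_integral_bij_count_space)
       (auto intro!: bij_betwI[where g = uminus] int_lattice_uminus)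
  finally show ?thesis by (simp add: c_def)
qed

text \<open>\<open>S\<close> inverts \<open>T\<close> and \<open>c\<close> is the Jacobian factor of
  \<open>S\<close>. Substitution puts \<open>c\<close> into each coefficient, hence
  \<open>c^2\<close> into the sum, while the squared norm contains \<open>c\<close> once; one factor
  \<open>c\<close> remains.\<close>

lemma fourier_Parseval_affine:
  fixes F :: "'a::euclidean_space \<Rightarrow> complex"
  assumes [measurable]: "S \<in> borel_measurable borel" "T \<in> borel_measurable borel"
    and inv: "\<And>y. T (S y) = y" and c: "c > 0" "lborel = density (distr lborel borel S) (\<lambda>_. ennreal c)"
    and F: "F \<in> L2 lborel" and r: "r \<in> int_lattice" and supp: "\<And>x. T x - r \<notin> ucube \<Longrightarrow> F x = 0"
  shows "(\<integral>\<^sup>+k. ennreal ((cmod (LINT x|lborel. F x * fchar k (T x)))\<^sup>2) \<partial>count_space int_lattice) = ennreal c * nn2 lborel F"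
proof -
  have [measurable]: "F \<in> borel_measurable borel" using L2_measurable[OF F] by simp
  have nn: "(\<integral>\<^sup>+x. g x \<partial>lborel) = ennreal c * (\<integral>\<^sup>+y. g (S y) \<partial>lborel)" if [measurable]: "g \<in> borel_measurable borel" for g
    by (subst c(2)) (simp add: nn_integral_density nn_integral_distr nn_integral_cmult)
  have li: "(LINT x|lborel. g x) = c * (LINT y|lborel. g (S y))" if [measurable]: "g \<in> borel_measurable borel" for g :: "'a \<Rightarrow> complex"
    using c(1) by (subst c(2)) (simp add: integral_density integral_distr scaleR_conv_of_real)
  define G where "G = (\<lambda>y. F (S y))"
  have G2: "nn2 lborel F = ennreal c * nn2 lborel G" unfolding nn2_def G_def by (rule nn) measurable
  have G: "G \<in> L2 lborel"
  proof -
    have "nn2 lborel G < \<infinity>"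
      using F c(1) unfolding L2_iff G2 by (auto simp: ennreal_mult_less_top)
    then show ?thesis unfolding L2_iff G_def by simp
  qed
  have "(LINT x|lborel. F x * fchar k (T x)) = c * (LINT y|lborel. G y * fchar k y)" for k
    by (subst li) (simp_all add: G_def inv)
  then have "(\<integral>\<^sup>+k. ennreal ((cmod (LINT x|lborel. F x * fchar k (T x)))\<^sup>2) \<partial>count_space int_lattice) =
     (\<integral>\<^sup>+k. ennreal (c\<^sup>2) * ennreal ((cmod (LINT y|lborel. G y * fchar k y))\<^sup>2) \<partial>count_space int_lattice)"
    using c(1) by (simp add: norm_mult power_mult_distrib ennreal_mult)
  also have "\<dots> = ennreal (c\<^sup>2) * nn2 lborel G"
    by (subst nn_integral_cmult, simp, subst fourier_Parseval[OF G r]) (auto simp: G_def intro!: supp simp: inv)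
  also have "\<dots> = ennreal c * nn2 lborel F"
    unfolding G2 using c(1) by (simp add: power2_eq_square ennreal_mult mult.assoc)
  finally show ?thesis .
qed

section \<open>The Euclidean Plancherel theorem\<close>

lemma fchar_measurable2 [measurable]:
  fixes f g :: "'b \<Rightarrow> 'a::euclidean_space"
  assumes [measurable]: "f \<in> borel_measurable M" "g \<in> borel_measurable M"
  shows "(\<lambda>x. fchar (f x) (g x)) \<in> borel_measurable M"
  unfolding fchar_def by measurable

definition ft :: "('a::euclidean_space \<Rightarrow> complex) \<Rightarrow> 'a \<Rightarrow> complex" where
  "ft f \<xi> = (LINT x|lborel. f x * fchar \<xi> x)"

lemma ft_measurable [measurable]:
  assumes [measurable]: "f \<in> borel_measurable borel"
  shows "ft f \<in> borel_measurable borel"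
  unfolding ft_def[abs_def] by measurable

lemma integrable_fchar:
  assumes "integrable lborel f" shows "integrable lborel (\<lambda>x. f x * fchar \<xi> x)"
proof -
  have [measurable]: "f \<in> borel_measurable borel" using borel_measurable_integrable[OF assms] by simp
  show ?thesis
    by (rule Bochner_Integration.integrable_bound[OF assms]) (auto simp: norm_mult)
qed

lemma nn_integral_scale:
  fixes f :: "'a::euclidean_space \<Rightarrow> ennreal"
  assumes [measurable]: "f \<in> borel_measurable borel" and c: "c \<noteq> 0"
  shows "(\<integral>\<^sup>+x. f x \<partial>lborel) = ennreal (\<bar>c\<bar> ^ DIM('a)) * (\<integral>\<^sup>+x. f (c *\<^sub>R x) \<partial>lborel)"
  by (subst lborel_affine[OF c, where t = 0]) (simp add: nn_integral_density nn_integral_distr nn_integral_cmult ennreal_power)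

text \<open>For \<open>f\<close> supported in a cube of side \<open>a\<close>, the values of
  \<open>ft f\<close> on a translate of the lattice of mesh \<open>1/a\<close> are, up to unimodular
  factors, Fourier coefficients of \<open>f\<close> times a character. Parseval holds for every
  translate, and integration over one mesh cell covers the frequency space once. The shift
  \<open>h\<close> admits cubes centred at the origin.\<close>

lemma plancherel_cube:
  fixes f :: "'a::euclidean_space \<Rightarrow> complex"
  assumes f: "f \<in> L2 lborel" and a: "a > 0" and supp: "\<And>x. (1/a) *\<^sub>R x + h \<notin> ucube \<Longrightarrow> f x = 0"
  shows "nn2 lborel (ft f) = nn2 lborel f"
proof -
  have [measurable]: "f \<in> borel_measurable borel" using L2_measurable[OF f] by simp
  define c where "c = a ^ DIM('a)"
  have c: "c > 0" using a by (simp add: c_def)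
  have sum: "(\<integral>\<^sup>+r. ennreal ((cmod (ft f (\<xi> + (1/a) *\<^sub>R r)))\<^sup>2) \<partial>count_space int_lattice) = ennreal c * nn2 lborel f" for \<xi>
  proof -
    define F where "F = (\<lambda>x. f x * fchar \<xi> x)"
    have F: "F \<in> L2 lborel" unfolding F_def
      using L2_bounded_mult[OF f, of "fchar \<xi>" 1] by (simp add: mult.commute)
    have nF: "nn2 lborel F = nn2 lborel f" by (simp add: nn2_def F_def norm_mult)
    have eq: "(LINT x|lborel. F x * fchar k ((1/a) *\<^sub>R x + h)) = fchar k h * ft f (\<xi> + (1/a) *\<^sub>R k)" for k
    proof -
      have "F x * fchar k ((1/a) *\<^sub>R x + h) = fchar k h * (f x * fchar (\<xi> + (1/a) *\<^sub>R k) x)" for x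
      proof -
        have "fchar k ((1/a) *\<^sub>R x) = fchar ((1/a) *\<^sub>R k) x" by (simp add: fchar_def)
        then show ?thesis by (simp add: F_def fchar_add fchar_mult[symmetric] mult_ac)
      qed
      then show ?thesis by (simp add: ft_def)
    qed
    have "(\<integral>\<^sup>+k. ennreal ((cmod (LINT x|lborel. F x * fchar k ((1/a) *\<^sub>R x + h)))\<^sup>2) \<partial>count_space int_lattice) = ennreal c * nn2 lborel F"
    proof (rule fourier_Parseval_affine[where S = "\<lambda>y. (- a) *\<^sub>R h + a *\<^sub>R y" and r = 0])
      show "lborel = density (distr lborel borel (\<lambda>y. (- a) *\<^sub>R h + a *\<^sub>R y)) (\<lambda>_. ennreal c)"
        using lborel_affine[of a "(- a) *\<^sub>R h"] a by (simp add: c_def)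
    qed (use a c F supp in \<open>auto simp: F_def algebra_simps\<close>)
    then show ?thesis by (simp add: eq norm_mult nF)
  qed
  have "nn2 lborel (ft f) = (\<integral>\<^sup>+r. \<integral>\<^sup>+\<xi>. ennreal ((cmod (ft f \<xi>))\<^sup>2) * indicator ucube (a *\<^sub>R \<xi> - r) \<partial>lborel \<partial>count_space int_lattice)"
    unfolding nn2_def by (rule nn_integral_lattice) measurable
  also have "\<dots> = (\<integral>\<^sup>+r. \<integral>\<^sup>+\<xi>. ennreal ((cmod (ft f (\<xi> + (1/a) *\<^sub>R r)))\<^sup>2) * indicator ucube (a *\<^sub>R \<xi>) \<partial>lborel \<partial>count_space int_lattice)"
  proof (rule nn_integral_cong)
    fix r
    have "(\<integral>\<^sup>+\<xi>. ennreal ((cmod (ft f \<xi>))\<^sup>2) * indicator ucube (a *\<^sub>R \<xi> - r) \<partial>lborel) =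
      (\<integral>\<^sup>+\<xi>. ennreal ((cmod (ft f (\<xi> + (1/a) *\<^sub>R r)))\<^sup>2) * indicator ucube (a *\<^sub>R (\<xi> + (1/a) *\<^sub>R r) - r) \<partial>lborel)"
      by (rule lborel_shift[symmetric]) measurable
    then show "(\<integral>\<^sup>+\<xi>. ennreal ((cmod (ft f \<xi>))\<^sup>2) * indicator ucube (a *\<^sub>R \<xi> - r) \<partial>lborel) =
      (\<integral>\<^sup>+\<xi>. ennreal ((cmod (ft f (\<xi> + (1/a) *\<^sub>R r)))\<^sup>2) * indicator ucube (a *\<^sub>R \<xi>) \<partial>lborel)"
      using a by (simp add: scaleR_add_right)
  qed
  also have "\<dots> = (\<integral>\<^sup>+\<xi>. \<integral>\<^sup>+r. ennreal ((cmod (ft f (\<xi> + (1/a) *\<^sub>R r)))\<^sup>2) * indicator ucube (a *\<^sub>R \<xi>) \<partial>count_space int_lattice \<partial>lborel)"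
    by (rule nn_integral_count_space_nn_integral[symmetric]) (auto simp: countable_int_lattice)
  also have "\<dots> = (\<integral>\<^sup>+(\<xi>::'a). (ennreal c * nn2 lborel f) * indicator ucube (a *\<^sub>R \<xi>) \<partial>lborel)"
    by (rule nn_integral_cong, subst nn_integral_multc) (simp_all add: sum)
  also have "\<dots> = (ennreal c * nn2 lborel f) * (\<integral>\<^sup>+(\<xi>::'a). indicator ucube (a *\<^sub>R \<xi>) \<partial>lborel)"
    by (rule nn_integral_cmult) measurable
  also have "\<dots> = nn2 lborel f * (ennreal c * (\<integral>\<^sup>+(\<xi>::'a). indicator ucube (a *\<^sub>R \<xi>) \<partial>lborel))"
    by (simp add: mult_ac)
  also have "ennreal c * (\<integral>\<^sup>+(\<xi>::'a). indicator ucube (a *\<^sub>R \<xi>) \<partial>lborel) = 1"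
    using nn_integral_scale[of "indicator ucube :: 'a \<Rightarrow> ennreal" a] a by (simp add: c_def)
  finally show ?thesis by simp
qed

lemma L2_norm_tendsto_0_iff:
  assumes "\<And>k. f k \<in> L2 M"
  shows "(\<lambda>k. L2_norm M (f k)) \<longlonglongrightarrow> 0 \<longleftrightarrow> (\<lambda>k. nn2 M (f k)) \<longlonglongrightarrow> 0"
proof -
  have "(\<lambda>k. nn2 M (f k)) \<longlonglongrightarrow> 0 \<longleftrightarrow> (\<lambda>k. ennreal ((L2_norm M (f k))\<^sup>2)) \<longlonglongrightarrow> ennreal 0"
    by (simp add: nn2_L2 assms)
  also have "\<dots> \<longleftrightarrow> (\<lambda>k. (L2_norm M (f k))\<^sup>2) \<longlonglongrightarrow> 0"
    by (rule tendsto_ennreal_iff) auto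
  also have "\<dots> \<longleftrightarrow> (\<lambda>k. L2_norm M (f k)) \<longlonglongrightarrow> 0"
    using tendsto_null_power tendsto_power[of "\<lambda>k. L2_norm M (f k)" 0 sequentially 2]
      tendsto_real_sqrt[of "\<lambda>k. (L2_norm M (f k))\<^sup>2" 0 sequentially]
    by auto
  finally show ?thesis by simp
qed

lemma L2_restrict:
  assumes "f \<in> L2 M" "A \<in> sets M"
  shows "(\<lambda>x. f x * indicator A x) \<in> L2 M"
  using L2_bounded_mult[OF assms(1), of "indicator A" 1] assms(2) by (simp add: mult.commute indicator_def)

lemma L2_restrict_tendsto:
  assumes f: "f \<in> L2 M" and A: "\<And>n::nat. A n \<in> sets M" and ex: "\<And>x. x \<in> space M \<Longrightarrow> \<exists>N. \<forall>n\<ge>N. x \<in> A n"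
  shows "(\<lambda>n. L2_norm M (\<lambda>x. f x * indicator (A n) x - f x)) \<longlonglongrightarrow> 0"
proof -
  note [measurable] = A L2_measurable[OF f]
  have "(\<lambda>n. LINT x|M. (cmod (f x * indicator (A n) x - f x))\<^sup>2) \<longlonglongrightarrow> (LINT x|M. 0)"
  proof (rule integral_dominated_convergence)
    show "integrable M (\<lambda>x. (cmod (f x))\<^sup>2)" by (rule L2_integrable[OF f])
    show "AE x in M. (\<lambda>n. (cmod (f x * indicator (A n) x - f x))\<^sup>2) \<longlonglongrightarrow> 0"
    proof (rule AE_I2)
      fix x assume "x \<in> space M"
      then obtain N where "\<forall>n\<ge>N. x \<in> A n" using ex by blast
      then have "\<forall>\<^sub>F n in sequentially. (cmod (f x * indicator (A n) x - f x))\<^sup>2 = 0"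
        by (auto simp: eventually_sequentially intro!: exI[of _ N])
      then show "(\<lambda>n. (cmod (f x * indicator (A n) x - f x))\<^sup>2) \<longlonglongrightarrow> 0"
        by (rule tendsto_eventually)
    qed
    show "AE x in M. norm ((cmod (f x * indicator (A n) x - f x))\<^sup>2) \<le> (cmod (f x))\<^sup>2" for n
      by (auto simp: indicator_def)
  qed auto
  from tendsto_real_sqrt[OF this] show ?thesis by (simp add: L2_norm_def)
qed

text \<open>Truncation to cubes reduces to bounded support. Fatou's lemma first gives a contraction
  on all integrable \<open>L2\<close> functions; the contraction applied to the difference of
  \<open>f\<close> and its truncations then gives convergence in norm, hence equality.\<close>

theorem ft_isometry:
  fixes f :: "'a::euclidean_space \<Rightarrow> complex"
  assumes f: "f \<in> L2 lborel" and f1: "integrable lborel f"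
  shows "nn2 lborel (ft f) = nn2 lborel f"
proof -
  \<comment> \<open>Half-open cubes centred at the origin with side
    \<open>2 * (n + 1)\<close>.\<close>
  define A :: "nat \<Rightarrow> 'a set" where
    "A n = {x. (1 / (2 * real (Suc n))) *\<^sub>R x + (1/2) *\<^sub>R One \<in> ucube}" for n
  have [measurable]: "A n \<in> sets borel" for n unfolding A_def by measurable
  have exA: "\<exists>N. \<forall>n\<ge>N. x \<in> A n" for x
  proof -
    obtain N :: nat where N: "norm x < real N" using reals_Archimedean2 by blast
    have "x \<in> A n" if "n \<ge> N" for n
    proof -
      have "0 \<le> (1 / (2 * real (Suc n))) * (x \<bullet> b) + 1/2 \<and> (1 / (2 * real (Suc n))) * (x \<bullet> b) + 1/2 < 1"
        if "b \<in> Basis" for b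
      proof -
        have "\<bar>x \<bullet> b\<bar> < real (Suc n)"
          using Basis_le_norm[OF that, of x] N \<open>n \<ge> N\<close> by linarith
        moreover define t where "t = x \<bullet> b / real (Suc n)"
        ultimately have t: "\<bar>t\<bar> < 1"
          by (simp add: abs_divide pos_divide_less_eq)
        have eq: "(1 / (2 * real (Suc n))) * (x \<bullet> b) = t / 2" by (simp add: t_def)
        show ?thesis unfolding eq using t by (auto simp: abs_less_iff)
      qed
      then show ?thesis by (simp add: A_def ucube_def inner_add_left)
    qed
    then show ?thesis by blast
  qed
  have fA: "(\<lambda>x. g x * indicator (A n) x) \<in> L2 lborel" if "g \<in> L2 lborel" for g :: "'a \<Rightarrow> complex" and n
    using that by (intro L2_restrict) auto
  have isoA: "nn2 lborel (ft (\<lambda>x. g x * indicator (A n) x)) = nn2 lborel (\<lambda>x. g x * indicator (A n) x)" if "g \<in> L2 lborel" for g :: "'a \<Rightarrow> complex" and n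
    by (rule plancherel_cube[OF fA[OF that], where a = "2 * real (Suc n)" and h = "(1/2) *\<^sub>R One"])
       (auto simp: A_def indicator_def)
  have ftA: "(\<lambda>n. ft (\<lambda>x. g x * indicator (A n) x) \<xi>) \<longlonglongrightarrow> ft g \<xi>" if g: "integrable lborel g" for g :: "'a \<Rightarrow> complex" and \<xi>
    unfolding ft_def
  proof (rule integral_dominated_convergence)
    have [measurable]: "g \<in> borel_measurable borel" using borel_measurable_integrable[OF g] by simp
    show "integrable lborel (\<lambda>x. cmod (g x))" using g by simp
    show "AE x in lborel. (\<lambda>n. g x * indicator (A n) x * fchar \<xi> x) \<longlonglongrightarrow> g x * fchar \<xi> x"
    proof (rule AE_I2)
      fix x
      obtain N where "\<forall>n\<ge>N. x \<in> A n" using exA by blast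
      then have "\<forall>\<^sub>F n in sequentially. g x * indicator (A n) x * fchar \<xi> x = g x * fchar \<xi> x"
        by (auto simp: eventually_sequentially intro!: exI[of _ N])
      then show "(\<lambda>n. g x * indicator (A n) x * fchar \<xi> x) \<longlonglongrightarrow> g x * fchar \<xi> x"
        by (rule tendsto_eventually)
    qed
    show "AE x in lborel. norm (g x * indicator (A n) x * fchar \<xi> x) \<le> cmod (g x)" for n
      by (auto simp: norm_mult indicator_def)
    show "(\<lambda>x. g x * fchar \<xi> x) \<in> borel_measurable lborel" by measurable
    show "(\<lambda>x. g x * indicator (A n) x * fchar \<xi> x) \<in> borel_measurable lborel" for n by measurable
  qed
  have le: "nn2 lborel (ft g) \<le> nn2 lborel g" if g: "g \<in> L2 lborel" "integrable lborel g" for g :: "'a \<Rightarrow> complex"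
  proof -
    have [measurable]: "g \<in> borel_measurable borel" using L2_measurable[OF g(1)] by simp
    have "nn2 lborel (ft g) = (\<integral>\<^sup>+\<xi>. liminf (\<lambda>n. ennreal ((cmod (ft (\<lambda>x. g x * indicator (A n) x) \<xi>))\<^sup>2)) \<partial>lborel)"
      unfolding nn2_def
    proof (rule nn_integral_cong)
      fix \<xi>
      have "(\<lambda>n. ennreal ((cmod (ft (\<lambda>x. g x * indicator (A n) x) \<xi>))\<^sup>2)) \<longlonglongrightarrow> ennreal ((cmod (ft g \<xi>))\<^sup>2)"
        by (intro tendsto_intros ftA g)
      then show "ennreal ((cmod (ft g \<xi>))\<^sup>2) = liminf (\<lambda>n. ennreal ((cmod (ft (\<lambda>x. g x * indicator (A n) x) \<xi>))\<^sup>2))"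
        using lim_imp_Liminf[OF sequentially_bot] by metis
    qed
    also have "\<dots> \<le> liminf (\<lambda>n. nn2 lborel (ft (\<lambda>x. g x * indicator (A n) x)))"
      unfolding nn2_def by (rule nn_integral_liminf) measurable
    also have "\<dots> \<le> nn2 lborel g"
    proof (rule Liminf_le)
      have "nn2 lborel (\<lambda>x. g x * indicator (A n) x) \<le> nn2 lborel g" for n
        unfolding nn2_def by (rule nn_integral_mono) (auto simp: indicator_def)
      then show "\<forall>\<^sub>F n in sequentially. nn2 lborel (ft (\<lambda>x. g x * indicator (A n) x)) \<le> nn2 lborel g"
        by (simp add: isoA g)
    qed simp
    finally show ?thesis .
  qed
  have [measurable]: "f \<in> borel_measurable borel" using L2_measurable[OF f] by simp
  define fn where "fn = (\<lambda>n x. f x * indicator (A n) x)"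
  have fn: "fn n \<in> L2 lborel" "integrable lborel (fn n)" for n
    unfolding fn_def using fA[OF f] f1
    by (auto intro!: Bochner_Integration.integrable_bound[OF f1] simp: norm_mult indicator_def)
  have L: "ft g \<in> L2 lborel" if "g \<in> L2 lborel" "integrable lborel g" for g :: "'a \<Rightarrow> complex"
    using le[OF that] nn2_L2[OF that(1)] L2_measurable[OF that(1)] by (auto simp: L2_iff intro: le_less_trans)
  have fn_lim: "(\<lambda>n. L2_norm lborel (\<lambda>x. fn n x - f x)) \<longlonglongrightarrow> 0"
    unfolding fn_def by (rule L2_restrict_tendsto) (auto simp: f exA)
  have ftd: "ft (\<lambda>x. fn n x - f x) = (\<lambda>\<xi>. ft (fn n) \<xi> - ft f \<xi>)" for n
    unfolding ft_def using integrable_fchar[OF fn(2)] integrable_fchar[OF f1]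
    by (auto simp: left_diff_distrib)
  have "(\<lambda>n. nn2 lborel (\<lambda>\<xi>. ft (fn n) \<xi> - ft f \<xi>)) \<longlonglongrightarrow> 0"
  proof (rule tendsto_sandwich[OF _ _ tendsto_const])
    show "\<forall>\<^sub>F n in sequentially. nn2 lborel (\<lambda>\<xi>. ft (fn n) \<xi> - ft f \<xi>) \<le> nn2 lborel (\<lambda>x. fn n x - f x)"
      unfolding ftd[symmetric] using fn f f1 by (auto intro!: le always_eventually)
    show "(\<lambda>n. nn2 lborel (\<lambda>x. fn n x - f x)) \<longlonglongrightarrow> 0"
      using fn_lim by (subst (asm) L2_norm_tendsto_0_iff) (auto simp: fn f)
  qed auto
  then have "(\<lambda>n. L2_norm lborel (\<lambda>\<xi>. ft (fn n) \<xi> - ft f \<xi>)) \<longlonglongrightarrow> 0"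
    using L fn f f1 by (subst L2_norm_tendsto_0_iff) auto
  then have lim: "(\<lambda>n. L2_norm lborel (ft (fn n))) \<longlonglongrightarrow> L2_norm lborel (ft f)"
    using L fn f f1 by (intro L2_norm_tendsto) auto
  have eq: "L2_norm lborel (ft (fn n)) = L2_norm lborel (fn n)" for n
  proof -
    have "(L2_norm lborel (ft (fn n)))\<^sup>2 = (L2_norm lborel (fn n))\<^sup>2"
      using isoA[OF f, of n] L2_measurable[OF L[OF fn]] L2_measurable[OF fn(1)] by (simp add: L2_norm_nn2 fn_def)
    then show ?thesis by simp
  qed
  have "L2_norm lborel (ft f) = L2_norm lborel f"
    by (rule LIMSEQ_unique[OF lim[unfolded eq] L2_norm_tendsto[OF fn(1) f fn_lim]])
  then show ?thesis using nn2_L2[OF f] nn2_L2[OF L[OF f f1]] by simp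
qed

section \<open>Linear changes of variables\<close>

text \<open>Each line in direction \<open>b\<close> is moved by a constant, since
  \<open>\<phi>\<close> does not vary along it. Instead of splitting off the coordinate
  \<open>b\<close>, an auxiliary translation along \<open>b\<close> is averaged over a unit
  interval; this uses only Tonelli and invariance under translation and reflection.\<close>

lemma nn_integral_shear:
  fixes h :: "'a::euclidean_space \<Rightarrow> ennreal"
  assumes [measurable]: "h \<in> borel_measurable borel" "\<phi> \<in> borel_measurable borel"
    and b: "b \<in> Basis" and inv: "\<And>x s. \<phi> (x + s *\<^sub>R b) = \<phi> x"
  shows "(\<integral>\<^sup>+x. h (x + \<phi> x *\<^sub>R b) \<partial>lborel) = (\<integral>\<^sup>+x. h x \<partial>lborel)"
proof -
  have one: "(\<integral>\<^sup>+s. indicator {0..1} (t + s) \<partial>lborel) = 1" for t :: real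
    using lborel_shift[of "indicator {0..1::real}" t] by (simp add: add.commute)
  \<comment> \<open>The right-hand side does not involve \<open>\<phi>\<close>, so comparison with
    the zero function gives the claim.\<close>
  have gen: "(\<integral>\<^sup>+x. h (x + \<phi> x *\<^sub>R b) \<partial>lborel) =
      (\<integral>\<^sup>+x. indicator {0..1} (x \<bullet> b) * (\<integral>\<^sup>+s. h (x + s *\<^sub>R b) \<partial>lborel) \<partial>lborel)"
    if [measurable]: "\<phi> \<in> borel_measurable borel" and inv: "\<And>x s. \<phi> (x + s *\<^sub>R b) = \<phi> x" for \<phi>
  proof -
    have "(\<integral>\<^sup>+x. h (x + \<phi> x *\<^sub>R b) \<partial>lborel) =
        (\<integral>\<^sup>+x. \<integral>\<^sup>+s. indicator {0..1} (x \<bullet> b + s) * h (x + \<phi> x *\<^sub>R b) \<partial>lborel \<partial>lborel)"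
      by (intro nn_integral_cong) (simp add: nn_integral_multc one)
    also have "\<dots> = (\<integral>\<^sup>+s. \<integral>\<^sup>+x. indicator {0..1} (x \<bullet> b + s) * h (x + \<phi> x *\<^sub>R b) \<partial>lborel \<partial>lborel)"
      by (rule lborel_pair.Fubini') measurable
    also have "\<dots> = (\<integral>\<^sup>+s. \<integral>\<^sup>+x. indicator {0..1} (x \<bullet> b) * h (x + (\<phi> x - s) *\<^sub>R b) \<partial>lborel \<partial>lborel)"
    proof (rule nn_integral_cong)
      fix s :: real
      have \<phi>: "\<phi> (x - s *\<^sub>R b) = \<phi> x" for x using inv[of x "- s"] by simp
      have "(\<integral>\<^sup>+x. indicator {0..1} (x \<bullet> b + s) * h (x + \<phi> x *\<^sub>R b) \<partial>lborel) =
         (\<integral>\<^sup>+x. indicator {0..1} ((x + (- s) *\<^sub>R b) \<bullet> b + s) * h (x + (- s) *\<^sub>R b + \<phi> (x + (- s) *\<^sub>R b) *\<^sub>R b) \<partial>lborel)"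
        by (rule lborel_shift[symmetric]) measurable
      also have "\<dots> = (\<integral>\<^sup>+x. indicator {0..1} (x \<bullet> b) * h (x + (\<phi> x - s) *\<^sub>R b) \<partial>lborel)"
        using b by (intro nn_integral_cong) (simp add: inner_diff_left \<phi> algebra_simps)
      finally show "(\<integral>\<^sup>+x. indicator {0..1} (x \<bullet> b + s) * h (x + \<phi> x *\<^sub>R b) \<partial>lborel) =
         (\<integral>\<^sup>+x. indicator {0..1} (x \<bullet> b) * h (x + (\<phi> x - s) *\<^sub>R b) \<partial>lborel)" .
    qed
    also have "\<dots> = (\<integral>\<^sup>+x. \<integral>\<^sup>+s. indicator {0..1} (x \<bullet> b) * h (x + (\<phi> x - s) *\<^sub>R b) \<partial>lborel \<partial>lborel)"
      by (rule lborel_pair.Fubini') measurable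
    also have "\<dots> = (\<integral>\<^sup>+x. indicator {0..1} (x \<bullet> b) * (\<integral>\<^sup>+s. h (x + s *\<^sub>R b) \<partial>lborel) \<partial>lborel)"
    proof (rule nn_integral_cong)
      fix x
      have "(\<integral>\<^sup>+s. h (x + (\<phi> x - s) *\<^sub>R b) \<partial>lborel) = (\<integral>\<^sup>+s. h (x + s *\<^sub>R b) \<partial>lborel)"
        using nn_integral_real_affine[of "\<lambda>s. h (x + s *\<^sub>R b)" "-1" "\<phi> x"] by simp
      then show "(\<integral>\<^sup>+s. indicator {0..1} (x \<bullet> b) * h (x + (\<phi> x - s) *\<^sub>R b) \<partial>lborel) =
           indicator {0..1} (x \<bullet> b) * (\<integral>\<^sup>+s. h (x + s *\<^sub>R b) \<partial>lborel)"
        by (simp add: nn_integral_cmult)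
    qed
    finally show ?thesis .
  qed
  show ?thesis using gen[of \<phi>] gen[of "\<lambda>_. 0"] inv by simp
qed

text \<open>Every linear map is a composition of elementary ones: diagonal maps, coordinate swaps,
  additions of one coordinate to another, and maps with a vanishing coordinate. For the last kind
  the determinant is zero and nothing is claimed.\<close>

lemma nn_integral_linear:
  fixes f :: "real^'n \<Rightarrow> real^'n"
  assumes "linear f" "h \<in> borel_measurable borel" "det (matrix f) \<noteq> 0"
  shows "(\<integral>\<^sup>+x. h x \<partial>lborel) = ennreal \<bar>det (matrix f)\<bar> * (\<integral>\<^sup>+x. h (f x) \<partial>lborel)"
proof -
  define Q where "Q f \<longleftrightarrow> (linear f \<and> (det (matrix f) \<noteq> 0 \<longrightarrow> (\<forall>h\<in>borel_measurable borel.
     (\<integral>\<^sup>+x. h x \<partial>lborel) = ennreal \<bar>det (matrix f)\<bar> * (\<integral>\<^sup>+x. h (f x) \<partial>lborel))))" for f :: "real^'n \<Rightarrow> real^'n"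
  have meas: "f \<in> borel_measurable borel" if "linear f" for f :: "real^'n \<Rightarrow> real^'n"
  proof -
    have "bounded_linear f" using that by (simp add: linear_conv_bounded_linear)
    then have "continuous_on UNIV f" by (rule linear_continuous_on)
    then show ?thesis by (rule borel_measurable_continuous_onI)
  qed
  have "Q f"
  proof (rule induct_linear_elementary[where P = Q, OF assms(1)])
    fix f g :: "real^'n \<Rightarrow> real^'n" assume comp: "linear f" "linear g" "Q f" "Q g"
    show "Q (f \<circ> g)" unfolding Q_def
    proof (intro conjI impI ballI)
      show "linear (f \<circ> g)" using comp by (intro linear_compose)
      have m: "matrix (f \<circ> g) = matrix f ** matrix g" using comp by (intro matrix_compose)
      assume "det (matrix (f \<circ> g)) \<noteq> 0"
      then have ne: "det (matrix f) \<noteq> 0" "det (matrix g) \<noteq> 0" by (auto simp: m det_mul)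
      fix h :: "real^'n \<Rightarrow> ennreal" assume h: "h \<in> borel_measurable borel"
      have hf: "(\<lambda>x. h (f x)) \<in> borel_measurable borel" using measurable_compose[OF meas[OF comp(1)] h] .
      have "(\<integral>\<^sup>+x. h x \<partial>lborel) = ennreal \<bar>det (matrix f)\<bar> * (\<integral>\<^sup>+x. h (f x) \<partial>lborel)"
        using comp(3) ne h unfolding Q_def by blast
      also have "(\<integral>\<^sup>+x. h (f x) \<partial>lborel) = ennreal \<bar>det (matrix g)\<bar> * (\<integral>\<^sup>+x. h (f (g x)) \<partial>lborel)"
        using comp(4) ne hf unfolding Q_def by blast
      finally show "(\<integral>\<^sup>+x. h x \<partial>lborel) = ennreal \<bar>det (matrix (f \<circ> g))\<bar> * (\<integral>\<^sup>+x. h ((f \<circ> g) x) \<partial>lborel)"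
        by (simp add: m det_mul abs_mult ennreal_mult mult.assoc)
    qed
  next
    fix f :: "real^'n \<Rightarrow> real^'n" and i assume zeroes: "linear f" "\<And>x. f x $ i = 0"
    have "row i (matrix f) = 0"
      using zeroes(2) by (auto simp: row_def matrix_def vec_eq_iff)
    then show "Q f" using zeroes(1) det_zero_row(1)[of i "matrix f"] unfolding Q_def by blast
  next
    fix c :: "'n \<Rightarrow> real"
    have lin: "linear (\<lambda>x::real^'n. \<chi> i. c i * x $ i)"
      by (rule linearI) (auto simp: vec_eq_iff algebra_simps)
    have det: "det (matrix (\<lambda>x::real^'n. \<chi> i. c i * x $ i)) = (\<Prod>i\<in>UNIV. c i)"
      by (subst det_diagonal) (auto simp: matrix_def axis_def)
    show "Q (\<lambda>x. \<chi> i. c i * x $ i)" unfolding Q_def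
    proof (intro conjI impI ballI lin)
      assume "det (matrix (\<lambda>x::real^'n. \<chi> i. c i * x $ i)) \<noteq> 0"
      then have c: "c i \<noteq> 0" for i by (auto simp: det)
      fix h :: "real^'n \<Rightarrow> ennreal" assume h[measurable]: "h \<in> borel_measurable borel"
      \<comment> \<open>The scaling factors indexed by basis vectors instead of coordinates, the
        form in which the affine change of variables takes them.\<close>
      define k :: "real^'n \<Rightarrow> real" where "k j = c (THE i. j = axis i 1)" for j
      have k: "k (axis i 1) = c i" for i by (simp add: k_def axis_eq_axis)
      have Basis: "(Basis :: (real^'n) set) = range (\<lambda>i. axis i 1)" by (auto simp: Basis_vec_def)
      have inj: "inj (\<lambda>i. axis i 1 :: real^'n)" by (auto intro!: injI simp: axis_eq_axis)
      have "lborel = density (distr lborel borel (\<lambda>x::real^'n. 0 + (\<Sum>j\<in>Basis. (k j * (x \<bullet> j)) *\<^sub>R j))) (\<lambda>_. (\<Prod>j\<in>(Basis::(real^'n) set). \<bar>k j\<bar>))"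
        by (rule lborel_affine_euclidean) (auto simp: Basis k c)
      moreover have "(\<Prod>j\<in>(Basis::(real^'n) set). \<bar>k j\<bar>) = \<bar>\<Prod>i\<in>UNIV. c i\<bar>"
        unfolding Basis by (subst prod.reindex[OF inj]) (simp add: k abs_prod)
      moreover have "0 + (\<Sum>j\<in>Basis. (k j * (x \<bullet> j)) *\<^sub>R j) = (\<chi> i. c i * x $ i)" for x :: "real^'n"
      proof -
        have "(\<Sum>j\<in>Basis. (k j * (x \<bullet> j)) *\<^sub>R j) = (\<Sum>i\<in>UNIV. (c i * x $ i) *\<^sub>R axis i 1)"
          unfolding Basis by (subst sum.reindex[OF inj]) (simp add: k cart_eq_inner_axis)
        then show ?thesis by (simp add: vec_eq_iff axis_def if_distrib cong: if_cong)
      qed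
      ultimately have eq: "lborel = density (distr lborel borel (\<lambda>x::real^'n. \<chi> i. c i * x $ i)) (\<lambda>_. ennreal \<bar>\<Prod>i\<in>UNIV. c i\<bar>)"
        by simp
      have [measurable]: "(\<lambda>x::real^'n. \<chi> i. c i * x $ i) \<in> borel_measurable borel" by (rule meas[OF lin])
      show "(\<integral>\<^sup>+x. h x \<partial>lborel) = ennreal \<bar>det (matrix (\<lambda>x::real^'n. \<chi> i. c i * x $ i))\<bar> *
           (\<integral>\<^sup>+x. h (\<chi> i. c i * x $ i) \<partial>lborel)"
        unfolding det by (subst eq) (simp add: nn_integral_density nn_integral_distr nn_integral_cmult)
    qed
  next
    fix m n :: 'n assume "m \<noteq> n"
    let ?h = "\<lambda>v::(real, 'n) vec. \<chi> i. v $ Transposition.transpose m n i"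
    have lin: "linear ?h"
      by (rule linearI) (simp_all add: plus_vec_def scaleR_vec_def)
    have "(\<chi> i j. if Transposition.transpose m n i = j then 1 else 0) = (\<chi> i j. if j = Transposition.transpose m n i then 1 else (0::real))"
      by (auto intro!: Cart_lambda_cong)
    then have "matrix ?h = transpose(\<chi> i j. mat 1 $ i $ Transposition.transpose m n j)"
      by (auto simp: matrix_eq transpose_def axis_def mat_def matrix_def)
    then have 1: "\<bar>det (matrix ?h)\<bar> = 1"
      by (simp add: det_permute_columns permutes_swap_id sign_swap_id abs_mult)
    have [measurable]: "?h \<in> borel_measurable borel" by (rule meas[OF lin])
    \<comment> \<open>Swapping two coordinates carries boxes to boxes of the same volume, and the
      measure of boxes determines Lebesgue measure.\<close>
    have eq: "lborel = distr lborel borel ?h"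
    proof (rule lborel_eqI)
      fix l u :: "real^'n" assume le: "\<And>b. b \<in> Basis \<Longrightarrow> l \<bullet> b \<le> u \<bullet> b"
      have le': "l $ i \<le> u $ i" for i using le[of "axis i 1"] by (auto simp: cart_eq_inner_axis Basis_vec_def)
      have vi: "?h -` box l u = box (?h l) (?h u)"
        by (auto simp: mem_box_cart) (metis transpose_involutory)+
      have P: "(\<Prod>b\<in>(Basis::(real^'n) set). (w::real^'n) \<bullet> b) = (\<Prod>i\<in>UNIV. w $ i)" for w
      proof -
        have inj: "inj (\<lambda>i. axis i 1 :: real^'n)" by (auto intro!: injI simp: axis_eq_axis)
        have Basis: "(Basis :: (real^'n) set) = range (\<lambda>i. axis i 1)" by (auto simp: Basis_vec_def)
        show ?thesis unfolding Basis by (subst prod.reindex[OF inj]) (simp add: cart_eq_inner_axis)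
      qed
      have "emeasure (distr lborel borel ?h) (box l u) = ennreal (\<Prod>b\<in>Basis. (?h u - ?h l) \<bullet> b)"
        using le' by (auto simp: emeasure_distr vi emeasure_lborel_box_eq Basis_vec_def cart_eq_inner_axis[symmetric] inner_axis)
      also have "(\<Prod>b\<in>Basis. (?h u - ?h l) \<bullet> b) = (\<Prod>b\<in>Basis. (u - l) \<bullet> b)"
      proof -
        have "Transposition.transpose m n permutes UNIV" by (simp add: permutes_swap_id)
        from prod.permute[OF this, of "\<lambda>i. (u - l) $ i"] show ?thesis
          unfolding P by (simp add: comp_def)
      qed
      finally show "emeasure (distr lborel borel ?h) (box l u) = (\<Prod>b\<in>Basis. (u - l) \<bullet> b)" .
    qed simp
    show "Q ?h" unfolding Q_def
    proof (intro conjI impI ballI lin)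
      fix h :: "real^'n \<Rightarrow> ennreal" assume [measurable]: "h \<in> borel_measurable borel"
      show "(\<integral>\<^sup>+x. h x \<partial>lborel) = ennreal \<bar>det (matrix ?h)\<bar> * (\<integral>\<^sup>+x. h (?h x) \<partial>lborel)"
        by (subst eq) (simp add: 1 nn_integral_distr)
    qed
  next
    fix m n :: 'n assume idplus: "m \<noteq> n"
    let ?h = "\<lambda>v::(real, 'n) vec. \<chi> i. if i = m then v $ m + v $ n else v $ i"
    have lin: "linear ?h"
      by (rule linearI) (auto simp: algebra_simps plus_vec_def scaleR_vec_def vec_eq_iff)
    have "matrix ?h = (\<chi> i. if i = m then row m (mat 1) + 1 *s row n (mat 1) else row i (mat 1))"
      using idplus by (auto simp: matrix_def row_def axis_def mat_def vec_eq_iff)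
    then have 1: "det (matrix ?h) = 1"
      using det_row_operation[OF idplus, of "mat 1" 1] by simp
    have h: "?h v = v + (v $ n) *\<^sub>R axis m 1" for v
      using idplus by (auto simp: vec_eq_iff axis_def)
    show "Q ?h" unfolding Q_def
    proof (intro conjI impI ballI lin)
      fix k :: "real^'n \<Rightarrow> ennreal" assume [measurable]: "k \<in> borel_measurable borel"
      have "(\<integral>\<^sup>+x. k (x + (x $ n) *\<^sub>R axis m 1) \<partial>lborel) = (\<integral>\<^sup>+x. k x \<partial>lborel)"
        using idplus by (intro nn_integral_shear) (auto simp: axis_def Basis_vec_def intro!: borel_measurable_continuous_onI continuous_intros)
      then show "(\<integral>\<^sup>+x. k x \<partial>lborel) = ennreal \<bar>det (matrix ?h)\<bar> * (\<integral>\<^sup>+x. k (?h x) \<partial>lborel)"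
        unfolding 1 by (simp add: h)
    qed
  qed
  then show ?thesis using assms unfolding Q_def by blast
qed

section \<open>Hilbert--Schmidt operators\<close>

definition hs_basis :: "nat \<Rightarrow> 'b::euclidean_space \<Rightarrow> complex" where
  "hs_basis = (SOME e. orthonormal_basis lborel e)"

text \<open>\<open>wave_seq\<close> witnesses existence, so the basis selected in the definition of
  \<open>hs_norm2\<close> really is orthonormal and complete.\<close>

lemma hs_basis: "orthonormal_basis lborel (hs_basis :: nat \<Rightarrow> 'b::euclidean_space \<Rightarrow> complex)"
  unfolding hs_basis_def by (rule someI[of "orthonormal_basis lborel", OF orthonormal_basis_wave_seq])

lemma hs_basis_L2 [simp]: "hs_basis i \<in> L2 lborel"
  by (rule orthonormal_basisD(1)[OF hs_basis])

lemma hs_basis_measurable [measurable]: "hs_basis i \<in> borel_measurable borel"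
  using L2_measurable[OF hs_basis_L2] by simp

lemma hs_basis_nn2 [simp]: "nn2 lborel (hs_basis i) = 1"
proof -
  have "complex_of_real ((L2_norm lborel (hs_basis i))\<^sup>2) = 1"
    by (simp only: L2_inner_self[symmetric] orthonormal_basisD(2)[OF hs_basis]) simp
  then have "(L2_norm lborel (hs_basis i))\<^sup>2 = 1" by (simp only: of_real_eq_1_iff)
  then show ?thesis by (simp add: nn2_L2)
qed

lemma hs_norm2_eq:
  assumes "\<And>i. T (hs_basis i) \<in> L2 lborel"
  shows "hs_norm2 lborel T = (\<Sum>i. nn2 lborel (T (hs_basis i)))"
  using assms by (simp add: hs_norm2_def hs_basis_def[symmetric] nn2_L2)

lemma hs_norm2_cong:
  assumes "\<And>i. AE x in lborel. T (hs_basis i) x = T' (hs_basis i) x"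
    "\<And>i. T (hs_basis i) \<in> borel_measurable borel" "\<And>i. T' (hs_basis i) \<in> borel_measurable borel"
  shows "hs_norm2 lborel T = hs_norm2 lborel T'"
  unfolding hs_norm2_def hs_basis_def[symmetric] using assms
  by (intro suminf_cong) (simp add: L2_norm_cong_AE)

lemma bounded_operatorD:
  assumes "bounded_operator M T"
  shows "f \<in> L2 M \<Longrightarrow> T f \<in> L2 M"
    "f \<in> L2 M \<Longrightarrow> g \<in> L2 M \<Longrightarrow> AE x in M. T (\<lambda>y. f y + g y) x = T f x + T g x"
    "f \<in> L2 M \<Longrightarrow> AE x in M. T (\<lambda>y. c * f y) x = c * T f x"
  using assms by (auto simp: bounded_operator_def)

lemma bounded_operator_bound:
  assumes "bounded_operator M T"
  obtains C where "C \<ge> 0" "\<And>f. f \<in> L2 M \<Longrightarrow> L2_norm M (T f) \<le> C * L2_norm M f"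
proof -
  obtain C where "\<And>f. f \<in> L2 M \<Longrightarrow> L2_norm M (T f) \<le> C * L2_norm M f"
    using assms unfolding bounded_operator_def by blast
  then have "L2_norm M (T f) \<le> \<bar>C\<bar> * L2_norm M f" if "f \<in> L2 M" for f
    using that by (meson L2_norm_nonneg abs_ge_self mult_right_mono order_trans)
  then show ?thesis using that[of "\<bar>C\<bar>"] by auto
qed

lemma bounded_operator_diff:
  assumes T: "bounded_operator M T" and f: "f \<in> L2 M" "g \<in> L2 M"
  shows "AE x in M. T (\<lambda>y. f y - g y) x = T f x - T g x"
proof -
  have "AE x in M. T (\<lambda>y. f y + (-1) * g y) x = T f x + T (\<lambda>y. (-1) * g y) x"
    by (rule bounded_operatorD(2)[OF T]) (use f in \<open>auto intro: L2_scale simp del: mult_minus1\<close>)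
  moreover have "AE x in M. T (\<lambda>y. (-1) * g y) x = (-1) * T g x"
    by (rule bounded_operatorD(3)[OF T f(2)])
  ultimately show ?thesis by eventually_elim simp
qed

lemma bounded_operator_sum:
  assumes T: "bounded_operator M T" and u: "\<And>i. u i \<in> L2 M"
  shows "AE x in M. T (\<lambda>y. \<Sum>i<(n::nat). c i * u i y) x = (\<Sum>i<n. c i * T (u i) x)"
proof (induction n)
  case 0
  have "AE x in M. T (\<lambda>y. 0 * (0::complex)) x = 0 * T (\<lambda>_. 0) x"
    by (rule bounded_operatorD(3)[OF T L2_zero])
  then show ?case by simp
next
  case (Suc n)
  have "AE x in M. T (\<lambda>y. (\<Sum>i<n. c i * u i y) + c n * u n y) x = T (\<lambda>y. \<Sum>i<n. c i * u i y) x + T (\<lambda>y. c n * u n y) x"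
    by (rule bounded_operatorD(2)[OF T]) (use u in auto)
  moreover have "AE x in M. T (\<lambda>y. c n * u n y) x = c n * T (u n) x"
    by (rule bounded_operatorD(3)[OF T u])
  ultimately show ?case using Suc by eventually_elim (simp add: add.commute)
qed

lemma bounded_operator_tendsto:
  assumes T: "bounded_operator M T" and f: "\<And>n::nat. f n \<in> L2 M" "g \<in> L2 M"
    and lim: "(\<lambda>n. L2_norm M (\<lambda>x. f n x - g x)) \<longlonglongrightarrow> 0"
  shows "(\<lambda>n. L2_norm M (\<lambda>x. T (f n) x - T g x)) \<longlonglongrightarrow> 0"
proof -
  note TL = bounded_operatorD(1)[OF T]
  obtain C where C: "C \<ge> 0" "\<And>f. f \<in> L2 M \<Longrightarrow> L2_norm M (T f) \<le> C * L2_norm M f"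
    using bounded_operator_bound[OF T] by blast
  have le: "L2_norm M (\<lambda>x. T (f n) x - T g x) \<le> C * L2_norm M (\<lambda>x. f n x - g x)" for n
  proof -
    have "L2_norm M (\<lambda>x. T (f n) x - T g x) = L2_norm M (T (\<lambda>y. f n y - g y))"
      using bounded_operator_diff[OF T f(1)[of n] f(2)] L2_measurable[OF TL[OF f(1)[of n]]] L2_measurable[OF TL[OF f(2)]]
        L2_measurable[OF TL[OF L2_diff[OF f(1)[of n] f(2)]]]
      by (intro L2_norm_cong_AE) auto
    then show ?thesis using C(2)[OF L2_diff[OF f(1)[of n] f(2)]] by simp
  qed
  have "(\<lambda>n. C * L2_norm M (\<lambda>x. f n x - g x)) \<longlonglongrightarrow> 0"
    using tendsto_mult_left[OF lim, of C] by simp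
  then show ?thesis
    by (rule Lim_null_comparison[rotated]) (simp add: le)
qed

lemma bounded_operator_expansion:
  assumes T: "bounded_operator lborel T" and f: "f \<in> L2 lborel"
  shows "(\<lambda>n. L2_norm lborel (\<lambda>x. (\<Sum>i<n. L2_inner lborel f (hs_basis i) * T (hs_basis i) x) - T f x)) \<longlonglongrightarrow> 0"
proof -
  note TL = bounded_operatorD(1)[OF T]
  let ?S = "\<lambda>n x. \<Sum>i<n. L2_inner lborel f (hs_basis i) * hs_basis i x"
  have "(\<lambda>n. L2_norm lborel (\<lambda>x. ?S n x - f x)) \<longlonglongrightarrow> 0"
    using orthonormal_basis_expansion[OF hs_basis f] by (subst L2_norm_minus_commute)
  then have "(\<lambda>n. L2_norm lborel (\<lambda>x. T (?S n) x - T f x)) \<longlonglongrightarrow> 0"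
    by (intro bounded_operator_tendsto[OF T]) (auto simp: f)
  moreover have "L2_norm lborel (\<lambda>x. T (?S n) x - T f x) =
     L2_norm lborel (\<lambda>x. (\<Sum>i<n. L2_inner lborel f (hs_basis i) * T (hs_basis i) x) - T f x)" for n
  proof (rule L2_norm_cong_AE)
    show "AE x in lborel. T (?S n) x - T f x = (\<Sum>i<n. L2_inner lborel f (hs_basis i) * T (hs_basis i) x) - T f x"
      using bounded_operator_sum[OF T, of hs_basis "\<lambda>i. L2_inner lborel f (hs_basis i)" n] by simp
    have TT: "T (?S n) \<in> L2 lborel" "T f \<in> L2 lborel" "\<And>i. T (hs_basis i) \<in> L2 lborel"
      using TL f by auto
    show "(\<lambda>x. T (?S n) x - T f x) \<in> borel_measurable lborel"
      "(\<lambda>x. (\<Sum>i<n. L2_inner lborel f (hs_basis i) * T (hs_basis i) x) - T f x) \<in> borel_measurable lborel"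
      by (rule L2_measurable[OF L2_diff[OF TT(1,2)]], rule L2_measurable[OF L2_diff[OF L2_lincomb[OF TT(3)] TT(2)]])
  qed
  ultimately show ?thesis by simp
qed

text \<open>On partial sums of the expansion of \<open>f\<close>, the triangle inequality and
  Cauchy-Schwarz for finite sums give the bound; boundedness of \<open>T\<close> lets the images of
  the partial sums converge to \<open>T f\<close>.\<close>

lemma hs_norm2_bound:
  assumes T: "bounded_operator lborel T" and f: "f \<in> L2 lborel" and fin: "hs_norm2 lborel T < \<infinity>"
  shows "nn2 lborel (T f) \<le> hs_norm2 lborel T * nn2 lborel f"
proof -
  note TL = bounded_operatorD(1)[OF T]
  have Te: "T (hs_basis i) \<in> L2 lborel" for i using TL by simp
  define c where "c = (\<lambda>i. L2_inner lborel f (hs_basis i))"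
  define d where "d = (\<lambda>i. L2_norm lborel (T (hs_basis i)))"
  obtain D where D: "hs_norm2 lborel T = ennreal D" "D \<ge> 0"
    using fin by (cases "hs_norm2 lborel T") auto
  have dD: "(\<Sum>i<n. (d i)\<^sup>2) \<le> D" for n
  proof -
    have "ennreal (\<Sum>i<n. (d i)\<^sup>2) = (\<Sum>i<n. ennreal ((d i)\<^sup>2))" by (simp add: sum_ennreal)
    also have "\<dots> \<le> (\<Sum>i. ennreal ((d i)\<^sup>2))" by (intro sum_le_suminf) auto
    also have "\<dots> = ennreal D" using D by (simp add: hs_norm2_def hs_basis_def[symmetric] d_def)
    finally show ?thesis using D by simp
  qed
  have cf: "(\<Sum>i<n. (cmod (c i))\<^sup>2) \<le> (L2_norm lborel f)\<^sup>2" for n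
    unfolding c_def by (rule L2_Bessel) (auto simp: f orthonormal_basisD(2)[OF hs_basis])
  have bound: "L2_norm lborel (\<lambda>x. \<Sum>i<n. c i * T (hs_basis i) x) \<le> sqrt D * L2_norm lborel f" for n
  proof -
    have "L2_norm lborel (\<lambda>x. \<Sum>i<n. c i * T (hs_basis i) x) \<le> (\<Sum>i<n. cmod (c i) * d i)"
    proof (induction n)
      case (Suc n)
      have "L2_norm lborel (\<lambda>x. (\<Sum>i<n. c i * T (hs_basis i) x) + c n * T (hs_basis n) x) \<le>
         L2_norm lborel (\<lambda>x. (\<Sum>i<n. c i * T (hs_basis i) x)) + L2_norm lborel (\<lambda>x. c n * T (hs_basis n) x)"
        by (rule L2_triangle) (auto simp: Te)
      then show ?case using Suc by (simp add: L2_norm_scale d_def add.commute)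
    qed simp
    also have "\<dots> \<le> sqrt (\<Sum>i<n. (cmod (c i))\<^sup>2) * sqrt (\<Sum>i<n. (d i)\<^sup>2)"
    proof -
      have "(\<Sum>i<n. cmod (c i) * d i)\<^sup>2 \<le> (\<Sum>i<n. (cmod (c i))\<^sup>2) * (\<Sum>i<n. (d i)\<^sup>2)"
        by (rule Cauchy_Schwarz_ineq_sum)
      then show ?thesis by (simp add: real_le_rsqrt flip: real_sqrt_mult)
    qed
    also have "\<dots> \<le> L2_norm lborel f * sqrt D"
      using real_sqrt_le_mono[OF cf[of n]] real_sqrt_le_mono[OF dD[of n]]
      by (intro mult_mono) (auto simp: sum_nonneg)
    finally show ?thesis by (simp add: mult.commute)
  qed
  have "(\<lambda>n. L2_norm lborel (\<lambda>x. \<Sum>i<n. c i * T (hs_basis i) x)) \<longlonglongrightarrow> L2_norm lborel (T f)"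
    using bounded_operator_expansion[OF T f] by (intro L2_norm_tendsto) (auto simp: TL f Te c_def)
  then have "L2_norm lborel (T f) \<le> sqrt D * L2_norm lborel f"
    by (rule LIMSEQ_le_const2) (use bound in auto)
  then have "(L2_norm lborel (T f))\<^sup>2 \<le> (sqrt D * L2_norm lborel f)\<^sup>2"
    by (intro power_mono) auto
  then have "ennreal ((L2_norm lborel (T f))\<^sup>2) \<le> ennreal (D * (L2_norm lborel f)\<^sup>2)"
    using D by (intro ennreal_leI) (simp add: power_mult_distrib)
  then show ?thesis using D by (simp add: nn2_L2 f TL ennreal_mult)
qed

lemma bounded_operator_elem_tensor:
  assumes f: "f \<in> L2 M" and u: "u \<in> L2 M"
  shows "bounded_operator M (elem_tensor M f u)"
  unfolding bounded_operator_def
proof (intro conjI ballI allI exI[of _ "L2_norm M f * L2_norm M u"])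
  fix h assume h: "h \<in> L2 M"
  show "elem_tensor M f u h \<in> L2 M" using f by (simp add: elem_tensor_def L2_scale)
  have "L2_norm M (elem_tensor M f u h) = cmod (L2_inner M h u) * L2_norm M f"
    by (simp add: elem_tensor_def L2_norm_scale)
  also have "\<dots> \<le> (L2_norm M h * L2_norm M u) * L2_norm M f"
    using L2_Cauchy_Schwarz[OF h u] by (intro mult_right_mono) auto
  finally show "L2_norm M (elem_tensor M f u h) \<le> L2_norm M f * L2_norm M u * L2_norm M h"
    by (simp add: mult_ac)
  fix g assume g: "g \<in> L2 M"
  show "AE x in M. elem_tensor M f u (\<lambda>y. h y + g y) x = elem_tensor M f u h x + elem_tensor M f u g x"
    using h g u by (simp add: elem_tensor_def L2_inner_add_left distrib_right)
next
  fix c h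
  show "AE x in M. elem_tensor M f u (\<lambda>y. c * h y) x = c * elem_tensor M f u h x"
    by (simp add: elem_tensor_def L2_inner_scale_left)
qed

lemma nn2_scale: "nn2 M (\<lambda>x. c * f x) = ennreal ((cmod c)\<^sup>2) * nn2 M f" if "f \<in> borel_measurable M"
  using that unfolding nn2_def by (subst nn_integral_cmult[symmetric]) (auto simp: norm_mult power_mult_distrib ennreal_mult)

lemma nn2_cnj: "nn2 M (\<lambda>x. cnj (f x)) = nn2 M f"
  by (simp add: nn2_def)

lemma hs_norm2_elem_tensor:
  assumes f: "f \<in> L2 lborel" and u: "u \<in> L2 lborel"
  shows "hs_norm2 lborel (elem_tensor lborel f u) = nn2 lborel f * nn2 lborel u"
proof -
  have "hs_norm2 lborel (elem_tensor lborel f u) = (\<Sum>i. nn2 lborel (\<lambda>x. L2_inner lborel (hs_basis i) u * f x))"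
    by (subst hs_norm2_eq) (auto simp: elem_tensor_def f)
  also have "\<dots> = (\<Sum>i. ennreal ((cmod (L2_inner lborel u (hs_basis i)))\<^sup>2) * nn2 lborel f)"
    by (intro suminf_cong) (subst nn2_scale[OF L2_measurable[OF f]], subst L2_inner_commute, simp)
  also have "\<dots> = (\<Sum>i. ennreal ((cmod (L2_inner lborel u (hs_basis i)))\<^sup>2)) * nn2 lborel f"
    by simp
  finally show ?thesis by (simp add: orthonormal_basis_nn2[OF hs_basis u] mult.commute)
qed

text \<open>
  Operators in the tensor product \<open>L\<^sup>2 \<otimes> range P\<close> satisfy \<open>T P = T\<close>: finite sums of elementary
  tensors do, and the operator norm is bounded by the Hilbert--Schmidt norm.
\<close>

lemma hs_tensor_projection:
  fixes T P :: "'b::euclidean_space operator"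
  assumes P: "orthogonal_projection lborel P" and T: "T \<in> hs_tensor lborel (L2_range lborel P)" and h: "h \<in> L2 lborel"
  shows "AE x in lborel. T (P h) x = T h x"
proof -
  have Pb: "bounded_operator lborel P" using P by (simp add: orthogonal_projection_def)
  have T1: "bounded_operator lborel T" "hs_norm2 lborel T < \<infinity>"
    using T by (auto simp: hs_tensor_def hs_operator_def)
  have Ph: "P h \<in> L2 lborel" by (rule bounded_operatorD(1)[OF Pb h])
  \<comment> \<open>The component of \<open>h\<close> orthogonal to the range of \<open>P\<close>.
    The claim amounts to \<open>T w = 0\<close>.\<close>
  define w where "w = (\<lambda>x. h x - P h x)"
  have w: "w \<in> L2 lborel" unfolding w_def using h Ph by auto
  have ortho: "L2_inner lborel w u = 0" if u: "u \<in> L2_range lborel P" for u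
  proof -
    obtain g where g: "g \<in> L2 lborel" "AE x in lborel. u x = P g x" "u \<in> L2 lborel"
      using u unfolding L2_range_def by blast
    have Pg: "P g \<in> L2 lborel" by (rule bounded_operatorD(1)[OF Pb g(1)])
    have "L2_inner lborel w u = L2_inner lborel w (P g)"
      using g Pg w by (intro L2_inner_cong_AE) (auto dest: L2_measurable)
    also have "\<dots> = L2_inner lborel h (P g) - L2_inner lborel (P h) (P g)"
      unfolding w_def using h Ph Pg by (rule L2_inner_diff_left)
    also have "L2_inner lborel (P h) (P g) = L2_inner lborel h (P (P g))"
      using P h Pg by (simp add: orthogonal_projection_def)
    also have "\<dots> = L2_inner lborel h (P g)"
    proof -
      have "AE x in lborel. P (P g) x = P g x" using P g(1) by (simp add: orthogonal_projection_def)
      then show ?thesis using h Pg bounded_operatorD(1)[OF Pb Pg]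
        by (intro L2_inner_cong_AE) (auto dest: L2_measurable)
    qed
    finally show ?thesis by simp
  qed
  have small: "nn2 lborel (T w) \<le> ennreal \<epsilon> * nn2 lborel w" if eps: "\<epsilon> > 0" for \<epsilon> :: real
  proof -
    obtain n f u where fu: "\<forall>i<n. f i \<in> L2 lborel \<and> u i \<in> L2_range lborel P"
      and lt: "hs_norm2 lborel (\<lambda>h x. T h x - (\<Sum>i<(n::nat). elem_tensor lborel (f i) (u i) h x)) < ennreal \<epsilon>"
      using T eps unfolding hs_tensor_def by (auto dest!: spec[of _ "ennreal \<epsilon>"])
    have uL: "u i \<in> L2 lborel" if "i < n" for i using fu that by (auto simp: L2_range_def)
    define E where "E = (\<lambda>h x. \<Sum>i<n. elem_tensor lborel (f i) (u i) h x)"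
    \<comment> \<open>\<open>E\<close> kills \<open>w\<close>, so \<open>D\<close> and
      \<open>T\<close> agree on \<open>w\<close>, while the Hilbert-Schmidt norm of \<open>D\<close>
      is small.\<close>
    define D where "D = (\<lambda>h x. T h x - E h x)"
    have Eb: "bounded_operator lborel E"
    proof -
      have "bounded_operator lborel (\<lambda>h x. \<Sum>i<m. elem_tensor lborel (f i) (u i) h x)" if "m \<le> n" for m
        using that
      proof (induction m)
        case 0
        show ?case by (auto simp: bounded_operator_def intro!: exI[of _ 0])
      next
        case (Suc m)
        let ?E = "\<lambda>h x. \<Sum>i<m. elem_tensor lborel (f i) (u i) h x" and ?e = "elem_tensor lborel (f m) (u m)"
        have a: "bounded_operator lborel ?E" using Suc by simp
        have b: "bounded_operator lborel ?e"
          using Suc fu uL by (intro bounded_operator_elem_tensor) auto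
        obtain C1 where C1: "\<And>f. f \<in> L2 lborel \<Longrightarrow> L2_norm lborel (?E f) \<le> C1 * L2_norm lborel f"
          using bounded_operator_bound[OF a] by blast
        obtain C2 where C2: "\<And>f. f \<in> L2 lborel \<Longrightarrow> L2_norm lborel (?e f) \<le> C2 * L2_norm lborel f"
          using bounded_operator_bound[OF b] by blast
        have "bounded_operator lborel (\<lambda>h x. ?E h x + ?e h x)"
          unfolding bounded_operator_def
        proof (intro conjI ballI allI exI[of _ "C1 + C2"])
          fix h assume h: "h \<in> L2 (lborel :: 'b measure)"
          show "(\<lambda>x. ?E h x + ?e h x) \<in> L2 lborel"
            by (rule L2_add[OF bounded_operatorD(1)[OF a h] bounded_operatorD(1)[OF b h]])
          show "L2_norm lborel (\<lambda>x. ?E h x + ?e h x) \<le> (C1 + C2) * L2_norm lborel h"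
            using L2_triangle[OF bounded_operatorD(1)[OF a h] bounded_operatorD(1)[OF b h]] C1[OF h] C2[OF h]
            by (simp add: distrib_right)
          fix g assume g: "g \<in> L2 (lborel :: 'b measure)"
          show "AE x in lborel. ?E (\<lambda>y. h y + g y) x + ?e (\<lambda>y. h y + g y) x = ?E h x + ?e h x + (?E g x + ?e g x)"
            using bounded_operatorD(2)[OF a h g] bounded_operatorD(2)[OF b h g] by eventually_elim simp
        next
          fix c h assume h: "h \<in> L2 (lborel :: 'b measure)"
          show "AE x in lborel. ?E (\<lambda>y. c * h y) x + ?e (\<lambda>y. c * h y) x = c * (?E h x + ?e h x)"
            using bounded_operatorD(3)[OF a h, of c] bounded_operatorD(3)[OF b h, of c]
            by eventually_elim (simp add: distrib_left)
        qed
        then show ?case by (simp add: add.commute)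
      qed
      then show ?thesis unfolding E_def by blast
    qed
    obtain C1 where C1: "\<And>f. f \<in> L2 lborel \<Longrightarrow> L2_norm lborel (T f) \<le> C1 * L2_norm lborel f"
      using bounded_operator_bound[OF T1(1)] by blast
    obtain C2 where C2: "\<And>f. f \<in> L2 lborel \<Longrightarrow> L2_norm lborel (E f) \<le> C2 * L2_norm lborel f"
      using bounded_operator_bound[OF Eb] by blast
    have Db: "bounded_operator lborel D"
      unfolding bounded_operator_def D_def
    proof (intro conjI ballI allI exI[of _ "C1 + C2"])
      fix h assume h: "h \<in> L2 (lborel :: 'b measure)"
      note TE = bounded_operatorD(1)[OF T1(1) h] bounded_operatorD(1)[OF Eb h]
      show "(\<lambda>x. T h x - E h x) \<in> L2 lborel" by (rule L2_diff[OF TE])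
      show "L2_norm lborel (\<lambda>x. T h x - E h x) \<le> (C1 + C2) * L2_norm lborel h"
        using L2_triangle_diff[OF TE(1) L2_zero TE(2)] C1[OF h] C2[OF h] L2_norm_minus_commute[of lborel "\<lambda>_. 0" "E h"]
        by (simp add: distrib_right)
      fix g assume g: "g \<in> L2 (lborel :: 'b measure)"
      show "AE x in lborel. T (\<lambda>y. h y + g y) x - E (\<lambda>y. h y + g y) x = T h x - E h x + (T g x - E g x)"
        using bounded_operatorD(2)[OF T1(1) h g] bounded_operatorD(2)[OF Eb h g] by eventually_elim simp
    next
      fix c h assume h: "h \<in> L2 (lborel :: 'b measure)"
      show "AE x in lborel. T (\<lambda>y. c * h y) x - E (\<lambda>y. c * h y) x = c * (T h x - E h x)"
        using bounded_operatorD(3)[OF T1(1) h, of c] bounded_operatorD(3)[OF Eb h, of c]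
        by eventually_elim (simp add: right_diff_distrib)
    qed
    have lt': "hs_norm2 lborel D < ennreal \<epsilon>" using lt by (simp add: D_def E_def)
    then have fD: "hs_norm2 lborel D < \<infinity>" using ennreal_less_top less_trans unfolding infinity_ennreal_def by blast
    have "E w x = 0" for x
      unfolding E_def elem_tensor_def using ortho fu by (intro sum.neutral) auto
    then have "D w = T w" by (auto simp: D_def)
    then have "nn2 lborel (T w) \<le> hs_norm2 lborel D * nn2 lborel w"
      using hs_norm2_bound[OF Db w fD] by simp
    also have "\<dots> \<le> ennreal \<epsilon> * nn2 lborel w" using lt' by (intro mult_right_mono) auto
    finally show ?thesis .
  qed
  have Tw: "T w \<in> L2 lborel" by (rule bounded_operatorD(1)[OF T1(1) w])
  have le: "(L2_norm lborel (T w))\<^sup>2 \<le> \<epsilon> * (L2_norm lborel w)\<^sup>2" if "\<epsilon> > 0" for \<epsilon>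
    using small[OF that] that by (simp add: nn2_L2 w Tw flip: ennreal_mult)
  have "(L2_norm lborel (T w))\<^sup>2 \<le> 0"
  proof (rule field_le_epsilon)
    fix e :: real assume e: "e > 0"
    define n where "n = (L2_norm lborel w)\<^sup>2"
    have n: "n \<ge> 0" by (simp add: n_def)
    have "e / (n + 1) > 0" using e n by simp
    from le[OF this] have "(L2_norm lborel (T w))\<^sup>2 \<le> (e / (n + 1)) * n"
      unfolding n_def .
    also have "\<dots> = e * (n / (n + 1))" by simp
    also have "\<dots> \<le> e * 1" using e n by (intro mult_left_mono) auto
    finally show "(L2_norm lborel (T w))\<^sup>2 \<le> 0 + e" by simp
  qed
  then have "AE x in lborel. T w x = 0" by (intro L2_norm_eq_0[OF Tw]) auto
  moreover have "AE x in lborel. T w x = T h x - T (P h) x"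
    unfolding w_def by (rule bounded_operator_diff[OF T1(1) h Ph])
  ultimately show ?thesis by eventually_elim simp
qed

subsection \<open>Integral operators with square-integrable kernel\<close>

definition kop :: "('b::euclidean_space \<Rightarrow> 'b \<Rightarrow> complex) \<Rightarrow> 'b operator" where
  "kop \<kappa> h x = (LINT s|lborel. \<kappa> x s * h s)"

context
  fixes \<kappa> :: "'b::euclidean_space \<Rightarrow> 'b \<Rightarrow> complex"
  assumes \<kappa>m [measurable]: "(\<lambda>(x, s). \<kappa> x s) \<in> borel_measurable (borel \<Otimes>\<^sub>M borel)"
    and fin: "(\<integral>\<^sup>+x. nn2 lborel (\<kappa> x) \<partial>lborel) < \<infinity>"
begin

lemma kop_measurable:
  assumes [measurable]: "h \<in> borel_measurable borel"
  shows "kop \<kappa> h \<in> borel_measurable borel"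
  unfolding kop_def[abs_def] by measurable

lemma kernel_AE_L2: "AE x in lborel. \<kappa> x \<in> L2 lborel"
proof -
  have [measurable]: "(\<lambda>x. nn2 lborel (\<kappa> x)) \<in> borel_measurable borel" unfolding nn2_def by measurable
  have "AE x in lborel. nn2 lborel (\<kappa> x) \<noteq> \<infinity>"
    using fin by (intro nn_integral_PInf_AE) auto
  then show ?thesis by eventually_elim (auto simp: L2_iff less_top)
qed

text \<open>Each value is, up to conjugation, an inner product with one row of the kernel; this
  makes Cauchy-Schwarz and Parseval available row by row.\<close>

lemma kop_eq_inner: "kop \<kappa> h x = cnj (L2_inner lborel (\<lambda>s. cnj (\<kappa> x s)) h)"
  unfolding kop_def L2_inner_def by (simp flip: Bochner_Integration.integral_cnj)

lemma kop_nn2: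
  assumes h: "h \<in> L2 lborel"
  shows "nn2 lborel (kop \<kappa> h) \<le> (\<integral>\<^sup>+x. nn2 lborel (\<kappa> x) \<partial>lborel) * nn2 lborel h"
proof -
  have [measurable]: "(\<lambda>x. nn2 lborel (\<kappa> x)) \<in> borel_measurable borel" unfolding nn2_def by measurable
  have "nn2 lborel (kop \<kappa> h) \<le> (\<integral>\<^sup>+x. nn2 lborel (\<kappa> x) * nn2 lborel h \<partial>lborel)"
    unfolding nn2_def[of lborel "kop \<kappa> h"]
  proof (rule nn_integral_mono_AE)
    show "AE x in lborel. ennreal ((cmod (kop \<kappa> h x))\<^sup>2) \<le> nn2 lborel (\<kappa> x) * nn2 lborel h"
      using kernel_AE_L2
    proof eventually_elim
      case (elim x)
      have "(cmod (kop \<kappa> h x))\<^sup>2 \<le> (L2_norm lborel (\<lambda>s. cnj (\<kappa> x s)) * L2_norm lborel h)\<^sup>2"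
        unfolding kop_eq_inner complex_mod_cnj using elim h by (intro power_mono L2_Cauchy_Schwarz) auto
      then show ?case
        using elim h by (simp add: L2_norm_cnj power_mult_distrib nn2_L2 ennreal_leI flip: ennreal_mult)
    qed
  qed
  also have "\<dots> = (\<integral>\<^sup>+x. nn2 lborel (\<kappa> x) \<partial>lborel) * nn2 lborel h"
    by (rule nn_integral_multc) measurable
  finally show ?thesis .
qed

lemma kop_L2:
  assumes h: "h \<in> L2 lborel" shows "kop \<kappa> h \<in> L2 lborel"
proof -
  have "nn2 lborel (kop \<kappa> h) < \<infinity>"
    using kop_nn2[OF h] fin h by (auto simp: L2_iff ennreal_mult_less_top intro: le_less_trans)
  then show ?thesis using kop_measurable[of h] L2_measurable[OF h] by (simp add: L2_iff)
qed

lemma bounded_operator_kop: "bounded_operator lborel (kop \<kappa>)"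
proof -
  obtain D where D: "(\<integral>\<^sup>+x. nn2 lborel (\<kappa> x) \<partial>lborel) = ennreal D" "D \<ge> 0"
    using fin by (cases "\<integral>\<^sup>+x. nn2 lborel (\<kappa> x) \<partial>lborel") auto
  show ?thesis
    unfolding bounded_operator_def
  proof (intro conjI ballI allI exI[of _ "sqrt D"])
    fix h :: "'b \<Rightarrow> complex" assume h: "h \<in> L2 lborel"
    show "kop \<kappa> h \<in> L2 lborel" by (rule kop_L2[OF h])
    have "ennreal ((L2_norm lborel (kop \<kappa> h))\<^sup>2) \<le> ennreal ((sqrt D * L2_norm lborel h)\<^sup>2)"
      using kop_nn2[OF h] D by (simp add: nn2_L2 h kop_L2[OF h] power_mult_distrib flip: ennreal_mult)
    then have "(L2_norm lborel (kop \<kappa> h))\<^sup>2 \<le> (sqrt D * L2_norm lborel h)\<^sup>2"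
      by (subst (asm) ennreal_le_iff) auto
    then show "L2_norm lborel (kop \<kappa> h) \<le> sqrt D * L2_norm lborel h"
      by (rule power2_le_imp_le) (use D in auto)
    fix g :: "'b \<Rightarrow> complex" assume g: "g \<in> L2 lborel"
    show "AE x in lborel. kop \<kappa> (\<lambda>y. h y + g y) x = kop \<kappa> h x + kop \<kappa> g x"
      using kernel_AE_L2
      by eventually_elim (simp add: kop_def distrib_left L2_integrable_mult' h g)
  next
    fix c and h :: "'b \<Rightarrow> complex"
    show "AE x in lborel. kop \<kappa> (\<lambda>y. c * h y) x = c * kop \<kappa> h x"
      by (simp add: kop_def mult.left_commute[of _ c])
  qed
qed

text \<open>Parseval in the second kernel variable for almost every row, after the sum over the
  basis has been exchanged with the integral over the rows.\<close>

lemma hs_norm2_kop: "hs_norm2 lborel (kop \<kappa>) = (\<integral>\<^sup>+x. nn2 lborel (\<kappa> x) \<partial>lborel)"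
proof -
  have [measurable]: "kop \<kappa> (hs_basis i) \<in> borel_measurable borel" for i
    by (rule kop_measurable) measurable
  have "hs_norm2 lborel (kop \<kappa>) = (\<Sum>i. \<integral>\<^sup>+x. ennreal ((cmod (kop \<kappa> (hs_basis i) x))\<^sup>2) \<partial>lborel)"
    by (subst hs_norm2_eq) (auto simp: kop_L2 nn2_def)
  also have "\<dots> = (\<integral>\<^sup>+x. (\<Sum>i. ennreal ((cmod (kop \<kappa> (hs_basis i) x))\<^sup>2)) \<partial>lborel)"
    by (rule nn_integral_suminf[symmetric]) measurable
  also have "\<dots> = (\<integral>\<^sup>+x. nn2 lborel (\<kappa> x) \<partial>lborel)"
  proof (rule nn_integral_cong_AE)
    show "AE x in lborel. (\<Sum>i. ennreal ((cmod (kop \<kappa> (hs_basis i) x))\<^sup>2)) = nn2 lborel (\<kappa> x)"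
      using kernel_AE_L2
    proof eventually_elim
      case (elim x)
      then have c: "(\<lambda>s. cnj (\<kappa> x s)) \<in> L2 lborel" by simp
      show ?case
        unfolding kop_eq_inner complex_mod_cnj orthonormal_basis_nn2[OF hs_basis c] by (rule nn2_cnj)
    qed
  qed
  finally show ?thesis .
qed

lemma hs_operator_kop: "hs_operator lborel (kop \<kappa>)"
  unfolding hs_operator_def hs_norm2_kop using bounded_operator_kop fin by simp

end

section \<open>The Plancherel measure in coordinates\<close>

lemma sigma_finite_lebesgue: "sigma_finite_measure (lebesgue :: 'a::euclidean_space measure)"
proof
  obtain A :: "'a set set" where A: "countable A" "A \<subseteq> sets lborel" "\<Union>A = space lborel" "\<forall>a\<in>A. emeasure lborel a \<noteq> \<infinity>"
    using lborel.sigma_finite_countable by blast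
  then show "\<exists>A::'a set set. countable A \<and> A \<subseteq> sets lebesgue \<and> \<Union>A = space lebesgue \<and> (\<forall>a\<in>A. emeasure lebesgue a \<noteq> \<infinity>)"
    by (intro exI[of _ A]) (auto simp: subset_eq)
qed

section \<open>Determinants of matrix pencils, reflections and products of Lebesgue measure\<close>

lemma det_scaleR: "det (r *\<^sub>R A) = r ^ CARD('n) * det (A :: real^'n^'n)"
proof -
  have "r *\<^sub>R A = (\<chi> i. r *s A $ i)" by (simp add: vec_eq_iff)
  then show ?thesis using det_rows_mul[of "\<lambda>_. r" "\<lambda>i. A $ i"] by (simp add: vec_lambda_eta)
qed

lemma det_pencil_poly: "\<exists>p. \<forall>r. poly p r = det (r *\<^sub>R A + C :: real^'n^'n)"
proof (intro exI allI)
  fix r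
  show "poly (\<Sum>p\<in>{p. p permutes UNIV}. [:of_int (sign p):] * (\<Prod>i\<in>UNIV. [:C $ i $ p i, A $ i $ p i:])) r = det (r *\<^sub>R A + C)"
    by (simp add: det_def poly_sum poly_prod algebra_simps)
qed

text \<open>Only \<open>C\<close> is known to be invertible, so the pencil is read from the other
  end: the determinant of \<open>A + s C\<close> is a power of \<open>s\<close> times that of
  \<open>A/s + C\<close>, and the polynomial \<open>r \<mapsto> det (r A + C)\<close> has the
  nonzero value \<open>det C\<close> at 0. The inverses of its finitely many roots, together with
  \<open>s = 0\<close>, cover all zeros.\<close>

lemma finite_det_pencil:
  assumes "det C \<noteq> 0"
  shows "finite {s. det (A + s *\<^sub>R C :: real^'n^'n) = 0}"
proof -
  obtain p where p: "\<And>r. poly p r = det (r *\<^sub>R A + C)" using det_pencil_poly by blast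
  have "p \<noteq> 0" using p[of 0] assms by auto
  then have "finite {r. poly p r = 0}" by (rule poly_roots_finite)
  then have "finite (inverse ` {r. poly p r = 0} \<union> {0})" by auto
  moreover have "{s. det (A + s *\<^sub>R C) = 0} \<subseteq> inverse ` {r. poly p r = 0} \<union> {0}"
  proof
    fix s assume s: "s \<in> {s. det (A + s *\<^sub>R C) = 0}"
    show "s \<in> inverse ` {r. poly p r = 0} \<union> {0}"
    proof (cases "s = 0")
      case False
      then have "A + s *\<^sub>R C = s *\<^sub>R (inverse s *\<^sub>R A + C)" by (simp add: scaleR_add_right)
      then have "poly p (inverse s) = 0" using s False by (simp add: p det_scaleR)
      then show ?thesis by (auto intro!: image_eqI[of _ _ "inverse s"])
    qed simp
  qed
  ultimately show ?thesis using finite_subset by blast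
qed

lemma inner_matrix_transpose: "(x::real^'n) \<bullet> (A *v y) = (transpose A *v x) \<bullet> y"
  by (metis dot_lmul_matrix vector_transpose_matrix transpose_transpose)

lemma nn_integral_reflect:
  fixes f :: "'a::euclidean_space \<Rightarrow> ennreal"
  assumes [measurable]: "f \<in> borel_measurable borel"
  shows "(\<integral>\<^sup>+s. f (x - s) \<partial>lborel) = (\<integral>\<^sup>+s. f s \<partial>lborel)"
proof -
  have "(\<integral>\<^sup>+s. f s \<partial>lborel) = (\<integral>\<^sup>+s. f (s + x) \<partial>lborel)" by (simp add: lborel_shift)
  also have "\<dots> = (\<integral>\<^sup>+s. f (x - s) \<partial>lborel)"
    by (subst nn_integral_scale[of _ "-1"]) auto
  finally show ?thesis by simp
qed

lemma lborel_reflect: "distr lborel borel (\<lambda>s. x - s) = (lborel :: 'a::euclidean_space measure)"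
proof (rule measure_eqI)
  fix A assume "A \<in> sets (distr lborel borel (\<lambda>s. x - s))"
  then have [measurable]: "A \<in> sets borel" by simp
  have "emeasure (distr lborel borel (\<lambda>s. x - s)) A = (\<integral>\<^sup>+s. indicator A s \<partial>distr lborel borel (\<lambda>s. x - s))" by simp
  also have "\<dots> = (\<integral>\<^sup>+s. indicator A (x - s) \<partial>lborel)" by (rule nn_integral_distr) measurable
  also have "\<dots> = emeasure lborel A" by (subst nn_integral_reflect) auto
  finally show "emeasure (distr lborel borel (\<lambda>s. x - s)) A = emeasure lborel A" .
qed simp

lemma integral_reflect:
  fixes f :: "'a::euclidean_space \<Rightarrow> complex"
  assumes "f \<in> borel_measurable borel"
  shows "(LINT s|lborel. f (x - s)) = (LINT s|lborel. f s)"
  using integral_distr[of "\<lambda>s. x - s" lborel borel f] assms by (simp add: lborel_reflect)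

lemma nn_integral_lborel_pair:
  fixes f :: "'a::euclidean_space \<times> 'b::euclidean_space \<Rightarrow> ennreal"
  assumes "f \<in> borel_measurable borel"
  shows "(\<integral>\<^sup>+z. f z \<partial>lborel) = (\<integral>\<^sup>+x. \<integral>\<^sup>+y. f (x, y) \<partial>lborel \<partial>lborel)"
    "(\<integral>\<^sup>+z. f z \<partial>lborel) = (\<integral>\<^sup>+y. \<integral>\<^sup>+x. f (x, y) \<partial>lborel \<partial>lborel)"
proof -
  have f: "f \<in> borel_measurable (lborel \<Otimes>\<^sub>M lborel)" using assms by (simp add: lborel_prod)
  show "(\<integral>\<^sup>+z. f z \<partial>lborel) = (\<integral>\<^sup>+x. \<integral>\<^sup>+y. f (x, y) \<partial>lborel \<partial>lborel)"
    using lborel.nn_integral_fst[OF f] by (simp add: lborel_prod)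
  show "(\<integral>\<^sup>+z. f z \<partial>lborel) = (\<integral>\<^sup>+y. \<integral>\<^sup>+x. f (x, y) \<partial>lborel \<partial>lborel)"
    using lborel_pair.nn_integral_snd[OF f] by (simp add: lborel_prod)
qed

lemma borel_measurable_lebesgue_on:
  "f \<in> borel_measurable borel \<Longrightarrow> f \<in> borel_measurable (lebesgue_on S)"
  by (intro measurable_restrict_space1 measurable_completion) simp

text \<open>The group enters the analysis only through the linear map
  \<open>l \<mapsto> B(l)\<close>: the representations, the Plancherel density and the group law in
  the coordinates \<open>(z, y, t)\<close> are all expressed by it.\<close>

locale weil_coords =
  fixes Bm :: "real^'k::finite \<Rightarrow> real^'d::finite^'d"
  assumes linear_Bm: "linear Bm" and nondeg: "\<exists>l. det (Bm l) \<noteq> 0"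
begin

definition sig :: "(real^'k) set" where "sig = {l. det (Bm l) \<noteq> 0}"

definition mu :: "(real^'k) measure" where
  "mu = density (lebesgue_on sig) (\<lambda>l. ennreal \<bar>det (Bm l)\<bar>)"

lemma continuous_Bm: "continuous_on UNIV Bm"
  using linear_Bm by (simp add: linear_conv_bounded_linear linear_continuous_on)

lemma continuous_det_Bm: "continuous_on UNIV (\<lambda>l. det (Bm l))"
  unfolding det_def by (intro continuous_intros continuous_on_subset[OF continuous_Bm]) auto

lemma det_Bm_measurable [measurable]: "(\<lambda>l. det (Bm l)) \<in> borel_measurable borel"
  by (rule borel_measurable_continuous_onI[OF continuous_det_Bm])

lemma sig_borel [measurable]: "sig \<in> sets borel"
  unfolding sig_def by measurable

lemma BmT_measurable [measurable]:
  assumes [measurable]: "f \<in> borel_measurable M" "g \<in> borel_measurable M"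
  shows "(\<lambda>w. transpose (Bm (f w)) *v g w) \<in> borel_measurable M"
proof -
  have "continuous_on UNIV (\<lambda>(l, x). transpose (Bm l) *v x)"
    unfolding matrix_vector_mult_def transpose_def case_prod_unfold
    by (intro continuous_intros continuous_on_compose2[OF continuous_Bm]) auto
  then have "(\<lambda>(l, x). transpose (Bm l) *v x) \<in> borel_measurable borel"
    by (rule borel_measurable_continuous_onI)
  then have m: "(\<lambda>(l, x). transpose (Bm l) *v x) \<in> borel_measurable (borel \<Otimes>\<^sub>M borel)"
    by (simp add: borel_prod)
  have p: "(\<lambda>w. (f w, g w)) \<in> M \<rightarrow>\<^sub>M borel \<Otimes>\<^sub>M borel" by measurable
  show ?thesis using measurable_compose[OF p m] by simp
qed

text \<open>A line in the direction of a nonsingular \<open>l0\<close> meets the singular set in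
  finitely many points. Averaging over the translates by \<open>s * l0\<close>, with
  \<open>s\<close> in the unit interval, and exchanging the integrals shows that the set is
  null.\<close>

lemma AE_sig: "AE l in lborel. l \<in> sig"
proof -
  obtain l0 where l0: "det (Bm l0) \<noteq> 0" using nondeg by blast
  define N where "N = {l. det (Bm l) = 0}"
  have [measurable]: "N \<in> sets borel" unfolding N_def by measurable
  have line: "(\<integral>\<^sup>+s. indicator {0..1} s * indicator N (l + s *\<^sub>R l0) \<partial>lborel) = (0 :: ennreal)" for l
  proof -
    have "finite {s. l + s *\<^sub>R l0 \<in> N}"
      unfolding N_def using finite_det_pencil[OF l0, of "Bm l"]
      by (simp add: linear_add[OF linear_Bm] linear_scale[OF linear_Bm])
    then have "{s. l + s *\<^sub>R l0 \<in> N} \<in> null_sets lborel" by (rule finite_imp_null_set_lborel)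
    then have "AE s in lborel. s \<notin> {s. l + s *\<^sub>R l0 \<in> N}" by (rule AE_not_in)
    then have "(\<integral>\<^sup>+s. indicator {0..1} s * indicator N (l + s *\<^sub>R l0) \<partial>lborel) = (\<integral>\<^sup>+(s::real). (0::ennreal) \<partial>lborel)"
      by (intro nn_integral_cong_AE) auto
    then show ?thesis by simp
  qed
  have "emeasure lborel N = (\<integral>\<^sup>+s. indicator {0..1::real} s * emeasure lborel N \<partial>lborel)"
    by (simp add: nn_integral_multc)
  also have "\<dots> = (\<integral>\<^sup>+s. indicator {0..1} s * (\<integral>\<^sup>+l. indicator N (l + s *\<^sub>R l0) \<partial>lborel) \<partial>lborel)"
    by (intro nn_integral_cong) (simp add: lborel_shift)
  also have "\<dots> = (\<integral>\<^sup>+s. \<integral>\<^sup>+l. indicator {0..1} s * indicator N (l + s *\<^sub>R l0) \<partial>lborel \<partial>lborel)"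
    by (intro nn_integral_cong) (simp add: nn_integral_cmult)
  also have "\<dots> = (\<integral>\<^sup>+l. \<integral>\<^sup>+s. indicator {0..1} s * indicator N (l + s *\<^sub>R l0) \<partial>lborel \<partial>lborel)"
    by (rule lborel_pair.Fubini') measurable
  also have "\<dots> = 0" by (simp add: line)
  finally have "N \<in> null_sets lborel" by auto
  then have "AE l in lborel. l \<notin> N" by (rule AE_not_in)
  then show ?thesis by (simp add: N_def sig_def)
qed

lemma space_mu [simp]: "space mu = sig"
  by (simp add: mu_def)

lemma measurable_mu: "borel_measurable mu = borel_measurable (lebesgue_on sig)"
  by (simp add: mu_def measurable_def)

lemma measurable_mu_borel: "f \<in> borel_measurable borel \<Longrightarrow> f \<in> borel_measurable mu"
  by (simp add: measurable_mu borel_measurable_lebesgue_on)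

lemma det_measurable_sig: "(\<lambda>l. ennreal \<bar>det (Bm l)\<bar>) \<in> borel_measurable (lebesgue_on sig)"
  by (rule borel_measurable_lebesgue_on) measurable

lemma nn_integral_mu:
  assumes "f \<in> borel_measurable mu"
  shows "(\<integral>\<^sup>+l. f l \<partial>mu) = (\<integral>\<^sup>+l. ennreal \<bar>det (Bm l)\<bar> * f l \<partial>lborel)"
proof -
  have "(\<integral>\<^sup>+l. f l \<partial>mu) = (\<integral>\<^sup>+l. ennreal \<bar>det (Bm l)\<bar> * f l \<partial>lebesgue_on sig)"
    unfolding mu_def using assms det_measurable_sig by (intro nn_integral_density) (auto simp: measurable_mu)
  also have "\<dots> = (\<integral>\<^sup>+l. ennreal \<bar>det (Bm l)\<bar> * f l * indicator sig l \<partial>lebesgue)"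
    by (rule nn_integral_restrict_space) auto
  also have "\<dots> = (\<integral>\<^sup>+l. ennreal \<bar>det (Bm l)\<bar> * f l \<partial>lebesgue)"
    by (intro nn_integral_cong) (auto simp: sig_def indicator_def)
  finally show ?thesis by (simp add: nn_integral_completion)
qed

lemma AE_mu: "(AE l in mu. P l) \<longleftrightarrow> (AE l in lborel. l \<in> sig \<longrightarrow> P l)"
proof -
  have "(AE l in mu. P l) \<longleftrightarrow> (AE l in lebesgue_on sig. 0 < ennreal \<bar>det (Bm l)\<bar> \<longrightarrow> P l)"
    unfolding mu_def by (rule AE_density[OF det_measurable_sig])
  also have "\<dots> \<longleftrightarrow> (AE l in lebesgue. l \<in> sig \<longrightarrow> 0 < ennreal \<bar>det (Bm l)\<bar> \<longrightarrow> P l)"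
    by (rule AE_restrict_space_iff) auto
  also have "\<dots> \<longleftrightarrow> (AE l in lborel. l \<in> sig \<longrightarrow> P l)"
    unfolding AE_completion_iff by (intro AE_cong) (auto simp: sig_def)
  finally show ?thesis .
qed

lemma sigma_finite_mu: "sigma_finite_measure mu"
proof -
  interpret sigma_finite_measure "lebesgue_on sig"
    by (rule sigma_finite_measure_restrict_space[OF sigma_finite_lebesgue]) auto
  show ?thesis unfolding mu_def
    using sigma_finite_iff_density_finite[OF det_measurable_sig] by auto
qed

subsection \<open>Kernels\<close>

text \<open>The kernel of the integrated representation at \<open>l\<close>. \<open>H\<close> stands
  for a partial Fourier transform in \<open>z\<close> and \<open>y\<close>: the frequency dual to
  \<open>y\<close> is \<open>transpose (Bm l) *v x\<close>, and the remaining argument is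
  \<open>t = x - s\<close>.\<close>

definition kap :: "(((real^'k) \<times> (real^'d)) \<times> (real^'d) \<Rightarrow> complex) \<Rightarrow> real^'k \<Rightarrow> real^'d \<Rightarrow> real^'d \<Rightarrow> complex" where
  "kap H l x s = H ((l, transpose (Bm l) *v x), x - s)"

definition Opr :: "(((real^'k) \<times> (real^'d)) \<times> (real^'d) \<Rightarrow> complex) \<Rightarrow> real^'k \<Rightarrow> (real^'d) operator" where
  "Opr H l = kop (kap H l)"

lemma kap_measurable:
  assumes [measurable]: "H \<in> borel_measurable borel"
  shows "(\<lambda>(x, s). kap H l x s) \<in> borel_measurable (borel \<Otimes>\<^sub>M borel)"
  unfolding kap_def by measurable

lemma kap_measurable3 [measurable]:
  assumes [measurable]: "H \<in> borel_measurable borel" "f \<in> borel_measurable M" "g \<in> borel_measurable M" "h \<in> borel_measurable M"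
  shows "(\<lambda>w. kap H (f w) (g w) (h w)) \<in> borel_measurable M"
  unfolding kap_def by measurable

text \<open>For fixed \<open>l\<close> the substitution of the frequency
  \<open>transpose (Bm l) *v x\<close> for \<open>x\<close> has the Jacobian
  \<open>|det (Bm l)|\<close>. This is where the Plancherel density comes from.\<close>

lemma nn_integral_kap:
  assumes [measurable]: "H \<in> borel_measurable borel"
  shows "(\<integral>\<^sup>+l. \<integral>\<^sup>+x. nn2 lborel (kap H l x) \<partial>lborel \<partial>mu) = nn2 lborel H"
proof -
  define J where "J = (\<lambda>p. \<integral>\<^sup>+t. ennreal ((cmod (H (p, t)))\<^sup>2) \<partial>lborel)"
  have [measurable]: "J \<in> borel_measurable borel"
    unfolding J_def by measurable
  have nk: "nn2 lborel (kap H l x) = J (l, transpose (Bm l) *v x)" for l x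
    unfolding nn2_def kap_def J_def
    by (rule nn_integral_reflect[where f = "\<lambda>t. ennreal ((cmod (H ((l, transpose (Bm l) *v x), t)))\<^sup>2)"]) measurable
  have "(\<integral>\<^sup>+l. \<integral>\<^sup>+x. nn2 lborel (kap H l x) \<partial>lborel \<partial>mu) =
     (\<integral>\<^sup>+l. ennreal \<bar>det (Bm l)\<bar> * (\<integral>\<^sup>+x. J (l, transpose (Bm l) *v x) \<partial>lborel) \<partial>lborel)"
    unfolding nk by (intro nn_integral_mu measurable_mu_borel) measurable
  also have "\<dots> = (\<integral>\<^sup>+l. \<integral>\<^sup>+\<eta>. J (l, \<eta>) \<partial>lborel \<partial>lborel)"
  proof (rule nn_integral_cong_AE)
    show "AE l in lborel. ennreal \<bar>det (Bm l)\<bar> * (\<integral>\<^sup>+x. J (l, transpose (Bm l) *v x) \<partial>lborel) = (\<integral>\<^sup>+\<eta>. J (l, \<eta>) \<partial>lborel)"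
      using AE_sig
    proof eventually_elim
      case (elim l)
      show ?case
        using elim nn_integral_linear[of "(*v) (transpose (Bm l))" "\<lambda>\<eta>. J (l, \<eta>)"]
        by (simp add: det_transpose sig_def)
    qed
  qed
  also have "\<dots> = (\<integral>\<^sup>+p. J p \<partial>lborel)"
    by (rule nn_integral_lborel_pair(1)[symmetric]) measurable
  also have "\<dots> = nn2 lborel H"
    unfolding J_def nn2_def by (rule nn_integral_lborel_pair(1)[symmetric]) measurable
  finally show ?thesis .
qed

end

section \<open>Borel structure on products and sums over index pairs\<close>

lemma fst_borel [measurable]: "fst \<in> borel_measurable borel"
  by (intro borel_measurable_continuous_onI continuous_intros)

lemma snd_borel [measurable]: "snd \<in> borel_measurable borel"
  by (intro borel_measurable_continuous_onI continuous_intros)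

text \<open>Continuity arguments yield Borel measurability on the product space, whereas integration
  over one variable expects the product sigma-algebra; for Euclidean spaces the two
  coincide.\<close>

lemma borel_measurable_pairD:
  fixes f :: "'a::euclidean_space \<Rightarrow> 'b::euclidean_space \<Rightarrow> 'c::topological_space"
  assumes "(\<lambda>p. f (fst p) (snd p)) \<in> borel_measurable borel"
  shows "(\<lambda>(x, y). f x y) \<in> borel_measurable (borel \<Otimes>\<^sub>M lborel)"
proof -
  have "sets ((borel :: 'a measure) \<Otimes>\<^sub>M (lborel :: 'b measure)) = sets (borel \<Otimes>\<^sub>M borel)"
    by (intro sets_pair_measure_cong) auto
  then have "sets ((borel :: 'a measure) \<Otimes>\<^sub>M (lborel :: 'b measure)) = sets borel"
    by (simp only: borel_prod)
  then have "borel_measurable ((borel :: 'a measure) \<Otimes>\<^sub>M (lborel :: 'b measure)) = (borel_measurable borel :: ('a \<times> 'b \<Rightarrow> 'c) set)"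
    by (intro measurable_cong_sets) auto
  then show ?thesis using assms by (simp add: case_prod_unfold)
qed

lemma nn_integral_count_nat_pair:
  "(\<integral>\<^sup>+p. f p \<partial>count_space (UNIV :: (nat \<times> nat) set)) = (\<Sum>i. \<Sum>j. f (i, j))"
proof -
  have c: "count_space (UNIV :: (nat \<times> nat) set) = count_space UNIV \<Otimes>\<^sub>M count_space UNIV"
    by (subst pair_measure_countable) auto
  have s: "sigma_finite_measure (count_space (UNIV :: nat set))"
    by (rule sigma_finite_measure_count_space_countable) simp
  have f: "f \<in> borel_measurable (count_space UNIV \<Otimes>\<^sub>M count_space UNIV)"
    by (simp flip: c)
  show ?thesis
    unfolding c sigma_finite_measure.nn_integral_fst[OF s f, symmetric] by (simp add: nn_integral_count_space_nat)
qed

lemma hs_norm2_entries: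
  assumes "\<And>i. T (hs_basis i) \<in> L2 lborel"
  shows "hs_norm2 lborel T = (\<integral>\<^sup>+p. ennreal ((cmod (L2_inner lborel (T (hs_basis (fst p))) (hs_basis (snd p))))\<^sup>2) \<partial>count_space UNIV)"
  unfolding nn_integral_count_nat_pair
  by (subst hs_norm2_eq) (auto simp: assms orthonormal_basis_nn2[OF hs_basis])

lemma AE_lborel_snd:
  assumes "AE t in lborel. P t"
  shows "AE p in (lborel :: ('a::euclidean_space \<times> 'b::euclidean_space) measure). P (snd p)"
proof -
  obtain N where N: "{t. \<not> P t} \<subseteq> N" "N \<in> null_sets lborel"
    using assms by (auto simp: eventually_ae_filter)
  then have [measurable]: "N \<in> sets borel" by auto
  have "(\<integral>\<^sup>+p. indicator N (snd p) \<partial>(lborel :: ('a \<times> 'b) measure)) = 0"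
    using N by (subst nn_integral_lborel_pair(1)) auto
  then have "AE p in (lborel :: ('a \<times> 'b) measure). indicator N (snd p) = (0::ennreal)"
    by (subst (asm) nn_integral_0_iff_AE) auto
  then show ?thesis by eventually_elim (use N in \<open>auto simp: indicator_def split: if_splits\<close>)
qed

lemma L2_norm_eqI:
  assumes "f \<in> borel_measurable M" "g \<in> borel_measurable N" "nn2 M f = nn2 N g"
  shows "L2_norm M f = L2_norm N g"
proof -
  have "(L2_norm M f)\<^sup>2 = (L2_norm N g)\<^sup>2" using assms by (simp add: L2_norm_nn2)
  then show ?thesis by simp
qed

lemma kap_add_scale_op:
  assumes "\<kappa>1 x \<in> L2 lborel" "\<kappa>2 x \<in> L2 lborel" "h \<in> L2 lborel"
  shows "kop (\<lambda>x s. \<kappa>1 x s + c * \<kappa>2 x s) h x = kop \<kappa>1 h x + c * kop \<kappa>2 h x"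
proof -
  have "integrable lborel (\<lambda>s. \<kappa>1 x s * h s)" "integrable lborel (\<lambda>s. \<kappa>2 x s * h s)"
    using assms by (auto intro: L2_integrable_mult')
  then show ?thesis
    by (simp add: kop_def distrib_right mult.assoc)
qed

context weil_coords
begin

lemma kap_fin:
  assumes H: "H \<in> L2 lborel"
  shows "AE l in mu. (\<integral>\<^sup>+x. nn2 lborel (kap H l x) \<partial>lborel) < \<infinity>"
proof -
  have [measurable]: "H \<in> borel_measurable borel" using L2_measurable[OF H] by simp
  have "(\<integral>\<^sup>+l. \<integral>\<^sup>+x. nn2 lborel (kap H l x) \<partial>lborel \<partial>mu) \<noteq> \<infinity>"
    using H by (subst nn_integral_kap) (auto simp: L2_iff)
  moreover have "(\<lambda>l. \<integral>\<^sup>+x. nn2 lborel (kap H l x) \<partial>lborel) \<in> borel_measurable mu"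
    unfolding nn2_def by (rule measurable_mu_borel) measurable
  ultimately have "AE l in mu. (\<integral>\<^sup>+x. nn2 lborel (kap H l x) \<partial>lborel) \<noteq> \<infinity>"
    by (intro nn_integral_PInf_AE)
  then show ?thesis by eventually_elim (simp add: less_top)
qed

lemma Opr_hs:
  assumes H: "H \<in> L2 lborel"
  shows "AE l in mu. hs_operator lborel (Opr H l) \<and> hs_norm2 lborel (Opr H l) = (\<integral>\<^sup>+x. nn2 lborel (kap H l x) \<partial>lborel)"
proof -
  have [measurable]: "H \<in> borel_measurable borel" using L2_measurable[OF H] by simp
  show ?thesis using kap_fin[OF H]
    by eventually_elim (simp add: Opr_def hs_operator_kop hs_norm2_kop kap_measurable)
qed

lemma measurable_field_Opr:
  assumes [measurable]: "H \<in> borel_measurable borel"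
  shows "measurable_field mu (Opr H)"
  unfolding measurable_field_def
proof (intro ballI)
  fix u v :: "real^'d \<Rightarrow> complex" assume "u \<in> L2 lborel" "v \<in> L2 lborel"
  then have [measurable]: "u \<in> borel_measurable borel" "v \<in> borel_measurable borel"
    using L2_measurable by fastforce+
  show "(\<lambda>l. L2_inner lborel (Opr H l u) v) \<in> borel_measurable mu"
    unfolding L2_inner_def Opr_def kop_def by (rule measurable_mu_borel) measurable
qed

lemma nn_integral_hs_Opr:
  assumes H: "H \<in> L2 lborel"
  shows "(\<integral>\<^sup>+l. hs_norm2 lborel (Opr H l) \<partial>mu) = nn2 lborel H"
proof -
  have "(\<integral>\<^sup>+l. hs_norm2 lborel (Opr H l) \<partial>mu) = (\<integral>\<^sup>+l. \<integral>\<^sup>+x. nn2 lborel (kap H l x) \<partial>lborel \<partial>mu)"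
    using Opr_hs[OF H] by (intro nn_integral_cong_AE) auto
  then show ?thesis using L2_measurable[OF H] by (simp add: nn_integral_kap)
qed

lemma Opr_direct_integral:
  assumes H: "H \<in> L2 lborel"
  shows "Opr H \<in> direct_integral mu (\<lambda>_. Collect (hs_operator lborel))"
  unfolding direct_integral_def using Opr_hs[OF H] measurable_field_Opr[of H] L2_measurable[OF H] nn_integral_hs_Opr[OF H] H
  by (auto simp: L2_iff)

text \<open>Additivity in the kernel holds at every \<open>x\<close> whose two kernel rows are
  square-integrable, which is almost every \<open>x\<close> for almost every \<open>l\<close>. The
  exceptional set of \<open>l\<close> does not depend on \<open>h\<close>.\<close>

lemma Opr_lincomb:
  assumes H: "H1 \<in> L2 lborel" "H2 \<in> L2 lborel"
  shows "AE l in mu. \<forall>h\<in>L2 lborel. AE x in lborel. Opr (\<lambda>p. H1 p + c * H2 p) l h x = Opr H1 l h x + c * Opr H2 l h x"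
  using kap_fin[OF H(1)] kap_fin[OF H(2)]
proof eventually_elim
  case (elim l)
  have [measurable]: "H1 \<in> borel_measurable borel" "H2 \<in> borel_measurable borel"
    using L2_measurable[OF H(1)] L2_measurable[OF H(2)] by auto
  have k: "kap (\<lambda>p. H1 p + c * H2 p) l = (\<lambda>x s. kap H1 l x s + c * kap H2 l x s)" by (simp add: kap_def fun_eq_iff)
  show ?case
  proof
    fix h :: "real^'d \<Rightarrow> complex" assume h: "h \<in> L2 lborel"
    have "AE x in lborel. kap H1 l x \<in> L2 lborel" "AE x in lborel. kap H2 l x \<in> L2 lborel"
      using elim by (auto intro!: kernel_AE_L2 kap_measurable)
    then show "AE x in lborel. Opr (\<lambda>p. H1 p + c * H2 p) l h x = Opr H1 l h x + c * Opr H2 l h x"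
      by eventually_elim (simp add: Opr_def k kap_add_scale_op h)
  qed
qed

subsection \<open>Matrix entries\<close>

text \<open>
  An operator field is encoded by its matrix entries with respect to the fixed orthonormal basis, as
  a function on the product of a counting measure and the Plancherel measure. This makes the direct
  integral a concrete \<open>L\<^sup>2\<close> space without choosing jointly measurable kernels.
\<close>

definition Mp :: "((nat \<times> nat) \<times> (real^'k)) measure" where
  "Mp = count_space UNIV \<Otimes>\<^sub>M mu"

definition mat :: "(real^'k \<Rightarrow> (real^'d) operator) \<Rightarrow> (nat \<times> nat) \<times> (real^'k) \<Rightarrow> complex" where
  "mat \<Phi> p = L2_inner lborel (\<Phi> (snd p) (hs_basis (fst (fst p)))) (hs_basis (snd (fst p)))"

lemma pair_sigma_finite_Mp: "pair_sigma_finite (count_space (UNIV :: (nat \<times> nat) set)) mu"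
  by (intro pair_sigma_finite.intro sigma_finite_mu sigma_finite_measure_count_space_countable) simp

lemma Mp_measurable:
  assumes "\<And>ij. (\<lambda>l. m (ij, l)) \<in> borel_measurable mu"
  shows "m \<in> borel_measurable Mp"
  unfolding Mp_def by (rule measurable_pair_measure_countable1) (auto simp: assms)

lemma mat_measurable:
  assumes "measurable_field mu \<Phi>"
  shows "mat \<Phi> \<in> borel_measurable Mp"
  by (rule Mp_measurable) (use assms in \<open>simp add: mat_def measurable_field_def\<close>)

lemma nn_integral_Mp:
  assumes "m \<in> borel_measurable Mp"
  shows "(\<integral>\<^sup>+p. m p \<partial>Mp) = (\<integral>\<^sup>+l. \<integral>\<^sup>+ij. m (ij, l) \<partial>count_space UNIV \<partial>mu)"
  using pair_sigma_finite.nn_integral_snd[OF pair_sigma_finite_Mp, of m] assms by (simp add: Mp_def)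

lemma nn2_mat:
  assumes "measurable_field mu \<Phi>" "AE l in mu. \<forall>i. \<Phi> l (hs_basis i) \<in> L2 lborel"
  shows "nn2 Mp (mat \<Phi>) = (\<integral>\<^sup>+l. hs_norm2 lborel (\<Phi> l) \<partial>mu)"
proof -
  have "nn2 Mp (mat \<Phi>) = (\<integral>\<^sup>+l. \<integral>\<^sup>+ij. ennreal ((cmod (mat \<Phi> (ij, l)))\<^sup>2) \<partial>count_space UNIV \<partial>mu)"
    unfolding nn2_def using mat_measurable[OF assms(1)] by (intro nn_integral_Mp) measurable
  also have "\<dots> = (\<integral>\<^sup>+l. hs_norm2 lborel (\<Phi> l) \<partial>mu)"
  proof (rule nn_integral_cong_AE)
    show "AE l in mu. (\<integral>\<^sup>+ij. ennreal ((cmod (mat \<Phi> (ij, l)))\<^sup>2) \<partial>count_space UNIV) = hs_norm2 lborel (\<Phi> l)"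
      using assms(2) by eventually_elim (simp add: hs_norm2_entries mat_def)
  qed
  finally show ?thesis .
qed

lemma direct_integralD:
  assumes "\<Phi> \<in> direct_integral mu (\<lambda>_. Collect (hs_operator lborel))"
  shows "measurable_field mu \<Phi>" "AE l in mu. hs_operator lborel (\<Phi> l)"
    "AE l in mu. \<forall>i. \<Phi> l (hs_basis i) \<in> L2 lborel" "mat \<Phi> \<in> L2 Mp"
proof -
  show m: "measurable_field mu \<Phi>" and h: "AE l in mu. hs_operator lborel (\<Phi> l)"
    using assms by (auto simp: direct_integral_def)
  show e: "AE l in mu. \<forall>i. \<Phi> l (hs_basis i) \<in> L2 lborel"
    using h by eventually_elim (auto simp: hs_operator_def intro: bounded_operatorD(1))
  show "mat \<Phi> \<in> L2 Mp"
    using mat_measurable[OF m] assms by (simp add: L2_iff nn2_mat[OF m e] direct_integral_def)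
qed

text \<open>The entries of the combined field are the combinations of the entries, almost
  everywhere. The norm is computed for every \<open>c\<close> because this is the form that
  polarization takes as input.\<close>

lemma mat_Opr_lincomb:
  assumes H: "H1 \<in> L2 lborel" "H2 \<in> L2 lborel"
  shows "nn2 Mp (\<lambda>p. mat (Opr H1) p + c * mat (Opr H2) p) = nn2 lborel (\<lambda>p. H1 p + c * H2 p)"
proof -
  have HL: "(\<lambda>p. H1 p + c * H2 p) \<in> L2 lborel" using H by simp
  note m = measurable_field_Opr[OF L2_measurable[OF H(1), simplified]] measurable_field_Opr[OF L2_measurable[OF H(2), simplified]]
    measurable_field_Opr[OF L2_measurable[OF HL, simplified]]
  note mm = mat_measurable[OF m(1)] mat_measurable[OF m(2)] mat_measurable[OF m(3)]
  have [measurable]: "mat (Opr H1) \<in> borel_measurable Mp" "mat (Opr H2) \<in> borel_measurable Mp" by (fact mm)+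
  have "nn2 Mp (\<lambda>p. mat (Opr H1) p + c * mat (Opr H2) p) =
      (\<integral>\<^sup>+l. \<integral>\<^sup>+ij. ennreal ((cmod (mat (Opr H1) (ij, l) + c * mat (Opr H2) (ij, l)))\<^sup>2) \<partial>count_space UNIV \<partial>mu)"
    unfolding nn2_def by (intro nn_integral_Mp) measurable
  also have "\<dots> = (\<integral>\<^sup>+l. hs_norm2 lborel (Opr (\<lambda>p. H1 p + c * H2 p) l) \<partial>mu)"
  proof (rule nn_integral_cong_AE)
    show "AE l in mu. (\<integral>\<^sup>+ij. ennreal ((cmod (mat (Opr H1) (ij, l) + c * mat (Opr H2) (ij, l)))\<^sup>2) \<partial>count_space UNIV)
        = hs_norm2 lborel (Opr (\<lambda>p. H1 p + c * H2 p) l)"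
      using Opr_hs[OF H(1)] Opr_hs[OF H(2)] Opr_hs[OF HL] Opr_lincomb[OF H, of c]
    proof eventually_elim
      case (elim l)
      then have L: "Opr H1 l (hs_basis i) \<in> L2 lborel" "Opr H2 l (hs_basis i) \<in> L2 lborel"
        "Opr (\<lambda>p. H1 p + c * H2 p) l (hs_basis i) \<in> L2 lborel" for i
        by (auto simp: hs_operator_def intro: bounded_operatorD(1))
      have "mat (Opr H1) (ij, l) + c * mat (Opr H2) (ij, l) = mat (Opr (\<lambda>p. H1 p + c * H2 p)) (ij, l)" for ij
      proof -
        obtain i j where ij: "ij = (i, j)" by (cases ij)
        have "L2_inner lborel (Opr (\<lambda>p. H1 p + c * H2 p) l (hs_basis i)) (hs_basis j) =
            L2_inner lborel (\<lambda>x. Opr H1 l (hs_basis i) x + c * Opr H2 l (hs_basis i) x) (hs_basis j)"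
          using elim(4) L2_measurable[OF L(3)[of i]] L2_measurable[OF L2_add[OF L(1)[of i] L2_scale[OF L(2)[of i], of c]]]
          by (intro L2_inner_cong_AE) auto
        then show ?thesis
          using L(1,2)[of i] by (simp add: mat_def ij L2_inner_add_left L2_inner_scale_left)
      qed
      then show ?case using hs_norm2_entries[where T = "Opr (\<lambda>p. H1 p + c * H2 p) l", OF L(3)] by (simp add: mat_def)
    qed
  qed
  also have "\<dots> = nn2 lborel (\<lambda>p. H1 p + c * H2 p)" by (rule nn_integral_hs_Opr[OF HL])
  finally show ?thesis .
qed

lemma mat_Opr_L2: "H \<in> L2 lborel \<Longrightarrow> mat (Opr H) \<in> L2 Mp"
  by (intro direct_integralD(4) Opr_direct_integral)

lemma mat_Opr_norm:
  assumes H: "H1 \<in> L2 lborel" "H2 \<in> L2 lborel"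
  shows "L2_norm Mp (\<lambda>p. mat (Opr H1) p + c * mat (Opr H2) p) = L2_norm lborel (\<lambda>p. H1 p + c * H2 p)"
  by (rule L2_norm_eqI[OF _ _ mat_Opr_lincomb[OF H]])
     (auto intro!: L2_measurable[OF L2_add[OF mat_Opr_L2[OF H(1)] L2_scale[OF mat_Opr_L2[OF H(2)]]]]
       L2_measurable[OF L2_add[OF H(1) L2_scale[OF H(2)]], simplified])

lemma mat_Opr_inner:
  assumes H: "H1 \<in> L2 lborel" "H2 \<in> L2 lborel"
  shows "L2_inner Mp (mat (Opr H1)) (mat (Opr H2)) = L2_inner lborel H1 H2"
  by (rule L2_polarization) (auto simp: H mat_Opr_L2 mat_Opr_norm)

subsection \<open>The partial Fourier transform\<close>

text \<open>The variables \<open>z\<close> and \<open>y\<close> are treated as one Euclidean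
  variable, so that one Fourier transform handles both, and \<open>t\<close> remains a parameter.
  The product type is reassociated to match the argument of \<open>kap\<close>.\<close>

definition hat :: "((real^'k) \<times> (real^'d) \<times> (real^'d) \<Rightarrow> complex) \<Rightarrow> ((real^'k) \<times> (real^'d)) \<times> (real^'d) \<Rightarrow> complex" where
  "hat G p = ft (\<lambda>q. G (fst q, snd q, snd p)) (fst p)"

lemma nn_integral_assoc:
  fixes F :: "(real^'k) \<times> (real^'d) \<times> (real^'d) \<Rightarrow> ennreal"
  assumes [measurable]: "F \<in> borel_measurable borel"
  shows "(\<integral>\<^sup>+w. F w \<partial>lborel) = (\<integral>\<^sup>+t. \<integral>\<^sup>+q. F (fst q, snd q, t) \<partial>lborel \<partial>lborel)"
proof -
  have m: "(\<lambda>(q, t). F (fst q, snd q, t)) \<in> borel_measurable (borel \<Otimes>\<^sub>M lborel)"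
    by (rule borel_measurable_pairD) measurable
  have m': "(\<lambda>q. \<integral>\<^sup>+t. F (fst q, snd q, t) \<partial>lborel) \<in> borel_measurable borel"
    using lborel.borel_measurable_nn_integral[OF m] by simp
  have "(\<integral>\<^sup>+w. F w \<partial>lborel) = (\<integral>\<^sup>+z. \<integral>\<^sup>+y. \<integral>\<^sup>+t. F (z, y, t) \<partial>lborel \<partial>lborel \<partial>lborel)"
    by (subst nn_integral_lborel_pair(1), measurable, intro nn_integral_cong, subst nn_integral_lborel_pair(1)) auto
  also have "\<dots> = (\<integral>\<^sup>+q. \<integral>\<^sup>+t. F (fst q, snd q, t) \<partial>lborel \<partial>lborel)"
    by (subst nn_integral_lborel_pair(1)[OF m']) simp
  also have "\<dots> = (\<integral>\<^sup>+t. \<integral>\<^sup>+q. F (fst q, snd q, t) \<partial>lborel \<partial>lborel)"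
    by (rule lborel_pair.Fubini'[symmetric]) (use m in simp)
  finally show ?thesis .
qed

lemma lborel_assoc:
  "distr lborel borel (\<lambda>p. (fst (fst p), snd (fst p), snd p)) = (lborel :: ((real^'k) \<times> (real^'d) \<times> (real^'d)) measure)"
proof (rule measure_eqI)
  let ?a = "\<lambda>p :: ((real^'k) \<times> (real^'d)) \<times> (real^'d). (fst (fst p), snd (fst p), snd p)"
  fix A assume "A \<in> sets (distr lborel borel ?a)"
  then have [measurable]: "A \<in> sets borel" by simp
  have "emeasure (distr lborel borel ?a) A = (\<integral>\<^sup>+p. indicator A p \<partial>distr lborel borel ?a)" by simp
  also have "\<dots> = (\<integral>\<^sup>+p. indicator A (?a p) \<partial>lborel)" by (rule nn_integral_distr) measurable
  also have "\<dots> = (\<integral>\<^sup>+t. \<integral>\<^sup>+q. indicator A (fst q, snd q, t) \<partial>lborel \<partial>lborel)"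
  proof -
    have "(\<lambda>p. indicator A (?a p) :: ennreal) \<in> borel_measurable borel" by measurable
    from nn_integral_lborel_pair(2)[OF this] show ?thesis by simp
  qed
  also have "\<dots> = (\<integral>\<^sup>+w. indicator A w \<partial>lborel)" by (rule nn_integral_assoc[symmetric]) measurable
  finally show "emeasure (distr lborel borel ?a) A = emeasure lborel A" by simp
qed simp

lemma integral_assoc:
  fixes F :: "(real^'k) \<times> (real^'d) \<times> (real^'d) \<Rightarrow> complex"
  assumes F: "integrable lborel F"
  shows "(LINT w|lborel. F w) = (LINT t|lborel. LINT q|lborel. F (fst q, snd q, t))"
proof -
  have [measurable]: "F \<in> borel_measurable borel" using borel_measurable_integrable[OF F] by simp
  let ?a = "\<lambda>p :: ((real^'k) \<times> (real^'d)) \<times> (real^'d). (fst (fst p), snd (fst p), snd p)"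
  have "integrable (distr lborel borel ?a) F" using F by (simp add: lborel_assoc)
  then have i: "integrable lborel (\<lambda>p. F (?a p))"
    by (subst (asm) integrable_distr_eq) auto
  have "(LINT w|lborel. F w) = (LINT p|lborel. F (?a p))"
    using integral_distr[of ?a lborel borel F] by (simp add: lborel_assoc)
  also have "\<dots> = (LINT t|lborel. LINT q|lborel. F (fst q, snd q, t))"
    using lborel_pair.integral_snd[of "\<lambda>q t. F (fst q, snd q, t)"] i by (simp add: lborel_prod case_prod_unfold)
  finally show ?thesis .
qed

lemma hat_measurable [measurable]:
  assumes [measurable]: "G \<in> borel_measurable borel"
  shows "hat G \<in> borel_measurable borel"
proof -
  have "(\<lambda>r. (fst (snd r), snd (snd r), snd (fst r))) \<in> borel_measurable borel"
    by (intro borel_measurable_continuous_onI continuous_intros)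
  then have [measurable]: "(\<lambda>r. G (fst (snd r), snd (snd r), snd (fst r))) \<in> borel_measurable borel"
    by measurable
  have "(\<lambda>(p, q). G (fst q, snd q, snd p) * fchar (fst p) q) \<in> borel_measurable (borel \<Otimes>\<^sub>M lborel)"
    by (rule borel_measurable_pairD) measurable
  from lborel.borel_measurable_lebesgue_integral[OF this] show ?thesis
    unfolding hat_def[abs_def] ft_def by simp
qed

lemma slice_AE:
  fixes G :: "(real^'k) \<times> (real^'d) \<times> (real^'d) \<Rightarrow> complex"
  assumes G: "integrable lborel G"
  shows "AE t in lborel. integrable lborel (\<lambda>q. G (fst q, snd q, t))"
proof -
  have [measurable]: "G \<in> borel_measurable borel" using borel_measurable_integrable[OF G] by simp
  have "(\<integral>\<^sup>+t. \<integral>\<^sup>+q. ennreal (cmod (G (fst q, snd q, t))) \<partial>lborel \<partial>lborel) \<noteq> \<infinity>"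
    using G nn_integral_assoc[of "\<lambda>w. ennreal (cmod (G w))"] by (auto simp: integrable_iff_bounded)
  then have "AE t in lborel. (\<integral>\<^sup>+q. ennreal (cmod (G (fst q, snd q, t))) \<partial>lborel) \<noteq> \<infinity>"
    by (intro nn_integral_PInf_AE) measurable
  then show ?thesis by eventually_elim (auto simp: integrable_iff_bounded less_top)
qed

lemma slice_AE_L2:
  fixes G :: "(real^'k) \<times> (real^'d) \<times> (real^'d) \<Rightarrow> complex"
  assumes G: "G \<in> L2 lborel"
  shows "AE t in lborel. (\<lambda>q. G (fst q, snd q, t)) \<in> L2 lborel"
proof -
  have [measurable]: "G \<in> borel_measurable borel" using L2_measurable[OF G] by simp
  have "(\<integral>\<^sup>+t. \<integral>\<^sup>+q. ennreal ((cmod (G (fst q, snd q, t)))\<^sup>2) \<partial>lborel \<partial>lborel) \<noteq> \<infinity>"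
    using G nn_integral_assoc[of "\<lambda>w. ennreal ((cmod (G w))\<^sup>2)"] by (auto simp: L2_iff nn2_def)
  then have "AE t in lborel. (\<integral>\<^sup>+q. ennreal ((cmod (G (fst q, snd q, t)))\<^sup>2) \<partial>lborel) \<noteq> \<infinity>"
    by (intro nn_integral_PInf_AE) measurable
  then show ?thesis by eventually_elim (auto simp: L2_iff nn2_def less_top)
qed

text \<open>Plancherel's theorem on almost every slice of constant \<open>t\<close>, integrated over
  \<open>t\<close>.\<close>

lemma hat_isometry:
  assumes G: "G \<in> L2 lborel" "integrable lborel G"
  shows "nn2 lborel (hat G) = nn2 lborel G" "hat G \<in> L2 lborel"
proof -
  have [measurable]: "G \<in> borel_measurable borel" using L2_measurable[OF G(1)] by simp
  have "nn2 lborel (hat G) = (\<integral>\<^sup>+t. nn2 lborel (ft (\<lambda>q. G (fst q, snd q, t))) \<partial>lborel)"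
    unfolding nn2_def by (subst nn_integral_lborel_pair(2)) (measurable, simp add: hat_def)
  also have "\<dots> = (\<integral>\<^sup>+t. nn2 lborel (\<lambda>q. G (fst q, snd q, t)) \<partial>lborel)"
  proof (rule nn_integral_cong_AE)
    show "AE t in lborel. nn2 lborel (ft (\<lambda>q. G (fst q, snd q, t))) = nn2 lborel (\<lambda>q. G (fst q, snd q, t))"
      using slice_AE[OF G(2)] slice_AE_L2[OF G(1)] by eventually_elim (rule ft_isometry)
  qed
  also have "\<dots> = nn2 lborel G"
    unfolding nn2_def by (rule nn_integral_assoc[symmetric]) measurable
  finally show *: "nn2 lborel (hat G) = nn2 lborel G" .
  show "hat G \<in> L2 lborel" using G by (simp add: L2_iff *)
qed

lemma hat_lincomb:
  assumes G: "integrable lborel G1" "integrable lborel G2"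
  shows "AE p in lborel. hat (\<lambda>w. G1 w + c * G2 w) p = hat G1 p + c * hat G2 p"
proof -
  have "AE t in lborel. integrable lborel (\<lambda>q. G1 (fst q, snd q, t)) \<and> integrable lborel (\<lambda>q. G2 (fst q, snd q, t))"
    using slice_AE[OF G(1)] slice_AE[OF G(2)] by eventually_elim simp
  from AE_lborel_snd[OF this]
  have "AE p in (lborel :: (((real^'k) \<times> (real^'d)) \<times> (real^'d)) measure).
     integrable lborel (\<lambda>q. G1 (fst q, snd q, snd p)) \<and> integrable lborel (\<lambda>q. G2 (fst q, snd q, snd p))" .
  then show ?thesis
  proof eventually_elim
    case (elim p)
    then have "integrable lborel (\<lambda>q. G1 (fst q, snd q, snd p) * fchar (fst p) q)"
      "integrable lborel (\<lambda>q. G2 (fst q, snd q, snd p) * fchar (fst p) q)"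
      by (auto intro: integrable_fchar)
    then show ?case by (simp add: hat_def ft_def distrib_right mult.assoc)
  qed
qed

lemma hat_norm:
  assumes G1: "G1 \<in> L2 lborel" "integrable lborel G1" and G2: "G2 \<in> L2 lborel" "integrable lborel G2"
  shows "L2_norm lborel (\<lambda>p. hat G1 p + c * hat G2 p) = L2_norm lborel (\<lambda>w. G1 w + c * G2 w)"
proof (rule L2_norm_eqI)
  have G: "(\<lambda>w. G1 w + c * G2 w) \<in> L2 lborel" "integrable lborel (\<lambda>w. G1 w + c * G2 w)"
    using G1 G2 by auto
  have "nn2 lborel (\<lambda>p. hat G1 p + c * hat G2 p) = nn2 lborel (hat (\<lambda>w. G1 w + c * G2 w))"
    by (rule nn2_cong_AE) (use hat_lincomb[OF G1(2) G2(2), of c] in \<open>auto elim: AE_mp\<close>)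
  then show "nn2 lborel (\<lambda>p. hat G1 p + c * hat G2 p) = nn2 lborel (\<lambda>w. G1 w + c * G2 w)"
    using hat_isometry(1)[OF G] by simp
  show "(\<lambda>w. G1 w + c * G2 w) \<in> borel_measurable lborel" by (rule L2_measurable[OF G(1)])
  show "(\<lambda>p. hat G1 p + c * hat G2 p) \<in> borel_measurable lborel"
    using L2_measurable[OF L2_add[OF hat_isometry(2)[OF G1] L2_scale[OF hat_isometry(2)[OF G2]]]] .
qed

lemma hat_inner:
  assumes G1: "G1 \<in> L2 lborel" "integrable lborel G1" and G2: "G2 \<in> L2 lborel" "integrable lborel G2"
  shows "L2_inner lborel (hat G1) (hat G2) = L2_inner lborel G1 G2"
  by (rule L2_polarization) (auto simp: G1 G2 hat_isometry hat_norm)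

end

lemma L2_integrable_finite:
  assumes f: "f \<in> L2 M" and A: "A \<in> sets M" "emeasure M A < \<infinity>"
  shows "integrable M (\<lambda>x. f x * indicator A x)"
proof -
  have "nn2 M (indicator A) = emeasure M A"
    using A by (simp add: nn2_def indicator_def ennreal_indicator[symmetric] flip: nn_integral_indicator)
       (rule nn_integral_cong, auto)
  then have "(indicator A :: _ \<Rightarrow> complex) \<in> L2 M" using A by (simp add: L2_iff)
  from L2_integrable_mult'[OF f this] show ?thesis .
qed

context weil_coords
begin

section \<open>The Plancherel transform in coordinates\<close>

definition rep :: "real^'k \<Rightarrow> (real^'k) \<times> (real^'d) \<times> (real^'d) \<Rightarrow> (real^'d) operator" where
  "rep l w F = (case w of (z, y, t) \<Rightarrow>
     (\<lambda>x. cis (2 * pi * (l \<bullet> z)) * cis (2 * pi * (x \<bullet> (Bm l *v y))) * F (x - t)))"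

definition ir :: "((real^'k) \<times> (real^'d) \<times> (real^'d) \<Rightarrow> complex) \<Rightarrow> real^'k \<Rightarrow> (real^'d) operator" where
  "ir G l F = (\<lambda>x. LINT w|lborel. G w * rep l w F x)"

lemma rep_eq: "rep l w F x = fchar (l, transpose (Bm l) *v x) (fst w, fst (snd w)) * F (x - snd (snd w))"
  by (simp add: rep_def case_prod_unfold fchar_def cis_mult inner_matrix_transpose distrib_left)

lemma rep_joint_measurable:
  assumes [measurable]: "G \<in> borel_measurable borel" "h \<in> borel_measurable borel"
  shows "(\<lambda>(x, w). G w * rep l w h x) \<in> borel_measurable (borel \<Otimes>\<^sub>M lborel)"
proof (rule borel_measurable_pairD)
  have [measurable]: "(\<lambda>p::(real^'d) \<times> (real^'k) \<times> (real^'d) \<times> (real^'d). (fst (snd p), fst (snd (snd p)))) \<in> borel_measurable borel"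
    "(\<lambda>p::(real^'d) \<times> (real^'k) \<times> (real^'d) \<times> (real^'d). fst p - snd (snd (snd p))) \<in> borel_measurable borel"
    by (intro borel_measurable_continuous_onI continuous_intros)+
  have [measurable]: "(\<lambda>p::(real^'d) \<times> (real^'k) \<times> (real^'d) \<times> (real^'d). (l, transpose (Bm l) *v fst p)) \<in> borel_measurable borel"
    by measurable
  have [measurable]: "(\<lambda>p::(real^'d) \<times> (real^'k) \<times> (real^'d) \<times> (real^'d). h (fst p - snd (snd (snd p)))) \<in> borel_measurable borel"
    by measurable
  show "(\<lambda>p. G (snd p) * rep l (snd p) h (fst p)) \<in> borel_measurable borel"
    unfolding rep_eq by measurable
qed

lemma ir_measurable:
  assumes "G \<in> borel_measurable borel" "h \<in> borel_measurable borel"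
  shows "ir G l h \<in> borel_measurable borel"
  unfolding ir_def using lborel.borel_measurable_lebesgue_integral[OF rep_joint_measurable[OF assms]] by simp

text \<open>Since \<open>c \<le> 1 + c^2\<close>, the integrand is dominated by \<open>|G|\<close>
  plus \<open>|G|\<close> times the square of the translated \<open>|h|\<close>. The integral of the
  second term over \<open>x\<close> and \<open>w\<close> is the \<open>L1\<close> norm of
  \<open>G\<close> times the squared norm of \<open>h\<close>, so for almost every \<open>x\<close>
  the integral over \<open>w\<close> is finite.\<close>

lemma rep_integrable_AE:
  assumes G: "integrable lborel G" and h: "h \<in> L2 lborel"
  shows "AE x in lborel. integrable lborel (\<lambda>w. G w * rep l w h x)"
proof -
  have [measurable]: "G \<in> borel_measurable borel" "h \<in> borel_measurable borel"
    using borel_measurable_integrable[OF G] L2_measurable[OF h] by auto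
  note m = rep_joint_measurable[OF \<open>G \<in> borel_measurable borel\<close> \<open>h \<in> borel_measurable borel\<close>, of l]
  define N where "N = (\<lambda>x w. ennreal (cmod (G w) * (cmod (h (x - snd (snd w))))\<^sup>2))"
  have "(\<lambda>p. N (fst p) (snd p)) \<in> borel_measurable borel"
  proof -
    have [measurable]: "(\<lambda>p::(real^'d) \<times> (real^'k) \<times> (real^'d) \<times> (real^'d). fst p - snd (snd (snd p))) \<in> borel_measurable borel"
      by (intro borel_measurable_continuous_onI continuous_intros)
    have [measurable]: "(\<lambda>p::(real^'d) \<times> (real^'k) \<times> (real^'d) \<times> (real^'d). h (fst p - snd (snd (snd p)))) \<in> borel_measurable borel"
      by measurable
    show ?thesis unfolding N_def by measurable
  qed
  then have Nm: "(\<lambda>(x, w). N x w) \<in> borel_measurable (borel \<Otimes>\<^sub>M lborel)" by (rule borel_measurable_pairD)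
  have Nm': "(\<lambda>(x, w). N x w) \<in> borel_measurable (lborel \<Otimes>\<^sub>M lborel)"
    using Nm by (simp cong: measurable_cong_sets sets_pair_measure_cong)
  have "(\<integral>\<^sup>+x. \<integral>\<^sup>+w. N x w \<partial>lborel \<partial>lborel) = (\<integral>\<^sup>+w. \<integral>\<^sup>+x. N x w \<partial>lborel \<partial>lborel)"
    by (rule lborel_pair.Fubini'[symmetric]) (rule Nm')
  also have "\<dots> = (\<integral>\<^sup>+w. ennreal (cmod (G w)) * nn2 lborel h \<partial>lborel)"
  proof (rule nn_integral_cong)
    fix w
    have "(\<integral>\<^sup>+x. N x w \<partial>lborel) = ennreal (cmod (G w)) * (\<integral>\<^sup>+x. ennreal ((cmod (h (x + - snd (snd w))))\<^sup>2) \<partial>lborel)"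
      unfolding N_def by (subst nn_integral_cmult[symmetric]) (auto simp: ennreal_mult)
    also have "(\<integral>\<^sup>+x. ennreal ((cmod (h (x + - snd (snd w))))\<^sup>2) \<partial>lborel) = nn2 lborel h"
      unfolding nn2_def by (rule lborel_shift[where f = "\<lambda>x. ennreal ((cmod (h x))\<^sup>2)"]) measurable
    finally show "(\<integral>\<^sup>+x. N x w \<partial>lborel) = ennreal (cmod (G w)) * nn2 lborel h" .
  qed
  also have "\<dots> = (\<integral>\<^sup>+w. ennreal (cmod (G w)) \<partial>lborel) * nn2 lborel h"
    by (rule nn_integral_multc) measurable
  also have "\<dots> < \<infinity>"
    using G h by (simp add: integrable_iff_bounded L2_iff ennreal_mult_less_top)
  finally have fin: "(\<integral>\<^sup>+x. \<integral>\<^sup>+w. N x w \<partial>lborel \<partial>lborel) \<noteq> \<infinity>" by simp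
  have "AE x in lborel. (\<integral>\<^sup>+w. N x w \<partial>lborel) \<noteq> \<infinity>"
    using lborel.borel_measurable_nn_integral[OF Nm] fin by (intro nn_integral_PInf_AE) auto
  then show ?thesis
  proof eventually_elim
    case (elim x)
    have gm: "(\<lambda>w. G w * rep l w h x) \<in> borel_measurable lborel"
      using measurable_Pair2[OF m, of x] by simp
    have nm: "N x \<in> borel_measurable lborel"
      using measurable_Pair2[OF Nm, of x] by simp
    have "(\<integral>\<^sup>+w. ennreal (norm (G w * rep l w h x)) \<partial>lborel) \<le> (\<integral>\<^sup>+w. ennreal (cmod (G w)) + N x w \<partial>lborel)"
    proof (rule nn_integral_mono)
      fix w
      have "cmod (G w) * c \<le> cmod (G w) + cmod (G w) * c\<^sup>2" if "c \<ge> 0" for c :: real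
      proof -
        have "c \<le> 1 + c\<^sup>2" using mult_le_sum_squares[of c 1] that by (simp add: power2_eq_square add.commute)
        then have "cmod (G w) * c \<le> cmod (G w) * (1 + c\<^sup>2)" by (rule mult_left_mono) simp
        then show ?thesis by (simp add: distrib_left)
      qed
      then show "ennreal (norm (G w * rep l w h x)) \<le> ennreal (cmod (G w)) + N x w"
        unfolding N_def rep_eq by (simp add: norm_mult ennreal_leI flip: ennreal_plus)
    qed
    also have "\<dots> = (\<integral>\<^sup>+w. ennreal (cmod (G w)) \<partial>lborel) + (\<integral>\<^sup>+w. N x w \<partial>lborel)"
      by (rule nn_integral_add) (use nm in auto)
    also have "\<dots> < \<infinity>" using elim G by (simp add: integrable_iff_bounded less_top)
    finally show ?case using gm by (simp add: integrable_iff_bounded)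
  qed
qed

text \<open>Integration over \<open>z\<close> and \<open>y\<close> with \<open>t\<close> fixed
  produces the partial Fourier transform at the frequency attached to \<open>x\<close>; the
  reflection \<open>t = x - s\<close> then turns the remaining integral into a kernel
  operator.\<close>

lemma ir_eq_Opr:
  assumes G: "integrable lborel G" and h: "h \<in> L2 lborel"
  shows "AE x in lborel. ir G l h x = Opr (hat G) l h x"
  using rep_integrable_AE[OF G h, of l]
proof eventually_elim
  case (elim x)
  have [measurable]: "G \<in> borel_measurable borel" "h \<in> borel_measurable borel"
    using borel_measurable_integrable[OF G] L2_measurable[OF h] by auto
  let ?\<xi> = "(l, transpose (Bm l) *v x)"
  have "ir G l h x = (LINT t|lborel. LINT q|lborel. G (fst q, snd q, t) * rep l (fst q, snd q, t) h x)"
    unfolding ir_def by (rule integral_assoc[OF elim])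
  also have "\<dots> = (LINT t|lborel. hat G (?\<xi>, t) * h (x - t))"
    unfolding hat_def ft_def rep_eq by (simp flip: mult.assoc)
  also have "\<dots> = (LINT s|lborel. hat G (?\<xi>, x - s) * h (x - (x - s)))"
    by (rule integral_reflect[where f = "\<lambda>t. hat G (?\<xi>, t) * h (x - t)", symmetric]) measurable
  finally show ?case by (simp add: Opr_def kop_def kap_def)
qed

text \<open>The Plancherel relation read in the coordinates \<open>(z, y, t)\<close>, in which Haar
  measure is Lebesgue measure.\<close>

definition isp :: "((real^'k) \<times> (real^'d) \<times> (real^'d) \<Rightarrow> complex) \<Rightarrow> (real^'k \<Rightarrow> (real^'d) operator) \<Rightarrow> bool" where
  "isp f \<Phi> \<longleftrightarrow> f \<in> L2 lborel \<and> \<Phi> \<in> direct_integral mu (\<lambda>_. Collect (hs_operator lborel)) \<and>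
     (\<exists>g :: nat \<Rightarrow> _. (\<forall>k. g k \<in> L2 lborel \<and> integrable lborel (g k)) \<and>
        (\<lambda>k. L2_norm lborel (\<lambda>x. g k x - f x)) \<longlonglongrightarrow> 0 \<and>
        (\<lambda>k. \<integral>\<^sup>+l. hs_norm2 lborel (\<lambda>h x. ir (g k) l h x - \<Phi> l h x) \<partial>mu) \<longlonglongrightarrow> 0)"

text \<open>Turns the convergence required by \<open>isp\<close> into convergence in the concrete
  \<open>L2\<close> space of matrix entries.\<close>

lemma hs_norm2_ir_diff:
  assumes G: "G \<in> L2 lborel" "integrable lborel G"
    and \<Phi>: "\<Phi> \<in> direct_integral mu (\<lambda>_. Collect (hs_operator lborel))"
  shows "(\<integral>\<^sup>+l. hs_norm2 lborel (\<lambda>h x. ir G l h x - \<Phi> l h x) \<partial>mu) = nn2 Mp (\<lambda>p. mat (Opr (hat G)) p - mat \<Phi> p)"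
proof -
  note H = hat_isometry(2)[OF G]
  note D1 = direct_integralD[OF \<Phi>] and D2 = direct_integralD[OF Opr_direct_integral[OF H]]
  note [measurable] = L2_measurable[OF D1(4)] L2_measurable[OF D2(4)]
  have "nn2 Mp (\<lambda>p. mat (Opr (hat G)) p - mat \<Phi> p) =
     (\<integral>\<^sup>+l. \<integral>\<^sup>+ij. ennreal ((cmod (mat (Opr (hat G)) (ij, l) - mat \<Phi> (ij, l)))\<^sup>2) \<partial>count_space UNIV \<partial>mu)"
    unfolding nn2_def by (intro nn_integral_Mp) measurable
  also have "\<dots> = (\<integral>\<^sup>+l. hs_norm2 lborel (\<lambda>h x. ir G l h x - \<Phi> l h x) \<partial>mu)"
  proof (rule nn_integral_cong_AE)
    show "AE l in mu. (\<integral>\<^sup>+ij. ennreal ((cmod (mat (Opr (hat G)) (ij, l) - mat \<Phi> (ij, l)))\<^sup>2) \<partial>count_space UNIV) =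
       hs_norm2 lborel (\<lambda>h x. ir G l h x - \<Phi> l h x)"
      using D1(3) D2(3)
    proof eventually_elim
      case (elim l)
      let ?T = "\<lambda>h x. Opr (hat G) l h x - \<Phi> l h x"
      have T: "?T (hs_basis i) \<in> L2 lborel" for i using elim by simp
      have "hs_norm2 lborel (\<lambda>h x. ir G l h x - \<Phi> l h x) = hs_norm2 lborel ?T"
      proof (rule hs_norm2_cong)
        fix i
        show "AE x in lborel. ir G l (hs_basis i) x - \<Phi> l (hs_basis i) x = ?T (hs_basis i) x"
          using ir_eq_Opr[OF G(2) hs_basis_L2[of i], of l] by eventually_elim simp
        show "?T (hs_basis i) \<in> borel_measurable borel" using L2_measurable[OF T[of i]] by simp
        have "\<Phi> l (hs_basis i) \<in> borel_measurable borel" using elim L2_measurable by fastforce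
        then show "(\<lambda>x. ir G l (hs_basis i) x - \<Phi> l (hs_basis i) x) \<in> borel_measurable borel"
          using ir_measurable[of G "hs_basis i" l] L2_measurable[OF G(1)] by auto
      qed
      also have "\<dots> = (\<integral>\<^sup>+p. ennreal ((cmod (L2_inner lborel (?T (hs_basis (fst p))) (hs_basis (snd p))))\<^sup>2) \<partial>count_space UNIV)"
        by (rule hs_norm2_entries[where T = ?T, OF T])
      also have "\<dots> = (\<integral>\<^sup>+ij. ennreal ((cmod (mat (Opr (hat G)) (ij, l) - mat \<Phi> (ij, l)))\<^sup>2) \<partial>count_space UNIV)"
        using elim by (intro nn_integral_cong) (simp add: mat_def L2_inner_diff_left)
      finally show ?case by simp
    qed
  qed
  finally show ?thesis by simp
qed

text \<open>On integrable \<open>L2\<close> functions the transform is the composition of two maps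
  preserving inner products, the partial Fourier transform and the passage from kernels to matrix
  entries. Both sides of the identity are limits along the approximating sequences.\<close>

lemma isp_inner:
  assumes "isp f1 \<Phi>1" "isp f2 \<Phi>2"
  shows "L2_inner lborel f1 f2 = L2_inner Mp (mat \<Phi>1) (mat \<Phi>2)"
proof -
  have ex: "\<exists>g :: nat \<Rightarrow> _. (\<forall>k. g k \<in> L2 lborel \<and> integrable lborel (g k)) \<and>
        (\<lambda>k. L2_norm lborel (\<lambda>x. g k x - f x)) \<longlonglongrightarrow> 0 \<and>
        (\<lambda>k. L2_norm Mp (\<lambda>p. mat (Opr (hat (g k))) p - mat \<Phi> p)) \<longlonglongrightarrow> 0" if i: "isp f \<Phi>" for f \<Phi>
  proof -
    have \<Phi>: "\<Phi> \<in> direct_integral mu (\<lambda>_. Collect (hs_operator lborel))" using i by (simp add: isp_def)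
    obtain g where g: "\<And>k::nat. g k \<in> L2 lborel" "\<And>k. integrable lborel (g k)"
       "(\<lambda>k. L2_norm lborel (\<lambda>x. g k x - f x)) \<longlonglongrightarrow> 0"
       "(\<lambda>k. \<integral>\<^sup>+l. hs_norm2 lborel (\<lambda>h x. ir (g k) l h x - \<Phi> l h x) \<partial>mu) \<longlonglongrightarrow> 0"
      using i unfolding isp_def by blast
    have "(\<lambda>k. L2_norm Mp (\<lambda>p. mat (Opr (hat (g k))) p - mat \<Phi> p)) \<longlonglongrightarrow> 0"
      using g(4) unfolding hs_norm2_ir_diff[OF g(1,2) \<Phi>]
      by (subst L2_norm_tendsto_0_iff[OF L2_diff[OF mat_Opr_L2[OF hat_isometry(2)[OF g(1,2)]] direct_integralD(4)[OF \<Phi>]]])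
    then show ?thesis using g by blast
  qed
  obtain g1 where g1: "\<And>k::nat. g1 k \<in> L2 lborel" "\<And>k. integrable lborel (g1 k)"
       "(\<lambda>k. L2_norm lborel (\<lambda>x. g1 k x - f1 x)) \<longlonglongrightarrow> 0"
       "(\<lambda>k. L2_norm Mp (\<lambda>p. mat (Opr (hat (g1 k))) p - mat \<Phi>1 p)) \<longlonglongrightarrow> 0"
    using ex[OF assms(1)] by blast
  obtain g2 where g2: "\<And>k::nat. g2 k \<in> L2 lborel" "\<And>k. integrable lborel (g2 k)"
       "(\<lambda>k. L2_norm lborel (\<lambda>x. g2 k x - f2 x)) \<longlonglongrightarrow> 0"
       "(\<lambda>k. L2_norm Mp (\<lambda>p. mat (Opr (hat (g2 k))) p - mat \<Phi>2 p)) \<longlonglongrightarrow> 0"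
    using ex[OF assms(2)] by blast
  have f: "f1 \<in> L2 lborel" "f2 \<in> L2 lborel" "mat \<Phi>1 \<in> L2 Mp" "mat \<Phi>2 \<in> L2 Mp"
    using assms by (auto simp: isp_def intro: direct_integralD(4))
  have h: "hat (g1 k) \<in> L2 lborel" "hat (g2 k) \<in> L2 lborel" for k
    by (intro hat_isometry(2) g1 g2)+
  have lim1: "(\<lambda>k. L2_inner lborel (g1 k) (g2 k)) \<longlonglongrightarrow> L2_inner lborel f1 f2"
    by (rule L2_inner_tendsto) (fact g1 g2 f)+
  have lim2: "(\<lambda>k. L2_inner Mp (mat (Opr (hat (g1 k)))) (mat (Opr (hat (g2 k))))) \<longlonglongrightarrow> L2_inner Mp (mat \<Phi>1) (mat \<Phi>2)"
    by (rule L2_inner_tendsto) (fact g1 g2 f mat_Opr_L2[OF h(1)] mat_Opr_L2[OF h(2)])+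
  have eq: "L2_inner Mp (mat (Opr (hat (g1 k)))) (mat (Opr (hat (g2 k)))) = L2_inner lborel (g1 k) (g2 k)" for k
    using mat_Opr_inner[OF h(1) h(2), of k k] hat_inner[OF g1(1,2) g2(1,2), of k k] by simp
  show ?thesis by (rule LIMSEQ_unique[OF lim1 lim2[unfolded eq]])
qed

lemma isp_norm:
  assumes "isp f \<Phi>"
  shows "nn2 lborel f = (\<integral>\<^sup>+l. hs_norm2 lborel (\<Phi> l) \<partial>mu)"
proof -
  have D: "\<Phi> \<in> direct_integral mu (\<lambda>_. Collect (hs_operator lborel))" and f: "f \<in> L2 lborel"
    using assms by (auto simp: isp_def)
  have "complex_of_real ((L2_norm lborel f)\<^sup>2) = complex_of_real ((L2_norm Mp (mat \<Phi>))\<^sup>2)"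
    unfolding L2_inner_self[symmetric] by (rule isp_inner[OF assms assms])
  then have "(L2_norm lborel f)\<^sup>2 = (L2_norm Mp (mat \<Phi>))\<^sup>2" by (simp only: of_real_eq_iff)
  then have "nn2 lborel f = nn2 Mp (mat \<Phi>)"
    using f direct_integralD(4)[OF D] by (simp add: nn2_L2)
  then show ?thesis using nn2_mat[OF direct_integralD(1,3)[OF D]] by simp
qed

text \<open>Truncations to balls are integrable and converge to \<open>f\<close>. Their partial
  Fourier transforms are Cauchy by the isometry and converge to some \<open>H\<close>, whose kernel
  operators form the transform of \<open>f\<close>.\<close>

lemma isp_exists:
  assumes f: "f \<in> L2 lborel"
  shows "\<exists>\<Phi>. isp f \<Phi>"
proof -
  define g where "g = (\<lambda>(k::nat) x. f x * indicator (cball 0 (real k)) x)"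
  have g1: "g k \<in> L2 lborel" for k unfolding g_def by (rule L2_restrict[OF f]) simp
  have g2: "integrable lborel (g k)" for k
    unfolding g_def by (rule L2_integrable_finite[OF f]) (auto intro!: emeasure_bounded_finite simp flip: infinity_ennreal_def)
  have g3: "(\<lambda>k. L2_norm lborel (\<lambda>x. g k x - f x)) \<longlonglongrightarrow> 0"
    unfolding g_def
  proof (rule L2_restrict_tendsto[OF f])
    fix x :: "(real^'k) \<times> (real^'d) \<times> (real^'d)"
    obtain N :: nat where "norm x \<le> real N" using real_arch_simple by blast
    then show "\<exists>N. \<forall>n\<ge>N. x \<in> cball 0 (real n)" by (intro exI[of _ N]) auto
  qed simp
  have h: "hat (g k) \<in> L2 lborel" for k by (rule hat_isometry(2)[OF g1 g2])
  obtain H where H: "H \<in> L2 lborel" "(\<lambda>k. L2_norm lborel (\<lambda>p. hat (g k) p - H p)) \<longlonglongrightarrow> 0"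
  proof (rule L2_Riesz_Fischer[OF h])
    fix e :: real assume "e > 0"
    then obtain N where N: "\<And>n. n \<ge> N \<Longrightarrow> L2_norm lborel (\<lambda>x. g n x - f x) < e / 2"
      using LIMSEQ_D[OF g3, of "e/2"] by auto
    have "L2_norm lborel (\<lambda>p. hat (g m) p - hat (g n) p) < e" if "m \<ge> N" "n \<ge> N" for m n
    proof -
      have "L2_norm lborel (\<lambda>p. hat (g m) p - hat (g n) p) = L2_norm lborel (\<lambda>x. g m x - g n x)"
        using hat_norm[OF g1 g2 g1 g2, of m "-1" n] by simp
      also have "\<dots> \<le> L2_norm lborel (\<lambda>x. g m x - f x) + L2_norm lborel (\<lambda>x. f x - g n x)"
        by (rule L2_triangle_diff[OF g1 f g1])
      also have "\<dots> < e" using N[OF that(1)] N[OF that(2)] L2_norm_minus_commute[of lborel f "g n"] by simp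
      finally show ?thesis .
    qed
    then show "\<exists>N. \<forall>m\<ge>N. \<forall>n\<ge>N. L2_norm lborel (\<lambda>p. hat (g m) p - hat (g n) p) < e" by blast
  qed
  have D: "Opr H \<in> direct_integral mu (\<lambda>_. Collect (hs_operator lborel))" by (rule Opr_direct_integral[OF H(1)])
  have "(\<integral>\<^sup>+l. hs_norm2 lborel (\<lambda>h x. ir (g k) l h x - Opr H l h x) \<partial>mu) = nn2 lborel (\<lambda>p. hat (g k) p - H p)" for k
    unfolding hs_norm2_ir_diff[OF g1 g2 D] using mat_Opr_lincomb[OF h[of k] H(1), of "-1"] by simp
  moreover have "(\<lambda>k. nn2 lborel (\<lambda>p. hat (g k) p - H p)) \<longlonglongrightarrow> 0"
    using H(2) by (subst (asm) L2_norm_tendsto_0_iff) (auto simp: h H)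
  ultimately have "isp f (Opr H)"
    unfolding isp_def using f D g1 g2 g3 by (intro conjI exI[of _ g]) simp_all
  then show ?thesis by blast
qed

subsection \<open>Left translation\<close>

text \<open>The central coordinates of the bracket of the \<open>X\<close>-vector with coordinates
  \<open>t\<close> and the \<open>Y\<close>-vector with coordinates \<open>y\<close>. The component
  \<open>k\<close> is read off from \<open>Bm\<close> at the unit vector \<open>axis k 1\<close>;
  the minus sign is the one in the definition of \<open>B(l)\<close>.\<close>

definition cc :: "real^'d \<Rightarrow> real^'d \<Rightarrow> real^'k" where
  "cc t y = (\<chi> k. - (t \<bullet> (Bm (axis k 1) *v y)))"

text \<open>The group law for elements written as central part times \<open>Y\<close> part times
  \<open>X\<close> part: moving the first \<open>X\<close> part past the second \<open>Y\<close>
  part creates the commutator \<open>cc\<close>.\<close>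

definition mulc :: "(real^'k) \<times> (real^'d) \<times> (real^'d) \<Rightarrow> (real^'k) \<times> (real^'d) \<times> (real^'d) \<Rightarrow> (real^'k) \<times> (real^'d) \<times> (real^'d)" where
  "mulc \<gamma> w = (fst \<gamma> + fst w + cc (snd (snd \<gamma>)) (fst (snd w)), fst (snd \<gamma>) + fst (snd w), snd (snd \<gamma>) + snd (snd w))"

text \<open>The inverse of the representation operator of \<open>\<gamma>\<close> at
  \<open>l\<close>, written out.\<close>

definition piinv :: "real^'k \<Rightarrow> (real^'k) \<times> (real^'d) \<times> (real^'d) \<Rightarrow> (real^'d) operator" where
  "piinv l \<gamma> F x = cis (- (2 * pi * (l \<bullet> fst \<gamma>))) * cis (- (2 * pi * ((x + snd (snd \<gamma>)) \<bullet> (Bm l *v fst (snd \<gamma>))))) * F (x + snd (snd \<gamma>))"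

lemma inner_cc: "l \<bullet> cc t y = - (t \<bullet> (Bm l *v y))"
proof -
  have l: "l = (\<Sum>k\<in>UNIV. l $ k *\<^sub>R axis k 1)"
    by (simp add: vec_eq_iff axis_def if_distrib cong: if_cong)
  have "Bm l = (\<Sum>k\<in>UNIV. l $ k *\<^sub>R Bm (axis k 1))"
    by (subst l) (simp add: linear_sum[OF linear_Bm] linear_scale[OF linear_Bm])
  then have "t \<bullet> (Bm l *v y) = (\<Sum>k\<in>UNIV. l $ k * (t \<bullet> (Bm (axis k 1) *v y)))"
  proof -
    have "(\<Sum>k\<in>A. l $ k *\<^sub>R Bm (axis k 1)) *v y = (\<Sum>k\<in>A. l $ k *\<^sub>R (Bm (axis k 1) *v y))" for A :: "'k set"
      by (induction A rule: infinite_finite_induct)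
         (simp_all add: matrix_vector_mult_add_rdistrib scaleR_matrix_vector_assoc)
    then show ?thesis using \<open>Bm l = _\<close> by (simp add: inner_sum_right)
  qed
  then show ?thesis by (simp add: inner_vec_def[of l] cc_def sum_negf)
qed

lemma continuous_cc: "continuous_on UNIV (cc t)"
  unfolding cc_def[abs_def] by (intro continuous_intros)

lemma mulc_measurable [measurable]: "mulc \<gamma> \<in> borel_measurable borel"
  unfolding mulc_def[abs_def]
  by (intro borel_measurable_continuous_onI continuous_intros continuous_on_compose2[OF continuous_cc]) auto

text \<open>Left translation shifts \<open>(y, t)\<close> by a constant and \<open>z\<close> by an
  amount depending on \<open>y\<close>. Integrating over \<open>z\<close> first removes the
  latter.\<close>

lemma lborel_mulc: "distr lborel borel (mulc \<gamma>) = lborel"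
proof (rule measure_eqI)
  obtain z0 y0 t0 where \<gamma>: "\<gamma> = (z0, y0, t0)" by (cases \<gamma>)
  fix A assume "A \<in> sets (distr lborel borel (mulc \<gamma>))"
  then have [measurable]: "A \<in> sets borel" by simp
  have m: "(\<lambda>p. indicator A (mulc \<gamma> p) :: ennreal) \<in> borel_measurable borel" by measurable
  have mA: "(indicator A :: _ \<Rightarrow> ennreal) \<in> borel_measurable borel" by measurable
  have "emeasure (distr lborel borel (mulc \<gamma>)) A = (\<integral>\<^sup>+p. indicator A p \<partial>distr lborel borel (mulc \<gamma>))" by simp
  also have "\<dots> = (\<integral>\<^sup>+p. indicator A (mulc \<gamma> p) \<partial>lborel)" by (rule nn_integral_distr) measurable
  also have "\<dots> = (\<integral>\<^sup>+v. \<integral>\<^sup>+z. indicator A (mulc \<gamma> (z, v)) \<partial>lborel \<partial>lborel)"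
    by (rule nn_integral_lborel_pair(2)[OF m])
  also have "\<dots> = (\<integral>\<^sup>+v. \<integral>\<^sup>+z. indicator A (z, v + (y0, t0)) \<partial>lborel \<partial>lborel)"
  proof (rule nn_integral_cong)
    fix v :: "(real^'d) \<times> (real^'d)"
    have "(\<integral>\<^sup>+z. indicator A (mulc \<gamma> (z, v)) \<partial>lborel) = (\<integral>\<^sup>+z. indicator A (z + (z0 + cc t0 (fst v)), v + (y0, t0)) \<partial>lborel)"
      by (cases v) (simp add: mulc_def \<gamma> add_ac)
    also have "\<dots> = (\<integral>\<^sup>+z. indicator A (z, v + (y0, t0)) \<partial>lborel)"
      by (rule lborel_shift[where f = "\<lambda>z. indicator A (z, v + (y0, t0))"]) measurable
    finally show "(\<integral>\<^sup>+z. indicator A (mulc \<gamma> (z, v)) \<partial>lborel) = (\<integral>\<^sup>+z. indicator A (z, v + (y0, t0)) \<partial>lborel)" .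
  qed
  also have "\<dots> = (\<integral>\<^sup>+z. \<integral>\<^sup>+v. indicator A (z, v + (y0, t0)) \<partial>lborel \<partial>lborel)"
  proof -
    have "(\<lambda>p::(real^'k) \<times> (real^'d) \<times> (real^'d). (fst p, snd p + (y0, t0))) \<in> borel_measurable borel"
      by (intro borel_measurable_continuous_onI continuous_intros)
    then have m2: "(\<lambda>p::(real^'k) \<times> (real^'d) \<times> (real^'d). indicator A (fst p, snd p + (y0, t0)) :: ennreal) \<in> borel_measurable borel"
      by measurable
    show ?thesis using nn_integral_lborel_pair[OF m2] by simp
  qed
  also have "\<dots> = (\<integral>\<^sup>+z. \<integral>\<^sup>+v. indicator A (z, v) \<partial>lborel \<partial>lborel)"
  proof (rule nn_integral_cong)
    fix z :: "real^'k"
    have "(\<lambda>v::(real^'d) \<times> (real^'d). (z, v)) \<in> borel_measurable borel"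
      by (intro borel_measurable_continuous_onI continuous_intros)
    then have "(\<lambda>v. indicator A (z, v) :: ennreal) \<in> borel_measurable borel" by measurable
    then show "(\<integral>\<^sup>+v. indicator A (z, v + (y0, t0)) \<partial>lborel) = (\<integral>\<^sup>+v. indicator A (z, v) \<partial>lborel)"
      by (rule lborel_shift)
  qed
  also have "\<dots> = (\<integral>\<^sup>+w. indicator A w \<partial>lborel)" by (rule nn_integral_lborel_pair(1)[OF mA, symmetric])
  finally show "emeasure (distr lborel borel (mulc \<gamma>)) A = emeasure lborel A" by simp
qed simp

lemma nn_integral_mulc:
  assumes "f \<in> borel_measurable borel"
  shows "(\<integral>\<^sup>+w. f (mulc \<gamma> w) \<partial>lborel) = (\<integral>\<^sup>+w. f w \<partial>lborel)"
  using nn_integral_distr[of "mulc \<gamma>" lborel borel f] assms by (simp add: lborel_mulc)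

lemma integral_mulc:
  assumes "f \<in> borel_measurable borel"
  shows "(LINT w|lborel. f (mulc \<gamma> w)) = (LINT w|lborel. (f w :: complex))"
  using integral_distr[of "mulc \<gamma>" lborel borel f] assms by (simp add: lborel_mulc)

lemma nn2_mulc:
  assumes "f \<in> borel_measurable borel"
  shows "nn2 lborel (\<lambda>w. f (mulc \<gamma> w)) = nn2 lborel f"
  unfolding nn2_def using nn_integral_mulc[of "\<lambda>w. ennreal ((cmod (f w))\<^sup>2)" \<gamma>] assms by simp

lemma L2_mulc:
  assumes "f \<in> L2 lborel" shows "(\<lambda>w. f (mulc \<gamma> w)) \<in> L2 lborel"
proof -
  have [measurable]: "f \<in> borel_measurable borel" using L2_measurable[OF assms] by simp
  have "(\<lambda>w. f (mulc \<gamma> w)) \<in> borel_measurable borel" by measurable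
  then show ?thesis using assms by (simp add: L2_iff nn2_mulc)
qed

text \<open>The operator of \<open>w\<close> is the inverse of the operator of
  \<open>\<gamma>\<close> followed after the operator of the product \<open>mulc \<gamma> w\<close>.
  The phase that pairs the translation part of \<open>\<gamma>\<close> with the \<open>y\<close>
  part of \<open>w\<close> is cancelled by \<open>cc\<close> in the central variable.\<close>

lemma rep_mulc: "rep l w h x = cis (- (2 * pi * (l \<bullet> fst \<gamma>))) * cis (- (2 * pi * ((x + snd (snd \<gamma>)) \<bullet> (Bm l *v fst (snd \<gamma>))))) *
   rep l (mulc \<gamma> w) h (x + snd (snd \<gamma>))"
proof -
  obtain z0 y0 t0 where \<gamma>: "\<gamma> = (z0, y0, t0)" by (cases \<gamma>)
  obtain z y t where w: "w = (z, y, t)" by (cases w)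
  have arg: "2 * pi * (l \<bullet> z) + 2 * pi * (x \<bullet> (Bm l *v y)) =
    - (2 * pi * (l \<bullet> z0)) + - (2 * pi * ((x + t0) \<bullet> (Bm l *v y0))) +
    (2 * pi * (l \<bullet> (z0 + z + cc t0 y)) + 2 * pi * ((x + t0) \<bullet> (Bm l *v (y0 + y))))"
    by (simp add: inner_add_right inner_add_left inner_cc matrix_vector_right_distrib algebra_simps)
  have "rep l w h x = cis (2 * pi * (l \<bullet> z) + 2 * pi * (x \<bullet> (Bm l *v y))) * h (x - t)"
    by (simp add: rep_def w cis_mult)
  also have "\<dots> = cis (- (2 * pi * (l \<bullet> z0)) + - (2 * pi * ((x + t0) \<bullet> (Bm l *v y0)))) *
     (cis (2 * pi * (l \<bullet> (z0 + z + cc t0 y)) + 2 * pi * ((x + t0) \<bullet> (Bm l *v (y0 + y)))) * h (x - t))"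
    unfolding arg by (simp only: cis_mult[symmetric] mult.assoc)
  finally show ?thesis by (simp add: rep_def mulc_def \<gamma> w cis_mult)
qed

lemma ir_mulc:
  assumes "G \<in> borel_measurable borel" "h \<in> borel_measurable borel"
  shows "ir (\<lambda>w. G (mulc \<gamma> w)) l h x = piinv l \<gamma> (ir G l h) x"
proof -
  define c where "c = cis (- (2 * pi * (l \<bullet> fst \<gamma>))) * cis (- (2 * pi * ((x + snd (snd \<gamma>)) \<bullet> (Bm l *v fst (snd \<gamma>)))))"
  have "ir (\<lambda>w. G (mulc \<gamma> w)) l h x = (LINT w|lborel. c * (G (mulc \<gamma> w) * rep l (mulc \<gamma> w) h (x + snd (snd \<gamma>))))"
    unfolding ir_def by (subst rep_mulc[of l _ h x \<gamma>]) (simp add: c_def mult_ac)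
  also have "\<dots> = c * (LINT w|lborel. G (mulc \<gamma> w) * rep l (mulc \<gamma> w) h (x + snd (snd \<gamma>)))" by simp
  also have "(LINT w|lborel. G (mulc \<gamma> w) * rep l (mulc \<gamma> w) h (x + snd (snd \<gamma>))) = ir G l h (x + snd (snd \<gamma>))"
    unfolding ir_def using measurable_Pair2[OF rep_joint_measurable[OF assms, of l], of "x + snd (snd \<gamma>)"]
    by (intro integral_mulc[where f = "\<lambda>w. G w * rep l w h (x + snd (snd \<gamma>))"]) simp
  finally show ?thesis by (simp add: piinv_def c_def)
qed

lemma piinv_measurable:
  assumes [measurable]: "F \<in> borel_measurable borel"
  shows "piinv l \<gamma> F \<in> borel_measurable borel"
  unfolding piinv_def[abs_def] by measurable

lemma nn2_piinv:
  assumes [measurable]: "F \<in> borel_measurable borel"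
  shows "nn2 lborel (piinv l \<gamma> F) = nn2 lborel F"
proof -
  have "nn2 lborel (piinv l \<gamma> F) = (\<integral>\<^sup>+x. ennreal ((cmod (F (x + snd (snd \<gamma>))))\<^sup>2) \<partial>lborel)"
    unfolding nn2_def by (simp add: piinv_def norm_mult)
  also have "\<dots> = nn2 lborel F" unfolding nn2_def
    by (rule lborel_shift[where f = "\<lambda>x. ennreal ((cmod (F x))\<^sup>2)"]) measurable
  finally show ?thesis .
qed

lemma L2_piinv:
  assumes F: "F \<in> L2 lborel" shows "piinv l \<gamma> F \<in> L2 lborel"
proof -
  have m: "F \<in> borel_measurable borel" using L2_measurable[OF F] by simp
  show ?thesis using F unfolding L2_iff by (simp add: nn2_piinv[OF m] piinv_measurable[OF m])
qed

lemma L2_norm_piinv: "F \<in> borel_measurable borel \<Longrightarrow> L2_norm lborel (piinv l \<gamma> F) = L2_norm lborel F"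
  by (rule L2_norm_eqI) (simp_all add: nn2_piinv piinv_measurable)

lemma AE_shift:
  assumes "AE x in lborel. P (x :: real^'d)"
  shows "AE x in lborel. P (x + c)"
proof -
  have "AE x in distr lborel borel ((+) c). P x" by (subst lborel_distr_plus) (rule assms)
  then have "AE x in lborel. P (c + x)" by (intro AE_distrD[of "(+) c" lborel borel]) auto
  then show ?thesis by (simp add: add.commute)
qed

lemma hs_norm2_piinv:
  assumes "\<And>i. T (hs_basis i) \<in> borel_measurable borel"
  shows "hs_norm2 lborel (\<lambda>h. piinv l \<gamma> (T h)) = hs_norm2 lborel T"
  using assms by (simp add: hs_norm2_def hs_basis_def[symmetric] L2_norm_piinv)

lemma hs_operator_piinv:
  assumes T: "hs_operator lborel T"
  shows "hs_operator lborel (\<lambda>h. piinv l \<gamma> (T h))"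
proof -
  have b: "bounded_operator lborel T" using T by (simp add: hs_operator_def)
  note TL = bounded_operatorD(1)[OF b]
  have Tm: "h \<in> L2 lborel \<Longrightarrow> T h \<in> borel_measurable borel" for h using L2_measurable[OF TL[of h]] by simp
  obtain C where C: "\<And>f. f \<in> L2 lborel \<Longrightarrow> L2_norm lborel (T f) \<le> C * L2_norm lborel f"
    using bounded_operator_bound[OF b] by blast
  have "bounded_operator lborel (\<lambda>h. piinv l \<gamma> (T h))"
    unfolding bounded_operator_def
  proof (intro conjI ballI allI exI[of _ C])
    fix f :: "real^'d \<Rightarrow> complex" assume f: "f \<in> L2 lborel"
    show "piinv l \<gamma> (T f) \<in> L2 lborel" by (rule L2_piinv[OF TL[OF f]])
    show "L2_norm lborel (piinv l \<gamma> (T f)) \<le> C * L2_norm lborel f" by (simp add: L2_norm_piinv Tm f C)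
    fix g :: "real^'d \<Rightarrow> complex" assume g: "g \<in> L2 lborel"
    show "AE x in lborel. piinv l \<gamma> (T (\<lambda>y. f y + g y)) x = piinv l \<gamma> (T f) x + piinv l \<gamma> (T g) x"
      using AE_shift[OF bounded_operatorD(2)[OF b f g], of "snd (snd \<gamma>)"]
      by eventually_elim (simp add: piinv_def distrib_left)
  next
    fix c and f :: "real^'d \<Rightarrow> complex" assume f: "f \<in> L2 lborel"
    show "AE x in lborel. piinv l \<gamma> (T (\<lambda>y. c * f y)) x = c * piinv l \<gamma> (T f) x"
      using AE_shift[OF bounded_operatorD(3)[OF b f, of c], of "snd (snd \<gamma>)"]
      by eventually_elim (simp add: piinv_def mult.left_commute[of _ c])
  qed
  moreover have "hs_norm2 lborel (\<lambda>h. piinv l \<gamma> (T h)) = hs_norm2 lborel T"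
    by (rule hs_norm2_piinv) (simp add: Tm)
  ultimately show ?thesis using T by (simp add: hs_operator_def)
qed

text \<open>Left translation preserves Lebesgue measure and \<open>piinv\<close> preserves
  Hilbert-Schmidt norms, so the translated approximating sequence serves the translated function.
  Measurability of the translated field is a premise because each use derives it from an explicit
  formula.\<close>

lemma isp_mulc:
  assumes isp: "isp f \<Phi>" and meas: "measurable_field mu (\<lambda>l h. piinv l \<gamma> (\<Phi> l h))"
  shows "isp (\<lambda>w. f (mulc \<gamma> w)) (\<lambda>l h. piinv l \<gamma> (\<Phi> l h))"
proof -
  have f: "f \<in> L2 lborel" and D: "\<Phi> \<in> direct_integral mu (\<lambda>_. Collect (hs_operator lborel))"
    using isp by (auto simp: isp_def)
  note DD = direct_integralD[OF D]
  obtain g where g: "\<And>k::nat. g k \<in> L2 lborel" "\<And>k. integrable lborel (g k)"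
       "(\<lambda>k. L2_norm lborel (\<lambda>x. g k x - f x)) \<longlonglongrightarrow> 0"
       "(\<lambda>k. \<integral>\<^sup>+l. hs_norm2 lborel (\<lambda>h x. ir (g k) l h x - \<Phi> l h x) \<partial>mu) \<longlonglongrightarrow> 0"
    using isp unfolding isp_def by blast
  have gm: "g k \<in> borel_measurable borel" for k using L2_measurable[OF g(1)[of k]] by simp
  have "(\<integral>\<^sup>+l. hs_norm2 lborel (\<lambda>h. piinv l \<gamma> (\<Phi> l h)) \<partial>mu) = (\<integral>\<^sup>+l. hs_norm2 lborel (\<Phi> l) \<partial>mu)"
  proof (rule nn_integral_cong_AE)
    show "AE l in mu. hs_norm2 lborel (\<lambda>h. piinv l \<gamma> (\<Phi> l h)) = hs_norm2 lborel (\<Phi> l)"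
      using DD(3) by eventually_elim (rule hs_norm2_piinv, use L2_measurable in fastforce)
  qed
  then have D': "(\<lambda>l h. piinv l \<gamma> (\<Phi> l h)) \<in> direct_integral mu (\<lambda>_. Collect (hs_operator lborel))"
    using D meas DD(2) unfolding direct_integral_def by (auto elim!: AE_mp intro!: hs_operator_piinv)
  have gi: "integrable lborel (\<lambda>w. g k (mulc \<gamma> w))" for k
  proof -
    have "integrable (distr lborel borel (mulc \<gamma>)) (g k)" using g(2) by (simp add: lborel_mulc)
    then show ?thesis by (subst (asm) integrable_distr_eq) (auto simp: gm)
  qed
  have gn: "L2_norm lborel (\<lambda>w. g k (mulc \<gamma> w) - f (mulc \<gamma> w)) = L2_norm lborel (\<lambda>x. g k x - f x)" for k
  proof (rule L2_norm_eqI)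
    have "(\<lambda>x. g k x - f x) \<in> borel_measurable borel" using L2_measurable[OF L2_diff[OF g(1)[of k] f]] by simp
    then show "nn2 lborel (\<lambda>w. g k (mulc \<gamma> w) - f (mulc \<gamma> w)) = nn2 lborel (\<lambda>x. g k x - f x)" by (rule nn2_mulc)
    show "(\<lambda>w. g k (mulc \<gamma> w) - f (mulc \<gamma> w)) \<in> borel_measurable lborel"
      by (rule L2_measurable[OF L2_diff[OF L2_mulc[OF g(1)] L2_mulc[OF f]]])
    show "(\<lambda>x. g k x - f x) \<in> borel_measurable lborel" by (rule L2_measurable[OF L2_diff[OF g(1) f]])
  qed
  have "(\<integral>\<^sup>+l. hs_norm2 lborel (\<lambda>h x. ir (\<lambda>w. g k (mulc \<gamma> w)) l h x - piinv l \<gamma> (\<Phi> l h) x) \<partial>mu) =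
     (\<integral>\<^sup>+l. hs_norm2 lborel (\<lambda>h x. ir (g k) l h x - \<Phi> l h x) \<partial>mu)" for k
  proof (rule nn_integral_cong_AE)
    show "AE l in mu. hs_norm2 lborel (\<lambda>h x. ir (\<lambda>w. g k (mulc \<gamma> w)) l h x - piinv l \<gamma> (\<Phi> l h) x) =
       hs_norm2 lborel (\<lambda>h x. ir (g k) l h x - \<Phi> l h x)"
      using DD(3)
    proof eventually_elim
      case (elim l)
      have Pm: "\<Phi> l (hs_basis i) \<in> borel_measurable borel" for i using elim L2_measurable by fastforce
      have m: "(\<lambda>x. ir (g k) l (hs_basis i) x - \<Phi> l (hs_basis i) x) \<in> borel_measurable borel" for i
        using ir_measurable[OF gm hs_basis_measurable, of k l i] Pm[of i] by measurable
      have "hs_norm2 lborel (\<lambda>h x. ir (\<lambda>w. g k (mulc \<gamma> w)) l h x - piinv l \<gamma> (\<Phi> l h) x) =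
         hs_norm2 lborel (\<lambda>h. piinv l \<gamma> (\<lambda>x. ir (g k) l h x - \<Phi> l h x))"
      proof -
        have "(\<lambda>x. ir (\<lambda>w. g k (mulc \<gamma> w)) l (hs_basis i) x - piinv l \<gamma> (\<Phi> l (hs_basis i)) x) =
           piinv l \<gamma> (\<lambda>x. ir (g k) l (hs_basis i) x - \<Phi> l (hs_basis i) x)" for i
          by (rule ext) (simp add: ir_mulc[OF gm hs_basis_measurable] piinv_def right_diff_distrib)
        then show ?thesis by (simp add: hs_norm2_def hs_basis_def[symmetric])
      qed
      also have "\<dots> = hs_norm2 lborel (\<lambda>h x. ir (g k) l h x - \<Phi> l h x)"
        by (rule hs_norm2_piinv[where T = "\<lambda>h x. ir (g k) l h x - \<Phi> l h x", OF m])
      finally show ?case .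
    qed
  qed
  then show ?thesis
    unfolding isp_def using D' L2_mulc[OF f] L2_mulc[OF g(1)] gi gn g(3,4)
    by (intro conjI exI[of _ "\<lambda>k w. g k (mulc \<gamma> w)"]) auto
qed

end

section \<open>Fourier series on parallelepipeds\<close>

definition dg :: "real^'n \<Rightarrow> real^'n^'n" where
  "dg c = (\<chi> i j. if i = j then c $ i else 0)"

text \<open>The quasi-lattice coordinates \<open>m_j / a_j\<close> are the entries of
  \<open>dg (iv a) *v m\<close> with \<open>m\<close> in \<open>int_lattice\<close>.\<close>

definition iv :: "real^'n \<Rightarrow> real^'n" where
  "iv c = (\<chi> i. inverse (c $ i))"

lemma dg_mult: "dg c *v x = (\<chi> i. c $ i * x $ i)"
  by (simp add: dg_def matrix_vector_mult_def vec_eq_iff if_distrib if_distribR cong: if_cong)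

lemma det_dg: "det (dg c) = (\<Prod>i\<in>UNIV. c $ i)"
  by (subst det_diagonal) (auto simp: dg_def)

lemma inner_dg: "x \<bullet> (dg c *v y) = (dg c *v x) \<bullet> y"
  by (simp add: dg_mult inner_vec_def mult_ac)

lemma prod_iv: "(\<Prod>i\<in>UNIV. iv c $ i) = inverse (\<Prod>i\<in>UNIV. c $ i)"
  by (simp add: iv_def prod_inversef[symmetric] o_def)

lemma matrix_mult_measurable [measurable]:
  fixes M :: "real^'n^'n"
  shows "(*v) M \<in> borel_measurable borel"
  by (intro borel_measurable_continuous_onI continuous_intros)

lemma lborel_matrix:
  fixes M :: "real^'n^'n"
  assumes "det M \<noteq> 0"
  shows "lborel = density (distr lborel borel ((*v) M)) (\<lambda>_. ennreal \<bar>det M\<bar>)"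
proof (rule measure_eqI)
  fix A assume "A \<in> sets (lborel :: (real^'n) measure)"
  then have [measurable]: "A \<in> sets borel" by simp
  have "emeasure lborel A = (\<integral>\<^sup>+x. indicator A x \<partial>lborel)" by simp
  also have "\<dots> = ennreal \<bar>det M\<bar> * (\<integral>\<^sup>+x. indicator A (M *v x) \<partial>lborel)"
    using nn_integral_linear[of "(*v) M" "indicator A"] assms by simp
  also have "\<dots> = emeasure (density (distr lborel borel ((*v) M)) (\<lambda>_. ennreal \<bar>det M\<bar>)) A"
    by (simp add: emeasure_density nn_integral_cmult nn_integral_distr del: nn_integral_indicator)
  finally show "emeasure lborel A = emeasure (density (distr lborel borel ((*v) M)) (\<lambda>_. ennreal \<bar>det M\<bar>)) A" .
qed simp

text \<open>The support lies in one parallelepiped, the preimage of a unit cube under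
  \<open>M\<close>; its volume is the constant on the right.\<close>

lemma fourier_Parseval_matrix:
  fixes F :: "real^'n \<Rightarrow> complex" and M :: "real^'n^'n"
  assumes M: "det M \<noteq> 0" and F: "F \<in> L2 lborel" and r: "r \<in> int_lattice"
    and supp: "\<And>x. M *v x - r \<notin> ucube \<Longrightarrow> F x = 0"
  shows "(\<integral>\<^sup>+k. ennreal ((cmod (LINT x|lborel. F x * fchar k (M *v x)))\<^sup>2) \<partial>count_space int_lattice) =
    ennreal (1 / \<bar>det M\<bar>) * nn2 lborel F"
proof -
  obtain N where inv: "M ** N = mat 1" using M by (auto simp: invertible_det_nz[symmetric] invertible_def)
  then have "det M * det N = 1" by (simp add: det_mul[symmetric])
  then have d: "det N = 1 / det M" using M by (simp add: field_simps)
  show ?thesis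
  proof (rule fourier_Parseval_affine[where S = "(*v) N", OF _ _ _ _ _ F r supp])
    show "M *v (N *v y) = y" for y by (simp add: matrix_vector_mul_assoc inv)
    show "lborel = density (distr lborel borel ((*v) N)) (\<lambda>_. ennreal (1 / \<bar>det M\<bar>))"
      using lborel_matrix[of "N"] M by (simp add: d)
  qed (use M in auto)
qed

lemma lebesgue_AE_borel_complex:
  fixes F :: "'a::euclidean_space \<Rightarrow> complex"
  assumes "F \<in> borel_measurable lebesgue"
  shows "\<exists>F'\<in>borel_measurable borel. AE x in lborel. F x = F' x"
proof -
  have "(\<lambda>x. Re (F x)) \<in> borel_measurable lebesgue" "(\<lambda>x. Im (F x)) \<in> borel_measurable lebesgue"
    using assms by measurable
  then obtain f g where f: "f \<in> borel_measurable lborel" "AE x in lborel. Re (F x) = f x"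
    and g: "g \<in> borel_measurable lborel" "AE x in lborel. Im (F x) = g x"
    using completion_ex_borel_measurable_real[of "\<lambda>x. Re (F x)" lborel]
      completion_ex_borel_measurable_real[of "\<lambda>x. Im (F x)" lborel] by blast
  have "(\<lambda>x. Complex (f x) (g x)) \<in> borel_measurable borel"
  proof -
    have [measurable]: "f \<in> borel_measurable borel" "g \<in> borel_measurable borel" using f g by auto
    have "(\<lambda>x. complex_of_real (f x) + \<i> * complex_of_real (g x)) \<in> borel_measurable borel" by measurable
    then show ?thesis by (simp add: Complex_eq)
  qed
  moreover have "AE x in lborel. F x = Complex (f x) (g x)"
    using f(2) g(2) by eventually_elim (simp add: complex_eq_iff)
  ultimately show ?thesis by (intro bexI[where x = "\<lambda>x. Complex (f x) (g x)"])
qed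

text \<open>Operator fields are measurable only with respect to Lebesgue sets, which forces this
  version of Parseval in the variable \<open>l\<close>. \<open>F\<close> is replaced by a Borel
  function equal to it almost everywhere, cut back to the parallelepiped.\<close>

lemma fourier_Parseval_lebesgue:
  fixes F :: "real^'n \<Rightarrow> complex" and M :: "real^'n^'n"
  assumes M: "det M \<noteq> 0" and F: "F \<in> borel_measurable lebesgue" "nn2 lebesgue F < \<infinity>" and r: "r \<in> int_lattice"
    and supp: "\<And>x. M *v x - r \<notin> ucube \<Longrightarrow> F x = 0"
  shows "(\<integral>\<^sup>+k. ennreal ((cmod (LINT x|lebesgue. F x * fchar k (M *v x)))\<^sup>2) \<partial>count_space int_lattice) =
    ennreal (1 / \<bar>det M\<bar>) * nn2 lebesgue F"
proof -
  obtain F' where F': "F' \<in> borel_measurable borel" "AE x in lborel. F x = F' x"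
    using lebesgue_AE_borel_complex[OF F(1)] by blast
  note [measurable] = F'(1)
  define A where "A = {x. M *v x - r \<in> ucube}"
  have [measurable]: "A \<in> sets borel" unfolding A_def by measurable
  define G where "G = (\<lambda>x. F' x * indicator A x)"
  have [measurable]: "G \<in> borel_measurable borel" unfolding G_def by measurable
  have FG: "AE x in lborel. F x = G x"
    using F'(2) by eventually_elim (auto simp: G_def A_def indicator_def supp)
  have FG': "AE x in lebesgue. F x = G x" using FG by (rule AE_completion)
  have n: "nn2 lebesgue F = nn2 lborel G"
    unfolding nn2_cong_AE[OF FG'] by (simp add: nn2_def nn_integral_completion)
  have "G \<in> L2 lborel" using F(2) n by (simp add: L2_iff)
  then have "(\<integral>\<^sup>+k. ennreal ((cmod (LINT x|lborel. G x * fchar k (M *v x)))\<^sup>2) \<partial>count_space int_lattice) =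
    ennreal (1 / \<bar>det M\<bar>) * nn2 lborel G"
    by (rule fourier_Parseval_matrix[OF M _ r]) (auto simp: G_def A_def)
  moreover have "(LINT x|lebesgue. F x * fchar k (M *v x)) = (LINT x|lborel. G x * fchar k (M *v x))" for k
  proof -
    have gm: "(\<lambda>x. G x * fchar k (M *v x)) \<in> borel_measurable lborel" by measurable
    have fm: "(\<lambda>x. fchar k (M *v x)) \<in> borel_measurable lebesgue"
      by (rule measurable_completion) measurable
    have "(LINT x|lebesgue. F x * fchar k (M *v x)) = (LINT x|lebesgue. G x * fchar k (M *v x))"
    proof (rule integral_cong_AE)
      show "(\<lambda>x. F x * fchar k (M *v x)) \<in> borel_measurable lebesgue" using F(1) fm by (rule borel_measurable_times)
      show "(\<lambda>x. G x * fchar k (M *v x)) \<in> borel_measurable lebesgue" using gm by (rule measurable_completion)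
      show "AE x in lebesgue. F x * fchar k (M *v x) = G x * fchar k (M *v x)"
        using FG' by eventually_elim simp
    qed
    then show ?thesis using integral_completion[OF gm] by simp
  qed
  ultimately show ?thesis by (simp add: n)
qed

section \<open>Pairing with operator fields\<close>

lemma integral_count_nat_pair:
  fixes f :: "nat \<times> nat \<Rightarrow> complex"
  assumes f: "integrable (count_space UNIV) f"
  shows "(LINT p|count_space UNIV. f p) = (LINT i|count_space UNIV. LINT j|count_space UNIV. f (i, j))"
    "integrable (count_space UNIV) (\<lambda>i. LINT j|count_space UNIV. f (i, j))"
proof -
  have c: "count_space (UNIV :: (nat \<times> nat) set) = count_space UNIV \<Otimes>\<^sub>M count_space UNIV"
    by (subst pair_measure_countable) auto
  have s: "sigma_finite_measure (count_space (UNIV :: nat set))"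
    by (rule sigma_finite_measure_count_space_countable) simp
  have p: "pair_sigma_finite (count_space (UNIV :: nat set)) (count_space (UNIV :: nat set))"
    by (intro pair_sigma_finite.intro s)
  have f': "integrable (count_space UNIV \<Otimes>\<^sub>M count_space UNIV) f" using f by (simp add: c)
  show "(LINT p|count_space UNIV. f p) = (LINT i|count_space UNIV. LINT j|count_space UNIV. f (i, j))"
    using pair_sigma_finite.integral_fst'[OF p f'] by (simp add: c)
  show "integrable (count_space UNIV) (\<lambda>i. LINT j|count_space UNIV. f (i, j))"
    using pair_sigma_finite.integrable_fst'[OF p f'] .
qed

text \<open>The Hilbert-Schmidt pairing of \<open>c\<close> times the elementary tensor of
  \<open>g\<close> and \<open>u\<close> with \<open>T\<close>, in matrix entries. Summation over the
  second index is Parseval for \<open>g\<close> and the image of a basis vector; summation over the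
  first reassembles \<open>T u\<close> from the expansion of \<open>u\<close>. Integrability
  justifies the iterated sum.\<close>

lemma rank_one_pairing:
  assumes T: "bounded_operator lborel T" and u: "u \<in> L2 lborel" and g: "g \<in> L2 lborel"
    and int: "integrable (count_space UNIV) (\<lambda>p. (c * L2_inner lborel (hs_basis (fst p)) u * L2_inner lborel g (hs_basis (snd p)))
         * cnj (L2_inner lborel (T (hs_basis (fst p))) (hs_basis (snd p))))"
  shows "(LINT p|count_space UNIV. (c * L2_inner lborel (hs_basis (fst p)) u * L2_inner lborel g (hs_basis (snd p)))
         * cnj (L2_inner lborel (T (hs_basis (fst p))) (hs_basis (snd p)))) = c * L2_inner lborel g (T u)"
proof -
  let ?f = "\<lambda>p. (c * L2_inner lborel (hs_basis (fst p)) u * L2_inner lborel g (hs_basis (snd p)))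
         * cnj (L2_inner lborel (T (hs_basis (fst p))) (hs_basis (snd p)))"
  note TL = bounded_operatorD(1)[OF T]
  define d where "d = (\<lambda>i. c * L2_inner lborel (hs_basis i) u * L2_inner lborel g (T (hs_basis i)))"
  have inner: "(LINT j|count_space UNIV. ?f (i, j)) = d i" for i
  proof -
    have "(LINT j|count_space UNIV. ?f (i, j)) = c * L2_inner lborel (hs_basis i) u *
       L2_inner (count_space UNIV) (\<lambda>j. L2_inner lborel g (hs_basis j)) (\<lambda>j. L2_inner lborel (T (hs_basis i)) (hs_basis j))"
      unfolding L2_inner_def[of "count_space UNIV"] by (simp add: mult.assoc)
    then show ?thesis by (simp add: orthonormal_basis_inner[OF hs_basis] g TL d_def)
  qed
  have di: "integrable (count_space UNIV) d" using integral_count_nat_pair(2)[OF int] by (simp only: inner)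
  have "(LINT p|count_space UNIV. ?f p) = (LINT i|count_space UNIV. d i)"
    using integral_count_nat_pair(1)[OF int] by (simp only: inner)
  also have "\<dots> = suminf d" using integral_count_space_nat[OF di] .
  also have "\<dots> = c * L2_inner lborel g (T u)"
  proof (rule sums_unique[symmetric])
    have "(\<lambda>n. L2_inner lborel g (\<lambda>x. \<Sum>i<n. L2_inner lborel u (hs_basis i) * T (hs_basis i) x)) \<longlonglongrightarrow> L2_inner lborel g (T u)"
      by (rule L2_inner_tendsto) (auto simp: g TL u bounded_operator_expansion[OF T u])
    moreover have "L2_inner lborel g (\<lambda>x. \<Sum>i<n. L2_inner lborel u (hs_basis i) * T (hs_basis i) x) =
       (\<Sum>i<n. L2_inner lborel (hs_basis i) u * L2_inner lborel g (T (hs_basis i)))" for n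
      by (subst L2_inner_sum_right) (auto simp: TL g L2_inner_scale_right L2_inner_commute[of lborel "hs_basis _" u])
    ultimately have "(\<lambda>n. \<Sum>i<n. L2_inner lborel (hs_basis i) u * L2_inner lborel g (T (hs_basis i))) \<longlonglongrightarrow> L2_inner lborel g (T u)"
      by simp
    from tendsto_mult_left[OF this, of c] show "d sums (c * L2_inner lborel g (T u))"
      by (simp add: sums_def d_def sum_distrib_left mult.assoc)
  qed
  finally show ?thesis .
qed

lemma hs_norm2_pairing:
  assumes T: "bounded_operator lborel T" and fin: "hs_norm2 lborel T < \<infinity>"
  shows "(LINT p|count_space UNIV. (c * L2_inner lborel (T (hs_basis (fst p))) (hs_basis (snd p)))
         * cnj (L2_inner lborel (T (hs_basis (fst p))) (hs_basis (snd p)))) = c * of_real (enn2real (hs_norm2 lborel T))"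
proof -
  let ?e = "\<lambda>p. L2_inner lborel (T (hs_basis (fst p))) (hs_basis (snd p))"
  have n: "hs_norm2 lborel T = (\<integral>\<^sup>+p. ennreal ((cmod (?e p))\<^sup>2) \<partial>count_space UNIV)"
    by (rule hs_norm2_entries) (simp add: bounded_operatorD(1)[OF T])
  have "(LINT p|count_space UNIV. (c * ?e p) * cnj (?e p)) = (LINT p|count_space UNIV. c * of_real ((cmod (?e p))\<^sup>2))"
    by (intro Bochner_Integration.integral_cong) (simp_all add: complex_norm_square mult.assoc del: of_real_power)
  also have "\<dots> = c * of_real (LINT p|count_space UNIV. (cmod (?e p))\<^sup>2)"
    by (simp only: integral_mult_right_zero integral_complex_of_real)
  also have "(LINT p|count_space UNIV. (cmod (?e p))\<^sup>2) = enn2real (hs_norm2 lborel T)"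
    unfolding n by (rule integral_eq_nn_integral) auto
  finally show ?thesis .
qed

context weil_coords
begin

lemma isp_inner_integral:
  assumes "isp f1 \<Phi>1" "isp f2 \<Phi>2"
  shows "L2_inner lborel f1 f2 = (LINT l|mu. LINT ij|count_space UNIV. mat \<Phi>1 (ij, l) * cnj (mat \<Phi>2 (ij, l)))"
    "AE l in mu. integrable (count_space UNIV) (\<lambda>ij. mat \<Phi>1 (ij, l) * cnj (mat \<Phi>2 (ij, l)))"
proof -
  have "mat \<Phi>1 \<in> L2 Mp" "mat \<Phi>2 \<in> L2 Mp"
    using assms by (auto simp: isp_def intro: direct_integralD(4))
  then have "integrable Mp (\<lambda>p. mat \<Phi>1 p * cnj (mat \<Phi>2 p))" by (rule L2_integrable_mult)
  then have i: "integrable (count_space UNIV \<Otimes>\<^sub>M mu) (case_prod (\<lambda>ij l. mat \<Phi>1 (ij, l) * cnj (mat \<Phi>2 (ij, l))))"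
    by (simp add: Mp_def case_prod_unfold)
  show "AE l in mu. integrable (count_space UNIV) (\<lambda>ij. mat \<Phi>1 (ij, l) * cnj (mat \<Phi>2 (ij, l)))"
    by (rule pair_sigma_finite.AE_integrable_snd[OF pair_sigma_finite_Mp i])
  show "L2_inner lborel f1 f2 = (LINT l|mu. LINT ij|count_space UNIV. mat \<Phi>1 (ij, l) * cnj (mat \<Phi>2 (ij, l)))"
    unfolding pair_sigma_finite.integral_snd[OF pair_sigma_finite_Mp i] isp_inner[OF assms]
    by (simp add: L2_inner_def Mp_def case_prod_unfold)
qed

lemma integral_mu_cong_AE':
  fixes f g :: "real^'k \<Rightarrow> complex"
  assumes "AE l in mu. f l = g l" "g \<in> borel_measurable mu" "f \<in> borel_measurable mu"
  shows "(LINT l|mu. f l) = (LINT l|mu. g l)"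
  using assms by (intro integral_cong_AE) auto

lemma isp_inner_integral_measurable:
  assumes "isp f1 \<Phi>1" "isp f2 \<Phi>2"
  shows "(\<lambda>l. LINT ij|count_space UNIV. mat \<Phi>1 (ij, l) * cnj (mat \<Phi>2 (ij, l))) \<in> borel_measurable mu"
proof -
  have "mat \<Phi>1 \<in> L2 Mp" "mat \<Phi>2 \<in> L2 Mp"
    using assms by (auto simp: isp_def intro: direct_integralD(4))
  then have "integrable Mp (\<lambda>p. mat \<Phi>1 p * cnj (mat \<Phi>2 p))" by (rule L2_integrable_mult)
  then have i: "integrable (count_space UNIV \<Otimes>\<^sub>M mu) (case_prod (\<lambda>ij l. mat \<Phi>1 (ij, l) * cnj (mat \<Phi>2 (ij, l))))"
    by (simp add: Mp_def case_prod_unfold)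
  show ?thesis
    using pair_sigma_finite.integrable_snd[OF pair_sigma_finite_Mp i] by (rule borel_measurable_integrable)
qed

text \<open>Weak measurability is enough: the inner product is a pointwise limit of finite sums of
  products of measurable coefficients.\<close>

lemma inner_measurable:
  assumes F: "\<And>l. l \<in> sig \<Longrightarrow> F l \<in> L2 lborel" "\<And>j. (\<lambda>l. L2_inner lborel (F l) (hs_basis j)) \<in> borel_measurable mu"
    and G: "\<And>l. l \<in> sig \<Longrightarrow> G l \<in> L2 lborel" "\<And>j. (\<lambda>l. L2_inner lborel (G l) (hs_basis j)) \<in> borel_measurable mu"
  shows "(\<lambda>l. L2_inner lborel (F l) (G l) :: complex) \<in> borel_measurable mu"
proof (rule borel_measurable_LIMSEQ_metric)
  show "(\<lambda>l. \<Sum>i<n. L2_inner lborel (F l) (hs_basis i) * cnj (L2_inner lborel (G l) (hs_basis i))) \<in> borel_measurable mu" for n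
    using F(2) G(2) by measurable
  fix l assume "l \<in> space mu"
  then have l: "l \<in> sig" by simp
  have "(\<lambda>n. L2_inner lborel (\<lambda>x. \<Sum>i<n. L2_inner lborel (F l) (hs_basis i) * hs_basis i x) (G l)) \<longlonglongrightarrow> L2_inner lborel (F l) (G l)"
  proof (rule L2_inner_tendsto)
    show "(\<lambda>n. L2_norm lborel (\<lambda>x. (\<Sum>i<n. L2_inner lborel (F l) (hs_basis i) * hs_basis i x) - F l x)) \<longlonglongrightarrow> 0"
      using orthonormal_basis_expansion[OF hs_basis F(1)[OF l]] by (subst L2_norm_minus_commute)
  qed (auto simp: F G l)
  moreover have "L2_inner lborel (\<lambda>x. \<Sum>i<n. L2_inner lborel (F l) (hs_basis i) * hs_basis i x) (G l) =
     (\<Sum>i<n. L2_inner lborel (F l) (hs_basis i) * cnj (L2_inner lborel (G l) (hs_basis i)))" for n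
    by (subst L2_inner_sum_left) (auto simp: G l L2_inner_scale_left L2_inner_commute[of lborel "hs_basis _" "G l"])
  ultimately show "(\<lambda>n. \<Sum>i<n. L2_inner lborel (F l) (hs_basis i) * cnj (L2_inner lborel (G l) (hs_basis i))) \<longlonglongrightarrow> L2_inner lborel (F l) (G l)"
    by simp
qed

lemma nn2_measurable:
  assumes F: "\<And>l. l \<in> sig \<Longrightarrow> F l \<in> L2 lborel" "\<And>j. (\<lambda>l. L2_inner lborel (F l) (hs_basis j)) \<in> borel_measurable mu"
  shows "(\<lambda>l. nn2 lborel (F l :: real^'d \<Rightarrow> complex)) \<in> borel_measurable mu"
proof -
  have "(\<lambda>l. nn2 lborel (F l)) \<in> borel_measurable mu \<longleftrightarrow>
     (\<lambda>l. \<Sum>i. ennreal ((cmod (L2_inner lborel (F l) (hs_basis i)))\<^sup>2)) \<in> borel_measurable mu"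
    by (intro measurable_cong) (simp add: orthonormal_basis_nn2[OF hs_basis] F)
  also have "\<dots>" using F(2) by measurable
  finally show ?thesis .
qed

lemma hs_norm2_measurable:
  fixes \<Phi> :: "real^'k \<Rightarrow> (real^'d) operator"
  assumes F: "\<And>l i. l \<in> sig \<Longrightarrow> \<Phi> l (hs_basis i) \<in> L2 lborel" and m: "measurable_field mu \<Phi>"
  shows "(\<lambda>l. hs_norm2 lborel (\<Phi> l)) \<in> borel_measurable mu"
proof -
  have [measurable]: "(\<lambda>l. nn2 lborel (\<Phi> l (hs_basis i))) \<in> borel_measurable mu" for i
    by (rule nn2_measurable[where F = "\<lambda>l. \<Phi> l (hs_basis i)"]) (use F m in \<open>auto simp: measurable_field_def\<close>)
  have "(\<lambda>l. hs_norm2 lborel (\<Phi> l)) \<in> borel_measurable mu \<longleftrightarrow> (\<lambda>l. \<Sum>i. nn2 lborel (\<Phi> l (hs_basis i))) \<in> borel_measurable mu"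
    by (intro measurable_cong) (simp add: hs_norm2_eq F)
  also have "\<dots>" by measurable
  finally show ?thesis .
qed

text \<open>The integral stays over \<open>lebesgue\<close>, since \<open>f\<close> is measurable
  only with respect to the completed sigma-algebra.\<close>

lemma integral_mu:
  fixes f :: "real^'k \<Rightarrow> complex"
  assumes "f \<in> borel_measurable mu"
  shows "(LINT l|mu. f l) = (LINT l|lebesgue. indicator sig l * (of_real \<bar>det (Bm l)\<bar> * f l))"
    "(\<lambda>l. indicator sig l * (of_real \<bar>det (Bm l)\<bar> * f l)) \<in> borel_measurable lebesgue"
proof -
  have f: "f \<in> borel_measurable (lebesgue_on sig)" using assms by (simp add: measurable_mu)
  have si: "indicat_real sig l *\<^sub>R z = indicator sig l * z" for l and z :: complex by (simp add: indicator_def)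
  have d: "(\<lambda>l. \<bar>det (Bm l)\<bar>) \<in> borel_measurable (lebesgue_on sig)" by (rule borel_measurable_lebesgue_on) measurable
  have "(LINT l|mu. f l) = (LINT l|lebesgue_on sig. \<bar>det (Bm l)\<bar> *\<^sub>R f l)"
    unfolding mu_def by (rule integral_density) (use f d in auto)
  also have "\<dots> = (LINT l|lebesgue. indicator sig l *\<^sub>R (\<bar>det (Bm l)\<bar> *\<^sub>R f l))"
    by (rule integral_restrict_space) auto
  finally show "(LINT l|mu. f l) = (LINT l|lebesgue. indicator sig l * (of_real \<bar>det (Bm l)\<bar> * f l))"
    unfolding si by (simp only: scaleR_conv_of_real)
  have "(\<lambda>l. of_real \<bar>det (Bm l)\<bar> * f l) \<in> borel_measurable (lebesgue_on sig)"
    using f d by measurable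
  then have "(\<lambda>l. indicator sig l *\<^sub>R (of_real \<bar>det (Bm l)\<bar> * f l)) \<in> borel_measurable lebesgue"
    by (subst (asm) borel_measurable_restrict_space_iff) auto
  then show "(\<lambda>l. indicator sig l * (of_real \<bar>det (Bm l)\<bar> * f l)) \<in> borel_measurable lebesgue"
    by (simp only: si)
qed

text \<open>Up to conjugation, the integrals on the left are Fourier coefficients of the Lebesgue
  density \<open>|det (Bm l)|\<close> times \<open>F l\<close>. Parseval yields the square of the
  determinant against Lebesgue measure; one factor goes into \<open>mu\<close> and the other stays
  in the integrand.\<close>

lemma central_sum:
  fixes F :: "real^'k \<Rightarrow> complex" and M :: "real^'k^'k"
  assumes M: "det M \<noteq> 0" and F: "F \<in> borel_measurable mu"
    and fin: "(\<integral>\<^sup>+l. ennreal \<bar>det (Bm l)\<bar> * ennreal ((cmod (F l))\<^sup>2) \<partial>mu) < \<infinity>"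
    and supp: "\<And>l. l \<in> sig \<Longrightarrow> M *v l \<notin> ucube \<Longrightarrow> F l = 0"
  shows "(\<integral>\<^sup>+m. ennreal ((cmod (LINT l|mu. cnj (fchar m (M *v l)) * F l))\<^sup>2) \<partial>count_space int_lattice) =
    ennreal (1 / \<bar>det M\<bar>) * (\<integral>\<^sup>+l. ennreal \<bar>det (Bm l)\<bar> * ennreal ((cmod (F l))\<^sup>2) \<partial>mu)"
proof -
  define G where "G = (\<lambda>l. indicator sig l * (of_real \<bar>det (Bm l)\<bar> * cnj (F l)))"
  have cF: "(\<lambda>l. cnj (F l)) \<in> borel_measurable mu" using F by measurable
  have Gm: "G \<in> borel_measurable lebesgue" unfolding G_def by (rule integral_mu(2)[OF cF])
  have nG: "nn2 lebesgue G = (\<integral>\<^sup>+l. ennreal \<bar>det (Bm l)\<bar> * ennreal ((cmod (F l))\<^sup>2) \<partial>mu)"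
  proof -
    have dm: "(\<lambda>l. ennreal \<bar>det (Bm l)\<bar>) \<in> borel_measurable mu" by (rule measurable_mu_borel) measurable
    have "(\<integral>\<^sup>+l. ennreal \<bar>det (Bm l)\<bar> * ennreal ((cmod (F l))\<^sup>2) \<partial>mu) =
      (\<integral>\<^sup>+l. ennreal \<bar>det (Bm l)\<bar> * (ennreal \<bar>det (Bm l)\<bar> * ennreal ((cmod (F l))\<^sup>2)) \<partial>lborel)"
      by (rule nn_integral_mu) (use dm F in measurable)
    also have "\<dots> = nn2 lebesgue G"
      unfolding nn2_def nn_integral_completion
      by (intro nn_integral_cong)
         (auto simp: G_def sig_def indicator_def norm_mult power_mult_distrib ennreal_mult power2_eq_square mult_ac)
    finally show ?thesis by simp
  qed
  have eq: "cmod (LINT l|mu. cnj (fchar m (M *v l)) * F l) = cmod (LINT l|lebesgue. G l * fchar m (M *v l))" for m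
  proof -
    have fm: "(\<lambda>l. fchar m (M *v l)) \<in> borel_measurable mu" by (rule measurable_mu_borel) measurable
    have mm: "(\<lambda>l. fchar m (M *v l) * cnj (F l)) \<in> borel_measurable mu" using fm F by measurable
    have "cnj (LINT l|mu. cnj (fchar m (M *v l)) * F l) = (LINT l|mu. fchar m (M *v l) * cnj (F l))"
      by (simp flip: Bochner_Integration.integral_cnj)
    also have "\<dots> = (LINT l|lebesgue. G l * fchar m (M *v l))"
      unfolding integral_mu(1)[OF mm] G_def by (simp add: mult_ac)
    finally show ?thesis by (metis complex_mod_cnj)
  qed
  have "(\<integral>\<^sup>+m. ennreal ((cmod (LINT l|lebesgue. G l * fchar m (M *v l)))\<^sup>2) \<partial>count_space int_lattice) =
    ennreal (1 / \<bar>det M\<bar>) * nn2 lebesgue G"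
  proof (rule fourier_Parseval_lebesgue[OF M Gm _ int_lattice_0])
    show "nn2 lebesgue G < \<infinity>" using fin by (simp add: nG)
    show "G x = 0" if "M *v x - 0 \<notin> ucube" for x using supp[of x] that by (auto simp: G_def indicator_def)
  qed
  then show ?thesis by (simp add: eq nG)
qed

end

section \<open>The frame identity\<close>

lemma borel_measurable_count_space_integral:
  assumes "countable I" "\<And>i. i \<in> I \<Longrightarrow> f i \<in> borel_measurable M"
  shows "(\<lambda>x. \<integral>\<^sup>+i. f i x \<partial>count_space I) \<in> borel_measurable M"
proof -
  interpret sigma_finite_measure "count_space I"
    by (rule sigma_finite_measure_count_space_countable[OF assms(1)])
  have "(\<lambda>p. f (fst p) (snd p)) \<in> borel_measurable (count_space I \<Otimes>\<^sub>M M)"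
    by (rule measurable_pair_measure_countable1[OF assms(1)]) (simp add: assms(2))
  from measurable_pair_swap[OF this] have "(\<lambda>(x, i). f i x) \<in> borel_measurable (M \<Otimes>\<^sub>M count_space I)"
    by (simp add: case_prod_unfold)
  from borel_measurable_nn_integral[OF this] show ?thesis by simp
qed

lemma zero_operator: "hs_operator lborel (\<lambda>h x. 0)" "(\<lambda>h x. 0) \<in> hs_tensor lborel U"
  "hs_norm2 lborel (\<lambda>h x. 0) = 0"
proof -
  show *: "hs_norm2 lborel (\<lambda>h x. 0) = 0" by (simp add: hs_norm2_def)
  show "hs_operator lborel (\<lambda>h x. 0)"
    unfolding hs_operator_def * by (auto simp: bounded_operator_def intro!: exI[of _ 0])
  then show "(\<lambda>h x. 0) \<in> hs_tensor lborel U"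
    unfolding hs_tensor_def by (auto simp: * intro!: exI[of _ 0])
qed

lemma elem_tensor_mem:
  assumes f: "f \<in> L2 lborel" and u: "u \<in> U" "u \<in> L2 lborel"
  shows "hs_operator lborel (elem_tensor lborel f u)" "elem_tensor lborel f u \<in> hs_tensor lborel U"
proof -
  show *: "hs_operator lborel (elem_tensor lborel f u)"
    unfolding hs_operator_def using bounded_operator_elem_tensor[OF f u(2)] hs_norm2_elem_tensor[OF f u(2)] f u(2)
    by (simp add: L2_iff ennreal_mult_less_top)
  have "hs_norm2 lborel (\<lambda>h x. elem_tensor lborel f u h x - (\<Sum>i<(1::nat). elem_tensor lborel f u h x)) = 0"
    by (simp add: zero_operator(3))
  then have "\<exists>n f' u'. (\<forall>i<n. f' i \<in> L2 lborel \<and> u' i \<in> U) \<and>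
      hs_norm2 lborel (\<lambda>h x. elem_tensor lborel f u h x - (\<Sum>i<(n::nat). elem_tensor lborel (f' i) (u' i) h x)) < \<epsilon>"
    if "\<epsilon> > 0" for \<epsilon>
    using that f u by (intro exI[of _ 1] exI[of _ "\<lambda>_. f"] exI[of _ "\<lambda>_. u"]) auto
  then show "elem_tensor lborel f u \<in> hs_tensor lborel U" using * by (auto simp: hs_tensor_def)
qed

text \<open>Self-adjointness and idempotence give that the squared norm of \<open>P h\<close> is the
  inner product of \<open>h\<close> with \<open>P h\<close>, to which Cauchy-Schwarz
  applies.\<close>

lemma projection_nn2_le:
  assumes P: "orthogonal_projection lborel P" and h: "h \<in> L2 lborel"
  shows "nn2 lborel (P h) \<le> nn2 lborel h"
proof -
  have b: "bounded_operator lborel P" using P by (simp add: orthogonal_projection_def)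
  note PL = bounded_operatorD(1)[OF b]
  have "AE x in lborel. P (P h) x = P h x" using P h by (simp add: orthogonal_projection_def)
  then have "L2_inner lborel h (P (P h)) = L2_inner lborel h (P h)"
    using L2_measurable[OF h] L2_measurable[OF PL[OF h]] L2_measurable[OF PL[OF PL[OF h]]]
    by (intro L2_inner_cong_AE) auto
  moreover have "L2_inner lborel (P h) (P h) = L2_inner lborel h (P (P h))"
    using P h PL[OF h] by (simp add: orthogonal_projection_def)
  ultimately have "complex_of_real ((L2_norm lborel (P h))\<^sup>2) = L2_inner lborel h (P h)"
    by (simp add: L2_inner_self)
  then have "cmod (L2_inner lborel h (P h)) = (L2_norm lborel (P h))\<^sup>2" by (metis abs_of_nonneg norm_of_real zero_le_power2)
  then have "(L2_norm lborel (P h))\<^sup>2 \<le> L2_norm lborel h * L2_norm lborel (P h)"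
    using L2_Cauchy_Schwarz[OF h PL[OF h]] by simp
  then have "L2_norm lborel (P h) \<le> L2_norm lborel h"
    by (cases "L2_norm lborel (P h) = 0") (auto simp: power2_eq_square mult_le_cancel_right less_le)
  then have "(L2_norm lborel (P h))\<^sup>2 \<le> (L2_norm lborel h)\<^sup>2" by (intro power_mono) auto
  then show ?thesis by (simp add: nn2_L2 h PL ennreal_leI)
qed

text \<open>The frame hypothesis in coordinates. The translations act on the test function instead
  of the generator, so that \<open>isp_mulc\<close> describes their effect on the test field. The
  sum over the quasi-lattice is split into translations \<open>n\<close>, modulations
  \<open>k\<close> and central points \<open>m\<close>, with the central sum innermost.\<close>

locale frame_coords = weil_coords Bm for Bm :: "real^'k::finite \<Rightarrow> real^'d::finite^'d" +
  fixes phi :: "(real^'k) \<times> (real^'d) \<times> (real^'d) \<Rightarrow> complex"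
    and P :: "real^'k \<Rightarrow> (real^'d) operator" and a :: "real^'k" and q b :: "real^'d"
  assumes phi_L2: "phi \<in> L2 lborel"
    and proj: "\<And>l. l \<in> sig \<Longrightarrow> orthogonal_projection lborel (P l)"
    and P_meas: "measurable_field mu P"
    and image_sub: "\<And>\<Psi>. isp phi \<Psi> \<Longrightarrow> \<Psi> \<in> direct_integral mu (\<lambda>l. hs_tensor lborel (L2_range lborel (P l)))"
    and frame: "\<And>\<Psi>. \<Psi> \<in> direct_integral mu (\<lambda>l. hs_tensor lborel (L2_range lborel (P l))) \<Longrightarrow>
      \<exists>f. isp f \<Psi> \<and> (\<integral>\<^sup>+n. \<integral>\<^sup>+k. \<integral>\<^sup>+m. ennreal ((cmod (L2_inner lborel
          (\<lambda>w. f (mulc (dg (iv a) *v m, dg (iv q) *v k, dg (iv b) *v n) w)) phi))\<^sup>2)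
        \<partial>count_space int_lattice \<partial>count_space int_lattice \<partial>count_space int_lattice) = nn2 lborel f"
    and a_pos: "\<And>i. 0 < a $ i" and q_pos: "\<And>i. 0 < q $ i" and b_pos: "\<And>i. 0 < b $ i"
begin

abbreviation DI :: "(real^'k \<Rightarrow> (real^'d) operator) set" where
  "DI \<equiv> direct_integral mu (\<lambda>l. hs_tensor lborel (L2_range lborel (P l)))"

text \<open>Setting the transform to zero off \<open>sig\<close> and on an exceptional null set
  makes every \<open>\<Phi> l\<close> a Hilbert-Schmidt operator in the tensor space, so that
  computations at a single \<open>l\<close> need no exceptional set.\<close>

lemma normalized_transform:
  "\<exists>\<Phi>. isp phi \<Phi> \<and> (\<forall>l. hs_operator lborel (\<Phi> l) \<and> \<Phi> l \<in> hs_tensor lborel (L2_range lborel (P l)))"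
proof -
  obtain \<Phi>0 where i0: "isp phi \<Phi>0" using isp_exists[OF phi_L2] by blast
  have D0: "\<Phi>0 \<in> DI" by (rule image_sub[OF i0])
  then have "AE l in mu. hs_operator lborel (\<Phi>0 l) \<and> \<Phi>0 l \<in> hs_tensor lborel (L2_range lborel (P l))"
    and m0: "measurable_field mu \<Phi>0" by (auto simp: direct_integral_def)
  then obtain N where N: "N \<in> null_sets mu"
    "\<And>l. l \<in> sig \<Longrightarrow> l \<notin> N \<Longrightarrow> hs_operator lborel (\<Phi>0 l) \<and> \<Phi>0 l \<in> hs_tensor lborel (L2_range lborel (P l))"
    unfolding eventually_ae_filter by auto
  define \<Phi> where "\<Phi> = (\<lambda>l. if l \<in> N \<or> l \<notin> sig then (\<lambda>h x. 0) else \<Phi>0 l)"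
  have all: "hs_operator lborel (\<Phi> l) \<and> \<Phi> l \<in> hs_tensor lborel (L2_range lborel (P l))" for l
    using N(2) zero_operator by (auto simp: \<Phi>_def)
  have eq: "AE l in mu. \<Phi> l = \<Phi>0 l"
    using AE_not_in[OF N(1)] AE_space by eventually_elim (auto simp: \<Phi>_def)
  have m: "measurable_field mu \<Phi>"
    unfolding measurable_field_def
  proof (intro ballI)
    fix u v :: "real^'d \<Rightarrow> complex" assume "u \<in> L2 lborel" "v \<in> L2 lborel"
    then have "(\<lambda>l. L2_inner lborel (\<Phi>0 l u) v) \<in> borel_measurable mu" using m0 by (simp add: measurable_field_def)
    moreover have "N \<in> sets mu" using N(1) by auto
    ultimately have "(\<lambda>l. if l \<in> N then 0 else L2_inner lborel (\<Phi>0 l u) v) \<in> borel_measurable mu" by measurable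
    then show "(\<lambda>l. L2_inner lborel (\<Phi> l u) v) \<in> borel_measurable mu"
      by (rule measurable_cong[THEN iffD1, rotated]) (auto simp: \<Phi>_def)
  qed
  have "(\<integral>\<^sup>+l. hs_norm2 lborel (\<Phi> l) \<partial>mu) = (\<integral>\<^sup>+l. hs_norm2 lborel (\<Phi>0 l) \<partial>mu)"
    using eq by (intro nn_integral_cong_AE) auto
  then have D: "\<Phi> \<in> direct_integral mu (\<lambda>_. Collect (hs_operator lborel))"
    using D0 m all by (simp add: direct_integral_def)
  have "(\<integral>\<^sup>+l. hs_norm2 lborel (\<lambda>h x. ir g l h x - \<Phi> l h x) \<partial>mu) = (\<integral>\<^sup>+l. hs_norm2 lborel (\<lambda>h x. ir g l h x - \<Phi>0 l h x) \<partial>mu)" for g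
    using eq by (intro nn_integral_cong_AE) auto
  then have "isp phi \<Phi>" using i0 D unfolding isp_def by simp
  then show ?thesis using all by blast
qed

text \<open>A fundamental domain for the Fourier series in \<open>l\<close> attached to the central
  lattice points: the half-open box with sides \<open>a\<close>.\<close>

definition cell :: "(real^'k) set" where "cell = {l. dg (iv a) *v l \<in> ucube}"

lemma cell_borel [measurable]: "cell \<in> sets borel"
  unfolding cell_def by measurable

lemma cell_subset: "cell \<subseteq> cbox 0 a"
proof
  fix l assume l: "l \<in> cell"
  have "0 \<le> l $ i \<and> l $ i \<le> a $ i" for i
  proof -
    have "(dg (iv a) *v l) \<bullet> axis i 1 = l $ i / a $ i"
      by (simp add: dg_mult iv_def inner_axis divide_inverse mult.commute)
    moreover have "axis i 1 \<in> (Basis :: (real^'k) set)" by (auto simp: Basis_vec_def intro: exI[of _ i])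
    ultimately have "0 \<le> l $ i / a $ i" "l $ i / a $ i < 1"
      using l unfolding cell_def ucube_def by (metis (mono_tags, lifting) mem_Collect_eq)+
    then show ?thesis using a_pos[of i] by (simp add: zero_le_divide_iff pos_divide_less_eq less_imp_le)
  qed
  then show "l \<in> cbox 0 a" by (simp add: mem_box_cart)
qed

lemma emeasure_cell: "emeasure lborel cell < \<infinity>"
  by (rule emeasure_bounded_finite) (rule bounded_subset[OF bounded_cbox cell_subset])

lemma det_bounded_cell: "\<exists>D\<ge>0. \<forall>l\<in>cell. \<bar>det (Bm l)\<bar> \<le> D"
proof -
  have "compact ((\<lambda>l. det (Bm l)) ` cbox 0 a)"
    by (intro compact_continuous_image continuous_on_subset[OF continuous_det_Bm]) auto
  then obtain D where "\<forall>x\<in>(\<lambda>l. det (Bm l)) ` cbox 0 a. norm x \<le> D"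
    using compact_imp_bounded bounded_iff by metis
  then have "\<forall>l\<in>cell. \<bar>det (Bm l)\<bar> \<le> max 0 D" using cell_subset by fastforce
  then show ?thesis by (intro exI[of _ "max 0 D"]) auto
qed

definition pa :: real where "pa = (\<Prod>i\<in>UNIV. a $ i)"
definition pq :: real where "pq = (\<Prod>i\<in>UNIV. q $ i)"
definition pb :: real where "pb = (\<Prod>i\<in>UNIV. b $ i)"

lemma prods_pos: "pa > 0" "pq > 0" "pb > 0"
  by (auto simp: pa_def pq_def pb_def intro!: prod_pos a_pos q_pos b_pos)

lemma det_iv: "det (dg (iv a)) = 1 / pa" "det (dg (iv q)) = 1 / pq"
  by (simp_all add: det_dg prod_iv pa_def pq_def inverse_eq_divide)

lemma sets_mu_subset: "S \<in> sets mu \<Longrightarrow> S \<subseteq> sig"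
  using sets.sets_into_space[of S mu] by simp

lemma det_measurable_mu [measurable]: "(\<lambda>l. det (Bm l)) \<in> borel_measurable mu"
  by (rule measurable_mu_borel) measurable

text \<open>A bound on the Lebesgue density suffices because \<open>cell\<close> has finite volume.
  It serves to show that test fields belong to the direct integral and that the integrals to be
  compared are finite.\<close>

lemma nn_integral_mu_le_cell:
  assumes S: "S \<in> sets mu" "S \<subseteq> cell" and h: "h \<in> borel_measurable mu"
    and le: "\<And>l. l \<in> S \<Longrightarrow> ennreal \<bar>det (Bm l)\<bar> * h l \<le> ennreal C"
  shows "(\<integral>\<^sup>+l. indicator S l * h l \<partial>mu) < \<infinity>"
proof -
  have "(\<integral>\<^sup>+l. indicator S l * h l \<partial>mu) = (\<integral>\<^sup>+l. ennreal \<bar>det (Bm l)\<bar> * (indicator S l * h l) \<partial>lborel)"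
    by (rule nn_integral_mu) (use S h in measurable)
  also have "\<dots> \<le> (\<integral>\<^sup>+l. ennreal C * indicator cell l \<partial>lborel)"
    using S(2) le by (intro nn_integral_mono) (auto simp: indicator_def)
  also have "\<dots> = ennreal C * emeasure lborel cell" by (simp add: nn_integral_cmult)
  also have "\<dots> < \<infinity>" using emeasure_cell by (simp add: ennreal_mult_less_top)
  finally show ?thesis .
qed

end

section \<open>The norm bound from central translations\<close>

locale frame_field = frame_coords Bm phi P a q b
  for Bm :: "real^'k::finite \<Rightarrow> real^'d::finite^'d" and phi P a q b +
  fixes \<Phi> :: "real^'k \<Rightarrow> (real^'d) operator"
  assumes isp_phi: "isp phi \<Phi>"
    and Phi_hs: "\<And>l. hs_operator lborel (\<Phi> l)"
    and Phi_tensor: "\<And>l. \<Phi> l \<in> hs_tensor lborel (L2_range lborel (P l))"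
begin

lemma Phi_bounded: "bounded_operator lborel (\<Phi> l)"
  using Phi_hs by (simp add: hs_operator_def)

lemma Phi_L2: "h \<in> L2 lborel \<Longrightarrow> \<Phi> l h \<in> L2 lborel"
  by (rule bounded_operatorD(1)[OF Phi_bounded])

lemma Phi_measurable: "measurable_field mu \<Phi>"
  using isp_phi by (auto simp: isp_def direct_integral_def)

text \<open>The square of the Hilbert-Schmidt norm, as a real number.\<close>

definition nrm :: "real^'k \<Rightarrow> real" where "nrm l = enn2real (hs_norm2 lborel (\<Phi> l))"

lemma hs_norm2_Phi: "hs_norm2 lborel (\<Phi> l) = ennreal (nrm l)"
  using Phi_hs[of l] by (simp add: nrm_def hs_operator_def less_top)

lemma nrm_nonneg [simp]: "0 \<le> nrm l" by (simp add: nrm_def)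

lemma nrm_measurable [measurable]: "nrm \<in> borel_measurable mu"
proof -
  have "(\<lambda>l. hs_norm2 lborel (\<Phi> l)) \<in> borel_measurable mu"
    by (rule hs_norm2_measurable) (auto simp: Phi_L2 Phi_measurable)
  then show ?thesis unfolding nrm_def[abs_def] by measurable
qed

text \<open>The test field is \<open>\<Phi>\<close> cut off to \<open>S\<close>. Central
  translations multiply it by scalar characters, so its pairings with \<open>\<Phi>\<close> are
  Fourier coefficients built from \<open>nrm\<close>, and the full frame sum dominates the part over
  central points. The bound \<open>j\<close> ensures that the integrals are finite.\<close>

lemma central_inequality:
  assumes S: "S \<in> sets mu" "S \<subseteq> cell" and j: "\<And>l. l \<in> S \<Longrightarrow> \<bar>det (Bm l)\<bar> * nrm l \<le> j" "j \<ge> 0"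
  shows "ennreal pa * (\<integral>\<^sup>+l. indicator S l * ennreal (\<bar>det (Bm l)\<bar> * (nrm l)\<^sup>2) \<partial>mu) \<le> (\<integral>\<^sup>+l. indicator S l * ennreal (nrm l) \<partial>mu)"
    "(\<integral>\<^sup>+l. indicator S l * ennreal (nrm l) \<partial>mu) < \<infinity>"
proof -
  note [measurable] = S(1)
  show fin: "(\<integral>\<^sup>+l. indicator S l * ennreal (nrm l) \<partial>mu) < \<infinity>"
    by (rule nn_integral_mu_le_cell[OF S, of _ j]) (use j in \<open>auto simp: ennreal_leI simp flip: ennreal_mult\<close>)
  define \<Psi> where "\<Psi> = (\<lambda>l h x. indicator S l * \<Phi> l h x)"
  have \<Psi>_cases: "\<Psi> l = (if l \<in> S then \<Phi> l else (\<lambda>h x. 0))" for l by (auto simp: \<Psi>_def fun_eq_iff)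
  have \<Psi>n: "hs_norm2 lborel (\<Psi> l) = indicator S l * ennreal (nrm l)" for l
    by (auto simp: \<Psi>_cases zero_operator hs_norm2_Phi)
  have inner\<Psi>: "L2_inner lborel (\<Psi> l u) v = indicator S l * L2_inner lborel (\<Phi> l u) v" for l u v
    unfolding \<Psi>_def by (rule L2_inner_scale_left)
  have \<Psi>m: "measurable_field mu \<Psi>"
    unfolding measurable_field_def inner\<Psi> using Phi_measurable S(1) unfolding measurable_field_def
    by (auto intro!: borel_measurable_times borel_measurable_indicator)
  have "\<Psi> \<in> DI"
    unfolding direct_integral_def using \<Psi>m fin
    by (auto simp: \<Psi>n) (auto simp: \<Psi>_cases zero_operator Phi_hs Phi_tensor)
  then obtain f where f: "isp f \<Psi>" and fr: "(\<integral>\<^sup>+n. \<integral>\<^sup>+k. \<integral>\<^sup>+m. ennreal ((cmod (L2_inner lborel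
          (\<lambda>w. f (mulc (dg (iv a) *v m, dg (iv q) *v k, dg (iv b) *v n) w)) phi))\<^sup>2)
        \<partial>count_space int_lattice \<partial>count_space int_lattice \<partial>count_space int_lattice) = nn2 lborel f"
    using frame by blast
  \<comment> \<open>The pairing of the cut-off field with \<open>\<Phi>\<close> at \<open>l\<close>,
    before multiplication by a character.\<close>
  define F where "F = (\<lambda>l. indicator S l * complex_of_real (nrm l))"
  have Fm: "F \<in> borel_measurable mu" unfolding F_def by measurable
  have pairing: "L2_inner lborel (\<lambda>w. f (mulc (dg (iv a) *v m, 0, 0) w)) phi = (LINT l|mu. cnj (fchar m (dg (iv a) *v l)) * F l)" for m
  proof -
    let ?\<gamma> = "(dg (iv a) *v m, 0, 0) :: (real^'k) \<times> (real^'d) \<times> (real^'d)"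
    have sym: "l \<bullet> (dg (iv a) *v m) = m \<bullet> (dg (iv a) *v l)" for l by (simp add: dg_mult inner_vec_def mult_ac)
    have pi: "piinv l ?\<gamma> G = (\<lambda>x. cnj (fchar m (dg (iv a) *v l)) * G x)" for l G
      by (auto simp: piinv_def fun_eq_iff fchar_def cis_cnj sym)
    have fm: "(\<lambda>l. cnj (fchar m (dg (iv a) *v l))) \<in> borel_measurable mu"
      by (rule measurable_mu_borel) measurable
    have "measurable_field mu (\<lambda>l h. piinv l ?\<gamma> (\<Psi> l h))"
      unfolding pi measurable_field_def L2_inner_scale_left using \<Psi>m unfolding measurable_field_def
      by (auto intro!: borel_measurable_times fm)
    from isp_mulc[OF f this] have i: "isp (\<lambda>w. f (mulc ?\<gamma> w)) (\<lambda>l h. piinv l ?\<gamma> (\<Psi> l h))" .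
    have "(LINT ij|count_space UNIV. mat (\<lambda>l h. piinv l ?\<gamma> (\<Psi> l h)) (ij, l) * cnj (mat \<Phi> (ij, l))) =
      cnj (fchar m (dg (iv a) *v l)) * F l" for l
    proof -
      have "mat (\<lambda>l h. piinv l ?\<gamma> (\<Psi> l h)) (ij, l) =
        (cnj (fchar m (dg (iv a) *v l)) * indicator S l) * L2_inner lborel (\<Phi> l (hs_basis (fst ij))) (hs_basis (snd ij))" for ij
        by (simp add: mat_def pi L2_inner_scale_left inner\<Psi>)
      then show ?thesis
        using hs_norm2_pairing[OF Phi_bounded, of l "cnj (fchar m (dg (iv a) *v l)) * indicator S l"]
        by (simp add: mat_def F_def hs_norm2_Phi mult.assoc)
    qed
    then show ?thesis using isp_inner_integral(1)[OF i isp_phi] by simp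
  qed
  have detFn: "ennreal \<bar>det (Bm l)\<bar> * ennreal ((cmod (F l))\<^sup>2) = indicator S l * ennreal (\<bar>det (Bm l)\<bar> * (nrm l)\<^sup>2)" for l
    by (auto simp: F_def indicator_def norm_mult ennreal_mult)
  have "(\<integral>\<^sup>+l. indicator S l * ennreal (\<bar>det (Bm l)\<bar> * (nrm l)\<^sup>2) \<partial>mu) \<le> (\<integral>\<^sup>+l. ennreal j * (indicator S l * ennreal (nrm l)) \<partial>mu)"
  proof (rule nn_integral_mono)
    fix l
    have "\<bar>det (Bm l)\<bar> * (nrm l)\<^sup>2 \<le> j * nrm l" if "l \<in> S"
      using mult_right_mono[OF j(1)[OF that], of "nrm l"] by (simp add: power2_eq_square mult.assoc)
    then show "indicator S l * ennreal (\<bar>det (Bm l)\<bar> * (nrm l)\<^sup>2) \<le> ennreal j * (indicator S l * ennreal (nrm l))"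
      using j(2) by (auto simp: indicator_def ennreal_leI simp flip: ennreal_mult)
  qed
  also have "\<dots> = ennreal j * (\<integral>\<^sup>+l. indicator S l * ennreal (nrm l) \<partial>mu)"
    by (rule nn_integral_cmult) measurable
  also have "\<dots> < \<infinity>" using fin by (simp add: ennreal_mult_less_top)
  finally have fin2: "(\<integral>\<^sup>+l. indicator S l * ennreal (\<bar>det (Bm l)\<bar> * (nrm l)\<^sup>2) \<partial>mu) < \<infinity>" .
  have "ennreal (1 / \<bar>det (dg (iv a))\<bar>) * (\<integral>\<^sup>+l. ennreal \<bar>det (Bm l)\<bar> * ennreal ((cmod (F l))\<^sup>2) \<partial>mu) =
    (\<integral>\<^sup>+m. ennreal ((cmod (LINT l|mu. cnj (fchar m (dg (iv a) *v l)) * F l))\<^sup>2) \<partial>count_space int_lattice)"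
  proof (rule central_sum[symmetric, OF _ Fm])
    show "det (dg (iv a)) \<noteq> 0" using prods_pos by (simp add: det_iv)
    show "(\<integral>\<^sup>+l. ennreal \<bar>det (Bm l)\<bar> * ennreal ((cmod (F l))\<^sup>2) \<partial>mu) < \<infinity>" unfolding detFn by (rule fin2)
    show "F l = 0" if "dg (iv a) *v l \<notin> ucube" for l
    proof -
      have "l \<notin> S" using that S(2) by (auto simp: cell_def)
      then show ?thesis by (simp add: F_def)
    qed
  qed
  also have "\<dots> = (\<integral>\<^sup>+m. ennreal ((cmod (L2_inner lborel
          (\<lambda>w. f (mulc (dg (iv a) *v m, dg (iv q) *v 0, dg (iv b) *v 0) w)) phi))\<^sup>2) \<partial>count_space int_lattice)"
    by (simp add: pairing)
  \<comment> \<open>Enlarges the sum from the single modulation \<open>k = 0\<close> to all of them;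
    the next step does the same for the translations.\<close>
  also have "\<dots> \<le> (\<integral>\<^sup>+k. \<integral>\<^sup>+m. ennreal ((cmod (L2_inner lborel
          (\<lambda>w. f (mulc (dg (iv a) *v m, dg (iv q) *v k, dg (iv b) *v 0) w)) phi))\<^sup>2) \<partial>count_space int_lattice \<partial>count_space int_lattice)"
    by (rule nn_integral_ge_point[where x = 0]) simp
  also have "\<dots> \<le> (\<integral>\<^sup>+n. \<integral>\<^sup>+k. \<integral>\<^sup>+m. ennreal ((cmod (L2_inner lborel
          (\<lambda>w. f (mulc (dg (iv a) *v m, dg (iv q) *v k, dg (iv b) *v n) w)) phi))\<^sup>2) \<partial>count_space int_lattice \<partial>count_space int_lattice \<partial>count_space int_lattice)"
    by (rule nn_integral_ge_point[where x = 0]) simp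
  also have "\<dots> = (\<integral>\<^sup>+l. indicator S l * ennreal (nrm l) \<partial>mu)"
    unfolding fr isp_norm[OF f] \<Psi>n ..
  finally show "ennreal pa * (\<integral>\<^sup>+l. indicator S l * ennreal (\<bar>det (Bm l)\<bar> * (nrm l)\<^sup>2) \<partial>mu) \<le> (\<integral>\<^sup>+l. indicator S l * ennreal (nrm l) \<partial>mu)"
    using prods_pos by (simp add: detFn det_iv)
qed

text \<open>On a set where \<open>w\<close> is at least some \<open>cj > 1\<close>, the central
  inequality reads \<open>cj * J \<le> J\<close> for the finite integral \<open>J\<close> of
  \<open>nrm\<close>. So \<open>J = 0\<close> and \<open>nrm\<close> vanishes almost everywhere
  there, which contradicts \<open>w > 1\<close>.\<close>

lemma norm_bound: "AE l in mu. l \<in> cell \<longrightarrow> pa * \<bar>det (Bm l)\<bar> * nrm l \<le> 1"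
proof -
  define w where "w = (\<lambda>l. pa * \<bar>det (Bm l)\<bar> * nrm l)"
  have [measurable]: "w \<in> borel_measurable mu" unfolding w_def by measurable
  \<comment> \<open>The lower bound supplies the factor larger than 1 and the upper bound makes the
    integrals finite. Over all \<open>j\<close> these sets exhaust the part of \<open>cell\<close>
    in \<open>sig\<close> where \<open>w > 1\<close>.\<close>
  define S where "S = (\<lambda>j::nat. {l \<in> space mu. l \<in> cell \<and> 1 + 1 / real (Suc j) \<le> w l \<and> w l \<le> real j})"
  have cm: "Measurable.pred mu (\<lambda>l. l \<in> cell)"
  proof -
    have "indicator cell \<in> borel_measurable mu" by (rule measurable_mu_borel) measurable
    then have "Measurable.pred mu (\<lambda>l. indicator cell l = (1::real))" by measurable
    then show ?thesis by (simp add: indicator_eq_1_iff)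
  qed
  have Sm: "S j \<in> sets mu" for j unfolding S_def using cm by measurable
  have "AE l in mu. l \<notin> S j" for j
  proof -
    note [measurable] = Sm[of j]
    have sub: "S j \<subseteq> cell" by (auto simp: S_def)
    have bound: "\<bar>det (Bm l)\<bar> * nrm l \<le> real j / pa" if "l \<in> S j" for l
      using that prods_pos by (simp add: S_def w_def pos_le_divide_eq mult_ac)
    define J where "J = (\<integral>\<^sup>+l. indicator (S j) l * ennreal (nrm l) \<partial>mu)"
    note ci = central_inequality[OF Sm sub bound, folded J_def]
    have fin: "J < \<infinity>" using ci(2) prods_pos by simp
    define cj where "cj = 1 + 1 / real (Suc j)"
    have cj: "cj > 1" by (simp add: cj_def)
    have "ennreal cj * J = (\<integral>\<^sup>+l. ennreal cj * (indicator (S j) l * ennreal (nrm l)) \<partial>mu)"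
      unfolding J_def by (rule nn_integral_cmult[symmetric]) measurable
    also have "\<dots> \<le> (\<integral>\<^sup>+l. ennreal pa * (indicator (S j) l * ennreal (\<bar>det (Bm l)\<bar> * (nrm l)\<^sup>2)) \<partial>mu)"
    proof (rule nn_integral_mono)
      fix l
      have "cj * nrm l \<le> pa * (\<bar>det (Bm l)\<bar> * (nrm l)\<^sup>2)" if "l \<in> S j"
      proof -
        have "cj * nrm l \<le> w l * nrm l"
          using that by (intro mult_right_mono) (auto simp: S_def cj_def)
        then show ?thesis by (simp add: w_def power2_eq_square mult.assoc)
      qed
      then show "ennreal cj * (indicator (S j) l * ennreal (nrm l))
         \<le> ennreal pa * (indicator (S j) l * ennreal (\<bar>det (Bm l)\<bar> * (nrm l)\<^sup>2))"
        using prods_pos cj by (auto simp: indicator_def ennreal_leI simp flip: ennreal_mult)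
    qed
    also have "\<dots> = ennreal pa * (\<integral>\<^sup>+l. indicator (S j) l * ennreal (\<bar>det (Bm l)\<bar> * (nrm l)\<^sup>2) \<partial>mu)"
      by (rule nn_integral_cmult) measurable
    also have "\<dots> \<le> J" using ci(1) prods_pos by simp
    finally have le: "ennreal cj * J \<le> J" .
    obtain r where r: "J = ennreal r" "r \<ge> 0" using fin by (cases J) auto
    have "r = 0"
    proof -
      have "cj * r \<le> r" using le r cj by (simp flip: ennreal_mult)
      then have "(cj - 1) * r \<le> 0" by (simp add: left_diff_distrib)
      then show ?thesis using r(2) cj by (simp add: mult_le_0_iff)
    qed
    then have "(\<integral>\<^sup>+l. indicator (S j) l * ennreal (nrm l) \<partial>mu) = 0" using r J_def by simp
    then have "AE l in mu. indicator (S j) l * ennreal (nrm l) = 0"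
      by (subst (asm) nn_integral_0_iff_AE) measurable
    then show ?thesis
    proof eventually_elim
      case (elim l)
      show ?case
      proof
        assume l: "l \<in> S j"
        then have "nrm l = 0" using elim by (simp add: ennreal_eq_0_iff order_antisym)
        then show False using l by (simp add: S_def w_def)
          (smt (verit) divide_nonneg_nonneg of_nat_0_le_iff)
      qed
    qed
  qed
  then have "AE l in mu. \<forall>j. l \<notin> S j" by (simp add: AE_all_countable)
  then show ?thesis using AE_space
  proof eventually_elim
    case (elim l)
    show ?case
    proof
      assume c: "l \<in> cell"
      show "pa * \<bar>det (Bm l)\<bar> * nrm l \<le> 1"
      proof (rule ccontr)
        assume "\<not> ?thesis"
        then have w: "w l > 1" by (simp add: w_def)
        obtain j1 :: nat where j1: "w l \<le> real j1" using real_arch_simple by blast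
        obtain j2 :: nat where j2: "inverse (real (Suc j2)) < w l - 1" using reals_Archimedean[of "w l - 1"] w by auto
        let ?j = "max j1 j2"
        have "1 / real (Suc ?j) \<le> inverse (real (Suc j2))" by (simp add: inverse_eq_divide frac_le)
        then have "1 + 1 / real (Suc ?j) \<le> w l" using j2 by linarith
        moreover have "w l \<le> real ?j" using j1 by linarith
        ultimately have "l \<in> S ?j" using c elim(2) by (simp add: S_def)
        then show False using elim(1) by blast
      qed
    qed
  qed
qed

end

lemma int_lattice_uminus_bij: "bij_betw uminus int_lattice int_lattice"
  by (rule bij_betwI[where g = uminus]) (auto intro: int_lattice_uminus)

section \<open>Windows and Gabor coefficients at a fixed functional\<close>

context frame_field
begin

text \<open>Up to conjugation, the modulation with index \<open>k\<close> is multiplication by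
  \<open>fchar k (Mq l *v x)\<close>. The preimages of the lattice cubes under \<open>Mq l\<close>
  are therefore the tiles on which the modulations form an orthogonal basis.\<close>

definition Mq :: "real^'k \<Rightarrow> real^'d^'d" where
  "Mq l = dg (iv q) ** transpose (Bm l)"

text \<open>The part of the translation cell, a box with sides \<open>1 / b_i\<close>, that lies in
  the tile number \<open>r\<close>. For fixed \<open>l\<close> the windows with \<open>r\<close> in
  \<open>int_lattice\<close> partition the cell.\<close>

definition win :: "real^'d \<Rightarrow> real^'k \<Rightarrow> real^'d \<Rightarrow> complex" where
  "win r l x = indicator {x. dg b *v x \<in> ucube \<and> Mq l *v x - r \<in> ucube} x"

lemma Mq_mult: "Mq l *v x = dg (iv q) *v (transpose (Bm l) *v x)"
  by (simp only: Mq_def matrix_vector_mul_assoc)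

lemma det_Mq: "det (Mq l) = det (Bm l) / pq"
  by (simp add: Mq_def det_mul det_transpose det_iv)

lemma Mq_measurable [measurable]:
  assumes [measurable]: "f \<in> borel_measurable M" "g \<in> borel_measurable M"
  shows "(\<lambda>w. Mq (f w) *v g w) \<in> borel_measurable M"
  unfolding Mq_mult by measurable

lemma win_eq: "win r l x = indicator ucube (dg b *v x) * indicator ucube (Mq l *v x - r)"
  by (simp add: win_def indicator_def)

lemma win_measurable [measurable]:
  assumes [measurable]: "f \<in> borel_measurable M" "g \<in> borel_measurable M"
  shows "(\<lambda>w. win r (f w) (g w)) \<in> borel_measurable M"
  unfolding win_eq by measurable

lemma ennreal_win: "ennreal ((cmod (win r l x))\<^sup>2) = indicator ucube (dg b *v x) * indicator ucube (Mq l *v x - r)"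
  by (simp add: win_def indicator_def)

lemma cnj_win: "cnj (win r l x) = win r l x"
  by (simp add: win_def indicator_def)

lemma nn_box: "(\<integral>\<^sup>+x. indicator ucube (dg b *v x) \<partial>lborel) = ennreal (1 / pb)"
proof -
  have "ennreal pb * (\<integral>\<^sup>+x. indicator ucube (dg b *v x) \<partial>lborel) = 1"
    using nn_integral_linear[of "(*v) (dg b)" "indicator ucube"] prods_pos
    by (simp add: det_dg flip: pb_def)
  then show ?thesis
    using prods_pos
    by (metis ennreal_eq_0_iff ennreal_1 ennreal_mult_divide_eq ennreal_neq_top divide_ennreal linorder_not_le mult.commute zero_le_one)
qed

lemma nn2_win_le: "nn2 lborel (win r l) \<le> ennreal (1 / pb)"
proof -
  have "nn2 lborel (win r l) \<le> (\<integral>\<^sup>+x. indicator ucube (dg b *v x) \<partial>lborel)"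
    unfolding nn2_def ennreal_win by (intro nn_integral_mono) (simp add: indicator_def)
  then show ?thesis by (simp add: nn_box)
qed

lemma win_L2: "win r l \<in> L2 lborel"
  using nn2_win_le[of r l] by (auto simp: L2_iff intro: le_less_trans)

lemma nn2_win_sum: "(\<integral>\<^sup>+r. nn2 lborel (win r l) \<partial>count_space int_lattice) = ennreal (1 / pb)"
  unfolding nn2_def ennreal_win nn_box[symmetric]
  by (rule nn_integral_lattice[symmetric]) measurable

lemma nn2_win_measurable: "(\<lambda>l. nn2 lborel (win r l)) \<in> borel_measurable mu"
  unfolding nn2_def by (rule measurable_mu_borel) measurable

text \<open>The Gabor coefficient between a window and the \<open>i\<close>-th column of
  \<open>\<Phi> l\<close>. The central part of the lattice point is set to zero, since it
  contributes only a character in \<open>l\<close>.\<close>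

definition cf :: "nat \<Rightarrow> real^'d \<Rightarrow> real^'d \<Rightarrow> real^'d \<Rightarrow> real^'k \<Rightarrow> complex" where
  "cf i r n k l = L2_inner lborel (piinv l (0, dg (iv q) *v k, dg (iv b) *v n) (win r l)) (\<Phi> l (hs_basis i))"

lemma piinv_win_measurable:
  "(\<lambda>(l, x). piinv l \<gamma> (win r l) x) \<in> borel_measurable (borel \<Otimes>\<^sub>M borel)"
  unfolding piinv_def inner_matrix_transpose by measurable

lemma inner_piinv_win_measurable:
  assumes "v \<in> L2 lborel"
  shows "(\<lambda>l. L2_inner lborel (piinv l \<gamma> (win r l)) v) \<in> borel_measurable mu"
proof (rule measurable_mu_borel)
  have [measurable]: "v \<in> borel_measurable borel" using L2_measurable[OF assms] by simp
  note [measurable] = piinv_win_measurable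
  show "(\<lambda>l. L2_inner lborel (piinv l \<gamma> (win r l)) v) \<in> borel_measurable borel"
    unfolding L2_inner_def by measurable
qed

lemma cf_measurable: "cf i r n k \<in> borel_measurable mu"
  unfolding cf_def[abs_def]
  by (rule inner_measurable)
     (use Phi_measurable in \<open>auto simp: measurable_field_def inner_piinv_win_measurable L2_piinv win_L2 Phi_L2\<close>)

text \<open>For fixed \<open>l\<close>: the Gabor system with lattice \<open>B(l)(\<int>/q) \<times> \<int>/b\<close>, tested on windows supported in one
  fundamental domain of the dual lattice of the modulations.\<close>

lemma gabor_modulation_sum:
  assumes l: "l \<in> sig" and r: "r \<in> int_lattice"
  shows "(\<integral>\<^sup>+k. ennreal ((cmod (cf i r n k l))\<^sup>2) \<partial>count_space int_lattice) =
    ennreal (pq / \<bar>det (Bm l)\<bar>) * nn2 lborel (\<lambda>x. win r l x * \<Phi> l (hs_basis i) (x - dg (iv b) *v n))"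
proof -
  define \<psi> where "\<psi> = \<Phi> l (hs_basis i)"
  have \<psi>: "\<psi> \<in> L2 lborel" by (simp add: \<psi>_def Phi_L2)
  have [measurable]: "\<psi> \<in> borel_measurable borel" using L2_measurable[OF \<psi>] by simp
  define t where "t = dg (iv b) *v n"
  \<comment> \<open>After a shift of the integration variable the translation falls on the column of
    \<open>\<Phi> l\<close> and the modulation becomes a character on one tile, in which
    \<open>G\<close> is supported.\<close>
  define G where "G = (\<lambda>x. win r l x * \<psi> (x - t))"
  have G: "G \<in> L2 lborel"
  proof -
    have "nn2 lborel (\<lambda>x. \<psi> (x + - t)) = nn2 lborel \<psi>"
      unfolding nn2_def by (rule lborel_shift[where f = "\<lambda>x. ennreal ((cmod (\<psi> x))\<^sup>2)"]) measurable
    then have "(\<lambda>x. \<psi> (x - t)) \<in> L2 lborel" using \<psi> by (simp add: L2_iff)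
    then show ?thesis unfolding G_def by (rule L2_bounded_mult[where C = 1]) (auto simp: win_def indicator_def)
  qed
  have "cmod (cf i r n k l) = cmod (LINT x|lborel. G x * fchar k (Mq l *v x))" for k
  proof -
    let ?h = "\<lambda>x. cis (- (2 * pi * (x \<bullet> (Bm l *v (dg (iv q) *v k))))) * win r l x * cnj (\<psi> (x - t))"
    have hm: "?h \<in> borel_measurable borel" by measurable
    have "cf i r n k l = (LINT x|lborel. ?h (x + t))"
      unfolding cf_def L2_inner_def by (simp add: piinv_def t_def \<psi>_def)
    also have "\<dots> = (LINT x|lborel. ?h x)" by (rule integral_shift[OF hm])
    also have "\<dots> = cnj (LINT x|lborel. G x * fchar k (Mq l *v x))"
    proof -
      have "x \<bullet> (Bm l *v (dg (iv q) *v k)) = k \<bullet> (Mq l *v x)" for x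
      proof -
        have "x \<bullet> (Bm l *v (dg (iv q) *v k)) = (transpose (Bm l) *v x) \<bullet> (dg (iv q) *v k)"
          by (rule inner_matrix_transpose)
        also have "\<dots> = (Mq l *v x) \<bullet> k" by (simp only: inner_dg Mq_mult)
        finally show ?thesis by (simp only: inner_commute)
      qed
      then have "?h x = cnj (G x * fchar k (Mq l *v x))" for x
        by (simp add: G_def fchar_def cis_cnj cnj_win)
      then show ?thesis by (simp only: Bochner_Integration.integral_cnj)
    qed
    finally show ?thesis by (simp only: complex_mod_cnj)
  qed
  then have "(\<integral>\<^sup>+k. ennreal ((cmod (cf i r n k l))\<^sup>2) \<partial>count_space int_lattice) =
      (\<integral>\<^sup>+k. ennreal ((cmod (LINT x|lborel. G x * fchar k (Mq l *v x)))\<^sup>2) \<partial>count_space int_lattice)" by simp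
  also have "\<dots> = ennreal (1 / \<bar>det (Mq l)\<bar>) * nn2 lborel G"
  proof (rule fourier_Parseval_matrix[OF _ G r])
    show "det (Mq l) \<noteq> 0" using l prods_pos by (simp add: det_Mq sig_def)
    show "G x = 0" if "Mq l *v x - r \<notin> ucube" for x using that by (simp add: G_def win_def)
  qed
  also have "1 / \<bar>det (Mq l)\<bar> = pq / \<bar>det (Bm l)\<bar>" using prods_pos by (simp add: det_Mq abs_divide)
  finally show ?thesis by (simp add: G_def \<psi>_def t_def)
qed

text \<open>Summed over \<open>r\<close>, the windows give the indicator of the translation cell.
  Shifting the variable by \<open>n / b\<close> moves the cell instead of the column, and the moved
  cells tile the space.\<close>

lemma gabor_translation_sum:
  "(\<integral>\<^sup>+r. \<integral>\<^sup>+n. nn2 lborel (\<lambda>x. win r l x * \<Phi> l (hs_basis i) (x - dg (iv b) *v n)) \<partial>count_space int_lattice \<partial>count_space int_lattice)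
   = nn2 lborel (\<Phi> l (hs_basis i))"
proof -
  define \<psi> where "\<psi> = \<Phi> l (hs_basis i)"
  have "\<psi> \<in> L2 lborel" by (simp add: \<psi>_def Phi_L2)
  then have [measurable]: "\<psi> \<in> borel_measurable borel" using L2_measurable by fastforce
  let ?p = "\<lambda>x. ennreal ((cmod (\<psi> x))\<^sup>2)"
  have bb: "dg b *v (dg (iv b) *v n) = n" for n
  proof -
    have "b $ i \<noteq> 0" for i using b_pos[of i] by simp
    then show ?thesis by (simp add: dg_mult iv_def vec_eq_iff)
  qed
  have "(\<integral>\<^sup>+r. \<integral>\<^sup>+n. nn2 lborel (\<lambda>x. win r l x * \<psi> (x - dg (iv b) *v n)) \<partial>count_space int_lattice \<partial>count_space int_lattice)
     = (\<integral>\<^sup>+n. \<integral>\<^sup>+r. nn2 lborel (\<lambda>x. win r l x * \<psi> (x - dg (iv b) *v n)) \<partial>count_space int_lattice \<partial>count_space int_lattice)"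
    by (rule nn_integral_count_space_nn_integral) (auto simp: countable_int_lattice)
  also have "\<dots> = (\<integral>\<^sup>+n. \<integral>\<^sup>+x. ?p x * indicator ucube (dg b *v x - (- n)) \<partial>lborel \<partial>count_space int_lattice)"
  proof (rule nn_integral_cong)
    fix n
    have "(\<integral>\<^sup>+r. nn2 lborel (\<lambda>x. win r l x * \<psi> (x - dg (iv b) *v n)) \<partial>count_space int_lattice) =
       (\<integral>\<^sup>+r. \<integral>\<^sup>+x. (indicator ucube (dg b *v x) * ?p (x - dg (iv b) *v n)) * indicator ucube (Mq l *v x - r) \<partial>lborel \<partial>count_space int_lattice)"
      unfolding nn2_def by (intro nn_integral_cong) (simp add: win_def indicator_def)
    also have "\<dots> = (\<integral>\<^sup>+x. indicator ucube (dg b *v x) * ?p (x - dg (iv b) *v n) \<partial>lborel)"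
      by (rule nn_integral_lattice[symmetric]) measurable
    also have "\<dots> = (\<integral>\<^sup>+x. indicator ucube (dg b *v (x + dg (iv b) *v n)) * ?p (x + dg (iv b) *v n - dg (iv b) *v n) \<partial>lborel)"
      by (rule lborel_shift[symmetric]) measurable
    also have "\<dots> = (\<integral>\<^sup>+x. ?p x * indicator ucube (dg b *v x - (- n)) \<partial>lborel)"
      by (simp add: matrix_vector_right_distrib bb mult.commute)
    finally show "(\<integral>\<^sup>+r. nn2 lborel (\<lambda>x. win r l x * \<psi> (x - dg (iv b) *v n)) \<partial>count_space int_lattice) =
       (\<integral>\<^sup>+x. ?p x * indicator ucube (dg b *v x - (- n)) \<partial>lborel)" .
  qed
  also have "\<dots> = (\<integral>\<^sup>+n. \<integral>\<^sup>+x. ?p x * indicator ucube (dg b *v x - n) \<partial>lborel \<partial>count_space int_lattice)"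
    by (rule nn_integral_bij_count_space[OF int_lattice_uminus_bij])
  also have "\<dots> = nn2 lborel \<psi>"
    unfolding nn2_def by (rule nn_integral_lattice[symmetric]) measurable
  finally show ?thesis by (simp add: \<psi>_def)
qed

section \<open>Rank-one test fields and the trace identity\<close>

lemma P_basis_L2: "l \<in> sig \<Longrightarrow> P l (hs_basis i) \<in> L2 lborel"
  using proj[of l] by (auto simp: orthogonal_projection_def intro: bounded_operatorD(1))

lemma P_basis_measurable: "(\<lambda>l. nn2 lborel (P l (hs_basis i))) \<in> borel_measurable mu"
  by (rule nn2_measurable[where F = "\<lambda>l. P l (hs_basis i)"])
     (use P_meas in \<open>auto simp: P_basis_L2 measurable_field_def\<close>)

text \<open>Cauchy-Schwarz, where the squared norm of the window is at most the volume of the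
  translation cell. The bound is uniform in \<open>r\<close> and the lattice indices and gives
  finite integrals over \<open>l\<close>.\<close>

lemma cf_bound: "(cmod (cf i r n k l))\<^sup>2 \<le> nrm l / pb"
proof -
  let ?w = "piinv l (0, dg (iv q) *v k, dg (iv b) *v n) (win r l)"
  have w: "?w \<in> L2 lborel" by (rule L2_piinv[OF win_L2])
  have wm: "win r l \<in> borel_measurable borel" by measurable
  have "ennreal ((L2_norm lborel ?w)\<^sup>2) \<le> ennreal (1 / pb)"
    unfolding nn2_L2[OF w, symmetric] nn2_piinv[OF wm] by (rule nn2_win_le)
  then have "(L2_norm lborel ?w)\<^sup>2 \<le> 1 / pb"
    by (subst (asm) ennreal_le_iff) (use prods_pos in simp_all)
  moreover have "(L2_norm lborel (\<Phi> l (hs_basis i)))\<^sup>2 \<le> nrm l"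
  proof -
    have "nn2 lborel (\<Phi> l (hs_basis i)) \<le> hs_norm2 lborel (\<Phi> l) * nn2 lborel (hs_basis i :: real^'d \<Rightarrow> complex)"
      by (rule hs_norm2_bound[OF Phi_bounded]) (simp_all add: hs_norm2_Phi)
    then show ?thesis by (simp add: hs_norm2_Phi nn2_L2 Phi_L2)
  qed
  ultimately have "(L2_norm lborel ?w)\<^sup>2 * (L2_norm lborel (\<Phi> l (hs_basis i)))\<^sup>2 \<le> (1 / pb) * nrm l"
    using prods_pos by (intro mult_mono) auto
  moreover have "(cmod (cf i r n k l))\<^sup>2 \<le> (L2_norm lborel ?w * L2_norm lborel (\<Phi> l (hs_basis i)))\<^sup>2"
    unfolding cf_def by (intro power_mono L2_Cauchy_Schwarz w) (auto simp: Phi_L2)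
  ultimately show ?thesis by (simp add: power_mult_distrib)
qed

text \<open>The test field is the elementary tensor of \<open>win r l\<close> and
  \<open>P l (hs_basis i)\<close>, cut off to \<open>S\<close>. Its translates pair with
  \<open>\<Phi> l\<close> to the coefficients \<open>cf\<close>, and the sum over central points is
  evaluated by \<open>central_sum\<close>. The assumption \<open>small\<close> bounds the integrand
  so that this Parseval identity applies.\<close>

lemma frame_identity_window:
  assumes S: "S \<in> sets mu" "S \<subseteq> cell" and small: "\<And>l. l \<in> S \<Longrightarrow> pa * \<bar>det (Bm l)\<bar> * nrm l \<le> 1"
  shows "(\<integral>\<^sup>+n. \<integral>\<^sup>+k. ennreal pa * (\<integral>\<^sup>+l. ennreal \<bar>det (Bm l)\<bar> * (indicator S l * ennreal ((cmod (cf i r n k l))\<^sup>2)) \<partial>mu)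
      \<partial>count_space int_lattice \<partial>count_space int_lattice) =
    (\<integral>\<^sup>+l. indicator S l * (nn2 lborel (P l (hs_basis i)) * nn2 lborel (win r l)) \<partial>mu)"
proof -
  note [measurable] = S(1)
  have Ssig: "S \<subseteq> sig" by (rule sets_mu_subset[OF S(1)])
  obtain D where D: "D \<ge> 0" "\<And>l. l \<in> cell \<Longrightarrow> \<bar>det (Bm l)\<bar> \<le> D" using det_bounded_cell by blast
  define u where "u = (\<lambda>l. P l (hs_basis i))"
  have uL: "l \<in> sig \<Longrightarrow> u l \<in> L2 lborel" for l by (simp add: u_def P_basis_L2)
  have uR: "l \<in> sig \<Longrightarrow> u l \<in> L2_range lborel (P l)" for l
    using uL unfolding u_def L2_range_def by (auto intro!: bexI[of _ "hs_basis i"])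
  define \<Psi> where "\<Psi> = (\<lambda>l h x. indicator S l * (L2_inner lborel h (u l) * win r l x))"
  have \<Psi>_cases: "\<Psi> l = (if l \<in> S then elem_tensor lborel (win r l) (u l) else (\<lambda>h x. 0))" for l
    by (auto simp: \<Psi>_def elem_tensor_def fun_eq_iff)
  have \<Psi>n: "hs_norm2 lborel (\<Psi> l) = indicator S l * (nn2 lborel (u l) * nn2 lborel (win r l))" for l
    using Ssig uL[of l] by (auto simp: \<Psi>_cases zero_operator hs_norm2_elem_tensor win_L2 mult.commute)
  have um: "(\<lambda>l. L2_inner lborel h (u l)) \<in> borel_measurable mu" if "h \<in> L2 lborel" for h
  proof -
    have "(\<lambda>l. L2_inner lborel (P l (hs_basis i)) h) \<in> borel_measurable mu"
      using P_meas that by (simp add: measurable_field_def)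
    then have "(\<lambda>l. cnj (L2_inner lborel (P l (hs_basis i)) h)) \<in> borel_measurable mu" by measurable
    then show ?thesis by (simp add: u_def flip: L2_inner_commute)
  qed
  have sm: "(\<lambda>l. indicator S l :: complex) \<in> borel_measurable mu" by measurable
  have wm: "(\<lambda>l. L2_inner lborel (win r l) v) \<in> borel_measurable mu" if "v \<in> L2 lborel" for v
  proof (rule measurable_mu_borel)
    have [measurable]: "v \<in> borel_measurable borel" using L2_measurable[OF that] by simp
    show "(\<lambda>l. L2_inner lborel (win r l) v) \<in> borel_measurable borel" unfolding L2_inner_def by measurable
  qed
  have \<Psi>m: "measurable_field mu \<Psi>"
    unfolding measurable_field_def \<Psi>_def L2_inner_scale_left
    by (auto intro!: borel_measurable_times sm um wm)
  have unn_m: "(\<lambda>l. nn2 lborel (u l) * nn2 lborel (win r l)) \<in> borel_measurable mu"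
    unfolding u_def by (intro borel_measurable_times_ennreal P_basis_measurable nn2_win_measurable)
  have fin: "(\<integral>\<^sup>+l. hs_norm2 lborel (\<Psi> l) \<partial>mu) < \<infinity>"
    unfolding \<Psi>n
  proof (rule nn_integral_mu_le_cell[OF S unn_m])
    fix l assume l: "l \<in> S"
    have "nn2 lborel (u l) \<le> 1"
      unfolding u_def using projection_nn2_le[OF proj, of l "hs_basis i"] l Ssig by auto
    then have le: "nn2 lborel (u l) * nn2 lborel (win r l) \<le> 1 * ennreal (1 / pb)"
      by (intro mult_mono nn2_win_le) auto
    have "ennreal \<bar>det (Bm l)\<bar> \<le> ennreal D" using D(2)[of l] l S(2) by (intro ennreal_leI) auto
    from mult_mono[OF this le] have "ennreal \<bar>det (Bm l)\<bar> * (nn2 lborel (u l) * nn2 lborel (win r l)) \<le> ennreal D * (1 * ennreal (1 / pb))"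
      by simp
    moreover have "ennreal D * (1 * ennreal (1 / pb)) = ennreal (D * (1 / pb))"
      using D(1) prods_pos by (simp flip: ennreal_mult)
    ultimately show "ennreal \<bar>det (Bm l)\<bar> * (nn2 lborel (u l) * nn2 lborel (win r l)) \<le> ennreal (D * (1 / pb))"
      by (simp only:)
  qed
  have "\<Psi> \<in> DI"
    unfolding direct_integral_def using \<Psi>m fin AE_space[of mu]
    by (auto elim!: AE_mp intro!: AE_I2)
       (use uL uR win_L2 Ssig in \<open>auto simp: \<Psi>_cases zero_operator intro: elem_tensor_mem\<close>)
  then obtain f where f: "isp f \<Psi>" and fr: "(\<integral>\<^sup>+n. \<integral>\<^sup>+k. \<integral>\<^sup>+m. ennreal ((cmod (L2_inner lborel
          (\<lambda>w. f (mulc (dg (iv a) *v m, dg (iv q) *v k, dg (iv b) *v n) w)) phi))\<^sup>2)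
        \<partial>count_space int_lattice \<partial>count_space int_lattice \<partial>count_space int_lattice) = nn2 lborel f"
    using frame by blast
  have pairing: "L2_inner lborel (\<lambda>w. f (mulc (dg (iv a) *v m, dg (iv q) *v k, dg (iv b) *v n) w)) phi =
     (LINT l|mu. cnj (fchar m (dg (iv a) *v l)) * (indicator S l * cf i r n k l))" for m k n
  proof -
    let ?\<gamma> = "(dg (iv a) *v m, dg (iv q) *v k, dg (iv b) *v n)"
    let ?\<eta> = "(0, dg (iv q) *v k, dg (iv b) *v n) :: (real^'k) \<times> (real^'d) \<times> (real^'d)"
    have sym: "l \<bullet> (dg (iv a) *v m) = m \<bullet> (dg (iv a) *v l)" for l by (simp add: dg_mult inner_vec_def mult_ac)
    \<comment> \<open>Splits off the central part of the lattice point, which acts by a scalar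
      depending on \<open>l\<close> only.\<close>
    have pi0: "piinv l ?\<gamma> G = (\<lambda>x. cnj (fchar m (dg (iv a) *v l)) * piinv l ?\<eta> G x)" for l G
      by (rule ext) (simp add: piinv_def fchar_def cis_cnj sym mult.assoc)
    have pi\<Psi>: "piinv l ?\<gamma> (\<Psi> l h) = (\<lambda>x. (indicator S l * L2_inner lborel h (u l)) * piinv l ?\<gamma> (win r l) x)" for l h
      by (simp add: piinv_def \<Psi>_def fun_eq_iff mult_ac)
    have "measurable_field mu (\<lambda>l h. piinv l ?\<gamma> (\<Psi> l h))"
      unfolding pi\<Psi> measurable_field_def L2_inner_scale_left
      by (auto intro!: borel_measurable_times sm um inner_piinv_win_measurable)
    from isp_mulc[OF f this] have ip: "isp (\<lambda>w. f (mulc ?\<gamma> w)) (\<lambda>l h. piinv l ?\<gamma> (\<Psi> l h))" .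
    have "L2_inner lborel (\<lambda>w. f (mulc ?\<gamma> w)) phi =
      (LINT l|mu. LINT ij|count_space UNIV. mat (\<lambda>l h. piinv l ?\<gamma> (\<Psi> l h)) (ij, l) * cnj (mat \<Phi> (ij, l)))"
      by (rule isp_inner_integral(1)[OF ip isp_phi])
    also have "\<dots> = (LINT l|mu. cnj (fchar m (dg (iv a) *v l)) * (indicator S l * cf i r n k l))"
    proof (rule integral_mu_cong_AE'[OF _ _ isp_inner_integral_measurable[OF ip isp_phi]])
      have fm: "(\<lambda>l. cnj (fchar m (dg (iv a) *v l))) \<in> borel_measurable mu"
        by (rule measurable_mu_borel) measurable
      show "(\<lambda>l. cnj (fchar m (dg (iv a) *v l)) * (indicator S l * cf i r n k l)) \<in> borel_measurable mu"
        by (intro borel_measurable_times fm sm cf_measurable)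
      show "AE l in mu. (LINT ij|count_space UNIV. mat (\<lambda>l h. piinv l ?\<gamma> (\<Psi> l h)) (ij, l) * cnj (mat \<Phi> (ij, l))) =
         cnj (fchar m (dg (iv a) *v l)) * (indicator S l * cf i r n k l)"
        using isp_inner_integral(2)[OF ip isp_phi] AE_space
      proof eventually_elim
        case (elim l)
        then have l: "l \<in> sig" by simp
        let ?G = "piinv l ?\<gamma> (win r l)"
        have GL: "?G \<in> L2 lborel" by (rule L2_piinv[OF win_L2])
        have m1: "mat (\<lambda>l h. piinv l ?\<gamma> (\<Psi> l h)) (ij, l) * cnj (mat \<Phi> (ij, l)) =
          (indicator S l * L2_inner lborel (hs_basis (fst ij)) (u l) * L2_inner lborel ?G (hs_basis (snd ij)))
            * cnj (L2_inner lborel (\<Phi> l (hs_basis (fst ij))) (hs_basis (snd ij)))" for ij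
          by (simp add: mat_def pi\<Psi> L2_inner_scale_left)
        have "(LINT ij|count_space UNIV. mat (\<lambda>l h. piinv l ?\<gamma> (\<Psi> l h)) (ij, l) * cnj (mat \<Phi> (ij, l))) =
          indicator S l * L2_inner lborel ?G (\<Phi> l (u l))"
          using elim(1) unfolding m1 by (intro rank_one_pairing Phi_bounded uL l GL)
        \<comment> \<open>\<open>\<Phi> l\<close> absorbs the projection, so \<open>P\<close>
          disappears from the coefficient. It survives on the other side of the frame identity, in
          the norm of the test field.\<close>
        also have "L2_inner lborel ?G (\<Phi> l (u l)) = L2_inner lborel ?G (\<Phi> l (hs_basis i))"
        proof (rule L2_inner_cong_AE)
          show "AE x in lborel. \<Phi> l (u l) x = \<Phi> l (hs_basis i) x"
            unfolding u_def by (rule hs_tensor_projection[OF proj[OF l] Phi_tensor hs_basis_L2])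
        qed (use L2_measurable[OF GL] L2_measurable[OF Phi_L2[OF uL[OF l]]] L2_measurable[OF Phi_L2[OF hs_basis_L2]] in auto)
        also have "\<dots> = cnj (fchar m (dg (iv a) *v l)) * cf i r n k l"
          unfolding pi0 cf_def by (rule L2_inner_scale_left)
        finally show ?case by (simp add: mult_ac)
      qed
    qed
    finally show ?thesis .
  qed
  have "(\<integral>\<^sup>+m. ennreal ((cmod (L2_inner lborel
          (\<lambda>w. f (mulc (dg (iv a) *v m, dg (iv q) *v k, dg (iv b) *v n) w)) phi))\<^sup>2) \<partial>count_space int_lattice) =
     ennreal pa * (\<integral>\<^sup>+l. ennreal \<bar>det (Bm l)\<bar> * (indicator S l * ennreal ((cmod (cf i r n k l))\<^sup>2)) \<partial>mu)" for n k
  proof -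
    have sq: "ennreal ((cmod (indicator S l * cf i r n k l))\<^sup>2) = indicator S l * ennreal ((cmod (cf i r n k l))\<^sup>2)" for l
      by (simp add: indicator_def)
    have "(\<integral>\<^sup>+l. indicator S l * ennreal (\<bar>det (Bm l)\<bar> * (cmod (cf i r n k l))\<^sup>2) \<partial>mu) < \<infinity>"
    proof (rule nn_integral_mu_le_cell[OF S])
      show "(\<lambda>l. ennreal (\<bar>det (Bm l)\<bar> * (cmod (cf i r n k l))\<^sup>2)) \<in> borel_measurable mu"
        using cf_measurable[of i r n k] by measurable
      fix l assume l: "l \<in> S"
      have "\<bar>det (Bm l)\<bar> * (\<bar>det (Bm l)\<bar> * (cmod (cf i r n k l))\<^sup>2) \<le> D * (1 / (pa * pb))"
      proof (rule mult_mono)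
        have "\<bar>det (Bm l)\<bar> * (cmod (cf i r n k l))\<^sup>2 \<le> \<bar>det (Bm l)\<bar> * (nrm l / pb)"
          by (intro mult_left_mono cf_bound) auto
        also have "\<dots> \<le> 1 / (pa * pb)" using small[OF l] prods_pos by (simp add: field_simps)
        finally show "\<bar>det (Bm l)\<bar> * (cmod (cf i r n k l))\<^sup>2 \<le> 1 / (pa * pb)" .
      qed (use D l S(2) in auto)
      then show "ennreal \<bar>det (Bm l)\<bar> * ennreal (\<bar>det (Bm l)\<bar> * (cmod (cf i r n k l))\<^sup>2) \<le> ennreal (D * (1 / (pa * pb)))"
        by (simp add: ennreal_leI flip: ennreal_mult)
    qed
    then have fin2: "(\<integral>\<^sup>+l. ennreal \<bar>det (Bm l)\<bar> * ennreal ((cmod (indicator S l * cf i r n k l))\<^sup>2) \<partial>mu) < \<infinity>"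
      unfolding sq by (simp add: ennreal_mult mult_ac)
    have "(\<integral>\<^sup>+m. ennreal ((cmod (LINT l|mu. cnj (fchar m (dg (iv a) *v l)) * (indicator S l * cf i r n k l)))\<^sup>2) \<partial>count_space int_lattice) =
      ennreal (1 / \<bar>det (dg (iv a))\<bar>) * (\<integral>\<^sup>+l. ennreal \<bar>det (Bm l)\<bar> * ennreal ((cmod (indicator S l * cf i r n k l))\<^sup>2) \<partial>mu)"
    proof (rule central_sum[OF _ _ fin2])
      show "det (dg (iv a)) \<noteq> 0" using prods_pos by (simp add: det_iv)
      show "(\<lambda>l. indicator S l * cf i r n k l) \<in> borel_measurable mu" by (intro borel_measurable_times sm cf_measurable)
      show "indicator S l * cf i r n k l = 0" if "dg (iv a) *v l \<notin> ucube" for l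
        using that S(2) by (auto simp: cell_def indicator_def)
    qed
    then show ?thesis using prods_pos by (simp only: pairing sq det_iv) simp
  qed
  then have "(\<integral>\<^sup>+n. \<integral>\<^sup>+k. ennreal pa * (\<integral>\<^sup>+l. ennreal \<bar>det (Bm l)\<bar> * (indicator S l * ennreal ((cmod (cf i r n k l))\<^sup>2)) \<partial>mu)
      \<partial>count_space int_lattice \<partial>count_space int_lattice) = nn2 lborel f"
    using fr by simp
  also have "\<dots> = (\<integral>\<^sup>+l. hs_norm2 lborel (\<Psi> l) \<partial>mu)" by (rule isp_norm[OF f])
  finally show ?thesis by (simp add: \<Psi>n u_def)
qed

text \<open>Once the windows are summed over \<open>r\<close>, both Gabor sums can be evaluated at
  each \<open>l\<close>: the modulations contribute \<open>pq / |det (Bm l)|\<close>, and the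
  translations restore the squared norm of the column. On the other side the windows add up to the
  volume \<open>1 / pb\<close>.\<close>

lemma frame_identity_basis:
  assumes S: "S \<in> sets mu" "S \<subseteq> cell" and small: "\<And>l. l \<in> S \<Longrightarrow> pa * \<bar>det (Bm l)\<bar> * nrm l \<le> 1"
  shows "ennreal (pa * pq) * (\<integral>\<^sup>+l. indicator S l * nn2 lborel (\<Phi> l (hs_basis i)) \<partial>mu) =
    (\<integral>\<^sup>+l. indicator S l * nn2 lborel (P l (hs_basis i)) \<partial>mu) * ennreal (1 / pb)"
proof -
  note [measurable] = S(1) cf_measurable
  have Ssig: "S \<subseteq> sig" by (rule sets_mu_subset[OF S(1)])
  let ?L = "count_space (int_lattice :: (real^'d) set)"
  let ?g = "\<lambda>r n k l. ennreal pa * (ennreal \<bar>det (Bm l)\<bar> * (indicator S l * ennreal ((cmod (cf i r n k l))\<^sup>2)))"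
  have gm: "?g r n k \<in> borel_measurable mu" for r n k by measurable
  have gm1: "(\<lambda>l. \<integral>\<^sup>+k. ?g r n k l \<partial>?L) \<in> borel_measurable mu" for r n
    by (rule borel_measurable_count_space_integral[OF countable_int_lattice gm])
  have gm2: "(\<lambda>l. \<integral>\<^sup>+n. \<integral>\<^sup>+k. ?g r n k l \<partial>?L \<partial>?L) \<in> borel_measurable mu" for r
    by (rule borel_measurable_count_space_integral[OF countable_int_lattice gm1])
  have "(\<integral>\<^sup>+r. \<integral>\<^sup>+n. \<integral>\<^sup>+k. ennreal pa * (\<integral>\<^sup>+l. ennreal \<bar>det (Bm l)\<bar> * (indicator S l * ennreal ((cmod (cf i r n k l))\<^sup>2)) \<partial>mu) \<partial>?L \<partial>?L \<partial>?L)
    = (\<integral>\<^sup>+r. \<integral>\<^sup>+n. \<integral>\<^sup>+k. \<integral>\<^sup>+l. ?g r n k l \<partial>mu \<partial>?L \<partial>?L \<partial>?L)"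
    by (intro nn_integral_cong nn_integral_cmult[symmetric]) measurable
  also have "\<dots> = (\<integral>\<^sup>+r. \<integral>\<^sup>+n. \<integral>\<^sup>+l. \<integral>\<^sup>+k. ?g r n k l \<partial>?L \<partial>mu \<partial>?L \<partial>?L)"
    by (intro nn_integral_cong nn_integral_count_space_nn_integral[OF countable_int_lattice gm, symmetric])
  also have "\<dots> = (\<integral>\<^sup>+r. \<integral>\<^sup>+l. \<integral>\<^sup>+n. \<integral>\<^sup>+k. ?g r n k l \<partial>?L \<partial>?L \<partial>mu \<partial>?L)"
    by (intro nn_integral_cong nn_integral_count_space_nn_integral[OF countable_int_lattice gm1, symmetric])
  also have "\<dots> = (\<integral>\<^sup>+l. \<integral>\<^sup>+r. \<integral>\<^sup>+n. \<integral>\<^sup>+k. ?g r n k l \<partial>?L \<partial>?L \<partial>?L \<partial>mu)"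
    by (rule nn_integral_count_space_nn_integral[OF countable_int_lattice gm2, symmetric])
  also have "\<dots> = (\<integral>\<^sup>+l. ennreal (pa * pq) * (indicator S l * nn2 lborel (\<Phi> l (hs_basis i))) \<partial>mu)"
  proof (rule nn_integral_cong)
    fix l assume "l \<in> space mu"
    then have l: "l \<in> sig" by simp
    then have d: "det (Bm l) \<noteq> 0" by (simp add: sig_def)
    let ?W = "\<lambda>r n. nn2 lborel (\<lambda>x. win r l x * \<Phi> l (hs_basis i) (x - dg (iv b) *v n))"
    \<comment> \<open>The determinant left over from the central sum meets its reciprocal from the
      modulation sum.\<close>
    have dd: "ennreal \<bar>det (Bm l)\<bar> * ennreal (pq / \<bar>det (Bm l)\<bar>) = ennreal pq"
      using d prods_pos by (simp flip: ennreal_mult)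
    have "(\<integral>\<^sup>+r. \<integral>\<^sup>+n. \<integral>\<^sup>+k. ?g r n k l \<partial>?L \<partial>?L \<partial>?L) = (\<integral>\<^sup>+r. \<integral>\<^sup>+n. (ennreal (pa * pq) * indicator S l) * ?W r n \<partial>?L \<partial>?L)"
    proof (intro nn_integral_cong)
      fix r n assume "r \<in> space ?L"
      then have r: "r \<in> int_lattice" by simp
      have "(\<integral>\<^sup>+k. ?g r n k l \<partial>?L) = (ennreal pa * ennreal \<bar>det (Bm l)\<bar> * indicator S l) * (\<integral>\<^sup>+k. ennreal ((cmod (cf i r n k l))\<^sup>2) \<partial>?L)"
        by (subst nn_integral_cmult[symmetric]) (auto simp: mult.assoc)
      also have "\<dots> = (ennreal pa * (ennreal \<bar>det (Bm l)\<bar> * ennreal (pq / \<bar>det (Bm l)\<bar>)) * indicator S l) * ?W r n"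
        unfolding gabor_modulation_sum[OF l r] by (simp add: mult_ac)
      also have "\<dots> = (ennreal (pa * pq) * indicator S l) * ?W r n"
        unfolding dd using prods_pos by (simp add: ennreal_mult)
      finally show "(\<integral>\<^sup>+k. ?g r n k l \<partial>?L) = (ennreal (pa * pq) * indicator S l) * ?W r n" .
    qed
    also have "\<dots> = (ennreal (pa * pq) * indicator S l) * (\<integral>\<^sup>+r. \<integral>\<^sup>+n. ?W r n \<partial>?L \<partial>?L)"
      by (simp add: nn_integral_cmult)
    also have "\<dots> = ennreal (pa * pq) * (indicator S l * nn2 lborel (\<Phi> l (hs_basis i)))"
      unfolding gabor_translation_sum by (simp add: mult.assoc)
    finally show "(\<integral>\<^sup>+r. \<integral>\<^sup>+n. \<integral>\<^sup>+k. ?g r n k l \<partial>?L \<partial>?L \<partial>?L) =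
        ennreal (pa * pq) * (indicator S l * nn2 lborel (\<Phi> l (hs_basis i)))" .
  qed
  also have "\<dots> = ennreal (pa * pq) * (\<integral>\<^sup>+l. indicator S l * nn2 lborel (\<Phi> l (hs_basis i)) \<partial>mu)"
  proof (rule nn_integral_cmult)
    have "(\<lambda>l. nn2 lborel (\<Phi> l (hs_basis i))) \<in> borel_measurable mu"
      by (rule nn2_measurable[where F = "\<lambda>l. \<Phi> l (hs_basis i)"])
         (use Phi_measurable in \<open>auto simp: Phi_L2 measurable_field_def\<close>)
    then show "(\<lambda>l. indicator S l * nn2 lborel (\<Phi> l (hs_basis i))) \<in> borel_measurable mu" by measurable
  qed
  finally have lhs: "(\<integral>\<^sup>+r. \<integral>\<^sup>+n. \<integral>\<^sup>+k. ennreal pa * (\<integral>\<^sup>+l. ennreal \<bar>det (Bm l)\<bar> * (indicator S l * ennreal ((cmod (cf i r n k l))\<^sup>2)) \<partial>mu) \<partial>?L \<partial>?L \<partial>?L)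
    = ennreal (pa * pq) * (\<integral>\<^sup>+l. indicator S l * nn2 lborel (\<Phi> l (hs_basis i)) \<partial>mu)" .
  note [measurable] = P_basis_measurable nn2_win_measurable
  have "(\<integral>\<^sup>+r. \<integral>\<^sup>+l. indicator S l * (nn2 lborel (P l (hs_basis i)) * nn2 lborel (win r l)) \<partial>mu \<partial>?L) =
     (\<integral>\<^sup>+l. \<integral>\<^sup>+r. indicator S l * (nn2 lborel (P l (hs_basis i)) * nn2 lborel (win r l)) \<partial>?L \<partial>mu)"
    by (rule nn_integral_count_space_nn_integral[OF countable_int_lattice, symmetric]) measurable
  also have "\<dots> = (\<integral>\<^sup>+l. (indicator S l * nn2 lborel (P l (hs_basis i))) * ennreal (1 / pb) \<partial>mu)"
    by (intro nn_integral_cong) (simp add: nn_integral_cmult nn2_win_sum flip: mult.assoc)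
  also have "\<dots> = (\<integral>\<^sup>+l. indicator S l * nn2 lborel (P l (hs_basis i)) \<partial>mu) * ennreal (1 / pb)"
    by (rule nn_integral_multc) measurable
  finally have rhs: "(\<integral>\<^sup>+r. \<integral>\<^sup>+l. indicator S l * (nn2 lborel (P l (hs_basis i)) * nn2 lborel (win r l)) \<partial>mu \<partial>?L) =
     (\<integral>\<^sup>+l. indicator S l * nn2 lborel (P l (hs_basis i)) \<partial>mu) * ennreal (1 / pb)" .
  show ?thesis
    unfolding lhs[symmetric] rhs[symmetric] by (rule nn_integral_cong) (rule frame_identity_window[OF S small])
qed

text \<open>Summation over the basis: the columns of \<open>\<Phi> l\<close> give
  \<open>nrm l\<close>, and the vectors \<open>P l (hs_basis i)\<close> give the squared
  Hilbert-Schmidt norm of \<open>P l\<close>, which for an orthogonal projection is the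
  trace.\<close>

lemma frame_identity_trace:
  assumes S: "S \<in> sets mu" "S \<subseteq> cell" and small: "\<And>l. l \<in> S \<Longrightarrow> pa * \<bar>det (Bm l)\<bar> * nrm l \<le> 1"
  shows "ennreal (pa * pq) * (\<integral>\<^sup>+l. indicator S l * ennreal (nrm l) \<partial>mu) =
    (\<integral>\<^sup>+l. indicator S l * hs_norm2 lborel (P l) \<partial>mu) * ennreal (1 / pb)"
proof -
  note [measurable] = S(1) P_basis_measurable
  have [measurable]: "(\<lambda>l. nn2 lborel (\<Phi> l (hs_basis i))) \<in> borel_measurable mu" for i
    by (rule nn2_measurable[where F = "\<lambda>l. \<Phi> l (hs_basis i)"])
       (use Phi_measurable in \<open>auto simp: Phi_L2 measurable_field_def\<close>)
  have "(\<integral>\<^sup>+l. indicator S l * ennreal (nrm l) \<partial>mu) = (\<integral>\<^sup>+l. (\<Sum>i. indicator S l * nn2 lborel (\<Phi> l (hs_basis i))) \<partial>mu)"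
    by (intro nn_integral_cong) (simp add: hs_norm2_Phi[symmetric] hs_norm2_eq Phi_L2)
  also have "\<dots> = (\<Sum>i. \<integral>\<^sup>+l. indicator S l * nn2 lborel (\<Phi> l (hs_basis i)) \<partial>mu)"
    by (rule nn_integral_suminf) measurable
  finally have 1: "(\<integral>\<^sup>+l. indicator S l * ennreal (nrm l) \<partial>mu) = (\<Sum>i. \<integral>\<^sup>+l. indicator S l * nn2 lborel (\<Phi> l (hs_basis i)) \<partial>mu)" .
  have "(\<integral>\<^sup>+l. indicator S l * hs_norm2 lborel (P l) \<partial>mu) = (\<integral>\<^sup>+l. (\<Sum>i. indicator S l * nn2 lborel (P l (hs_basis i))) \<partial>mu)"
    by (intro nn_integral_cong) (simp add: hs_norm2_eq P_basis_L2)
  also have "\<dots> = (\<Sum>i. \<integral>\<^sup>+l. indicator S l * nn2 lborel (P l (hs_basis i)) \<partial>mu)"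
    by (rule nn_integral_suminf) measurable
  finally have 2: "(\<integral>\<^sup>+l. indicator S l * hs_norm2 lborel (P l) \<partial>mu) = (\<Sum>i. \<integral>\<^sup>+l. indicator S l * nn2 lborel (P l (hs_basis i)) \<partial>mu)" .
  show ?thesis
    unfolding 1 2 ennreal_suminf_cmult[symmetric] ennreal_suminf_multc[symmetric]
    by (intro suminf_cong frame_identity_basis S small)
qed

text \<open>On the set \<open>S\<close> where the trace is too large although the norm bound holds,
  the trace identity and the norm bound make the integral of the trace at most that of
  \<open>pq * pb / |det|\<close>. The trace is strictly larger at every point of \<open>S\<close>,
  and the smaller integral is finite, so \<open>S\<close> is null.\<close>

lemma trace_bound: "AE l in mu. l \<in> cell \<longrightarrow> ennreal \<bar>det (Bm l)\<bar> * hs_norm2 lborel (P l) \<le> ennreal (pq * pb)"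
proof -
  define \<tau> where "\<tau> = (\<lambda>l. hs_norm2 lborel (P l))"
  have [measurable]: "\<tau> \<in> borel_measurable mu"
    unfolding \<tau>_def by (rule hs_norm2_measurable) (auto simp: P_basis_L2 P_meas)
  have cm: "Measurable.pred mu (\<lambda>l. l \<in> cell)"
  proof -
    have "indicator cell \<in> borel_measurable mu" by (rule measurable_mu_borel) measurable
    then have "Measurable.pred mu (\<lambda>l. indicator cell l = (1::real))" by measurable
    then show ?thesis by (simp add: indicator_eq_1_iff)
  qed
  define S where "S = {l \<in> space mu. l \<in> cell \<and> pa * \<bar>det (Bm l)\<bar> * nrm l \<le> 1 \<and> ennreal (pq * pb) < ennreal \<bar>det (Bm l)\<bar> * \<tau> l}"
  have Sm[measurable]: "S \<in> sets mu" unfolding S_def using cm by measurable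
  have S: "S \<subseteq> cell" "\<And>l. l \<in> S \<Longrightarrow> pa * \<bar>det (Bm l)\<bar> * nrm l \<le> 1" by (auto simp: S_def)
  have det: "l \<in> S \<Longrightarrow> det (Bm l) \<noteq> 0" for l by (auto simp: S_def sig_def)
  \<comment> \<open>The claimed bound divided by the determinant, which is nonzero on
    \<open>sig\<close>. Its integral over the bounded cell is finite because the density of
    \<open>mu\<close> cancels the denominator.\<close>
  define Y where "Y = (\<lambda>l. indicator S l * ennreal (pq * pb / \<bar>det (Bm l)\<bar>))"
  define X where "X = (\<lambda>l. indicator S l * \<tau> l)"
  have [measurable]: "X \<in> borel_measurable mu" "Y \<in> borel_measurable mu" unfolding X_def Y_def by measurable
  have lt: "Y l < X l" if l: "l \<in> S" for l
  proof (rule ccontr)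
    assume "\<not> Y l < X l"
    then have "\<tau> l \<le> ennreal (pq * pb / \<bar>det (Bm l)\<bar>)" using l by (simp add: X_def Y_def not_less)
    then have "ennreal \<bar>det (Bm l)\<bar> * \<tau> l \<le> ennreal \<bar>det (Bm l)\<bar> * ennreal (pq * pb / \<bar>det (Bm l)\<bar>)"
      by (rule mult_left_mono) simp
    also have "\<dots> = ennreal (pq * pb)" using det[OF l] prods_pos by (simp flip: ennreal_mult)
    finally show False using l by (auto simp: S_def dest: leD)
  qed
  have le: "Y l \<le> X l" for l using lt[of l] by (cases "l \<in> S") (auto simp: X_def Y_def)
  have finY: "(\<integral>\<^sup>+l. Y l \<partial>mu) < \<infinity>"
    unfolding Y_def
  proof (rule nn_integral_mu_le_cell[OF Sm S(1)])
    fix l assume "l \<in> S"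
    then show "ennreal \<bar>det (Bm l)\<bar> * ennreal (pq * pb / \<bar>det (Bm l)\<bar>) \<le> ennreal (pq * pb)"
      using det[of l] prods_pos by (simp flip: ennreal_mult)
  qed measurable
  have "(\<integral>\<^sup>+l. X l \<partial>mu) \<le> (\<integral>\<^sup>+l. Y l \<partial>mu)"
  proof -
    have "(\<integral>\<^sup>+l. X l \<partial>mu) = (\<integral>\<^sup>+l. X l \<partial>mu) * ennreal (1 / pb) * ennreal pb"
      using prods_pos by (simp add: mult.assoc flip: ennreal_mult)
    also have "\<dots> = ennreal (pa * pq) * (\<integral>\<^sup>+l. indicator S l * ennreal (nrm l) \<partial>mu) * ennreal pb"
      unfolding X_def \<tau>_def by (simp only: frame_identity_trace[OF Sm S])
    also have "\<dots> = ennreal (pa * pq * pb) * (\<integral>\<^sup>+l. indicator S l * ennreal (nrm l) \<partial>mu)"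
      using prods_pos by (simp add: ennreal_mult mult_ac)
    also have "\<dots> = (\<integral>\<^sup>+l. ennreal (pa * pq * pb) * (indicator S l * ennreal (nrm l)) \<partial>mu)"
      by (rule nn_integral_cmult[symmetric]) measurable
    also have "\<dots> \<le> (\<integral>\<^sup>+l. Y l \<partial>mu)"
    proof (rule nn_integral_mono)
      fix l
      have "pa * pq * pb * nrm l \<le> pq * pb / \<bar>det (Bm l)\<bar>" if l: "l \<in> S"
      proof -
        have "(pa * \<bar>det (Bm l)\<bar> * nrm l) * (pq * pb) \<le> 1 * (pq * pb)"
          using S(2)[OF l] prods_pos by (intro mult_right_mono) auto
        then show ?thesis using det[OF l] by (simp add: pos_le_divide_eq mult_ac)
      qed
      then show "ennreal (pa * pq * pb) * (indicator S l * ennreal (nrm l)) \<le> Y l"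
        using prods_pos by (auto simp: Y_def indicator_def ennreal_leI simp flip: ennreal_mult)
    qed
    finally show ?thesis .
  qed
  then have "(\<integral>\<^sup>+l. X l - Y l \<partial>mu) = 0"
    using finY le by (subst nn_integral_diff) (auto simp: diff_eq_0_ennreal less_top)
  then have "AE l in mu. X l - Y l = 0" by (subst (asm) nn_integral_0_iff_AE) auto
  then show ?thesis using norm_bound AE_space
  proof eventually_elim
    case (elim l)
    show ?case
    proof
      assume c: "l \<in> cell"
      show "ennreal \<bar>det (Bm l)\<bar> * hs_norm2 lborel (P l) \<le> ennreal (pq * pb)"
      proof (rule ccontr)
        assume "\<not> ?thesis"
        then have "l \<in> S" using elim c by (simp add: S_def \<tau>_def not_le)
        then show False using lt[of l] ennreal_minus_eq_0[OF elim(1)] by (simp add: not_le[symmetric])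
      qed
    qed
  qed
qed

end

lemma (in frame_coords) trace_bound_AE:
  "AE l in mu. l \<in> cell \<longrightarrow> ennreal \<bar>det (Bm l)\<bar> * hs_norm2 lborel (P l) \<le> ennreal (pq * pb)"
proof -
  obtain \<Phi> where "isp phi \<Phi>" "\<forall>l. hs_operator lborel (\<Phi> l) \<and> \<Phi> l \<in> hs_tensor lborel (L2_range lborel (P l))"
    using normalized_transform by blast
  then interpret frame_field Bm phi P a q b \<Phi> by unfold_locales auto
  show ?thesis by (rule trace_bound)
qed

section \<open>Rank and trace of a projection\<close>

text \<open>The coefficients in the original family are kept, since they show later that a
  projection fixing every \<open>u k\<close> also fixes every \<open>w j\<close>.\<close>

lemma gram_schmidt:
  assumes u: "\<And>i. i < n \<Longrightarrow> u i \<in> L2 M" and ind: "L2_independent M n u"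
  shows "\<exists>w c. (\<forall>j<n. w j \<in> L2 M) \<and> (\<forall>i<n. \<forall>j<n. L2_inner M (w i) (w j) = (if i = j then 1 else 0)) \<and>
    (\<forall>j<n. AE x in M. w j x = (\<Sum>k<n. c j k * u k x))"
  using assms
proof (induction n)
  case 0
  then show ?case by simp
next
  case (Suc n)
  have un: "u n \<in> L2 M" and ui: "\<And>i. i < n \<Longrightarrow> u i \<in> L2 M" using Suc.prems(1) by auto
  have "L2_independent M n u"
    unfolding L2_independent_def
  proof (intro allI impI)
    fix c :: "nat \<Rightarrow> complex" and i assume c: "AE x in M. (\<Sum>i<n. c i * u i x) = 0" and "i < n"
    have "(\<Sum>i<Suc n. (c(n := 0)) i * u i x) = (\<Sum>i<n. c i * u i x)" for x by simp
    then have "AE x in M. (\<Sum>i<Suc n. (c(n := 0)) i * u i x) = 0" using c by simp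
    from Suc.prems(2)[unfolded L2_independent_def, rule_format, OF this, of i] \<open>i < n\<close> show "c i = 0" by simp
  qed
  from Suc.IH[OF ui this] obtain w c where
    "(\<forall>j<n. w j \<in> L2 M) \<and> (\<forall>i<n. \<forall>j<n. L2_inner M (w i) (w j) = (if i = j then 1 else 0)) \<and>
      (\<forall>j<n. AE x in M. w j x = (\<Sum>k<n. c j k * u k x))" by blast
  then have w: "\<And>j. j < n \<Longrightarrow> w j \<in> L2 M"
    and on: "\<And>i j. i < n \<Longrightarrow> j < n \<Longrightarrow> L2_inner M (w i) (w j) = (if i = j then 1 else 0)"
    and wc: "\<And>j. j < n \<Longrightarrow> AE x in M. w j x = (\<Sum>k<n. c j k * u k x)" by blast+
  define v where "v x = u n x - (\<Sum>j<n. L2_inner M (u n) (w j) * w j x)" for x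
  have S: "(\<lambda>x. \<Sum>j<n. L2_inner M (u n) (w j) * w j x) \<in> L2 M" using w by (intro L2_sum L2_scale) auto
  have v: "v \<in> L2 M" unfolding v_def[abs_def] by (rule L2_diff[OF un S])
  have vw: "L2_inner M v (w j) = 0" if "j < n" for j
  proof -
    have "L2_inner M v (w j) = L2_inner M (u n) (w j) - L2_inner M (\<lambda>x. \<Sum>j<n. L2_inner M (u n) (w j) * w j x) (w j)"
      unfolding v_def[abs_def] by (rule L2_inner_diff_left[OF un S w[OF that]])
    also have "L2_inner M (\<lambda>x. \<Sum>j<n. L2_inner M (u n) (w j) * w j x) (w j) = L2_inner M (u n) (w j)"
      by (rule L2_inner_orthonormal_sum) (use w on that in auto)
    finally show ?thesis by simp
  qed
  \<comment> \<open>The coefficients of the residual \<open>v\<close> in the family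
    \<open>u\<close>. The coefficient of \<open>u n\<close> is 1, so independence excludes
    \<open>v = 0\<close>.\<close>
  define d where "d k = (if k = n then 1 else - (\<Sum>j<n. L2_inner M (u n) (w j) * c j k))" for k
  have vd: "AE x in M. v x = (\<Sum>k<Suc n. d k * u k x)"
  proof -
    have "AE x in M. \<forall>j\<in>{..<n}. w j x = (\<Sum>k<n. c j k * u k x)" using wc by (subst AE_finite_all) auto
    then show ?thesis
    proof eventually_elim
      case (elim x)
      have "(\<Sum>j<n. L2_inner M (u n) (w j) * w j x) = (\<Sum>j<n. \<Sum>k<n. L2_inner M (u n) (w j) * c j k * u k x)"
        using elim by (simp add: sum_distrib_left mult.assoc)
      also have "\<dots> = (\<Sum>k<n. (\<Sum>j<n. L2_inner M (u n) (w j) * c j k) * u k x)"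
        by (subst sum.swap) (simp add: sum_distrib_right)
      finally show ?case by (simp add: v_def d_def sum_negf)
    qed
  qed
  have nz: "L2_norm M v \<noteq> 0"
  proof
    assume "L2_norm M v = 0"
    from L2_norm_eq_0[OF v this] vd have "AE x in M. (\<Sum>k<Suc n. d k * u k x) = 0"
      by eventually_elim simp
    from Suc.prems(2)[unfolded L2_independent_def, rule_format, OF this, of n] show False by (simp add: d_def)
  qed
  define r where "r = complex_of_real (1 / L2_norm M v)"
  define w' where "w' j = (if j = n then (\<lambda>x. r * v x) else w j)" for j
  define c' where "c' j k = (if j = n then r * d k else if k = n then 0 else c j k)" for j k
  have w'L: "\<forall>j<Suc n. w' j \<in> L2 M" using v w by (auto simp: w'_def less_Suc_eq)
  have wv: "L2_inner M (w j) v = 0" if "j < n" for j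
    using vw[OF that] L2_inner_commute[of M "w j" v] by simp
  have rr: "L2_inner M (\<lambda>x. r * v x) (\<lambda>x. r * v x) = 1"
    unfolding L2_inner_self L2_norm_scale using nz by (simp add: r_def norm_divide)
  have on': "\<forall>i<Suc n. \<forall>j<Suc n. L2_inner M (w' i) (w' j) = (if i = j then 1 else 0)"
    using on vw wv rr by (auto simp: w'_def less_Suc_eq L2_inner_scale_left L2_inner_scale_right mult.left_commute)
  have "AE x in M. w' j x = (\<Sum>k<Suc n. c' j k * u k x)" if "j < Suc n" for j
  proof (cases "j = n")
    case True
    then show ?thesis using vd by (auto simp: w'_def c'_def sum_distrib_left distrib_left mult.assoc elim!: eventually_mono)
  next
    case False
    then show ?thesis using wc[of j] that by (simp add: w'_def c'_def)
  qed
  then show ?case using w'L on' by blast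
qed

text \<open>Operators act on representatives, so compatibility with equality almost everywhere is
  drawn from the norm bound and additivity.\<close>

lemma bounded_operator_cong_AE:
  assumes T: "bounded_operator M T" and f: "f \<in> L2 M" and g: "g \<in> L2 M" and eq: "AE x in M. f x = g x"
  shows "AE x in M. T f x = T g x"
proof -
  let ?h = "\<lambda>x. f x - g x"
  have h: "?h \<in> L2 M" by (rule L2_diff[OF f g])
  have "AE x in M. ?h x = 0" using eq by eventually_elim simp
  from L2_norm_cong_AE[OF this L2_measurable[OF h]] have 0: "L2_norm M ?h = 0" by simp
  obtain C where "L2_norm M (T ?h) \<le> C * L2_norm M ?h"
    using T h unfolding bounded_operator_def by blast
  then have "L2_norm M (T ?h) = 0" using 0 L2_norm_nonneg[of M "T ?h"] by simp
  from L2_norm_eq_0[OF bounded_operatorD(1)[OF T h] this] bounded_operator_diff[OF T f g]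
  show ?thesis by eventually_elim simp
qed

text \<open>Independent vectors in the range yield orthonormal \<open>w j\<close> fixed by
  \<open>P\<close>, whose coefficients in the basis are, up to conjugation, the inner products of
  \<open>P (hs_basis i)\<close> with \<open>w j\<close>. Exchanging the two sums and applying Bessel
  to each \<open>P (hs_basis i)\<close> bounds the number of these vectors.\<close>

lemma rank_le_trace:
  assumes P: "orthogonal_projection lborel P"
  shows "ennreal_of_enat (L2_rank lborel P) \<le> hs_norm2 lborel P"
proof -
  have b: "bounded_operator lborel P" using P by (simp add: orthogonal_projection_def)
  note PL = bounded_operatorD(1)[OF b]
  have *: "of_nat n \<le> hs_norm2 lborel P"
    if ur: "\<forall>i<n. u i \<in> L2_range lborel P" and ind: "L2_independent lborel n u" for n u
  proof -
    have uL: "i < n \<Longrightarrow> u i \<in> L2 lborel" for i using ur by (auto simp: L2_range_def)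
    have Pu: "AE x in lborel. P (u i) x = u i x" if i: "i < n" for i
    proof -
      obtain h where h: "h \<in> L2 lborel" "AE x in lborel. u i x = P h x"
        using ur i unfolding L2_range_def by blast
      have "AE x in lborel. P (P h) x = P h x" using P h(1) by (simp add: orthogonal_projection_def)
      with bounded_operator_cong_AE[OF b uL[OF i] PL[OF h(1)] h(2)] h(2)
      show ?thesis by eventually_elim simp
    qed
    from gram_schmidt[OF uL ind] obtain w c where
      "(\<forall>j<n. w j \<in> L2 lborel) \<and> (\<forall>i<n. \<forall>j<n. L2_inner lborel (w i) (w j) = (if i = j then 1 else 0)) \<and>
        (\<forall>j<n. AE x in lborel. w j x = (\<Sum>k<n. c j k * u k x))" by blast
    then have w: "\<And>j. j < n \<Longrightarrow> w j \<in> L2 lborel"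
      and on: "\<And>i j. i < n \<Longrightarrow> j < n \<Longrightarrow> L2_inner lborel (w i) (w j) = (if i = j then 1 else 0)"
      and wc: "\<And>j. j < n \<Longrightarrow> AE x in lborel. w j x = (\<Sum>k<n. c j k * u k x)"
      by blast+
    have Pw: "AE x in lborel. P (w j) x = w j x" if j: "j < n" for j
    proof -
      \<comment> \<open>Padded by zero, because \<open>bounded_operator_sum\<close> takes a family
        that is square-integrable at every index.\<close>
      define u' where "u' k = (if k < n then u k else (\<lambda>_. 0))" for k
      have u': "u' k \<in> L2 lborel" for k using uL by (simp add: u'_def)
      have wc': "AE x in lborel. w j x = (\<Sum>k<n. c j k * u' k x)" using wc[OF j] by (simp add: u'_def)
      have SL: "(\<lambda>x. \<Sum>k<n. c j k * u' k x) \<in> L2 lborel" using u' by (intro L2_sum L2_scale)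
      note bounded_operator_cong_AE[OF b w[OF j] SL wc'] wc'
      moreover have "AE x in lborel. P (\<lambda>y. \<Sum>i<n. c j i * u' i y) x = (\<Sum>i<n. c j i * P (u' i) x)"
        by (rule bounded_operator_sum[OF b u'])
      moreover have "AE x in lborel. \<forall>k\<in>{..<n}. P (u k) x = u k x" using Pu by (subst AE_finite_all) auto
      ultimately show ?thesis
        by eventually_elim (simp add: u'_def)
    qed
    have wP: "L2_inner lborel (w j) (hs_basis i) = cnj (L2_inner lborel (P (hs_basis i)) (w j))" if j: "j < n" for i j
    proof -
      have "L2_inner lborel (w j) (hs_basis i) = L2_inner lborel (P (w j)) (hs_basis i)"
        using Pw[OF j] L2_measurable[OF w[OF j]] L2_measurable[OF PL[OF w[OF j]]]
        by (intro L2_inner_cong_AE) (auto elim!: eventually_mono)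
      also have "\<dots> = L2_inner lborel (w j) (P (hs_basis i))"
        using P w[OF j] by (auto simp: orthogonal_projection_def)
      finally show ?thesis using L2_inner_commute by metis
    qed
    have w1: "nn2 lborel (w j) = 1" if "j < n" for j
    proof -
      have "complex_of_real ((L2_norm lborel (w j))\<^sup>2) = 1" using on[OF that that] by (simp only: L2_inner_self) simp
      then show ?thesis using nn2_L2[OF w[OF that]] by (metis ennreal_1 of_real_eq_1_iff)
    qed
    have "of_nat n = (\<Sum>j<n. nn2 lborel (w j))" using w1 by simp
    also have "\<dots> = (\<Sum>j<n. \<Sum>i. ennreal ((cmod (L2_inner lborel (w j) (hs_basis i)))\<^sup>2))"
      using w by (intro sum.cong refl orthonormal_basis_nn2[OF hs_basis, symmetric]) auto
    also have "\<dots> = (\<Sum>i. \<Sum>j<n. ennreal ((cmod (L2_inner lborel (w j) (hs_basis i)))\<^sup>2))"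
      by (rule suminf_sum[symmetric]) auto
    also have "\<dots> \<le> (\<Sum>i. nn2 lborel (P (hs_basis i)))"
    proof (intro suminf_le allI summableI)
      fix i
      have "(\<Sum>j<n. ennreal ((cmod (L2_inner lborel (w j) (hs_basis i)))\<^sup>2)) =
          ennreal (\<Sum>j<n. (cmod (L2_inner lborel (P (hs_basis i)) (w j)))\<^sup>2)"
        by (simp add: wP sum_nonneg)
      also have "\<dots> \<le> ennreal ((L2_norm lborel (P (hs_basis i)))\<^sup>2)"
        by (intro ennreal_leI L2_Bessel) (use w on PL in auto)
      finally show "(\<Sum>j<n. ennreal ((cmod (L2_inner lborel (w j) (hs_basis i)))\<^sup>2)) \<le> nn2 lborel (P (hs_basis i))"
        by (simp add: nn2_L2 PL)
    qed
    also have "\<dots> = hs_norm2 lborel P" by (rule hs_norm2_eq[symmetric]) (use PL in auto)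
    finally show ?thesis .
  qed
  show ?thesis
    unfolding L2_rank_def ennreal_of_enat_Sup
    by (rule SUP_least) (use * in auto)
qed

section \<open>Sums over lattices\<close>

text \<open>Frame sums become integrals over counting measure, where Tonelli applies.\<close>

lemma has_sum_imp_nn_integral:
  fixes f :: "'i \<Rightarrow> real"
  assumes "(f has_sum s) A" "\<And>i. i \<in> A \<Longrightarrow> 0 \<le> f i"
  shows "(\<integral>\<^sup>+i. ennreal (f i) \<partial>count_space A) = ennreal s"
proof -
  have "f summable_on A" using assms(1) by (auto simp: summable_on_def)
  then have "(\<lambda>i. norm (f i)) summable_on A"
    by (subst summable_on_cong[where g = f]) (use assms(2) in auto)
  then have i: "Infinite_Set_Sum.abs_summable_on f A" by (rule abs_summable_equivalent[THEN iffD1])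
  then have "integral\<^sup>L (count_space A) f = s"
    using infsetsum_infsum[OF i] infsumI[OF assms(1)] by (simp add: infsetsum_def)
  moreover have "integrable (count_space A) f" using i by (simp add: Infinite_Set_Sum.abs_summable_on_def)
  ultimately show ?thesis using assms(2) by (subst nn_integral_eq_integral) (auto simp: AE_count_space)
qed

lemma nn_integral_count_space_prod:
  assumes "countable A" "countable T"
  shows "(\<integral>\<^sup>+p. f p \<partial>count_space (A \<times> T)) = (\<integral>\<^sup>+x. \<integral>\<^sup>+y. f (x, y) \<partial>count_space T \<partial>count_space A)"
proof -
  interpret A: sigma_finite_measure "count_space A" by (rule sigma_finite_measure_count_space_countable[OF assms(1)])
  interpret B: sigma_finite_measure "count_space T" by (rule sigma_finite_measure_count_space_countable[OF assms(2)])
  have c: "count_space (A \<times> T) = count_space A \<Otimes>\<^sub>M count_space T"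
    using assms by (simp add: pair_measure_countable)
  have "f \<in> borel_measurable (count_space A \<Otimes>\<^sub>M count_space T)" unfolding c[symmetric] by simp
  then show ?thesis unfolding c by (rule B.nn_integral_fst[symmetric])
qed

text \<open>The upper faces are null; they separate the closed box containing \<open>I\<close> from
  the half-open \<open>cell\<close>.\<close>

lemma AE_component_neq: "AE l in lborel. \<forall>i. l $ i \<noteq> (a :: real^'k) $ i"
proof -
  have "AE l in lborel. l $ i \<noteq> a $ i" for i
  proof (rule AE_I[where N = "{l. l $ i = a $ i}"])
    have "negligible {x::real^'k. axis i 1 \<bullet> x = a $ i}" by (rule negligible_hyperplane) (simp add: axis_eq_0_iff)
    then have "negligible {l::real^'k. l $ i = a $ i}" by (simp add: inner_axis' )
    moreover have "{l::real^'k. l $ i = a $ i} \<in> sets borel" by measurable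
    ultimately show "emeasure lborel {l::real^'k. l $ i = a $ i} = 0"
      by (simp add: negligible_iff_emeasure0)
    show "{l::real^'k. l $ i = a $ i} \<in> sets lborel" by measurable
  qed auto
  then show ?thesis by (subst AE_all_countable) auto
qed

section \<open>Coordinates on the group\<close>

context two_step_setting
begin

text \<open>The linear coordinates in the given basis. They differ from the coordinates of the group
  parametrization by half a commutator, as \<open>gpi\<close> records.\<close>

definition coord :: "'g \<Rightarrow> (real^'k) \<times> (real^'d) \<times> (real^'d)" where
  "coord = (SOME C. linear C \<and> (\<forall>k. C (Z k) = (axis k 1, 0, 0)) \<and>
     (\<forall>j. C (Y j) = (0, axis j 1, 0) \<and> C (X j) = (0, 0, axis j 1)))"

lemma coord: "linear coord" "coord (Z k) = (axis k 1, 0, 0)" "coord (Y j) = (0, axis j 1, 0)"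
  "coord (X j) = (0, 0, axis j 1)"
proof -
  let ?bas = "case_sum Z (case_sum Y X)"
  let ?c = "case_sum (\<lambda>k. (axis k 1, 0, 0)) (case_sum (\<lambda>j. (0, axis j 1, 0)) (\<lambda>j. (0, 0, axis j 1)))
    :: 'k + 'd + 'd \<Rightarrow> (real^'k) \<times> (real^'d) \<times> (real^'d)"
  obtain C where C: "linear C" "\<forall>x\<in>range ?bas. C x = ?c (inv ?bas x)"
    using linear_independent_extend[OF basis_independent, of "\<lambda>x. ?c (inv ?bas x)"] by blast
  have Cb: "C (?bas x) = ?c x" for x using C(2) inv_f_f[OF basis_inj, of x] by force
  have "C (Z k) = (axis k 1, 0, 0)" for k using Cb[of "Inl k"] by simp
  moreover have "C (Y j) = (0, axis j 1, 0)" for j using Cb[of "Inr (Inl j)"] by simp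
  moreover have "C (X j) = (0, 0, axis j 1)" for j using Cb[of "Inr (Inr j)"] by simp
  ultimately have "\<exists>C :: 'g \<Rightarrow> (real^'k) \<times> (real^'d) \<times> (real^'d). linear C \<and> (\<forall>k. C (Z k) = (axis k 1, 0, 0)) \<and>
     (\<forall>j. C (Y j) = (0, axis j 1, 0) \<and> C (X j) = (0, 0, axis j 1))"
    using C(1) by (auto intro!: exI[of _ C])
  from someI_ex[OF this]
  show "linear coord" "coord (Z k) = (axis k 1, 0, 0)" "coord (Y j) = (0, axis j 1, 0)"
    "coord (X j) = (0, 0, axis j 1)"
    unfolding coord_def by auto
qed

definition zz :: "real^'k \<Rightarrow> 'g" where "zz z = (\<Sum>k\<in>UNIV. z $ k *\<^sub>R Z k)"
definition yy :: "real^'d \<Rightarrow> 'g" where "yy y = (\<Sum>j\<in>UNIV. y $ j *\<^sub>R Y j)"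
definition xx :: "real^'d \<Rightarrow> 'g" where "xx t = (\<Sum>j\<in>UNIV. t $ j *\<^sub>R X j)"

lemma linear_zyx: "linear zz" "linear yy" "linear xx"
  by (auto intro!: linearI simp: zz_def yy_def xx_def scaleR_left_distrib sum.distrib scaleR_sum_right)

lemma zyx_add: "zz (z + z') = zz z + zz z'" "yy (y + y') = yy y + yy y'" "xx (t + t') = xx t + xx t'"
  using linear_zyx by (simp_all add: linear_add)

lemma axis_expansion: "(\<Sum>k\<in>UNIV. z $ k *\<^sub>R axis k 1) = (z :: real^'n)"
  by (simp add: vec_eq_iff axis_def if_distrib cong: if_cong)

lemma coord_zyx: "coord (zz z) = (z, 0, 0)" "coord (yy y) = (0, y, 0)" "coord (xx t) = (0, 0, t)"
  using axis_expansion
  by (simp_all add: zz_def yy_def xx_def linear_sum[OF coord(1)] linear_scale[OF coord(1)] coord prod_eq_iff fst_sum snd_sum)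

lemma zyx_coord: "zz (fst (coord v)) + yy (fst (snd (coord v))) + xx (snd (snd (coord v))) = v"
proof -
  have [simp]: "zz 0 = 0" "yy 0 = 0" "xx 0 = 0" using linear_zyx by (simp_all add: linear_0)
  have [simp]: "zz (axis k 1) = Z k" "yy (axis j 1) = Y j" "xx (axis j 1) = X j" for k j
    by (simp_all add: zz_def yy_def xx_def axis_def if_distrib if_distribR cong: if_cong)
  let ?f = "\<lambda>v. zz (fst (coord v)) + yy (fst (snd (coord v))) + xx (snd (snd (coord v)))"
  have lin: "linear ?f"
    by (intro linearI)
       (simp_all add: linear_add[OF coord(1)] linear_scale[OF coord(1)] zyx_add linear_scale[OF linear_zyx(1)]
          linear_scale[OF linear_zyx(2)] linear_scale[OF linear_zyx(3)] algebra_simps)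
  have eq: "?f x = x" if "x \<in> range (case_sum Z (case_sum Y X))" for x
    using that by (auto simp: coord split: sum.splits)
  have v: "v \<in> span (range (case_sum Z (case_sum Y X)))" by (simp only: basis_span UNIV_I)
  show ?thesis by (rule linear_eq_on_span[OF lin linear_ident eq v])
qed

lemma coord_eq_iff: "coord u = coord v \<longleftrightarrow> u = v"
  using zyx_coord by metis

lemma functional_eq: "functional Z Y X l v = l \<bullet> fst (coord v)"
proof -
  have "functional Z Y X l = (\<lambda>v. l \<bullet> fst (coord v))"
    unfolding functional_def
  proof (rule the_equality)
    show "linear (\<lambda>v. l \<bullet> fst (coord v)) \<and> (\<forall>k. l \<bullet> fst (coord (Z k)) = l $ k) \<and>
      (\<forall>j. l \<bullet> fst (coord (Y j)) = 0 \<and> l \<bullet> fst (coord (X j)) = 0)"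
      by (auto intro!: linearI simp: linear_add[OF coord(1)] linear_scale[OF coord(1)] coord inner_add_right inner_axis)
    fix \<phi> assume \<phi>: "linear \<phi> \<and> (\<forall>k. \<phi> (Z k) = l $ k) \<and> (\<forall>j. \<phi> (Y j) = 0 \<and> \<phi> (X j) = 0)"
    then have l\<phi>: "linear \<phi>" by simp
    show "\<phi> = (\<lambda>v. l \<bullet> fst (coord v))"
    proof
      fix v
      have "\<phi> v = \<phi> (zz (fst (coord v)) + yy (fst (snd (coord v))) + xx (snd (snd (coord v))))"
        by (simp add: zyx_coord)
      also have "\<dots> = l \<bullet> fst (coord v)"
        using \<phi> by (simp add: linear_add[OF l\<phi>] zz_def yy_def xx_def linear_sum[OF l\<phi>] linear_scale[OF l\<phi>]
          inner_vec_def mult.commute)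
      finally show "\<phi> v = l \<bullet> fst (coord v)" .
    qed
  qed
  then show ?thesis by simp
qed

lemma B_nth: "B br Z Y X l $ i $ j = - (l \<bullet> fst (coord (br (X i) (Y j))))"
  by (simp add: B_def B_mat_def functional_eq)

sublocale weil_coords "B br Z Y X"
proof (rule weil_coords.intro)
  show "linear (B br Z Y X)"
    by (auto intro!: linearI simp: vec_eq_iff B_nth inner_add_left)
  obtain \<phi> where \<phi>: "linear \<phi>" "det (B_mat br Y X \<phi>) \<noteq> 0" using square_integrable_mod_center by blast
  \<comment> \<open>\<open>\<phi>\<close> need not vanish on the vectors \<open>Y j\<close> and
    \<open>X j\<close>. Its values on the \<open>Z k\<close> suffice, because \<open>B_mat\<close>
    evaluates it only at the central elements \<open>br (X i) (Y j)\<close>.\<close>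
  define l where "l = (\<chi> k. \<phi> (Z k))"
  have "\<phi> v = l \<bullet> fst (coord v)" if "v \<in> span (range Z)" for v
    by (rule linear_eq_on_span[OF \<phi>(1) _ _ that])
       (auto intro!: linearI simp: linear_add[OF coord(1)] linear_scale[OF coord(1)] coord inner_add_right inner_axis l_def)
  then have "B br Z Y X l = B_mat br Y X \<phi>"
    by (simp add: vec_eq_iff B_nth B_mat_def XY_central)
  then show "\<exists>l. det (B br Z Y X l) \<noteq> 0" using \<phi>(2) by metis
qed

lemma br_anti: "br y x = - br x y"
proof -
  have "br x y + br y x = br (x + y) (x + y)"
    by (simp add: bilinear_ladd[OF bilinear] bilinear_radd[OF bilinear] alternating[of x] alternating[of y] add.commute)
  then have "br x y + br y x = 0" by (simp add: alternating)
  then show ?thesis by (simp add: minus_unique)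
qed

lemma br_center: "br x y \<in> span (range Z)"
proof -
  have "br (br x y) v = 0" for v using br_anti[where x = v and y = "br x y"] by (simp add: two_step)
  then show ?thesis by (simp add: center)
qed

lemma zz_center: "br (zz z) v = 0" "br v (zz z) = 0"
proof -
  have "zz z \<in> span (range Z)" unfolding zz_def by (intro span_sum span_scale span_base) auto
  then show "br (zz z) v = 0" by (auto simp: center)
  then show "br v (zz z) = 0" using br_anti[where x = "zz z" and y = v] by simp
qed

lemma xx_yy_brackets: "br (yy y) (yy y') = 0" "br (xx t) (xx t') = 0" "br (yy y) (xx t) = - br (xx t) (yy y)"
proof -
  have "yy y \<in> span (range Z \<union> range Y)" for y unfolding yy_def by (intro span_sum span_scale span_base) auto
  then show "br (yy y) (yy y') = 0" by (intro ZY_commutative)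
  have "xx t \<in> span (range X)" for t unfolding xx_def by (intro span_sum span_scale span_base) auto
  then show "br (xx t) (xx t') = 0" by (intro X_commutative)
qed (rule br_anti)

text \<open>The bracket is central, hence determined by its \<open>Z\<close>-coordinates. These are
  compared by pairing with an arbitrary \<open>l\<close>, which on both sides gives the negative of
  \<open>t \<bullet> (B br Z Y X l *v y)\<close>.\<close>

lemma br_xx_yy: "br (xx t) (yy y) = zz (cc t y)"
proof -
  let ?w = "br (xx t) (yy y)"
  have "coord v = (fst (coord v), 0)" if "v \<in> span (range Z)" for v
    by (rule linear_eq_on_span[OF coord(1) _ _ that])
       (auto intro!: linearI simp: linear_add[OF coord(1)] linear_scale[OF coord(1)] coord zero_prod_def)
  from this[OF br_center] have 1: "coord ?w = (fst (coord ?w), 0)" .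
  have "l \<bullet> fst (coord ?w) = l \<bullet> cc t y" for l
  proof -
    have "?w = (\<Sum>i\<in>UNIV. \<Sum>j\<in>UNIV. (t $ i * y $ j) *\<^sub>R br (X i) (Y j))"
      unfolding xx_def yy_def bilinear_sum[OF bilinear]
      by (simp add: sum.cartesian_product bilinear_lmul[OF bilinear] bilinear_rmul[OF bilinear] mult.commute)
    then have "l \<bullet> fst (coord ?w) = (\<Sum>i\<in>UNIV. \<Sum>j\<in>UNIV. t $ i * y $ j * (l \<bullet> fst (coord (br (X i) (Y j)))))"
      by (simp add: linear_sum[OF coord(1)] linear_scale[OF coord(1)] fst_sum inner_sum_right)
    also have "\<dots> = - (t \<bullet> (B br Z Y X l *v y))"
      by (simp add: inner_vec_def[of t] matrix_vector_mult_def B_nth sum_distrib_left sum_negf mult_ac)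
    finally show ?thesis by (simp add: inner_cc)
  qed
  then have "fst (coord ?w) = cc t y" using vector_eq_ldot by blast
  with 1 have "coord ?w = coord (zz (cc t y))" by (simp add: coord_zyx zero_prod_def)
  then show ?thesis by (simp add: coord_eq_iff)
qed

section \<open>The group law in exponential coordinates of the second kind\<close>

abbreviation gp :: "(real^'k) \<times> (real^'d) \<times> (real^'d) \<Rightarrow> 'g" where "gp \<equiv> grp_param br Z Y X"

lemmas br_simps = bilinear_ladd[OF bilinear] bilinear_radd[OF bilinear] bilinear_lmul[OF bilinear]
  bilinear_rmul[OF bilinear] bilinear_lneg[OF bilinear] bilinear_rneg[OF bilinear]
  bilinear_lsub[OF bilinear] bilinear_rsub[OF bilinear] bilinear_lzero[OF bilinear] bilinear_rzero[OF bilinear]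

text \<open>The last term is half the bracket of the \<open>Y\<close> part with the \<open>X\<close>
  part in the Baker-Campbell-Hausdorff formula; the order of these two factors makes it
  negative.\<close>

lemma gp_eq: "gp (z, y, t) = zz z + yy y + xx t - (1/2) *\<^sub>R zz (cc t y)"
  by (simp add: grp_param_def grp_mult_def zz_def[symmetric] yy_def[symmetric] xx_def[symmetric]
    br_simps zz_center xx_yy_brackets br_xx_yy)

lemma coord_gp: "coord (gp (z, y, t)) = (z - (1/2) *\<^sub>R cc t y, y, t)"
  by (simp add: gp_eq linear_add[OF coord(1)] linear_diff[OF coord(1)] linear_scale[OF coord(1)] coord_zyx)

definition gpi :: "'g \<Rightarrow> (real^'k) \<times> (real^'d) \<times> (real^'d)" where
  "gpi v = (fst (coord v) + (1/2) *\<^sub>R cc (snd (snd (coord v))) (fst (snd (coord v))), snd (coord v))"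

lemma gpi_gp [simp]: "gpi (gp w) = w"
  by (cases w) (simp add: gpi_def coord_gp)

lemma gp_gpi [simp]: "gp (gpi v) = v"
proof -
  have "coord (gp (gpi v)) = coord v"
    by (cases "coord v") (simp add: gpi_def coord_gp)
  then show ?thesis by (simp add: coord_eq_iff)
qed

lemma inv_gp [simp]: "inv gp v = gpi v"
  by (metis gp_gpi gpi_gp inv_equality)

lemma cc_continuous2: "continuous_on UNIV (\<lambda>w. cc (snd (snd w)) (fst (snd w)))"
  unfolding cc_def
  by (intro continuous_intros continuous_on_compose2[OF matrix_vector_mult_linear_continuous_on]) auto

lemma gp_measurable [measurable]: "gp \<in> borel_measurable borel"
proof -
  have "gp = (\<lambda>w. zz (fst w) + yy (fst (snd w)) + xx (snd (snd w)) - (1/2) *\<^sub>R zz (cc (snd (snd w)) (fst (snd w))))"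
    using gp_eq by auto
  moreover have "continuous_on UNIV (\<lambda>w. zz (fst w) + yy (fst (snd w)) + xx (snd (snd w)) - (1/2) *\<^sub>R zz (cc (snd (snd w)) (fst (snd w))))"
    using linear_zyx
    by (intro continuous_intros continuous_on_compose2[OF linear_continuous_on[of zz UNIV]] continuous_on_compose2[OF linear_continuous_on[of yy UNIV]]
      continuous_on_compose2[OF linear_continuous_on[of xx UNIV]] cc_continuous2) (auto simp: linear_conv_bounded_linear)
  ultimately show ?thesis by (simp add: borel_measurable_continuous_onI)
qed

lemma gpi_measurable [measurable]: "gpi \<in> borel_measurable borel"
proof -
  have c: "continuous_on UNIV coord" using coord(1) by (simp add: linear_conv_bounded_linear linear_continuous_on)
  have "continuous_on UNIV (\<lambda>v. cc (snd (snd (coord v))) (fst (snd (coord v))))"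
    by (rule continuous_on_compose2[OF cc_continuous2 c]) auto
  then have "continuous_on UNIV gpi"
    unfolding gpi_def[abs_def] by (intro continuous_intros c)
  then show ?thesis by (rule borel_measurable_continuous_onI)
qed

text \<open>The bracket of the factors contributes half of \<open>cc t y' - cc t' y\<close>, and
  each factor carries its own negative half of \<open>cc\<close>. Expanding
  \<open>cc (t + t') (y + y')\<close> bilinearly, the halves combine to the single term
  \<open>cc t y'\<close> of \<open>mulc\<close>.\<close>

lemma gp_mulc: "grp_mult br (gp v) (gp w) = gp (mulc v w)"
proof -
  obtain z y t z' y' t' where vw: "v = (z, y, t)" "w = (z', y', t')" by (metis prod_cases3)
  have cc: "cc (t + t') (y + y') = cc t y + cc t y' + cc t' y + cc t' y'"
  proof -
    have "coord (zz (cc (t + t') (y + y'))) = coord (zz (cc t y + cc t y' + cc t' y + cc t' y'))"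
      unfolding zyx_add br_xx_yy[symmetric] by (simp add: br_simps algebra_simps)
    then show ?thesis by (simp add: coord_zyx)
  qed
  have "coord (grp_mult br (gp v) (gp w)) = coord (gp v) + coord (gp w) + (1/2) *\<^sub>R coord (br (gp v) (gp w))"
    by (simp add: grp_mult_def linear_add[OF coord(1)] linear_scale[OF coord(1)])
  also have "br (gp v) (gp w) = zz (cc t y') - zz (cc t' y)"
    by (simp add: vw gp_eq br_simps zz_center xx_yy_brackets br_xx_yy)
  finally have "coord (grp_mult br (gp v) (gp w)) = coord (gp (mulc v w))"
    by (simp add: vw coord_gp mulc_def linear_diff[OF coord(1)] coord_zyx cc)
       (simp add: vec_eq_iff field_simps)
  then show ?thesis by (simp add: coord_eq_iff)
qed

lemma grp_mult_cancel: "grp_mult br (- x) (grp_mult br x y) = y"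
proof -
  have "br x (br x y) = 0" by (rule two_step)
  then show ?thesis by (simp add: grp_mult_def br_simps alternating)
qed

section \<open>Transfer to coordinates\<close>

abbreviation H :: "'g measure" where "H \<equiv> haar br Z Y X"

lemma measurable_H: "f \<in> borel_measurable H \<longleftrightarrow> f \<in> borel_measurable borel"
  by (simp add: haar_def cong: measurable_cong_sets)

lemma measurable_gp_iff: "(\<lambda>w. f (gp w)) \<in> borel_measurable borel \<longleftrightarrow> f \<in> borel_measurable borel"
proof
  assume "(\<lambda>w. f (gp w)) \<in> borel_measurable borel"
  from measurable_compose[OF gpi_measurable this] show "f \<in> borel_measurable borel" by simp
qed (rule measurable_compose[OF gp_measurable])

lemma nn2_H: "f \<in> borel_measurable borel \<Longrightarrow> nn2 H f = nn2 lborel (\<lambda>w. f (gp w))"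
  unfolding nn2_def haar_def by (subst nn_integral_distr) auto

lemma L2_H: "f \<in> L2 H \<longleftrightarrow> (\<lambda>w. f (gp w)) \<in> L2 lborel"
  unfolding L2_iff measurable_H using nn2_H[of f] measurable_gp_iff[of f] by auto

lemma L2_norm_H: "f \<in> borel_measurable borel \<Longrightarrow> L2_norm H f = L2_norm lborel (\<lambda>w. f (gp w))"
  by (rule L2_norm_eqI) (auto simp: measurable_H nn2_H)

lemma integral_H: "f \<in> borel_measurable borel \<Longrightarrow> (LINT g|H. f g) = (LINT w|lborel. (f (gp w) :: complex))"
  unfolding haar_def by (rule integral_distr) auto

lemma irrep_gp: "irrep br Z Y X l (gp w) F = rep l w F"
  by (simp add: irrep_def rep_def)

lemma integrated_rep_eq:
  assumes f: "f \<in> borel_measurable borel" and h: "h \<in> borel_measurable borel"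
  shows "integrated_rep br Z Y X f l h = ir (\<lambda>w. f (gp w)) l h"
proof
  fix x
  have G: "(\<lambda>w. f (gp w)) \<in> borel_measurable borel" using f by measurable
  have "(\<lambda>w. f (gp w) * rep l w h x) \<in> borel_measurable borel"
    using measurable_Pair2[OF rep_joint_measurable[OF G h], of x] by simp
  then have "(\<lambda>g. f g * irrep br Z Y X l g h x) \<in> borel_measurable borel"
    by (subst measurable_gp_iff[symmetric]) (simp add: irrep_gp)
  from integral_H[OF this] show "integrated_rep br Z Y X f l h x = ir (\<lambda>w. f (gp w)) l h x"
    by (simp add: integrated_rep_def ir_def irrep_gp)
qed

lemma Sigma_dual_eq: "Sigma_dual br Z Y X = sig"
  by (simp add: Sigma_dual_def sig_def)

lemma plancherel_measure_eq: "plancherel_measure br Z Y X = mu"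
  by (simp add: plancherel_measure_def mu_def Sigma_dual_eq)

lemma hs_norm2_integrated_rep:
  assumes "g \<in> borel_measurable borel"
  shows "hs_norm2 lborel (\<lambda>h x. integrated_rep br Z Y X g l h x - T h x) = hs_norm2 lborel (\<lambda>h x. ir (\<lambda>w. g (gp w)) l h x - T h x)"
  unfolding hs_norm2_def hs_basis_def[symmetric]
  by (simp add: integrated_rep_eq[OF assms])

text \<open>\<open>gp\<close> is a bijection, Borel in both directions, that carries Lebesgue
  measure to Haar measure. Approximating sequences are transported by \<open>gp\<close> one way and
  by \<open>gpi\<close> the other.\<close>

lemma is_plancherel_iff: "is_plancherel br Z Y X f \<Phi> \<longleftrightarrow> isp (\<lambda>w. f (gp w)) \<Phi>"
proof
  assume "is_plancherel br Z Y X f \<Phi>"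
  then obtain g where f: "f \<in> L2 H" and \<Phi>: "\<Phi> \<in> direct_integral mu (\<lambda>_. Collect (hs_operator lborel))"
    and g: "\<And>k::nat. g k \<in> L2 H" "\<And>k. integrable H (g k)" "(\<lambda>k. L2_norm H (\<lambda>x. g k x - f x)) \<longlonglongrightarrow> 0"
      "(\<lambda>k. \<integral>\<^sup>+l. hs_norm2 lborel (\<lambda>h x. integrated_rep br Z Y X (g k) l h x - \<Phi> l h x) \<partial>mu) \<longlonglongrightarrow> 0"
    unfolding is_plancherel_def plancherel_measure_eq by blast
  have m: "g k \<in> borel_measurable borel" "f \<in> borel_measurable borel" for k
    using L2_measurable[OF g(1)] L2_measurable[OF f] by (simp_all add: measurable_H)
  have "integrable lborel (\<lambda>w. g k (gp w))" for k
    using g(2)[of k] m unfolding haar_def by (subst (asm) integrable_distr_eq) auto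
  moreover have "L2_norm H (\<lambda>x. g k x - f x) = L2_norm lborel (\<lambda>w. g k (gp w) - f (gp w))" for k
    using m by (intro L2_norm_H) simp
  ultimately show "isp (\<lambda>w. f (gp w)) \<Phi>"
    unfolding isp_def using f \<Phi> g by (auto simp: L2_H hs_norm2_integrated_rep[OF m(1)] intro!: exI[of _ "\<lambda>k w. g k (gp w)"])
next
  assume "isp (\<lambda>w. f (gp w)) \<Phi>"
  then obtain g where f: "(\<lambda>w. f (gp w)) \<in> L2 lborel" and \<Phi>: "\<Phi> \<in> direct_integral mu (\<lambda>_. Collect (hs_operator lborel))"
    and g: "\<And>k::nat. g k \<in> L2 lborel" "\<And>k. integrable lborel (g k)" "(\<lambda>k. L2_norm lborel (\<lambda>x. g k x - f (gp x))) \<longlonglongrightarrow> 0"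
      "(\<lambda>k. \<integral>\<^sup>+l. hs_norm2 lborel (\<lambda>h x. ir (g k) l h x - \<Phi> l h x) \<partial>mu) \<longlonglongrightarrow> 0"
    unfolding isp_def by blast
  have m: "(\<lambda>v. g k (gpi v)) \<in> borel_measurable borel" "f \<in> borel_measurable borel" for k
    using L2_measurable[OF g(1)] L2_measurable[OF f] by (simp_all flip: measurable_gp_iff)
  have "integrable H (\<lambda>v. g k (gpi v))" for k
    using g(2)[of k] m unfolding haar_def by (subst integrable_distr_eq) auto
  moreover have "L2_norm H (\<lambda>x. g k (gpi x) - f x) = L2_norm lborel (\<lambda>w. g k w - f (gp w))" for k
    using m by (subst L2_norm_H) auto
  ultimately show "is_plancherel br Z Y X f \<Phi>"
    unfolding is_plancherel_def plancherel_measure_eq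
    using f \<Phi> g by (auto simp: L2_H hs_norm2_integrated_rep[OF m(1)] intro!: exI[of _ "\<lambda>k v. g k (gpi v)"])
qed

text \<open>Left invariance of the measure moves the translation from the generator to the test
  function, with \<open>v\<close> in place of its inverse.\<close>

lemma inner_left_regular:
  assumes m: "f \<in> borel_measurable borel" "left_regular br (gp v) \<phi> \<in> borel_measurable borel"
  shows "L2_inner H f (left_regular br (gp v) \<phi>) = L2_inner lborel (\<lambda>w. f (gp (mulc v w))) (\<lambda>w. \<phi> (gp w))"
proof -
  let ?F = "\<lambda>x. f x * cnj (left_regular br (gp v) \<phi> x)"
  have F: "?F \<in> borel_measurable borel" using m by measurable
  then have Fg: "(\<lambda>w. ?F (gp w)) \<in> borel_measurable borel" by measurable
  have "L2_inner H f (left_regular br (gp v) \<phi>) = (LINT w|lborel. ?F (gp w))"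
    unfolding L2_inner_def by (rule integral_H[OF F])
  also have "\<dots> = (LINT w|lborel. ?F (gp (mulc v w)))"
    by (rule integral_mulc[OF Fg, symmetric])
  also have "\<dots> = L2_inner lborel (\<lambda>w. f (gp (mulc v w))) (\<lambda>w. \<phi> (gp w))"
    by (simp add: L2_inner_def left_regular_def gp_mulc[symmetric] grp_mult_cancel)
  finally show ?thesis .
qed

end

section \<open>The quasi-lattice in coordinates\<close>

lemma int_lattice_vec: "x \<in> int_lattice \<longleftrightarrow> (\<forall>i. (x :: real^'n) $ i \<in> \<int>)"
  by (auto simp: int_lattice_def Basis_vec_def inner_axis)

lemma int_lattice_vec_coords:
  assumes "(x :: real^'n) \<in> int_lattice"
  obtains m where "\<And>i. x $ i = real_of_int (m i)"
proof -
  have "\<forall>i. \<exists>m. x $ i = real_of_int m" using assms by (auto simp: int_lattice_vec elim: Ints_cases)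
  then show ?thesis using that by metis
qed

lemma dg_iv_inj:
  assumes "\<And>i. 0 < c $ i"
  shows "dg (iv c) *v x = dg (iv c) *v y \<longleftrightarrow> x = y"
  using assms by (auto simp: dg_mult iv_def vec_eq_iff less_imp_neq[THEN not_sym])

text \<open>The triple is ordered as translations, modulations, centre, so that the sum over the
  product is directly the iterated sum with the central index innermost.\<close>

lemma (in two_step_setting) quasi_lattice_bij:
  assumes "\<And>i. 0 < a $ i" "\<And>i. 0 < q $ i" "\<And>i. 0 < b $ i"
  shows "bij_betw (\<lambda>(n, k, m). gp (dg (iv a) *v m, dg (iv q) *v k, dg (iv b) *v n))
    (int_lattice \<times> int_lattice \<times> int_lattice) (quasi_lattice br Z Y X a q b)" (is "bij_betw ?G ?L _")
proof -
  have gp_inj: "gp v = gp w \<longleftrightarrow> v = w" for v w by (metis gpi_gp)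
  have "inj_on ?G ?L" by (auto simp: inj_on_def gp_inj dg_iv_inj[OF assms(1)] dg_iv_inj[OF assms(2)] dg_iv_inj[OF assms(3)])
  moreover have "?G ` ?L = quasi_lattice br Z Y X a q b"
  proof (intro equalityI subsetI)
    fix x assume "x \<in> ?G ` ?L"
    then obtain n k m where x: "x = gp (dg (iv a) *v m, dg (iv q) *v k, dg (iv b) *v n)"
      and L: "n \<in> int_lattice" "k \<in> int_lattice" "m \<in> int_lattice" by auto
    obtain m' where m': "\<And>i. m $ i = real_of_int (m' i)" using L(3) by (rule int_lattice_vec_coords) blast
    obtain k' where k': "\<And>i. k $ i = real_of_int (k' i)" using L(2) by (rule int_lattice_vec_coords) blast
    obtain n' where n': "\<And>i. n $ i = real_of_int (n' i)" using L(1) by (rule int_lattice_vec_coords) blast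
    have "x = grp_mult br
        (grp_mult br (\<Sum>j\<in>UNIV. (of_int (m' j) / a $ j) *\<^sub>R Z j) (\<Sum>j\<in>UNIV. (of_int (k' j) / q $ j) *\<^sub>R Y j))
        (\<Sum>j\<in>UNIV. (of_int (n' j) / b $ j) *\<^sub>R X j)"
      by (simp add: x grp_param_def dg_mult iv_def divide_inverse mult.commute m' k' n')
    then show "x \<in> quasi_lattice br Z Y X a q b"
      unfolding quasi_lattice_def by blast
  next
    fix x assume "x \<in> quasi_lattice br Z Y X a q b"
    then obtain m k n where x: "x = grp_mult br
        (grp_mult br (\<Sum>j\<in>UNIV. (of_int (m j) / a $ j) *\<^sub>R Z j) (\<Sum>j\<in>UNIV. (of_int (k j) / q $ j) *\<^sub>R Y j))
        (\<Sum>j\<in>UNIV. (of_int (n j) / b $ j) *\<^sub>R X j)" unfolding quasi_lattice_def by blast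
    then have "x = ?G ((\<chi> j. of_int (n j)), (\<chi> j. of_int (k j)), (\<chi> j. of_int (m j)))"
      by (simp add: grp_param_def dg_mult iv_def divide_inverse mult.commute)
    then show "x \<in> ?G ` ?L"
      by (rule image_eqI) (simp add: int_lattice_vec)
  qed
  ultimately show ?thesis by (simp add: bij_betw_def)
qed

theorem proposition24:
  fixes br :: "'g::euclidean_space \<Rightarrow> 'g \<Rightarrow> 'g"
    and Z :: "'k::finite \<Rightarrow> 'g" and Y X :: "'d::finite \<Rightarrow> 'g"
    and K :: "('g \<Rightarrow> complex) set"
    and P :: "real^'k \<Rightarrow> (real^'d) operator"
    and a :: "real^'k" and q b :: "real^'d"
    and I :: "(real^'k) set"
  assumes setting: "two_step_setting br Z Y X"
    and K_closed: "L2_closed_subspace (haar br Z Y X) K"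
    and K_invariant: "\<And>x f. f \<in> K \<Longrightarrow> left_regular br x f \<in> K"
    and P_projection: "\<And>l. l \<in> Sigma_dual br Z Y X \<Longrightarrow> orthogonal_projection lborel (P l)"
    and P_measurable: "measurable_field (plancherel_measure br Z Y X) P"
    and K_image: "plancherel_image br Z Y X K =
      direct_integral (plancherel_measure br Z Y X) (\<lambda>l. hs_tensor lborel (L2_range lborel (P l)))"
    and pos: "\<And>i. 0 < a $ i" "\<And>i. 0 < q $ i" "\<And>i. 0 < b $ i"
    and I_measurable: "I \<in> sets lebesgue"
    and I_subset: "I \<subseteq> {l \<in> Sigma_dual br Z Y X. \<forall>i. 0 \<le> l $ i \<and> l $ i \<le> a $ i}"
    and frame: "\<exists>\<phi>\<in>K. parseval_frame (haar br Z Y X) (quasi_lattice br Z Y X a q b)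
      (\<lambda>\<gamma>. left_regular br \<gamma> \<phi>) K"
  shows "AE l in lebesgue. l \<in> I \<longrightarrow>
    ennreal \<bar>det (B br Z Y X l)\<bar> * ennreal_of_enat (L2_rank lborel (P l))
      \<le> ennreal (\<Prod>i\<in>UNIV. b $ i * q $ i)"
proof -
  interpret two_step_setting br Z Y X by (rule setting)
  obtain \<phi> where \<phi>: "\<phi> \<in> K" and pf: "parseval_frame H (quasi_lattice br Z Y X a q b) (\<lambda>\<gamma>. left_regular br \<gamma> \<phi>) K"
    using frame by blast
  have KL: "K \<subseteq> L2 H" using K_closed by (simp add: L2_closed_subspace_def)
  have K_borel: "f \<in> borel_measurable borel" if "f \<in> K" for f
    using L2_measurable[of f H] KL that by (auto simp: measurable_H)
  let ?DI = "direct_integral mu (\<lambda>l. hs_tensor lborel (L2_range lborel (P l)))"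
  \<comment> \<open>One direction places the transform of the generator in the tensor spaces. The
    other realizes every test field by an element of \<open>K\<close>, to which the frame identity
    applies.\<close>
  have DI: "\<Psi> \<in> ?DI \<longleftrightarrow> (\<exists>f\<in>K. isp (\<lambda>w. f (gp w)) \<Psi>)" for \<Psi>
    using K_image by (auto simp: plancherel_image_def is_plancherel_iff plancherel_measure_eq)
  let ?g = "\<lambda>n k m. (dg (iv a) *v m, dg (iv q) *v k, dg (iv b) *v n)"
  \<comment> \<open>The frame identity for \<open>f\<close>, with the quasi-lattice enumerated by
    integer vectors and the translations moved onto \<open>f\<close>.\<close>
  have lattice_sum: "(\<integral>\<^sup>+n. \<integral>\<^sup>+k. \<integral>\<^sup>+m. ennreal ((cmod (L2_inner lborel
        (\<lambda>w. f (gp (mulc (?g n k m) w))) (\<lambda>w. \<phi> (gp w))))\<^sup>2)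
      \<partial>count_space int_lattice \<partial>count_space int_lattice \<partial>count_space int_lattice) = nn2 lborel (\<lambda>w. f (gp w))"
    if f: "f \<in> K" for f
  proof -
    let ?c = "\<lambda>\<gamma>. (cmod (L2_inner H f (left_regular br \<gamma> \<phi>)))\<^sup>2"
    have "(?c has_sum (L2_norm H f)\<^sup>2) (quasi_lattice br Z Y X a q b)"
      using pf f by (auto simp: parseval_frame_def)
    then have "(\<integral>\<^sup>+\<gamma>. ennreal (?c \<gamma>) \<partial>count_space (quasi_lattice br Z Y X a q b)) = ennreal ((L2_norm H f)\<^sup>2)"
      by (rule has_sum_imp_nn_integral) simp
    also have "\<dots> = nn2 lborel (\<lambda>w. f (gp w))"
      using KL f K_borel[OF f] by (simp add: nn2_L2[symmetric] nn2_H subset_iff)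
    finally have "nn2 lborel (\<lambda>w. f (gp w)) = (\<integral>\<^sup>+\<gamma>. ennreal (?c \<gamma>) \<partial>count_space (quasi_lattice br Z Y X a q b))" ..
    also have "\<dots> = (\<integral>\<^sup>+p. ennreal (?c (case p of (n, k, m) \<Rightarrow> gp (?g n k m)))
        \<partial>count_space (int_lattice \<times> int_lattice \<times> int_lattice))"
      by (rule nn_integral_bij_count_space[OF quasi_lattice_bij[OF pos], symmetric])
    also have "\<dots> = (\<integral>\<^sup>+n. \<integral>\<^sup>+k. \<integral>\<^sup>+m. ennreal (?c (gp (?g n k m)))
        \<partial>count_space int_lattice \<partial>count_space int_lattice \<partial>count_space int_lattice)"
      by (simp add: nn_integral_count_space_prod countable_int_lattice countable_SIGMA)
    also have "\<dots> = (\<integral>\<^sup>+n. \<integral>\<^sup>+k. \<integral>\<^sup>+m. ennreal ((cmod (L2_inner lborel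
        (\<lambda>w. f (gp (mulc (?g n k m) w))) (\<lambda>w. \<phi> (gp w))))\<^sup>2)
      \<partial>count_space int_lattice \<partial>count_space int_lattice \<partial>count_space int_lattice)"
      by (simp only: inner_left_regular[OF K_borel[OF f] K_borel[OF K_invariant[OF \<phi>]]])
    finally show ?thesis ..
  qed
  interpret frame_coords "B br Z Y X" "\<lambda>w. \<phi> (gp w)" P a q b
  proof (intro frame_coords.intro frame_coords_axioms.intro)
    show "(\<lambda>w. \<phi> (gp w)) \<in> L2 lborel" using KL \<phi> by (auto simp flip: L2_H)
    show "\<exists>f. isp f \<Psi> \<and> (\<integral>\<^sup>+n. \<integral>\<^sup>+k. \<integral>\<^sup>+m. ennreal ((cmod (L2_inner lborel
          (\<lambda>w. f (mulc (?g n k m) w)) (\<lambda>w. \<phi> (gp w))))\<^sup>2)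
        \<partial>count_space int_lattice \<partial>count_space int_lattice \<partial>count_space int_lattice) = nn2 lborel f"
      if "\<Psi> \<in> ?DI" for \<Psi>
      using that lattice_sum unfolding DI by blast
  qed (use weil_coords_axioms P_projection P_measurable pos DI \<phi> in \<open>auto simp: Sigma_dual_eq plancherel_measure_eq\<close>)
  have "AE l in lborel. l \<in> sig \<longrightarrow> l \<in> cell \<longrightarrow>
      ennreal \<bar>det (B br Z Y X l)\<bar> * hs_norm2 lborel (P l) \<le> ennreal (pq * pb)"
    using trace_bound_AE by (simp add: AE_mu)
  with AE_component_neq[of a]
  have "AE l in lborel. l \<in> I \<longrightarrow> ennreal \<bar>det (B br Z Y X l)\<bar> * ennreal_of_enat (L2_rank lborel (P l))
      \<le> ennreal (\<Prod>i\<in>UNIV. b $ i * q $ i)"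
  proof eventually_elim
    case (elim l)
    show ?case
    proof
      assume "l \<in> I"
      then have l: "l \<in> sig" and le: "0 \<le> l $ i" "l $ i \<le> a $ i" for i
        using I_subset by (auto simp: Sigma_dual_eq)
      have lt: "l $ i < a $ i" for i using le(2)[of i] elim(1) by (simp add: order.not_eq_order_implies_strict)
      \<comment> \<open>The strict upper inequalities come from excluding the faces.\<close>
      have "l \<in> cell"
        using le(1) lt pos(1)
        by (auto simp: cell_def ucube_def dg_mult iv_def Basis_vec_def inner_axis field_simps less_imp_le)
      have "ennreal \<bar>det (B br Z Y X l)\<bar> * ennreal_of_enat (L2_rank lborel (P l))
          \<le> ennreal \<bar>det (B br Z Y X l)\<bar> * hs_norm2 lborel (P l)"
        by (intro mult_left_mono rank_le_trace proj l zero_le)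
      also have "\<dots> \<le> ennreal (pq * pb)" using elim(2) l \<open>l \<in> cell\<close> by blast
      also have "pq * pb = (\<Prod>i\<in>UNIV. b $ i * q $ i)"
        by (simp add: pq_def pb_def prod.distrib mult.commute)
      finally show "ennreal \<bar>det (B br Z Y X l)\<bar> * ennreal_of_enat (L2_rank lborel (P l))
          \<le> ennreal (\<Prod>i\<in>UNIV. b $ i * q $ i)" .
    qed
  qed
  then show ?thesis by (rule AE_completion)
qed

end
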